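(* Let $d_1,\dots,d_p\ge0$ be integers with $d_p>0$ and $\mathfrak l=\sum_{i=1}^pd_i\le\min(k,m)$, put $d_0=m-\mathfrak l$, and let $r_g>\dots>r_1$ be the indices $r\ge1$ with $d_r>0$ and $l_i=d_{r_i}$. Let $\mathcal{GO}$, $\mathcal Q$, $\mathcal F(f_1,\dots,f_{g+1};\mathbb R)$ and $\mathcal R$ be as in the context. Then: (1) $\mathcal Q$ is isomorphic to $O(l_1)\times\cdots\times O(l_g)$. (2) The map $\mathcal{GO}\to O(m)/O(m-\mathfrak l)$ obtained by representing $G^o\in\mathcal{GO}$ by a pair $(C,O)$ (with $C=(C_{r,l})_{r,l}$ and $O\in O(m)$) and sending it to the class $O(m-\mathfrak l)\,O$ is well defined: two representations $(C,O)$ and $(C_1,O_1)$ of the same $G^o$ give the same image in $O(m)/O(m-\mathfrak l)$. (3) This map induces a fiber bundle projection $\pi$ from $\mathcal{GO}/\mathcal Q$ to $\mathcal F(f_1,\dots,f_{g+1};\mathbb R)$. Each fiber is a vector space isomorphic to $\bigoplus_{r=1}^p\mathrm{Mat}\big(d_r,\sum_{l=1}^{r-1}\sum_{j=0}^{r-l-1}d_j\big)$, so $\mathcal K:=\mathcal{GO}/\mathcal Q$ is a vector bundle over $\mathcal F(f_1,\dots,f_{g+1};\mathbb R)$. When $p=1$ or $\mathfrak l=m$, $\mathcal K$ can be identified with $\mathcal F(f_1,\dots,f_{g+1};\mathbb R)$. (4) The dimension of $\mathcal K$ is $m\sum_{j>0}j\,d_j-\sum_{i\ge1}\big(\sum_{j\ge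 i}d_j\big)^2$. (5) The dimension of $\mathcal K$ is also $\sum_{i>j\ge0}d_id_j+\sum_{r=1}^pd_r\sum_{l=1}^{r-1}\sum_{j=0}^{r-l-1}d_j$. (6) $\mathcal R$ is a bounded smooth function on $\mathcal K$.
   Context: All matrices are real; $'$ is transpose; $k,m,p$ are positive integers; $\mathrm{Mat}(a,b)$ is the space of $a\times b$ matrices. $n_{\min}=\sum_i i\,d_i$; $F=\mathrm{diag}(K(p,d_p),\dots,K(1,d_1))$ with $K(r,d)=J_r\otimes I_d$, $J_r$ the $r\times r$ matrix with ones on the first superdiagonal and zeros elsewhere (blocks with $d_r=0$ are skipped). Rows of an $n_{\min}\times m$ matrix $G$ are partitioned into blocks $G_{r,j}$ of size $d_r\times m$ ($1\le r\le p$, $0\le j\le r-1$), stacked with $r$ descending from $p$ to $1$ and, for each $r$, $j$ descending from $r-1$ to $0$; $G_{:,0}$ is the vertical stack of $G_{p,0},\dots,G_{1,0}$. Square $n_{\min}\times n_{\min}$ matrices are partitioned accordingly into blocks $Q_{\rho_1,j_1;\rho_2,j_2}$ of size $d_{\rho_1}\times d_{\rho_2}$. $\mathcal{GO}$ is the set of $n_{\min}\times m$ matrices $G^o$ with $G^o_{:,0}(G^o_{:,0})'=I_{\mathfrak l}$ and $G^o_{\rho,l}(G^o_{\rho_1,0})'=0$ for all $\rho,\rho_1$ and all $l>\max(0,\rho-\rho_1-1)$. $\mathcal Q$ is the group of block diagonal matrices $Q$ commuting with $F$ with $Q_{r,0;r,0}=Q_{r,1;r,1}=\dots=Q_{r,r-1;r,r-1}$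 and $Q_{r,0;r,0}Q_{r,0;r,0}'=I_{d_r}$; it acts on $\mathcal{GO}$ by left multiplication. Representation: $O(m)$ is the group of $m\times m$ orthogonal matrices. A pair $(C,O)$ with $O\in O(m)$, split into row blocks $O_{p,0},\dots,O_{1,0},O_\perp$ of $d_p,\dots,d_1,d_0$ rows, and $C=(C_{r,l})_{1\le r\le p,\,0<l<r}$, $C_{r,l}\in\mathrm{Mat}(d_r,\sum_{j=0}^{r-l-1}d_j)$, represents $G^o$ if $G^o_{r,0}=O_{r,0}$ and, for $l>0$, $G^o_{r,l}=C_{r,l}M_{r,l}$, where $M_{r,l}$ is the vertical stack of $O_{r-l-1,0},\dots,O_{1,0},O_\perp$ (only $O_\perp$ when $l=r-1$). Every element of $\mathcal{GO}$ has such a representation. $O(m-\mathfrak l)$ acts on $O(m)$ by left multiplication on the last $m-\mathfrak l$ rows $O_\perp$, and $O(m)/O(m-\mathfrak l)$ is the corresponding quotient. Flag manifold: $f_i=\sum_{j=1}^il_j$ for $1\le i\le g$, $f_{g+1}=m$, and $\mathcal F(f_1,\dots,f_{g+1};\mathbb R)=O(m)/(O(l_1)\times\cdots\times O(l_g)\times O(m-\mathfrak l))$, where $O(l_i)$ acts by left multiplication on the row block $O_{r_i,0}$ and $O(m-\mathfrak l)$ on $O_\perp$. $\kappa(G)$ is the $n_{\min}\times pm$ block matrix with row blocks $(r,l)$ ($r$ descending from $p$ to $1$, $l$ ascending from $0$ to $r-1$) and column blocks of width $m$ indexed by $i=p,\dots,1$ from left to right, with $\kappa(G)_{(r,l),i}=G_{r,r-l-i}$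 if $i\le r-l$ and $0$ otherwise. $\mathcal R(G)=\mathcal R(G,A,B)=\det(\kappa(G)A\kappa(G)')/\det(\kappa(G)B\kappa(G)')$, the generalized Rayleigh quotient, where $A,B$ are symmetric $mp\times mp$ matrices with $B$ positive definite.
   Formalization: In (3), the identification of K with F for 𝔩=m is proved only when also d_j=0 for 1≤j≤p−2, exactly the case of zero fiber dimension; as printed it fails, e.g. for m=k=2, p=3, (d_1,d_2,d_3)=(1,0,1), where dim K=2 but dim F=1. *)

theory Defs
  imports
    "HOL-Analysis.Analysis"
    "HOL-Algebra.Product_Groups"
    "Jordan_Normal_Form.VS_Connect"
begin

section \<open>Smooth spaces and manifolds\<close>

text \<open>
  \<open>Ck_on n k D f\<close>: all iterated partial derivatives of \<open>f\<close> up to order \<open>k\<close> exist and are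
  continuous on \<open>D\<close>, an open subset of \<open>\<real>\<^sup>n\<close> (the topology \<^const>\<open>Euclidean_space\<close>, whose points are
  the sequences vanishing from index \<open>n\<close> on).
\<close>

fun Ck_on :: "nat \<Rightarrow> nat \<Rightarrow> (nat \<Rightarrow> real) set \<Rightarrow> ((nat \<Rightarrow> real) \<Rightarrow> real) \<Rightarrow> bool" where
  "Ck_on n 0 D f \<longleftrightarrow> continuous_map (subtopology (Euclidean_space n) D) euclideanreal f"
| "Ck_on n (Suc k) D f \<longleftrightarrow>
     continuous_map (subtopology (Euclidean_space n) D) euclideanreal f \<and>
     (\<forall>i<n. (\<forall>x\<in>D. (\<lambda>t. f (x(i := t))) differentiable (at (x i))) \<and>
            Ck_on n k D (\<lambda>x. deriv (\<lambda>t. f (x(i := t))) (x i)))"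

definition smooth_on_Rn :: "nat \<Rightarrow> (nat \<Rightarrow> real) set \<Rightarrow> ((nat \<Rightarrow> real) \<Rightarrow> real) \<Rightarrow> bool" where
  "smooth_on_Rn n D f \<longleftrightarrow> (\<forall>k. Ck_on n k D f)"

text \<open>
  A smooth structure is given by its sheaf of smooth real functions: a topology together with the
  set of smooth functions on each open set (only the values on that open set matter).
  A smooth manifold is such a space that is Hausdorff, second countable and locally isomorphic to an
  open subset of \<open>\<real>\<^sup>n\<close> with its sheaf of infinitely differentiable functions; this is the notion of a
  manifold usually given by a maximal smooth atlas.
\<close>

record 'a smooth_space =
  top_of :: "'a topology"
  smooth_funs :: "'a set \<Rightarrow> ('a \<Rightarrow> real) set"

abbreviation pts :: "'a smooth_space \<Rightarrow> 'a set" where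
  "pts X \<equiv> topspace (top_of X)"

definition Rn_space :: "nat \<Rightarrow> (nat \<Rightarrow> real) smooth_space" where
  "Rn_space n = \<lparr>top_of = Euclidean_space n, smooth_funs = (\<lambda>W. {f. smooth_on_Rn n W f})\<rparr>"

definition open_subspace :: "'a smooth_space \<Rightarrow> 'a set \<Rightarrow> 'a smooth_space" where
  "open_subspace X U = \<lparr>top_of = subtopology (top_of X) U, smooth_funs = smooth_funs X\<rparr>"

definition smooth_map :: "'a smooth_space \<Rightarrow> 'b smooth_space \<Rightarrow> ('a \<Rightarrow> 'b) \<Rightarrow> bool" where
  "smooth_map X Y \<phi> \<longleftrightarrow>
     continuous_map (top_of X) (top_of Y) \<phi> \<and>
     (\<forall>W f. openin (top_of Y) W \<and> f \<in> smooth_funs Y W \<longrightarrow>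
            f \<circ> \<phi> \<in> smooth_funs X {x \<in> pts X. \<phi> x \<in> W})"

definition diffeomorphism :: "'a smooth_space \<Rightarrow> 'b smooth_space \<Rightarrow> ('a \<Rightarrow> 'b) \<Rightarrow> bool" where
  "diffeomorphism X Y \<phi> \<longleftrightarrow>
     smooth_map X Y \<phi> \<and>
     (\<exists>\<psi>. smooth_map Y X \<psi> \<and> (\<forall>x\<in>pts X. \<psi> (\<phi> x) = x) \<and> (\<forall>y\<in>pts Y. \<phi> (\<psi> y) = y))"

definition smooth_manifold :: "nat \<Rightarrow> 'a smooth_space \<Rightarrow> bool" where
  "smooth_manifold n X \<longleftrightarrow>
     Hausdorff_space (top_of X) \<and> second_countable (top_of X) \<and>
     (\<forall>x\<in>pts X. \<exists>U V \<phi>. openin (top_of X) U \<and> x \<in> U \<and> openin (Euclidean_space n) V \<and>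
        diffeomorphism (open_subspace X U) (open_subspace (Rn_space n) V) \<phi>)"

text \<open>
  The sheaf generated by a family \<open>\<G>\<close> of functions (\<open>\<G> U\<close> being the generators available on the
  open set \<open>U\<close>): functions that are locally smooth functions of finitely many generators.
\<close>

definition generated_funs ::
    "'a topology \<Rightarrow> ('a set \<Rightarrow> ('a \<Rightarrow> real) set) \<Rightarrow> 'a set \<Rightarrow> ('a \<Rightarrow> real) set" where
  "generated_funs T \<G> W =
     {f. \<forall>x\<in>W. \<exists>U n u D F. openin T U \<and> x \<in> U \<and> U \<subseteq> W \<and> (\<forall>i<n. u i \<in> \<G> U) \<and>
         openin (Euclidean_space n) D \<and> smooth_on_Rn n D F \<and>
         (\<forall>y\<in>U. (\<lambda>i. if i < n then u i y else 0) \<in> D \<and>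
                 f y = F (\<lambda>i. if i < n then u i y else (0::real)))}"

text \<open>
  A subset \<open>E\<close> of a finite-dimensional real vector space with linear coordinates \<open>c\<close>: subspace
  topology, and the smooth functions are the local restrictions of smooth functions of the
  coordinates.
\<close>

definition coordinate_space :: "'a set \<Rightarrow> ('a \<Rightarrow> real) set \<Rightarrow> 'a smooth_space" where
  "coordinate_space E c =
     (let T = topology_generated_by (insert E {{x \<in> E. u x \<in> S} | u S. u \<in> c \<and> open S})
      in \<lparr>top_of = T, smooth_funs = generated_funs T (\<lambda>_. c)\<rparr>)"

definition product_space :: "'a smooth_space \<Rightarrow> 'b smooth_space \<Rightarrow> ('a \<times> 'b) smooth_space" where
  "product_space X Y =
     (let T = prod_topology (top_of X) (top_of Y)
      in \<lparr>top_of = T,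
          smooth_funs = generated_funs T
            (\<lambda>W. {f \<circ> fst | f. f \<in> smooth_funs X (fst ` W)} \<union>
                  {f \<circ> snd | f. f \<in> smooth_funs Y (snd ` W)})\<rparr>)"

definition quotient_open :: "'a topology \<Rightarrow> ('a \<Rightarrow> 'b) \<Rightarrow> 'b set \<Rightarrow> bool" where
  "quotient_open T q U \<longleftrightarrow> U \<subseteq> q ` topspace T \<and> openin T {x \<in> topspace T. q x \<in> U}"

lemma istopology_quotient_open: "istopology (quotient_open T q)"
proof -
  have 1: "{x \<in> topspace T. q x \<in> S \<inter> U} = {x \<in> topspace T. q x \<in> S} \<inter> {x \<in> topspace T. q x \<in> U}"
    for S U by auto
  have 2: "{x \<in> topspace T. q x \<in> \<Union>\<K>} = (\<Union>S\<in>\<K>. {x \<in> topspace T. q x \<in> S})" for \<K>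
    by auto
  show ?thesis
    unfolding istopology_def quotient_open_def 1 2 by (auto intro!: openin_Union)
qed

text \<open>
  Quotient along \<open>q\<close>: quotient topology, and a function is smooth iff its pullback is. When the
  quotient carries a manifold structure making \<open>q\<close> a submersion (as for free smooth actions of
  compact groups) this is that structure.
\<close>

definition quotient_space :: "'a smooth_space \<Rightarrow> ('a \<Rightarrow> 'b) \<Rightarrow> 'b smooth_space" where
  "quotient_space X q =
     \<lparr>top_of = topology (quotient_open (top_of X) q),
      smooth_funs = (\<lambda>W. {f. f \<circ> q \<in> smooth_funs X {x \<in> pts X. q x \<in> W}})\<rparr>"

section \<open>Fiber bundles and vector bundles\<close>

definition local_trivialization ::
    "'e smooth_space \<Rightarrow> 'b smooth_space \<Rightarrow> ('e \<Rightarrow> 'b) \<Rightarrow> 'v smooth_space \<Rightarrow>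
     'b set \<Rightarrow> ('e \<Rightarrow> 'b \<times> 'v) \<Rightarrow> bool" where
  "local_trivialization E B \<pi> V U \<Phi> \<longleftrightarrow>
     openin (top_of B) U \<and>
     diffeomorphism (open_subspace E {x \<in> pts E. \<pi> x \<in> U}) (product_space (open_subspace B U) V) \<Phi> \<and>
     (\<forall>x\<in>pts E. \<pi> x \<in> U \<longrightarrow> fst (\<Phi> x) = \<pi> x)"

definition smooth_fiber_bundle ::
    "'e smooth_space \<Rightarrow> 'b smooth_space \<Rightarrow> ('e \<Rightarrow> 'b) \<Rightarrow> 'v smooth_space \<Rightarrow> bool" where
  "smooth_fiber_bundle E B \<pi> V \<longleftrightarrow>
     (\<exists>n. smooth_manifold n E) \<and> (\<exists>n. smooth_manifold n B) \<and> (\<exists>n. smooth_manifold n V) \<and>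
     smooth_map E B \<pi> \<and> \<pi> ` pts E = pts B \<and>
     (\<forall>b\<in>pts B. \<exists>U \<Phi>. b \<in> U \<and> local_trivialization E B \<pi> V U \<Phi>)"

definition linear_iso :: "(real, 'a) module \<Rightarrow> (real, 'b) module \<Rightarrow> ('a \<Rightarrow> 'b) \<Rightarrow> bool" where
  "linear_iso M N \<phi> \<longleftrightarrow>
     \<phi> \<in> LinearCombinations.module_hom class_ring M N \<and> bij_betw \<phi> (carrier M) (carrier N)"

text \<open>\<open>fib b\<close> is the fiber over \<open>b\<close> with its vector space operations, and \<open>Vm\<close> is the model fiber
  \<open>V\<close> with its vector space operations.\<close>

definition smooth_vector_bundle ::
    "'e smooth_space \<Rightarrow> 'b smooth_space \<Rightarrow> ('e \<Rightarrow> 'b) \<Rightarrow> ('b \<Rightarrow> (real, 'e) module) \<Rightarrow>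
     'v smooth_space \<Rightarrow> (real, 'v) module \<Rightarrow> bool" where
  "smooth_vector_bundle E B \<pi> fib V Vm \<longleftrightarrow>
     smooth_fiber_bundle E B \<pi> V \<and>
     vectorspace class_ring Vm \<and> carrier Vm = pts V \<and>
     (\<forall>b\<in>pts B. vectorspace class_ring (fib b) \<and> carrier (fib b) = {x \<in> pts E. \<pi> x = b}) \<and>
     (\<forall>b\<in>pts B. \<exists>U \<Phi>. b \<in> U \<and> local_trivialization E B \<pi> V U \<Phi> \<and>
        (\<forall>b'\<in>U. linear_iso (fib b') Vm (snd \<circ> \<Phi>)))"

section \<open>Matrices\<close>

text \<open>\<open>nc\<close> (resp. \<open>nr\<close>) is the common number of columns (rows), needed for the empty list.\<close>

definition vstack :: "nat \<Rightarrow> real mat list \<Rightarrow> real mat" where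
  "vstack nc As = foldr append_rows As (0\<^sub>m 0 nc)"

definition hstack :: "nat \<Rightarrow> real mat list \<Rightarrow> real mat" where
  "hstack nr As = transpose_mat (vstack nr (map transpose_mat As))"

definition kronecker :: "real mat \<Rightarrow> real mat \<Rightarrow> real mat" where
  "kronecker A B = Matrix.mat (dim_row A * dim_row B) (dim_col A * dim_col B)
     (\<lambda>(i, j). A $$ (i div dim_row B, j div dim_col B) * B $$ (i mod dim_row B, j mod dim_col B))"

definition mat_entries :: "nat \<Rightarrow> nat \<Rightarrow> (real mat \<Rightarrow> real) set" where
  "mat_entries nr nc = {\<lambda>A. A $$ (i, j) | i j. i < nr \<and> j < nc}"

definition orth_mats :: "nat \<Rightarrow> real mat set" where
  "orth_mats n = {A \<in> carrier_mat n n. A * transpose_mat A = 1\<^sub>m n}"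

definition orth_group :: "nat \<Rightarrow> real mat monoid" where
  "orth_group n = \<lparr>carrier = orth_mats n, mult = (*), one = 1\<^sub>m n\<rparr>"

definition left_orbit :: "real mat set \<Rightarrow> real mat \<Rightarrow> real mat set" where
  "left_orbit H A = {h * A | h. h \<in> H}"

definition pos_def_mat :: "nat \<Rightarrow> real mat \<Rightarrow> bool" where
  "pos_def_mat n B \<longleftrightarrow> B \<in> carrier_mat n n \<and> transpose_mat B = B \<and>
     (\<forall>v\<in>carrier_vec n. v \<noteq> 0\<^sub>v n \<longrightarrow> scalar_prod v (B *\<^sub>v v) > 0)"

section \<open>The block structure\<close>

text \<open>Throughout, the block sizes are \<open>d 1, \<dots>, d p\<close>, and \<open>d 0 = m - ltot p d\<close>.\<close>

definition ltot :: "nat \<Rightarrow> (nat \<Rightarrow> nat) \<Rightarrow> nat" where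
  "ltot p d = (\<Sum>i=1..p. d i)"

definition nmin :: "nat \<Rightarrow> (nat \<Rightarrow> nat) \<Rightarrow> nat" where
  "nmin p d = (\<Sum>i=1..p. i * d i)"

definition r_list :: "nat \<Rightarrow> (nat \<Rightarrow> nat) \<Rightarrow> nat list" where
  "r_list p d = filter (\<lambda>r. d r > 0) [1..<Suc p]"

definition g_num :: "nat \<Rightarrow> (nat \<Rightarrow> nat) \<Rightarrow> nat" where
  "g_num p d = length (r_list p d)"

definition l_seq :: "nat \<Rightarrow> (nat \<Rightarrow> nat) \<Rightarrow> nat \<Rightarrow> nat" where
  "l_seq p d i = d (r_list p d ! (i - 1))"

definition F_mat :: "nat \<Rightarrow> (nat \<Rightarrow> nat) \<Rightarrow> real mat" where
  "F_mat p d = diag_block_mat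
     (map (\<lambda>r. kronecker (Matrix.mat r r (\<lambda>(i, j). if j = i + 1 then 1 else 0)) (1\<^sub>m (d r)))
          (rev [1..<Suc p]))"

text \<open>First row of the block \<open>(r, j)\<close>, the blocks being ordered with \<open>r\<close> descending and, for each
  \<open>r\<close>, \<open>j\<close> descending from \<open>r - 1\<close> to \<open>0\<close>.\<close>

definition row_off :: "nat \<Rightarrow> (nat \<Rightarrow> nat) \<Rightarrow> nat \<Rightarrow> nat \<Rightarrow> nat" where
  "row_off p d r j = (\<Sum>s=Suc r..p. s * d s) + (r - 1 - j) * d r"

definition rblk :: "nat \<Rightarrow> (nat \<Rightarrow> nat) \<Rightarrow> real mat \<Rightarrow> nat \<Rightarrow> nat \<Rightarrow> real mat" where
  "rblk p d G r j = Matrix.mat (d r) (dim_col G) (\<lambda>(a, b). G $$ (row_off p d r j + a, b))"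

definition sqblk ::
    "nat \<Rightarrow> (nat \<Rightarrow> nat) \<Rightarrow> real mat \<Rightarrow> nat \<Rightarrow> nat \<Rightarrow> nat \<Rightarrow> nat \<Rightarrow> real mat" where
  "sqblk p d Q r1 j1 r2 j2 = Matrix.mat (d r1) (d r2)
     (\<lambda>(a, b). Q $$ (row_off p d r1 j1 + a, row_off p d r2 j2 + b))"

definition stack_blocks :: "nat \<Rightarrow> nat \<Rightarrow> (nat \<Rightarrow> nat \<Rightarrow> real mat) \<Rightarrow> real mat" where
  "stack_blocks p m X =
     vstack m (concat (map (\<lambda>r. map (\<lambda>j. X r j) (rev [0..<r])) (rev [1..<Suc p])))"

definition zero_part :: "nat \<Rightarrow> (nat \<Rightarrow> nat) \<Rightarrow> real mat \<Rightarrow> real mat" where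
  "zero_part p d G = vstack (dim_col G) (map (\<lambda>r. rblk p d G r 0) (rev [1..<Suc p]))"

definition GO :: "nat \<Rightarrow> nat \<Rightarrow> (nat \<Rightarrow> nat) \<Rightarrow> real mat set" where
  "GO p m d = {G \<in> carrier_mat (nmin p d) m.
     zero_part p d G * transpose_mat (zero_part p d G) = 1\<^sub>m (ltot p d) \<and>
     (\<forall>\<rho>\<in>{1..p}. \<forall>\<rho>\<^sub>1\<in>{1..p}. \<forall>l<\<rho>. int l > max 0 (int \<rho> - int \<rho>\<^sub>1 - 1) \<longrightarrow>
        rblk p d G \<rho> l * transpose_mat (rblk p d G \<rho>\<^sub>1 0) = 0\<^sub>m (d \<rho>) (d \<rho>\<^sub>1))}"

definition Qset :: "nat \<Rightarrow> (nat \<Rightarrow> nat) \<Rightarrow> real mat set" where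
  "Qset p d = {Q \<in> carrier_mat (nmin p d) (nmin p d).
     (\<forall>r1\<in>{1..p}. \<forall>r2\<in>{1..p}. \<forall>j1<r1. \<forall>j2<r2. (r1, j1) \<noteq> (r2, j2) \<longrightarrow>
        sqblk p d Q r1 j1 r2 j2 = 0\<^sub>m (d r1) (d r2)) \<and>
     Q * F_mat p d = F_mat p d * Q \<and>
     (\<forall>r\<in>{1..p}. (\<forall>j<r. sqblk p d Q r j r j = sqblk p d Q r 0 r 0) \<and>
        sqblk p d Q r 0 r 0 * transpose_mat (sqblk p d Q r 0 r 0) = 1\<^sub>m (d r))}"

definition Qgroup :: "nat \<Rightarrow> (nat \<Rightarrow> nat) \<Rightarrow> real mat monoid" where
  "Qgroup p d = \<lparr>carrier = Qset p d, mult = (*), one = 1\<^sub>m (nmin p d)\<rparr>"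

definition Qspace :: "nat \<Rightarrow> (nat \<Rightarrow> nat) \<Rightarrow> real mat smooth_space" where
  "Qspace p d = coordinate_space (Qset p d) (mat_entries (nmin p d) (nmin p d))"

text \<open>\<open>O(n 1) \<times> \<dots> \<times> O(n g)\<close> as a smooth space (its points are those of the product group).\<close>

definition orth_product_space :: "nat \<Rightarrow> (nat \<Rightarrow> nat) \<Rightarrow> (nat \<Rightarrow> real mat) smooth_space" where
  "orth_product_space g n = coordinate_space (\<Pi>\<^sub>E i\<in>{1..g}. orth_mats (n i))
     {\<lambda>h. h i $$ (a, b) | i a b. i \<in> {1..g} \<and> a < n i \<and> b < n i}"

section \<open>Representations and quotients\<close>

text \<open>Row blocks \<open>O\<^bsub>p,0\<^esub>, \<dots>, O\<^bsub>1,0\<^esub>, O\<^sub>\<bottom>\<close> of an orthogonal matrix; \<open>O\<^sub>\<bottom>\<close> has index \<open>0\<close>.\<close>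

definition oblk :: "nat \<Rightarrow> (nat \<Rightarrow> nat) \<Rightarrow> real mat \<Rightarrow> nat \<Rightarrow> real mat" where
  "oblk p d Om r = Matrix.mat (d r) (dim_col Om) (\<lambda>(a, b). Om $$ ((\<Sum>s=Suc r..p. d s) + a, b))"

definition M_mat :: "nat \<Rightarrow> (nat \<Rightarrow> nat) \<Rightarrow> real mat \<Rightarrow> nat \<Rightarrow> nat \<Rightarrow> real mat" where
  "M_mat p d Om r l = vstack (dim_col Om) (map (oblk p d Om) (rev [0..<r - l]))"

definition represents ::
    "nat \<Rightarrow> nat \<Rightarrow> (nat \<Rightarrow> nat) \<Rightarrow> (nat \<Rightarrow> nat \<Rightarrow> real mat) \<Rightarrow> real mat \<Rightarrow> real mat \<Rightarrow> bool" where
  "represents p m d C Om G \<longleftrightarrow>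
     Om \<in> orth_mats m \<and>
     (\<forall>r\<in>{1..p}. rblk p d G r 0 = oblk p d Om r \<and>
        (\<forall>l. 0 < l \<and> l < r \<longrightarrow>
           C r l \<in> carrier_mat (d r) (\<Sum>j<r - l. d j) \<and>
           rblk p d G r l = C r l * M_mat p d Om r l))"

definition perp_group :: "nat \<Rightarrow> nat \<Rightarrow> (nat \<Rightarrow> nat) \<Rightarrow> real mat set" where
  "perp_group p m d = {diag_block_mat [1\<^sub>m (ltot p d), h] | h. h \<in> orth_mats (m - ltot p d)}"

abbreviation stiefel_class :: "nat \<Rightarrow> nat \<Rightarrow> (nat \<Rightarrow> nat) \<Rightarrow> real mat \<Rightarrow> real mat set" where
  "stiefel_class p m d Om \<equiv> left_orbit (perp_group p m d) Om"

text \<open>The row blocks of an orthogonal matrix come with \<open>r\<close> descending, so the factors act in the order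
  \<open>O(l\<^sub>g), \<dots>, O(l\<^sub>1), O(m - \<ll>)\<close> from top to bottom.\<close>

definition flag_group :: "nat \<Rightarrow> nat \<Rightarrow> (nat \<Rightarrow> nat) \<Rightarrow> real mat set" where
  "flag_group p m d =
     {diag_block_mat (map h (rev [1..<Suc (g_num p d)]) @ [h']) | h h'.
        (\<forall>i\<in>{1..g_num p d}. h i \<in> orth_mats (l_seq p d i)) \<and> h' \<in> orth_mats (m - ltot p d)}"

abbreviation flag_class :: "nat \<Rightarrow> nat \<Rightarrow> (nat \<Rightarrow> nat) \<Rightarrow> real mat \<Rightarrow> real mat set" where
  "flag_class p m d Om \<equiv> left_orbit (flag_group p m d) Om"

definition flag_manifold :: "nat \<Rightarrow> nat \<Rightarrow> (nat \<Rightarrow> nat) \<Rightarrow> real mat set smooth_space" where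
  "flag_manifold p m d =
     quotient_space (coordinate_space (orth_mats m) (mat_entries m m)) (flag_class p m d)"

abbreviation K_class :: "nat \<Rightarrow> (nat \<Rightarrow> nat) \<Rightarrow> real mat \<Rightarrow> real mat set" where
  "K_class p d G \<equiv> left_orbit (Qset p d) G"

definition K_space :: "nat \<Rightarrow> nat \<Rightarrow> (nat \<Rightarrow> nat) \<Rightarrow> real mat set smooth_space" where
  "K_space p m d =
     quotient_space (coordinate_space (GO p m d) (mat_entries (nmin p d) m)) (K_class p d)"

section \<open>Vector space structure of the fibers\<close>

text \<open>
  Two classes in the same fiber have representatives with equal blocks \<open>G\<^bsub>r,0\<^esub>\<close>; the other blocks
  are added, resp. scaled. In terms of representations \<open>(C, O)\<close> with fixed \<open>O\<close> these are the linear
  operations on \<open>C\<close>.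
\<close>

definition K_add :: "nat \<Rightarrow> nat \<Rightarrow> (nat \<Rightarrow> nat) \<Rightarrow> real mat set \<Rightarrow> real mat set \<Rightarrow> real mat set" where
  "K_add p m d x y =
     {stack_blocks p m (\<lambda>r j. if j = 0 then rblk p d G r 0 else rblk p d G r j + rblk p d H r j)
      | G H. G \<in> x \<and> H \<in> y \<and> zero_part p d G = zero_part p d H}"

definition K_smult :: "nat \<Rightarrow> nat \<Rightarrow> (nat \<Rightarrow> nat) \<Rightarrow> real \<Rightarrow> real mat set \<Rightarrow> real mat set" where
  "K_smult p m d c x =
     {stack_blocks p m (\<lambda>r j. if j = 0 then rblk p d G r 0 else c \<cdot>\<^sub>m rblk p d G r j) | G. G \<in> x}"

definition K_zero ::
    "nat \<Rightarrow> nat \<Rightarrow> (nat \<Rightarrow> nat) \<Rightarrow> (real mat set \<Rightarrow> real mat set) \<Rightarrow> real mat set \<Rightarrow> real mat set" where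
  "K_zero p m d \<pi> b = {G \<in> GO p m d. \<pi> (K_class p d G) = b \<and>
     (\<forall>r\<in>{1..p}. \<forall>l. 0 < l \<and> l < r \<longrightarrow> rblk p d G r l = 0\<^sub>m (d r) m)}"

text \<open>\<^typ>\<open>('a, 'b) module\<close> records extend rings; \<open>mult\<close> and \<open>one\<close> play no role.\<close>

definition fiber_module ::
    "nat \<Rightarrow> nat \<Rightarrow> (nat \<Rightarrow> nat) \<Rightarrow> (real mat set \<Rightarrow> real mat set) \<Rightarrow> real mat set \<Rightarrow>
     (real, real mat set) module" where
  "fiber_module p m d \<pi> b =
     \<lparr>carrier = {x \<in> pts (K_space p m d). \<pi> x = b}, mult = undefined, one = undefined,
      zero = K_zero p m d \<pi> b, add = K_add p m d, smult = K_smult p m d\<rparr>"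

definition direct_sum_module :: "'i set \<Rightarrow> ('i \<Rightarrow> (real, 'a) module) \<Rightarrow> (real, 'i \<Rightarrow> 'a) module" where
  "direct_sum_module I M =
     \<lparr>carrier = (\<Pi>\<^sub>E i\<in>I. carrier (M i)), mult = undefined, one = undefined,
      zero = (\<lambda>i\<in>I. \<zero>\<^bsub>M i\<^esub>), add = (\<lambda>x y. \<lambda>i\<in>I. x i \<oplus>\<^bsub>M i\<^esub> y i),
      smult = (\<lambda>c x. \<lambda>i\<in>I. c \<odot>\<^bsub>M i\<^esub> x i)\<rparr>"

definition fiber_width :: "(nat \<Rightarrow> nat) \<Rightarrow> nat \<Rightarrow> nat" where
  "fiber_width d r = (\<Sum>l=1..r - 1. \<Sum>j=0..r - l - 1. d j)"

definition model_fiber_module :: "nat \<Rightarrow> (nat \<Rightarrow> nat) \<Rightarrow> (real, nat \<Rightarrow> real mat) module" where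
  "model_fiber_module p d =
     direct_sum_module {1..p} (\<lambda>r. module_mat TYPE(real) (d r) (fiber_width d r))"

definition model_fiber_space :: "nat \<Rightarrow> (nat \<Rightarrow> nat) \<Rightarrow> (nat \<Rightarrow> real mat) smooth_space" where
  "model_fiber_space p d = coordinate_space (carrier (model_fiber_module p d))
     {\<lambda>C. C r $$ (a, b) | r a b. r \<in> {1..p} \<and> a < d r \<and> b < fiber_width d r}"

section \<open>The generalized Rayleigh quotient\<close>

definition kappa :: "nat \<Rightarrow> nat \<Rightarrow> (nat \<Rightarrow> nat) \<Rightarrow> real mat \<Rightarrow> real mat" where
  "kappa p m d G = vstack (p * m) (concat (map (\<lambda>r. map (\<lambda>l.
     hstack (d r) (map (\<lambda>i. if i \<le> r - l then rblk p d G r (r - l - i) else 0\<^sub>m (d r) m)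
       (rev [1..<Suc p]))) [0..<r]) (rev [1..<Suc p])))"

definition rayleigh_form :: "nat \<Rightarrow> nat \<Rightarrow> (nat \<Rightarrow> nat) \<Rightarrow> real mat \<Rightarrow> real mat \<Rightarrow> real" where
  "rayleigh_form p m d A G =
     Determinant.det (kappa p m d G * A * transpose_mat (kappa p m d G))"

definition rayleigh ::
    "nat \<Rightarrow> nat \<Rightarrow> (nat \<Rightarrow> nat) \<Rightarrow> real mat \<Rightarrow> real mat \<Rightarrow> real mat \<Rightarrow> real" where
  "rayleigh p m d A B G = rayleigh_form p m d A G / rayleigh_form p m d B G"

end

theory Submission
  imports Defs
begin

text \<open>
  Every \<open>G\<close> in \<open>\<G>\<O>\<close> has orthonormal rows \<open>G\<^bsub>r,0\<^esub>\<close>, which extend to an orthogonal matrix; the remaining blocks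
  are arbitrary linear combinations of those rows of that matrix to which they are not forced to be
  orthogonal. Hence \<open>G\<close> is a pair (orthonormal frame, coefficients), and dividing by \<open>\<Q>\<close> replaces the frame by its
  flag. Charts and local trivializations come from one local section of \<open>O(m)\<close> over the flag manifold: near
  \<open>O\<^sub>0\<close> the row spaces of \<open>O O\<^sub>0'\<close> have a unique block unipotent basis, and Gram-Schmidt turns it into
  an orthogonal representative depending smoothly on the flag. Normalizing \<open>G\<close> by the element of \<open>\<Q>\<close> that
  moves its frame to this section, the coefficients are the fiber coordinates.
  Quotients are Hausdorff because the entries of \<open>G\<^bsub>r,j\<^esub>' G\<^bsub>r,0\<^esub>\<close> are invariants that separate the orbits.
  For the Rayleigh quotient, the rows of \<open>\<kappa>(G)\<close> are linearly independent, so \<open>\<kappa>(G)\<close> may be replaced by a matrix \<open>U\<close>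
  with \<open>U B U' = 1\<close>; then \<open>\<R> = det (U A U')\<close>, whose entries are bounded independently of \<open>G\<close>.
\<close>

text \<open>The smooth structure of a quotient is defined only by pullback along the projection. A
  chart therefore has to be an invariant function upstairs, with a smooth inverse that passes
  through a section. No slice theorem is invoked: the section is an explicit formula, smooth because
  it uses only determinants, adjugates, divisions and square roots. Two facts fix its form. Labels
  decrease from top to bottom and Gram-Schmidt multiplies by a lower triangular matrix, which keeps
  the span of the leading row blocks; so orthonormalizing a unipotent representative does not move
  the flag. And G determines only the rows above the last block; so the unipotent factor is defined
  to ignore that block and can be evaluated on a matrix with zeros there. The free entries of a
  unipotent matrix are unconstrained, so all charts are onto a whole R^n, and a chart of the bundle
  is a product of two such charts. Indices r with d_r = 0 are carried along as empty blocks and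
  dropped only in the comparison with the indices r_1 < ... < r_g.\<close>

abbreviation (input) mdet :: "real mat => real" where "mdet == Determinant.det"
abbreviation (input) tr_mat :: "real mat => real mat" where "tr_mat == transpose_mat"

section \<open>Functions of class \<open>C\<^sup>k\<close> on Euclidean space\<close>

lemma continuous_map_local:
 assumes "!!x. x : topspace X ==> \<exists>U. openin X U & x : U & continuous_map (subtopology X U) Y f"
 shows "continuous_map X Y f"
 unfolding continuous_map_def
proof (intro conjI allI impI Pi_I)
 show "f x : topspace Y" if "x : topspace X" for x
  using assms[OF that] that by (auto simp: continuous_map_def Pi_iff)
 fix W assume W: "openin Y W"
 show "openin X {x : topspace X. f x : W}"
  unfolding openin_subopen[of X "{x : topspace X. f x : W}"]
 proof
  fix x assume x: "x : {x : topspace X. f x : W}"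
  then obtain U where U: "openin X U" "x : U" "continuous_map (subtopology X U) Y f"
  using assms by blast
  have "openin (subtopology X U) {y : topspace (subtopology X U). f y : W}"
  using openin_continuous_map_preimage[OF U(3) W] .
  then have "openin X {y : topspace (subtopology X U). f y : W}"
  by (rule openin_trans_full[OF _ U(1)])
  then show "\<exists>T. openin X T & x : T & T \<subseteq> {x : topspace X. f x : W}"
  using x U(2) by (intro exI[of _ "{y : topspace (subtopology X U). f y : W}"]) auto
 qed
qed

lemma Euclidean_space_eq: "Euclidean_space n = top_of_set {x. \<forall>i\<ge>n. x i = 0}"
 unfolding Euclidean_space_def euclidean_product_topology ..

lemma continuous_map_Euclidean_open_iff:
 assumes "openin (Euclidean_space n) D"
 shows "continuous_map (subtopology (Euclidean_space n) D) euclideanreal f \<longleftrightarrow> continuous_on D f"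
proof -
 have "D \<subseteq> {x. \<forall>i\<ge>n. x i = 0}"
  using openin_subset[OF assms] by (simp add: topspace_Euclidean_space)
 then have "subtopology (Euclidean_space n) D = top_of_set D"
  by (simp add: Euclidean_space_eq subtopology_subtopology Int_absorb1)
 then show ?thesis by simp
qed

lemma openin_Euclidean_box:
 assumes "openin (Euclidean_space n) D" "x : D"
 obtains e where "e > 0" "!!y. (!!i. i < n ==> \<bar>y i - x i\<bar> < e) ==> (!!i. i \<ge> n ==> y i = 0) ==> y : D"
proof -
 obtain U where U: "openin (powertop_real UNIV) U" "D = U \<inter> {x. \<forall>i\<ge>n. x i = 0}"
  using assms(1) by (auto simp: Euclidean_space_def openin_subtopology)
 obtain V where V: "x : (\<Pi>\<^sub>E i\<in>UNIV. V i)" "!!i. openin euclideanreal (V i)"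
  "(\<Pi>\<^sub>E i\<in>UNIV. V i) \<subseteq> U"
  using product_topology_open_contains_basis[OF U(1), of x] assms(2) U(2) by blast
 have "\<forall>i. \<exists>e>0. \<forall>y. \<bar>y - x i\<bar> < e --> y : V i"
 proof
  fix i
  have "open (V i)" "x i : V i" using V by (auto simp: PiE_iff)
  then show "\<exists>e>0. \<forall>y. \<bar>y - x i\<bar> < e --> y : V i"
  by (auto simp: open_dist dist_real_def)
 qed
 then obtain e where e: "!!i. e i > 0" "!!i y. \<bar>y - x i\<bar> < e i ==> y : V i" by metis
 \<comment> \<open>The entry 1 keeps the set nonempty when n = 0. Only the first n radii count,
   since the remaining coordinates are pinned to 0.\<close>
 define e0 where "e0 = Min (insert 1 (e ` {..<n}))"
 have "e0 > 0" using e(1) by (simp add: e0_def)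
 have le: "e0 <= e i" if "i < n" for i using that by (simp add: e0_def)
 show thesis
 proof
  show "e0 > 0" by fact
  fix y assume y: "!!i. i < n ==> \<bar>y i - x i\<bar> < e0" "!!i. i \<ge> n ==> y i = 0"
  have "y i : V i" for i
  proof (cases "i < n")
  case True then show ?thesis using e(2)[of "y i" i] y(1)[of i] le[of i] by simp
  next
  case False
  then have "y i = x i" using y(2) assms(2) U(2) by simp
  then show ?thesis using e by simp
  qed
  then show "y : D" using V(3) U(2) y(2) by (auto simp: PiE_iff subset_iff)
 qed
qed

lemma eventually_fun_upd_in_open:
 assumes "openin (Euclidean_space n) D" "x : D" "i < n"
 shows "eventually (%t. x(i := t) : D) (nhds (x i))"
proof -
 obtain e where e: "e > 0" "!!y. (!!i. i < n ==> \<bar>y i - x i\<bar> < e) ==> (!!i. i \<ge> n ==> y i = 0) ==> y : D"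
  using openin_Euclidean_box[OF assms(1,2)] by blast
 have x0: "!!j. j \<ge> n ==> x j = 0"
  using openin_subset[OF assms(1)] assms(2) by (auto simp: topspace_Euclidean_space)
 have "\<forall>t. dist t (x i) < e --> x(i := t) : D"
  using e assms(3) x0 by (auto simp: dist_real_def)
 then show ?thesis using e(1) by (auto simp: eventually_nhds_metric)
qed

lemma tendsto_fun_componentwise:
 fixes f :: "'a => nat => real"
 assumes "!!i. ((%t. f t i) \<longlongrightarrow> l i) F"
 shows "(f \<longlongrightarrow> l) F"
proof -
 have "limitin (powertop_real UNIV) f l F"
  using assms by (simp add: limitin_componentwise)
 then show ?thesis unfolding euclidean_product_topology limitin_canonical_iff .
qed

text \<open>Only continuous partial derivatives are given, so the increment of F along \<gamma> is
  telescoped: \<open>hyb k t\<close> takes its first k coordinates from \<gamma> t and the others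
  from \<gamma> t0. Each difference changes one coordinate, the mean value theorem gives it as a
  partial derivative at an intermediate point, and continuity of the partial derivative yields the
  limit.\<close>

lemma chain_rule_partial:
 fixes \<gamma> :: "real => nat => real"
 assumes D: "openin (Euclidean_space n) D"
  and F: "!!i x. i < n ==> x : D ==> ((%t. F (x(i := t))) has_real_derivative G i x) (at (x i))"
  and G: "!!i. i < n ==> continuous_on D (G i)"
  and \<gamma>: "!!i. i < n ==> ((%t. \<gamma> t i) has_real_derivative g i) (at t0)"
  and \<gamma>0: "!!t i. i \<ge> n ==> \<gamma> t i = 0" and mem: "\<gamma> t0 : D"
 shows "((%t. F (\<gamma> t)) has_real_derivative (\<Sum>i<n. G i (\<gamma> t0) * g i)) (at t0)"
proof -
 define x where "x = \<gamma> t0"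
 define hyb where "hyb k t = (%i. if i < k then \<gamma> t i else x i)" for k t
 obtain e where e: "e > 0" "!!y. (!!i. i < n ==> \<bar>y i - x i\<bar> < e) ==> (!!i. i \<ge> n ==> y i = 0) ==> y : D"
  using openin_Euclidean_box[OF D mem] by (auto simp: x_def)
 have x0: "x i = 0" if "i \<ge> n" for i using \<gamma>0 that by (simp add: x_def)
 have lim: "((%t. \<gamma> t i) \<longlongrightarrow> x i) (at t0)" for i
 proof (cases "i < n")
  case True
  then show ?thesis using DERIV_isCont[OF \<gamma>] by (simp add: isCont_def x_def)
 next
  case False then show ?thesis using \<gamma>0[of i] by (simp add: x_def)
 qed
 have "\<forall>\<^sub>F t in at t0. \<forall>i\<in>{..<n}. dist (\<gamma> t i) (x i) < e"
  using lim e(1) by (intro eventually_ball_finite) (auto intro: tendstoD)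
 then have near: "\<forall>\<^sub>F t in at t0. \<forall>i<n. \<bar>\<gamma> t i - x i\<bar> < e"
  by eventually_elim (auto simp: dist_real_def)
 have step: "((%t. (F (hyb (Suc k) t) - F (hyb k t)) / (t - t0)) \<longlongrightarrow> G k x * g k) (at t0)"
  if k: "k < n" for k
 proof -
  have ex: "\<exists>s. \<bar>s - x k\<bar> <= \<bar>\<gamma> t k - x k\<bar> & (hyb k t)(k := s) : D &
  F (hyb (Suc k) t) - F (hyb k t) = G k ((hyb k t)(k := s)) * (\<gamma> t k - x k)"
  if t: "\<forall>i<n. \<bar>\<gamma> t i - x i\<bar> < e" for t
  proof -
  have h0: "hyb k t = (hyb k t)(k := x k)" and h1: "hyb (Suc k) t = (hyb k t)(k := \<gamma> t k)"
  by (auto simp: hyb_def fun_eq_iff less_Suc_eq)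
  have inD: "(hyb k t)(k := s) : D" if "\<bar>s - x k\<bar> <= \<bar>\<gamma> t k - x k\<bar>" for s
  proof (rule e(2))
  show "\<bar>((hyb k t)(k := s)) i - x i\<bar> < e" if "i < n" for i
  using t k that \<open>\<bar>s - x k\<bar> <= \<bar>\<gamma> t k - x k\<bar>\<close> e(1) by (fastforce simp: hyb_def)
  show "((hyb k t)(k := s)) i = 0" if "n <= i" for i
  using that k x0 by (auto simp: hyb_def)
  qed
  define \<phi> where "\<phi> s = F ((hyb k t)(k := s))" for s
  have der: "(\<phi> has_real_derivative G k ((hyb k t)(k := s))) (at s)"
  if "\<bar>s - x k\<bar> <= \<bar>\<gamma> t k - x k\<bar>" for s
  using F[OF k inD[OF that]] by (simp add: \<phi>_def[abs_def])
  have d: "F (hyb (Suc k) t) - F (hyb k t) = \<phi> (\<gamma> t k) - \<phi> (x k)"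
  unfolding \<phi>_def using h0 h1 by simp
  consider "\<gamma> t k = x k" | "x k < \<gamma> t k" | "\<gamma> t k < x k" by linarith
  then show ?thesis
  proof cases
  case 1
  then show ?thesis using inD[of "x k"] d by (intro exI[of _ "x k"]) auto
  next
  case 2
  obtain s where "x k < s" "s < \<gamma> t k" "\<phi> (\<gamma> t k) - \<phi> (x k) = (\<gamma> t k - x k) * G k ((hyb k t)(k := s))"
  using MVT2[OF 2, of \<phi> "%s. G k ((hyb k t)(k := s))"] der by force
  then show ?thesis using inD[of s] d by (intro exI[of _ s]) auto
  next
  case 3
  obtain s where "\<gamma> t k < s" "s < x k" "\<phi> (x k) - \<phi> (\<gamma> t k) = (x k - \<gamma> t k) * G k ((hyb k t)(k := s))"
  using MVT2[OF 3, of \<phi> "%s. G k ((hyb k t)(k := s))"] der by force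
  then show ?thesis using inD[of s] d by (intro exI[of _ s]) (auto simp: algebra_simps)
  qed
  qed
  \<comment> \<open>The intermediate value of the k-th coordinate. It exists only while \<gamma> t
    is inside the box around x, hence the facts about s hold eventually; it is squeezed to x k
    because it lies no further from x k than \<gamma> t k does.\<close>
  define s where "s t = (SOME s. \<bar>s - x k\<bar> <= \<bar>\<gamma> t k - x k\<bar> & (hyb k t)(k := s) : D &
  F (hyb (Suc k) t) - F (hyb k t) = G k ((hyb k t)(k := s)) * (\<gamma> t k - x k))" for t
  define \<eta> where "\<eta> t = (hyb k t)(k := s t)" for t
  have s: "\<forall>\<^sub>F t in at t0. \<bar>s t - x k\<bar> <= \<bar>\<gamma> t k - x k\<bar> & \<eta> t : D &
  F (hyb (Suc k) t) - F (hyb k t) = G k (\<eta> t) * (\<gamma> t k - x k)"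
  using near
  proof eventually_elim
  case (elim t)
  from someI_ex[OF ex[OF elim]] show ?case by (simp add: s_def \<eta>_def)
  qed
  have "((%t. s t - x k) \<longlongrightarrow> 0) (at t0)"
  proof (rule Lim_null_comparison)
  show "\<forall>\<^sub>F t in at t0. norm (s t - x k) <= \<bar>\<gamma> t k - x k\<bar>"
  using s by eventually_elim simp
  show "((%t. \<bar>\<gamma> t k - x k\<bar>) \<longlongrightarrow> 0) (at t0)"
  using tendsto_rabs[OF LIM_zero[OF lim[of k]]] by simp
  qed
  then have slim: "(s \<longlongrightarrow> x k) (at t0)" by (rule LIM_zero_cancel)
  have "(\<eta> \<longlongrightarrow> x) (at t0)"
  proof (rule tendsto_fun_componentwise)
  fix i show "((%t. \<eta> t i) \<longlongrightarrow> x i) (at t0)"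
  by (cases "i = k"; cases "i < k") (simp_all add: \<eta>_def hyb_def slim lim)
  qed
  moreover have "\<forall>\<^sub>F t in at t0. \<eta> t : D" using s by eventually_elim simp
  ultimately have Glim: "((%t. G k (\<eta> t)) \<longlongrightarrow> G k x) (at t0)"
  using continuous_on_tendsto_compose[OF G[OF k]] mem by (simp add: x_def)
  have glim: "((%t. (\<gamma> t k - x k) / (t - t0)) \<longlongrightarrow> g k) (at t0)"
  using \<gamma>[OF k] by (simp add: has_field_derivative_iff x_def)
  show ?thesis
  proof (rule Lim_transform_eventually[OF tendsto_mult[OF Glim glim]])
  show "\<forall>\<^sub>F t in at t0. G k (\<eta> t) * ((\<gamma> t k - x k) / (t - t0)) =
  (F (hyb (Suc k) t) - F (hyb k t)) / (t - t0)"
  using s by eventually_elim simp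
  qed
 qed
 have hn: "hyb n t = \<gamma> t" for t using \<gamma>0 x0 by (auto simp: hyb_def fun_eq_iff)
 have h0: "hyb 0 t = \<gamma> t0" for t by (simp add: hyb_def x_def)
 have "(F (\<gamma> t) - F (\<gamma> t0)) / (t - t0) = (\<Sum>k<n. (F (hyb (Suc k) t) - F (hyb k t)) / (t - t0))" for t
 proof -
  have "(\<Sum>k<n. F (hyb (Suc k) t) - F (hyb k t)) = F (\<gamma> t) - F (\<gamma> t0)"
  using sum_lessThan_telescope[of "%k. F (hyb k t)" n] by (simp add: hn h0)
  then show ?thesis by (simp add: sum_divide_distrib[symmetric])
 qed
 moreover have "((%t. \<Sum>k<n. (F (hyb (Suc k) t) - F (hyb k t)) / (t - t0)) \<longlongrightarrow> (\<Sum>i<n. G i x * g i)) (at t0)"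
  by (intro tendsto_sum step) simp
 ultimately show ?thesis by (simp add: has_field_derivative_iff x_def)
qed

text \<open>\<open>deriv\<close> is applied to functions defined everywhere, but it sees only germs:
  D is open, so a coordinate can vary a little without leaving D, and there f and g
  coincide.\<close>

lemma Ck_on_cong:
 assumes "openin (Euclidean_space n) D" "!!x. x : D ==> f x = g x"
 shows "Ck_on n k D f \<longleftrightarrow> Ck_on n k D g"
 using assms(2)
proof (induction k arbitrary: f g)
 case 0
 then show ?case
  by (simp add: continuous_map_Euclidean_open_iff[OF assms(1)] cong: continuous_on_cong)
next
 case (Suc k)
 have ev: "\<forall>\<^sub>F t in nhds (x i). f (x(i := t)) = g (x(i := t))" if "x : D" "i < n" for x i
  using eventually_fun_upd_in_open[OF assms(1) that]
  by eventually_elim (use Suc.prems in auto)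
 have der: "deriv (%t. f (x(i := t))) (x i) = deriv (%t. g (x(i := t))) (x i)" if "x : D" "i < n" for x i
  using ev[OF that] by (intro deriv_cong_ev) auto
 have df: "(%t. f (x(i := t))) differentiable (at (x i)) \<longleftrightarrow> (%t. g (x(i := t))) differentiable (at (x i))"
  if "x : D" "i < n" for x i
 proof -
  have "DERIV (%t. f (x(i := t))) (x i) :> c \<longleftrightarrow> DERIV (%t. g (x(i := t))) (x i) :> c" for c
  using ev[OF that] by (intro DERIV_cong_ev) auto
  then show ?thesis by (simp add: real_differentiable_def)
 qed
 have c: "continuous_on D f \<longleftrightarrow> continuous_on D g"
  using Suc.prems by (intro continuous_on_cong) auto
 have "Ck_on n k D (%x. deriv (%t. f (x(i := t))) (x i)) \<longleftrightarrow> Ck_on n k D (%x. deriv (%t. g (x(i := t))) (x i))"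
  if "i < n" for i
  by (rule Suc.IH) (rule der[OF _ that])
 then show ?case
  using df c by (simp add: continuous_map_Euclidean_open_iff[OF assms(1)])
qed

lemma Ck_on_imp_continuous_on:
 assumes "openin (Euclidean_space n) D" "Ck_on n k D f"
 shows "continuous_on D f"
 using assms by (cases k) (auto simp: continuous_map_Euclidean_open_iff)

text \<open>Together with \<open>Ck_on_SucE\<close> this trades the terms \<open>deriv\<close> for
  an arbitrary family of partial derivatives, so that closure properties follow by induction on k
  from the usual differentiation rules.\<close>

lemma Ck_on_SucI:
 assumes "openin (Euclidean_space n) D" "continuous_on D f"
  and "!!i x. i < n ==> x : D ==> ((%t. f (x(i := t))) has_real_derivative f' i x) (at (x i))"
  and "!!i. i < n ==> Ck_on n k D (f' i)"
 shows "Ck_on n (Suc k) D f"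
proof -
 have "Ck_on n k D (%x. deriv (%t. f (x(i := t))) (x i))" if "i < n" for i
  using Ck_on_cong[OF assms(1), of "f' i" "%x. deriv (%t. f (x(i := t))) (x i)" k]
  assms(4)[OF that] DERIV_imp_deriv[OF assms(3)[OF that]] by auto
 then show ?thesis
  using assms by (auto simp: continuous_map_Euclidean_open_iff real_differentiable_def)
qed

lemma Ck_on_SucE:
 assumes "openin (Euclidean_space n) D" "Ck_on n (Suc k) D f"
 obtains f' where "!!i x. i < n ==> x : D ==> ((%t. f (x(i := t))) has_real_derivative f' i x) (at (x i))"
  "!!i. i < n ==> Ck_on n k D (f' i)"
proof
 show "((%t. f (x(i := t))) has_real_derivative deriv (%t. f (x(i := t))) (x i)) (at (x i))"
  if "i < n" "x : D" for i x
  using assms(2) that by (auto simp: DERIV_deriv_iff_real_differentiable)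
 show "Ck_on n k D (%x. deriv (%t. f (x(i := t))) (x i))" if "i < n" for i
  using assms(2) that by simp
qed

lemma Ck_on_mono: "Ck_on n k D f ==> U \<subseteq> D ==> Ck_on n k U f"
proof (induction k arbitrary: f)
 case 0 then show ?case using continuous_map_from_subtopology_mono by simp
next
 case (Suc k)
 then show ?case using continuous_map_from_subtopology_mono[of "Euclidean_space n" D] by auto
qed

lemma Ck_on_SucD: "Ck_on n (Suc k) D f ==> Ck_on n k D f"
proof (induction k arbitrary: f)
 case (Suc k)
 show ?case unfolding Ck_on.simps(2)[of n k]
  using Suc.prems Suc.IH by (simp only: Ck_on.simps(2)[of n "Suc k"]) blast
qed simp

lemma Ck_on_local:
 assumes "openin (Euclidean_space n) D"
  and "!!x. x : D ==> \<exists>U. openin (Euclidean_space n) U & x : U & U \<subseteq> D & Ck_on n k U f"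
 shows "Ck_on n k D f"
proof -
 have cont: "continuous_on D f"
  if "!!x. x : D ==> \<exists>U. openin (Euclidean_space n) U & x : U & U \<subseteq> D & continuous_on U f"
  for f :: "(nat => real) => real"
 proof -
  have "continuous_map (subtopology (Euclidean_space n) D) euclideanreal f"
  proof (rule continuous_map_local)
  fix x assume "x : topspace (subtopology (Euclidean_space n) D)"
  then have "x : D" by simp
  from that[OF this] obtain U where U: "openin (Euclidean_space n) U" "x : U" "U \<subseteq> D" "continuous_on U f"
  by blast
  then have "continuous_map (subtopology (subtopology (Euclidean_space n) D) U) euclideanreal f"
  by (simp add: subtopology_subtopology Int_absorb1 continuous_map_Euclidean_open_iff)
  moreover have "openin (subtopology (Euclidean_space n) D) U"
  using U openin_open_subtopology[OF assms(1)] by simp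
  ultimately show "\<exists>U. openin (subtopology (Euclidean_space n) D) U & x : U &
  continuous_map (subtopology (subtopology (Euclidean_space n) D) U) euclideanreal f"
  using U(2) by blast
  qed
  then show ?thesis by (simp add: continuous_map_Euclidean_open_iff assms(1))
 qed
 show ?thesis
  using assms(2)
 proof (induction k arbitrary: f)
  case 0
  show ?case
  unfolding Ck_on.simps continuous_map_Euclidean_open_iff[OF assms(1)]
  proof (rule cont)
  fix x assume "x : D"
  then show "\<exists>U. openin (Euclidean_space n) U & x : U & U \<subseteq> D & continuous_on U f"
  using 0[of x] Ck_on_imp_continuous_on[of n _ 0 f] by blast
  qed
 next
  case (Suc k)
  have "continuous_on D f"
  proof (rule cont)
  fix x assume "x : D"
  then show "\<exists>U. openin (Euclidean_space n) U & x : U & U \<subseteq> D & continuous_on U f"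
  using Suc.prems[of x] Ck_on_imp_continuous_on[of n _ "Suc k" f] by blast
  qed
  moreover have "(%t. f (x(i := t))) differentiable (at (x i))" if "i < n" "x : D" for i x
  using Suc.prems[OF that(2)] that(1) by auto
  moreover have "Ck_on n k D (%x. deriv (%t. f (x(i := t))) (x i))" if "i < n" for i
  proof (rule Suc.IH)
  fix x assume "x : D"
  from Suc.prems[OF this] that
  show "\<exists>U. openin (Euclidean_space n) U & x : U & U \<subseteq> D &
  Ck_on n k U (%x. deriv (%t. f (x(i := t))) (x i))" by auto
  qed
  ultimately show ?case by (simp add: continuous_map_Euclidean_open_iff assms(1))
 qed
qed

section \<open>Closure of the class C^k under arithmetic, roots and composition\<close>

lemma Ck_on_const: "openin (Euclidean_space n) D ==> Ck_on n k D (%x. c)"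
proof (induction k arbitrary: c)
 case (Suc k)
 show ?case by (rule Ck_on_SucI[of _ _ _ "%i x. 0"]) (use Suc in \<open>auto intro: Suc.IH\<close>)
qed simp

lemma Ck_on_coord:
 assumes D: "openin (Euclidean_space n) D" shows "Ck_on n k D (%x. x j)"
proof -
 have c: "continuous_on D (%x. x j)"
  by (rule continuous_on_subset[OF continuous_on_product_coordinates]) simp
 show ?thesis
 proof (cases k)
  case 0 then show ?thesis using c D by (simp add: continuous_map_Euclidean_open_iff)
 next
  case (Suc k')
  show ?thesis unfolding Suc
  using Ck_on_const[OF D] c
  by (intro Ck_on_SucI[OF D c, of "%i x. if i = j then 1 else 0"]) auto
 qed
qed

lemma Ck_on_add:
 assumes D: "openin (Euclidean_space n) D"
 shows "Ck_on n k D f ==> Ck_on n k D g ==> Ck_on n k D (%x. f x + g x)"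
proof (induction k arbitrary: f g)
 case 0 then show ?case by (auto intro: continuous_map_add)
next
 case (Suc k)
 obtain f' where f': "!!i x. i < n ==> x : D ==> ((%t. f (x(i := t))) has_real_derivative f' i x) (at (x i))"
  "!!i. i < n ==> Ck_on n k D (f' i)" using Ck_on_SucE[OF D Suc.prems(1)] by blast
 obtain g' where g': "!!i x. i < n ==> x : D ==> ((%t. g (x(i := t))) has_real_derivative g' i x) (at (x i))"
  "!!i. i < n ==> Ck_on n k D (g' i)" using Ck_on_SucE[OF D Suc.prems(2)] by blast
 show ?case
  using f' g' by (intro Ck_on_SucI[OF D, of _ "%i x. f' i x + g' i x"] continuous_on_add DERIV_add Suc.IH
  Ck_on_imp_continuous_on[OF D Suc.prems(1)] Ck_on_imp_continuous_on[OF D Suc.prems(2)])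
qed

lemma Ck_on_mult:
 assumes D: "openin (Euclidean_space n) D"
 shows "Ck_on n k D f ==> Ck_on n k D g ==> Ck_on n k D (%x. f x * g x)"
proof (induction k arbitrary: f g)
 case 0 then show ?case by (auto intro: continuous_map_real_mult)
next
 case (Suc k)
 obtain f' where f': "!!i x. i < n ==> x : D ==> ((%t. f (x(i := t))) has_real_derivative f' i x) (at (x i))"
  "!!i. i < n ==> Ck_on n k D (f' i)" using Ck_on_SucE[OF D Suc.prems(1)] by blast
 obtain g' where g': "!!i x. i < n ==> x : D ==> ((%t. g (x(i := t))) has_real_derivative g' i x) (at (x i))"
  "!!i. i < n ==> Ck_on n k D (g' i)" using Ck_on_SucE[OF D Suc.prems(2)] by blast
 have "((%t. f (x(i := t)) * g (x(i := t))) has_real_derivative f' i x * g x + g' i x * f x) (at (x i))"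
  if "i < n" "x : D" for i x
  using DERIV_mult[OF f'(1)[OF that] g'(1)[OF that]] by simp
 then show ?case
  using f'(2) g'(2)
  by (intro Ck_on_SucI[OF D, of _ "%i x. f' i x * g x + g' i x * f x"] continuous_on_mult
  Ck_on_add[OF D] Suc.IH Ck_on_SucD[OF Suc.prems(1)] Ck_on_SucD[OF Suc.prems(2)]
  Ck_on_imp_continuous_on[OF D Suc.prems(1)] Ck_on_imp_continuous_on[OF D Suc.prems(2)])
qed

lemma Ck_on_sum:
 assumes D: "openin (Euclidean_space n) D"
 shows "(!!i. i : I ==> Ck_on n k D (f i)) ==> Ck_on n k D (%x. \<Sum>i\<in>I. f i x)"
 by (induction I rule: infinite_finite_induct) (auto intro: Ck_on_add[OF D] Ck_on_const[OF D])

text \<open>The partial derivatives of 1/f are polynomials in those of f and in 1/f itself, so order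
  k for 1/f, the induction hypothesis, gives order k + 1. \<open>Ck_on_sqrt\<close> has the same
  shape.\<close>

lemma Ck_on_inverse:
 assumes D: "openin (Euclidean_space n) D" and nz: "!!x. x : D ==> f x ~= 0"
 shows "Ck_on n k D f ==> Ck_on n k D (%x. inverse (f x))"
proof (induction k)
 case 0 then show ?case using nz by (auto simp: continuous_map_Euclidean_open_iff[OF D] intro: continuous_on_inverse)
next
 case (Suc k)
 obtain f' where f': "!!i x. i < n ==> x : D ==> ((%t. f (x(i := t))) has_real_derivative f' i x) (at (x i))"
  "!!i. i < n ==> Ck_on n k D (f' i)" using Ck_on_SucE[OF D Suc.prems(1)] by blast
 have "((%t. inverse (f (x(i := t)))) has_real_derivative (-1) * (f' i x * (inverse (f x) * inverse (f x)))) (at (x i))"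
  if "i < n" "x : D" for i x
  using DERIV_inverse_fun[OF f'(1)[OF that]] nz[OF that(2)] by (simp add: field_simps)
 then show ?case
  using f'(2) nz
  by (intro Ck_on_imp_continuous_on[OF D Suc.prems] Suc.IH Ck_on_SucD[OF Suc.prems] Ck_on_SucI[OF D, of _ "%i x. (-1) * (f' i x * (inverse (f x) * inverse (f x)))"]
  continuous_on_inverse Ck_on_mult[OF D] Ck_on_const[OF D] ballI)
qed

lemma Ck_on_sqrt:
 assumes D: "openin (Euclidean_space n) D" and pos: "!!x. x : D ==> f x > 0"
 shows "Ck_on n k D f ==> Ck_on n k D (%x. sqrt (f x))"
proof (induction k)
 case 0 then show ?case by (auto simp: continuous_map_Euclidean_open_iff[OF D] intro: continuous_intros)
next
 case (Suc k)
 obtain f' where f': "!!i x. i < n ==> x : D ==> ((%t. f (x(i := t))) has_real_derivative f' i x) (at (x i))"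
  "!!i. i < n ==> Ck_on n k D (f' i)" using Ck_on_SucE[OF D Suc.prems(1)] by blast
 have der: "((%t. sqrt (f (x(i := t)))) has_real_derivative (1/2) * (inverse (sqrt (f x)) * f' i x)) (at (x i))"
  if "i < n" "x : D" for i x
  using DERIV_chain[OF DERIV_real_sqrt f'(1)[OF that]] pos[OF that(2)]
  by (simp add: o_def mult_ac)
 have S: "Ck_on n k D (%x. sqrt (f x))" using Suc Ck_on_SucD by blast
 have nz: "!!x. x : D ==> sqrt (f x) ~= 0" using pos by force
 show ?case
  using der f'(2)
  by (intro Ck_on_inverse[OF D nz S] Ck_on_imp_continuous_on[OF D Suc.prems] Ck_on_SucI[OF D, of _ "%i x. (1/2) * (inverse (sqrt (f x)) * f' i x)"]
  continuous_on_real_sqrt Ck_on_mult[OF D] Ck_on_const[OF D])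
qed

text \<open>The chain rule produces the partial derivatives of F composed with the same inner
  functions; hence F is generalized in the induction while u stays fixed. The tuples are padded with
  0 because points of \<open>Euclidean_space n\<close> are sequences vanishing from n on.\<close>

lemma Ck_on_compose:
 fixes u :: "nat => (nat => real) => real"
 assumes D: "openin (Euclidean_space n) D" and W: "openin (Euclidean_space m) W"
  and mem: "!!x. x : W ==> (%j. if j < n then u j x else 0) : D"
 shows "(!!j. j < n ==> Ck_on m k W (u j)) ==> Ck_on n k D F ==>
  Ck_on m k W (%x. F (%j. if j < n then u j x else 0))"
proof (induction k arbitrary: F)
 case (0 F)
 show ?case
  unfolding Ck_on.simps continuous_map_Euclidean_open_iff[OF W]
 proof (rule continuous_on_compose2[of D F])
  show "continuous_on D F" using 0(2) by (simp add: continuous_map_Euclidean_open_iff[OF D])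
  show "continuous_on W (%x j. if j < n then u j x else 0)"
  proof (rule continuous_on_coordinatewise_then_product)
  fix j show "continuous_on W (%x. if j < n then u j x else 0)"
  using 0(1) by (cases "j < n") (auto simp: continuous_map_Euclidean_open_iff[OF W])
  qed
 qed (use mem in auto)
next
 case (Suc k F)
 obtain F' where F': "!!i x. i < n ==> x : D ==> ((%t. F (x(i := t))) has_real_derivative F' i x) (at (x i))"
  "!!i. i < n ==> Ck_on n k D (F' i)" using Ck_on_SucE[OF D Suc.prems(2)] by blast
 have "\<forall>j. \<exists>v. j < n --> (\<forall>i x. i < m --> x : W --> ((%t. u j (x(i := t))) has_real_derivative v i x) (at (x i)))
  & (\<forall>i<m. Ck_on m k W (v i))"
 proof
  fix j show "\<exists>v. j < n --> (\<forall>i x. i < m --> x : W --> ((%t. u j (x(i := t))) has_real_derivative v i x) (at (x i)))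
  & (\<forall>i<m. Ck_on m k W (v i))"
  proof (cases "j < n")
  case True
  obtain v where "!!i x. i < m ==> x : W ==> ((%t. u j (x(i := t))) has_real_derivative v i x) (at (x i))"
  "!!i. i < m ==> Ck_on m k W (v i)"
  using Ck_on_SucE[OF W Suc.prems(1)[OF True]] by blast
  then show ?thesis by (intro exI[of _ v]) simp
  qed simp
 qed
 from choice[OF this] obtain v where v: "!!j i x. j < n ==> i < m ==> x : W ==> ((%t. u j (x(i := t))) has_real_derivative v j i x) (at (x i))"
  "!!j i. j < n ==> i < m ==> Ck_on m k W (v j i)" by blast
 let ?U = "%x j. if j < n then u j x else 0"
 have cont: "continuous_on W (%x. F (?U x))"
 proof (rule continuous_on_compose2[of D F])
  show "continuous_on D F" using Ck_on_imp_continuous_on[OF D Suc.prems(2)] .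
  show "continuous_on W ?U"
  proof (rule continuous_on_coordinatewise_then_product)
  fix j show "continuous_on W (%x. if j < n then u j x else 0)"
  using Suc.prems(1)[THEN Ck_on_imp_continuous_on[OF W]] by (cases "j < n") auto
  qed
 qed (use mem in auto)
 have der: "((%t. F (?U (x(i := t)))) has_real_derivative (\<Sum>j<n. F' j (?U x) * v j i x)) (at (x i))"
  if "i < m" "x : W" for i x
 proof -
  have "((%t. F (?U (x(i := t)))) has_real_derivative (\<Sum>j<n. F' j (?U (x(i := x i))) * v j i x)) (at (x i))"
  proof (rule chain_rule_partial[OF D F'(1), of "%t. ?U (x(i := t))" "%j. v j i x" "x i"])
  show "continuous_on D (F' j)" if "j < n" for j
  using Ck_on_imp_continuous_on[OF D F'(2)[OF that]] .
  show "((%t. ?U (x(i := t)) j) has_real_derivative v j i x) (at (x i))" if "j < n" for j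
  using v(1)[OF that \<open>i < m\<close> \<open>x : W\<close>] that by simp
  show "?U (x(i := x i)) : D" unfolding fun_upd_triv using mem[OF that(2)] .
  qed auto
  then show ?thesis unfolding fun_upd_triv .
 qed
 have "Ck_on m k W (%x. F' j (?U x))" if "j < n" for j
  using Suc.IH[of "F' j"] Ck_on_SucD[OF Suc.prems(1)] F'(2)[OF that] by simp
 then have "Ck_on m k W (%x. \<Sum>j<n. F' j (?U x) * v j i x)" if "i < m" for i
  using v(2) that by (intro Ck_on_sum[OF W] Ck_on_mult[OF W]) simp_all
 with der show ?case
  by (intro Ck_on_SucI[OF W cont, of "%i x. \<Sum>j<n. F' j (?U x) * v j i x"]) blast+
qed

lemma smooth_on_Rn_compose:
 fixes u :: "nat => (nat => real) => real"
 assumes "openin (Euclidean_space n) D" "openin (Euclidean_space m) W"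
  and "!!x. x : W ==> (%j. if j < n then u j x else 0) : D"
  and "!!j. j < n ==> smooth_on_Rn m W (u j)" "smooth_on_Rn n D F"
 shows "smooth_on_Rn m W (%x. F (%j. if j < n then u j x else 0))"
 unfolding smooth_on_Rn_def
proof
 fix k show "Ck_on m k W (%x. F (%j. if j < n then u j x else 0))"
  by (rule Ck_on_compose[OF assms(1-3)]) (use assms(4,5) in \<open>simp_all add: smooth_on_Rn_def\<close>)
qed

lemma smooth_on_Rn_local:
 assumes "openin (Euclidean_space n) D"
  and "!!x. x : D ==> \<exists>U. openin (Euclidean_space n) U & x : U & U \<subseteq> D & smooth_on_Rn n U f"
 shows "smooth_on_Rn n D f"
  unfolding smooth_on_Rn_def
proof
 fix k show "Ck_on n k D f"
 proof (rule Ck_on_local[OF assms(1)])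
  fix x assume "x : D"
  from assms(2)[OF this] show "\<exists>U. openin (Euclidean_space n) U & x : U & U \<subseteq> D & Ck_on n k U f"
  by (auto simp: smooth_on_Rn_def)
 qed
qed

section \<open>Sheaves of smooth functions\<close>

text \<open>The record \<open>smooth_space\<close> carries no axioms. These five are what later
  arguments draw on: dependence on values only, restriction, gluing, continuity, and closure under
  smooth functions of several variables. Every construction of spaces is shown to satisfy
  them.\<close>

definition smooth_sheaf :: "'a smooth_space => bool" where
 "smooth_sheaf X \<longleftrightarrow>
  (\<forall>W f g. openin (top_of X) W & f : smooth_funs X W & (\<forall>x\<in>W. f x = g x) --> g : smooth_funs X W) &
  (\<forall>W W' f. openin (top_of X) W & openin (top_of X) W' & W' \<subseteq> W & f : smooth_funs X W -->
  f : smooth_funs X W') &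
  (\<forall>W f. openin (top_of X) W &
  (\<forall>x\<in>W. \<exists>U. openin (top_of X) U & x : U & U \<subseteq> W & f : smooth_funs X U) --> f : smooth_funs X W) &
  (\<forall>W f. openin (top_of X) W & f : smooth_funs X W -->
  continuous_map (subtopology (top_of X) W) euclideanreal f) &
  (\<forall>W n u D F. openin (top_of X) W & (\<forall>i<n. u i : smooth_funs X W) &
  openin (Euclidean_space n) D & smooth_on_Rn n D F &
  (\<forall>y\<in>W. (%i. if i < n then u i y else 0) : D) -->
  (%y. F (%i. if i < n then u i y else (0::real))) : smooth_funs X W)"

context
 fixes X :: "'a smooth_space"
 assumes X: "smooth_sheaf X"
begin

lemma smooth_funs_cong:
 "f : smooth_funs X W ==> openin (top_of X) W ==> (!!x. x : W ==> f x = g x) ==> g : smooth_funs X W"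
 using X[unfolded smooth_sheaf_def, THEN conjunct1, THEN spec, THEN spec, THEN spec, of W f g] by simp

lemma smooth_funs_mono:
 "f : smooth_funs X W ==> openin (top_of X) W ==> openin (top_of X) W' ==> W' \<subseteq> W ==> f : smooth_funs X W'"
 using X[unfolded smooth_sheaf_def, THEN conjunct2, THEN conjunct1, THEN spec, THEN spec, THEN spec, of W W' f] by simp

lemma smooth_funs_glue:
 "openin (top_of X) W ==>
  (!!x. x : W ==> \<exists>U. openin (top_of X) U & x : U & U \<subseteq> W & f : smooth_funs X U) ==> f : smooth_funs X W"
 using X[unfolded smooth_sheaf_def, THEN conjunct2, THEN conjunct2, THEN conjunct1, THEN spec, THEN spec, of W f] by simp

lemma smooth_funs_continuous:
 "f : smooth_funs X W ==> openin (top_of X) W ==> continuous_map (subtopology (top_of X) W) euclideanreal f"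
 using X[unfolded smooth_sheaf_def, THEN conjunct2, THEN conjunct2, THEN conjunct2, THEN conjunct1, THEN spec, THEN spec, of W f] by simp

lemma smooth_funs_compose:
 fixes u :: "nat => 'a => real"
 assumes "openin (top_of X) W" "!!i. i < n ==> u i : smooth_funs X W"
  "openin (Euclidean_space n) D" "smooth_on_Rn n D F"
  "!!y. y : W ==> (%i. if i < n then u i y else 0) : D"
 shows "(%y. F (%i. if i < n then u i y else 0)) : smooth_funs X W"
 using assms X[unfolded smooth_sheaf_def, THEN conjunct2, THEN conjunct2, THEN conjunct2, THEN conjunct2,
  THEN spec, THEN spec, THEN spec, THEN spec, THEN spec, of W n u D F] by simp

end

lemma Euclidean_space_tuple [simp]:
 "(%i. if i < n then f i else 0) : topspace (Euclidean_space n)"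
 by (simp add: topspace_Euclidean_space)

lemma Euclidean_space_zero [simp]: "(%i. 0) : topspace (Euclidean_space n)"
 by (simp add: topspace_Euclidean_space)

lemma continuous_map_Euclidean_coord: "continuous_map (Euclidean_space n) euclideanreal (%x. x k)"
 unfolding Euclidean_space_def
 by (rule continuous_map_from_subtopology) (rule continuous_map_product_projection, simp)

lemma smooth_on_Rn_const: "openin (Euclidean_space n) D ==> smooth_on_Rn n D (%x. c)"
 by (simp add: smooth_on_Rn_def Ck_on_const)

lemma smooth_on_Rn_coord: "openin (Euclidean_space n) D ==> smooth_on_Rn n D (%x. x k)"
 by (simp add: smooth_on_Rn_def Ck_on_coord)

context
 fixes X :: "'a smooth_space" and W :: "'a set"
 assumes X: "smooth_sheaf X" and W: "openin (top_of X) W"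
begin

lemma smooth_const: "(%y. c) : smooth_funs X W"
 using smooth_funs_compose[OF X W, of 0 "%_ _. 0" "topspace (Euclidean_space 0)" "%_. c"]
 by (simp add: smooth_on_Rn_const)

lemma smooth_binary:
 assumes "f : smooth_funs X W" "g : smooth_funs X W"
  and "!!k. Ck_on 2 k (topspace (Euclidean_space 2)) F"
 shows "(%y. F (%i. if i < 2 then (if i = 0 then f else g) y else 0)) : smooth_funs X W"
 by (rule smooth_funs_compose[OF X W, of 2 "%i. if i = 0 then f else g" "topspace (Euclidean_space 2)" F])
  (use assms in \<open>auto simp: smooth_on_Rn_def\<close>)

lemma smooth_add:
 assumes "f : smooth_funs X W" "g : smooth_funs X W"
 shows "(%y. f y + g y) : smooth_funs X W"
 using smooth_binary[OF assms, of "%x. x 0 + x 1"] by (simp add: Ck_on_add Ck_on_coord)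

lemma smooth_mult:
 assumes "f : smooth_funs X W" "g : smooth_funs X W"
 shows "(%y. f y * g y) : smooth_funs X W"
 using smooth_binary[OF assms, of "%x. x 0 * x 1"] by (simp add: Ck_on_mult Ck_on_coord)

lemma smooth_diff:
 assumes "f : smooth_funs X W" "g : smooth_funs X W"
 shows "(%y. f y - g y) : smooth_funs X W"
 using smooth_add[OF assms(1) smooth_mult[OF smooth_const[of "-1"] assms(2)]] by simp

lemma smooth_sum:
 "(!!i. i : I ==> f i : smooth_funs X W) ==> (%y. \<Sum>i\<in>I. f i y) : smooth_funs X W"
 by (induction I rule: infinite_finite_induct) (simp_all add: smooth_const smooth_add)

lemma smooth_prod:
 "(!!i. i : I ==> f i : smooth_funs X W) ==> (%y. \<Prod>i\<in>I. f i y) : smooth_funs X W"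
 by (induction I rule: infinite_finite_induct) (simp_all add: smooth_const smooth_mult)

lemma smooth_unary:
 assumes "f : smooth_funs X W" "open S" "!!y. y : W ==> f y : S"
  and "!!k D. openin (Euclidean_space 1) D ==> (\<forall>x\<in>D. x 0 : S) ==> Ck_on 1 k D (%x. h (x 0))"
 shows "(%y. h (f y)) : smooth_funs X W"
proof -
 let ?D = "{x : topspace (Euclidean_space 1). x 0 : S}"
 have D: "openin (Euclidean_space 1) ?D"
  by (rule openin_continuous_map_preimage[OF continuous_map_Euclidean_coord]) (use assms(2) in simp)
 have "smooth_on_Rn 1 ?D (%x. h (x 0))" unfolding smooth_on_Rn_def using assms(4)[OF D] by simp
 moreover have "(%i. if i < 1 then f y else 0) : ?D" if "y : W" for y
  using assms(3)[OF that] Euclidean_space_tuple[of 1 "%i. f y"] by simp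
 ultimately show ?thesis
  using smooth_funs_compose[OF X W, of 1 "%i. f" ?D "%x. h (x 0)"] assms(1) D by simp
qed

lemma smooth_inverse:
 assumes "f : smooth_funs X W" "!!y. y : W ==> f y ~= 0"
 shows "(%y. inverse (f y)) : smooth_funs X W"
 by (rule smooth_unary[OF assms(1), of "- {0}"]) (use assms(2) in \<open>auto intro!: Ck_on_inverse Ck_on_coord\<close>)

lemma smooth_divide:
 assumes "f : smooth_funs X W" "g : smooth_funs X W" "!!y. y : W ==> g y ~= 0"
 shows "(%y. f y / g y) : smooth_funs X W"
 using smooth_mult[OF assms(1) smooth_inverse[OF assms(2,3)]] by (simp add: divide_inverse)

lemma smooth_sqrt:
 assumes "f : smooth_funs X W" "!!y. y : W ==> f y > 0"
 shows "(%y. sqrt (f y)) : smooth_funs X W"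
 by (rule smooth_unary[OF assms(1), of "{0<..}"]) (use assms(2) in \<open>auto intro!: Ck_on_sqrt Ck_on_coord\<close>)

end

lemma smooth_sheaf_Rn: "smooth_sheaf (Rn_space n)"
 unfolding smooth_sheaf_def Rn_space_def smooth_space.simps mem_Collect_eq
proof (intro conjI allI impI; elim conjE)
 fix W and f g :: "(nat => real) => real"
 assume "openin (Euclidean_space n) W" "smooth_on_Rn n W f" "\<forall>x\<in>W. f x = g x"
 then show "smooth_on_Rn n W g" using Ck_on_cong[of n W f g] by (simp add: smooth_on_Rn_def)
next
 fix W W' and f :: "(nat => real) => real"
 assume "W' \<subseteq> W" "smooth_on_Rn n W f"
 then show "smooth_on_Rn n W' f" unfolding smooth_on_Rn_def using Ck_on_mono by blast
next
 fix W and f :: "(nat => real) => real"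
 assume W: "openin (Euclidean_space n) W"
  and *: "\<forall>x\<in>W. \<exists>U. openin (Euclidean_space n) U & x : U & U \<subseteq> W & smooth_on_Rn n U f"
 show "smooth_on_Rn n W f" by (rule smooth_on_Rn_local[OF W]) (rule *[rule_format])
next
 fix W and f :: "(nat => real) => real"
 assume "openin (Euclidean_space n) W" "smooth_on_Rn n W f"
 then have "Ck_on n 0 W f" unfolding smooth_on_Rn_def by blast
 then show "continuous_map (subtopology (Euclidean_space n) W) euclideanreal f" by simp
next
 fix W m u D F
 assume "openin (Euclidean_space n) W" "\<forall>i<m. smooth_on_Rn n W (u i)"
  "openin (Euclidean_space m) D" "smooth_on_Rn m D F" "\<forall>y\<in>W. (%i. if i < m then u i y else 0) : D"
 then show "smooth_on_Rn n W (%y. F (%i. if i < m then u i y else 0))"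
  by (intro smooth_on_Rn_compose[of m D n W u F]) simp_all
qed

lemma smooth_sheaf_open_subspace:
 assumes X: "smooth_sheaf X" and U: "openin (top_of X) U"
 shows "smooth_sheaf (open_subspace X U)"
proof -
 have op: "openin (subtopology (top_of X) U) W \<longleftrightarrow> openin (top_of X) W & W \<subseteq> U" for W
  using openin_open_subtopology[OF U] by blast
 have sub: "subtopology (subtopology (top_of X) U) W = subtopology (top_of X) W" if "W \<subseteq> U" for W
  using that by (simp add: subtopology_subtopology Int_absorb1)
 show ?thesis
  unfolding smooth_sheaf_def open_subspace_def smooth_space.simps op
 proof (intro conjI allI impI; elim conjE)
  fix W f assume *: "openin (top_of X) W" "W \<subseteq> U"
  "\<forall>x\<in>W. \<exists>V. (openin (top_of X) V & V \<subseteq> U) & x : V & V \<subseteq> W & f : smooth_funs X V"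
  show "f : smooth_funs X W" using *(3) by (intro smooth_funs_glue[OF X *(1)]) blast
 next
  fix W n u D F
  assume "openin (top_of X) W" "W \<subseteq> U" "\<forall>i<n. u i : smooth_funs X W"
  "openin (Euclidean_space n) D" "smooth_on_Rn n D F" "\<forall>y\<in>W. (%i. if i < n then u i y else 0) : D"
  then show "(%y. F (%i. if i < n then u i y else 0)) : smooth_funs X W"
  by (rule_tac smooth_funs_compose[OF X, of W n u D F]) simp_all
 qed (auto simp: sub intro: smooth_funs_cong[OF X] smooth_funs_mono[OF X] smooth_funs_continuous[OF X])
qed

text \<open>Finitely many functions that are locally expressed through generators, each in its own
  way, admit one common list of generators near a point. The induction intersects the neighbourhoods
  and concatenates the lists, which is why the generators must restrict to smaller open
  sets.\<close>

lemma merge_generators: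
 fixes f :: "nat => 'a => real" and \<G> :: "'a set => ('a => real) set"
 assumes W: "openin T W" "x : W"
  and res: "\<forall>U U' g. openin T U & openin T U' & U' \<subseteq> U & g : \<G> U --> g : \<G> U'"
  and f: "\<forall>j<n. f j : generated_funs T \<G> W"
 shows "\<exists>U N u D Fs. openin T U & x : U & U \<subseteq> W & (\<forall>i<N. u i : \<G> U) & openin (Euclidean_space N) D &
  (\<forall>j<n. smooth_on_Rn N D (Fs j)) &
  (\<forall>y\<in>U. (%i. if i < N then u i y else 0) : D &
  (\<forall>j<n. f j y = Fs j (%i. if i < N then u i y else (0::real))))"
 using f
proof (induction n)
 case 0
 show ?case
  using W by (intro exI[of _ W] exI[of _ 0] exI[of _ "%_ _. 0"] exI[of _ "topspace (Euclidean_space 0)"]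
  exI[of _ "%_ _. 0"]) auto
next
 case (Suc n)
 have "\<forall>j<n. f j : generated_funs T \<G> W" using Suc.prems by simp
 from Suc.IH[OF this] obtain U N u D Fs where U: "openin T U" "x : U" "U \<subseteq> W" "\<forall>i<N. u i : \<G> U"
  "openin (Euclidean_space N) D" "\<forall>j<n. smooth_on_Rn N D (Fs j)"
  "\<forall>y\<in>U. (%i. if i < N then u i y else 0) : D &
  (\<forall>j<n. f j y = Fs j (%i. if i < N then u i y else (0::real)))"
  by (elim exE conjE) (rule that)
 note 1 = U(1-3) U(4)[rule_format] U(5) U(6)[rule_format] U(7)[rule_format, THEN conjunct1]
  U(7)[rule_format, THEN conjunct2, rule_format]
 have "\<exists>U n' u D F. openin T U & x : U & U \<subseteq> W & (\<forall>i<n'. u i : \<G> U) &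
  openin (Euclidean_space n') D & smooth_on_Rn n' D F &
  (\<forall>y\<in>U. (%i. if i < n' then u i y else 0) : D &
  f n y = F (%i. if i < n' then u i y else (0::real)))"
  using Suc.prems W(2) unfolding generated_funs_def by simp
 then obtain U' N' u' D' F' where U': "openin T U'" "x : U'" "U' \<subseteq> W" "\<forall>i<N'. u' i : \<G> U'"
  "openin (Euclidean_space N') D'" "smooth_on_Rn N' D' F'"
  "\<forall>y\<in>U'. (%i. if i < N' then u' i y else 0) : D' &
  f n y = F' (%i. if i < N' then u' i y else (0::real))"
  by (elim exE conjE) (rule that)
 note 2 = U'(1-3) U'(4)[rule_format] U'(5,6) U'(7)[rule_format, THEN conjunct1]
  U'(7)[rule_format, THEN conjunct2]
 define V where "V = U \<inter> U'"
 have V: "openin T V" using 1(1) 2(1) by (auto simp: V_def)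
 define M where "M = N + N'"
 \<comment> \<open>The concatenated list: first the N generators of the earlier functions, then the
   N' generators of the new one. \<open>P\<close> and \<open>P'\<close> recover the two arguments
   from a tuple of length N + N'.\<close>
 define v where "v i = (if i < N then u i else u' (i - N))" for i
 define P where "P z = (%i. if i < N then z i else 0)" for z :: "nat => real"
 define P' where "P' z = (%i. if i < N' then z (N + i) else 0)" for z :: "nat => real"
 define D2 where "D2 = {z : topspace (Euclidean_space M). P z : D} \<inter> {z : topspace (Euclidean_space M). P' z : D'}"
 have cP: "continuous_map (Euclidean_space M) (Euclidean_space N) P"
  unfolding P_def[abs_def] continuous_map_componentwise_Euclidean_space
  by (simp add: continuous_map_Euclidean_coord)
 have cP': "continuous_map (Euclidean_space M) (Euclidean_space N') P'"
  unfolding P'_def[abs_def] continuous_map_componentwise_Euclidean_space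
  by (simp add: continuous_map_Euclidean_coord)
 have D2: "openin (Euclidean_space M) D2"
  unfolding D2_def
  by (intro openin_Int openin_continuous_map_preimage[OF cP 1(5)] openin_continuous_map_preimage[OF cP' 2(5)])
 define Gs where "Gs j = (if j < n then Fs j \<circ> P else F' \<circ> P')" for j
 have Ptup: "P (%i. if i < M then v i y else 0) = (%i. if i < N then u i y else 0)"
  and P'tup: "P' (%i. if i < M then v i y else 0) = (%i. if i < N' then u' i y else 0)" for y
  by (auto simp: P_def P'_def v_def M_def fun_eq_iff)
 show ?case
 proof (intro exI conjI allI impI ballI)
  show "openin T V" "x : V" "V \<subseteq> W" using V 1 2 by (auto simp: V_def)
  show "v i : \<G> V" if "i < M" for i
  using that 1(4)[of i] 2(4)[of "i - N"] res[THEN spec, THEN spec, THEN spec, of U V "u i"]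
  res[THEN spec, THEN spec, THEN spec, of U' V "u' (i - N)"] 1(1) 2(1) V
  by (auto simp: v_def V_def M_def)
  show "openin (Euclidean_space M) D2" by fact
  show "smooth_on_Rn M D2 (Gs j)" if "j < Suc n" for j
  proof (cases "j < n")
  case True
  have "smooth_on_Rn M D2 (%z. Fs j (%i. if i < N then z i else 0))"
  by (rule smooth_on_Rn_compose[OF 1(5) D2, of "%i z. z i"])
  (use 1(6)[OF True] D2 in \<open>auto simp: smooth_on_Rn_coord D2_def P_def\<close>)
  then show ?thesis using True by (simp add: Gs_def P_def o_def)
  next
  case False
  have "smooth_on_Rn M D2 (%z. F' (%i. if i < N' then z (N + i) else 0))"
  by (rule smooth_on_Rn_compose[OF 2(5) D2, of "%i z. z (N + i)"])
  (use 2(6) D2 in \<open>auto simp: smooth_on_Rn_coord D2_def P'_def\<close>)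
  then show ?thesis using False by (simp add: Gs_def P'_def o_def)
  qed
  fix y assume y: "y : V"
  show "(%i. if i < M then v i y else 0) : D2"
  using 1(7)[of y] 2(7)[of y] y unfolding D2_def
  by (auto simp: Ptup P'tup V_def)
  show "f j y = Gs j (%i. if i < M then v i y else 0)" if "j < Suc n" for j
  using that 1(8)[of y j] 2(8)[of y] y by (auto simp: Gs_def Ptup P'tup V_def less_Suc_eq)
 qed
qed

text \<open>Four of the axioms only rearrange the local description. Closure under composition is
  the real one: the arguments are first written in common generators by
  \<open>merge_generators\<close>, and then two smooth maps between Euclidean spaces are
  composed.\<close>

lemma smooth_sheaf_generated:
 fixes T :: "'a topology"
 assumes cont: "!!U g. openin T U ==> g : \<G> U ==> continuous_map (subtopology T U) euclideanreal g"
  and res: "!!U U' g. openin T U ==> openin T U' ==> U' \<subseteq> U ==> g : \<G> U ==> g : \<G> U'"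
 shows "smooth_sheaf \<lparr>top_of = T, smooth_funs = generated_funs T \<G>\<rparr>"
 unfolding smooth_sheaf_def smooth_space.simps
proof (intro conjI allI impI; elim conjE)
 fix W and f g :: "'a => real"
 assume W: "openin T W" and f: "f : generated_funs T \<G> W" and eq: "\<forall>x\<in>W. f x = g x"
 show "g : generated_funs T \<G> W"
  unfolding generated_funs_def
 proof (intro CollectI ballI)
  fix x assume "x : W"
  then obtain U n u D F where "openin T U" "x : U" "U \<subseteq> W" "\<forall>i<n. u i : \<G> U"
  "openin (Euclidean_space n) D" "smooth_on_Rn n D F"
  "\<forall>y\<in>U. (%i. if i < n then u i y else 0) : D & f y = F (%i. if i < n then u i y else 0)"
  using f unfolding generated_funs_def by blast
  moreover from this eq have "\<forall>y\<in>U. (%i. if i < n then u i y else 0) : D & g y = F (%i. if i < n then u i y else 0)"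
  by (metis subsetD)
  ultimately show "\<exists>U n u D F. openin T U & x : U & U \<subseteq> W & (\<forall>i<n. u i : \<G> U) &
  openin (Euclidean_space n) D & smooth_on_Rn n D F &
  (\<forall>y\<in>U. (%i. if i < n then u i y else 0) : D & g y = F (%i. if i < n then u i y else (0::real)))"
  by blast
 qed
next
 fix W W' and f :: "'a => real"
 assume W: "openin T W" and W': "openin T W'" "W' \<subseteq> W" and f: "f : generated_funs T \<G> W"
 show "f : generated_funs T \<G> W'"
  unfolding generated_funs_def
 proof (intro CollectI ballI)
  fix x assume x: "x : W'"
  then obtain U n u D F where U: "openin T U" "x : U" "U \<subseteq> W" "\<forall>i<n. u i : \<G> U"
  "openin (Euclidean_space n) D" "smooth_on_Rn n D F"
  "\<forall>y\<in>U. (%i. if i < n then u i y else 0) : D & f y = F (%i. if i < n then u i y else 0)"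
  using f W'(2) unfolding generated_funs_def by blast
  have "openin T (U \<inter> W')" using U(1) W'(1) by blast
  with U x res[OF U(1) this] show "\<exists>U n u D F. openin T U & x : U & U \<subseteq> W' & (\<forall>i<n. u i : \<G> U) &
  openin (Euclidean_space n) D & smooth_on_Rn n D F &
  (\<forall>y\<in>U. (%i. if i < n then u i y else 0) : D & f y = F (%i. if i < n then u i y else (0::real)))"
  by (intro exI[of _ "U \<inter> W'"] exI[of _ n] exI[of _ u] exI[of _ D] exI[of _ F]) auto
 qed
next
 fix W and f :: "'a => real"
 assume W: "openin T W"
  and *: "\<forall>x\<in>W. \<exists>U. openin T U & x : U & U \<subseteq> W & f : generated_funs T \<G> U"
 show "f : generated_funs T \<G> W"
  unfolding generated_funs_def
 proof (intro CollectI ballI)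
  fix x assume x: "x : W"
  then obtain V where V: "x : V" "V \<subseteq> W" "f : generated_funs T \<G> V" using * by blast
  then obtain U n u D F where U: "openin T U" "x : U" "U \<subseteq> V" "\<forall>i<n. u i : \<G> U"
  "openin (Euclidean_space n) D" "smooth_on_Rn n D F"
  "\<forall>y\<in>U. (%i. if i < n then u i y else 0) : D & f y = F (%i. if i < n then u i y else 0)"
  unfolding generated_funs_def by blast
  with V(2) show "\<exists>U n u D F. openin T U & x : U & U \<subseteq> W & (\<forall>i<n. u i : \<G> U) &
  openin (Euclidean_space n) D & smooth_on_Rn n D F &
  (\<forall>y\<in>U. (%i. if i < n then u i y else 0) : D & f y = F (%i. if i < n then u i y else (0::real)))"
  by (intro exI[of _ U] exI[of _ n] exI[of _ u] exI[of _ D] exI[of _ F]) auto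
 qed
next
 fix W and f :: "'a => real"
 assume W: "openin T W" and f: "f : generated_funs T \<G> W"
 show "continuous_map (subtopology T W) euclideanreal f"
 proof (rule continuous_map_local)
  fix x assume "x : topspace (subtopology T W)"
  then obtain U n u D F where U: "openin T U" "x : U" "U \<subseteq> W" "\<forall>i<n. u i : \<G> U"
  and D: "openin (Euclidean_space n) D" "smooth_on_Rn n D F"
  and F: "\<forall>y\<in>U. (%i. if i < n then u i y else 0) : D & f y = F (%i. if i < n then u i y else 0)"
  using f unfolding generated_funs_def by auto
  have "Ck_on n 0 D F" using D(2) unfolding smooth_on_Rn_def by blast
  then have cF: "continuous_map (subtopology (Euclidean_space n) D) euclideanreal F" by simp
  have ct: "continuous_map (subtopology T U) (subtopology (Euclidean_space n) D) (%y i. if i < n then u i y else 0)"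
  unfolding continuous_map_in_subtopology continuous_map_componentwise_Euclidean_space
  using U(1,4) cont F by auto
  have "continuous_map (subtopology T U) euclideanreal f"
  by (rule continuous_map_eq[OF continuous_map_compose[OF ct cF]]) (use F in auto)
  then have "continuous_map (subtopology (subtopology T W) U) euclideanreal f"
  using U(3) by (simp add: subtopology_subtopology Int_absorb1)
  moreover have "openin (subtopology T W) U" using U openin_open_subtopology[OF W] by simp
  ultimately show "\<exists>U. openin (subtopology T W) U & x : U & continuous_map (subtopology (subtopology T W) U) euclideanreal f"
  using U(2) by blast
 qed
next
 have res': "\<forall>U U' g. openin T U & openin T U' & U' \<subseteq> U & g : \<G> U --> g : \<G> U'"
  by (intro allI impI, elim conjE) (rule res)
 fix W n E F and f :: "nat => 'a => real"
 assume W: "openin T W" and f: "\<forall>i<n. f i : generated_funs T \<G> W"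
  and E: "openin (Euclidean_space n) E" "smooth_on_Rn n E F"
  and mem: "\<forall>y\<in>W. (%i. if i < n then f i y else 0) : E"
 show "(%y. F (%i. if i < n then f i y else 0)) : generated_funs T \<G> W"
  unfolding generated_funs_def
 proof (intro CollectI ballI)
  fix x assume x: "x : W"
  obtain U N u D Fs where U: "openin T U" "x : U" "U \<subseteq> W" "\<forall>i<N. u i : \<G> U"
  and D: "openin (Euclidean_space N) D" and Fs: "\<forall>j<n. smooth_on_Rn N D (Fs j)"
  and eq: "\<forall>y\<in>U. (%i. if i < N then u i y else 0) : D &
  (\<forall>j<n. f j y = Fs j (%i. if i < N then u i y else (0::real)))"
  using merge_generators[OF W x res' f] by (elim exE conjE) (rule that)
  define \<Psi> where "\<Psi> z = (%j. if j < n then Fs j z else 0)" for z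
  \<comment> \<open>The domain of the common generators is cut down to the points whose image lies
    in the domain E of the outer function; it is open by continuity.\<close>
  define D2 where "D2 = {z : topspace (subtopology (Euclidean_space N) D). \<Psi> z : E}"
  have c: "continuous_map (subtopology (Euclidean_space N) D) (Euclidean_space n) \<Psi>"
  unfolding \<Psi>_def continuous_map_componentwise_Euclidean_space
  proof (intro allI impI)
  fix j assume "j < n"
  then have "Ck_on N 0 D (Fs j)" using Fs unfolding smooth_on_Rn_def by blast
  then show "continuous_map (subtopology (Euclidean_space N) D) euclideanreal (%x. Fs j x)" by simp
  qed
  have "openin (subtopology (Euclidean_space N) D) D2"
  unfolding D2_def by (rule openin_continuous_map_preimage[OF c E(1)])
  then have D2: "openin (Euclidean_space N) D2" by (rule openin_trans_full[OF _ D])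
  have sub: "D2 \<subseteq> D" by (auto simp: D2_def)
  have "smooth_on_Rn N D2 (%z. F (%j. if j < n then Fs j z else 0))"
  proof (rule smooth_on_Rn_compose[OF E(1) D2])
  show "(%j. if j < n then Fs j z else 0) : E" if "z : D2" for z
  using that by (simp add: D2_def \<Psi>_def)
  show "smooth_on_Rn N D2 (Fs j)" if "j < n" for j
  using Fs that sub by (auto simp: smooth_on_Rn_def intro: Ck_on_mono)
  qed (rule E(2))
  moreover have "(%i. if i < N then u i y else 0) : D2 & F (%j. if j < n then f j y else 0)
  = (%z. F (%j. if j < n then Fs j z else 0)) (%i. if i < N then u i y else 0)" if y: "y : U" for y
  proof -
  let ?t = "%i. if i < N then u i y else 0"
  have "\<Psi> ?t = (%j. if j < n then f j y else 0)"
  using eq y by (auto simp: \<Psi>_def fun_eq_iff)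
  moreover have "\<dots> : E" using mem y U(3) by blast
  moreover have "?t : D" using eq y by blast
  moreover have "?t : topspace (Euclidean_space N)" by simp
  ultimately show ?thesis unfolding D2_def by (simp add: \<Psi>_def)
  qed
  ultimately show "\<exists>U N u D G. openin T U & x : U & U \<subseteq> W & (\<forall>i<N. u i : \<G> U) &
  openin (Euclidean_space N) D & smooth_on_Rn N D G &
  (\<forall>y\<in>U. (%i. if i < N then u i y else 0) : D &
  F (%i. if i < n then f i y else 0) = G (%i. if i < N then u i y else (0::real)))"
  using U D2 by (intro exI[of _ U] exI[of _ N] exI[of _ u] exI[of _ D2]
  exI[of _ "%z. F (%j. if j < n then Fs j z else 0)"]) blast
 qed
qed

lemma generated_funs_generator:
 assumes "openin T U" "!!x. x : U ==> \<exists>V. openin T V & x : V & V \<subseteq> U & g : \<G> V"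
 shows "g : generated_funs T \<G> U"
 unfolding generated_funs_def
proof (intro CollectI ballI)
 fix x assume "x : U"
 then obtain V where V: "openin T V" "x : V" "V \<subseteq> U" "g : \<G> V" using assms by blast
 have 1: "openin (Euclidean_space 1) (topspace (Euclidean_space 1))" by simp
 show "\<exists>V n u D F. openin T V & x : V & V \<subseteq> U & (\<forall>i<n. u i : \<G> V) &
  openin (Euclidean_space n) D & smooth_on_Rn n D F &
  (\<forall>y\<in>V. (%i. if i < n then u i y else 0) : D & g y = F (%i. if i < n then u i y else (0::real)))"
  using V smooth_on_Rn_coord[OF 1, of 0]
  by (intro exI[of _ V] exI[of _ 1] exI[of _ "%_. g"] exI[of _ "topspace (Euclidean_space 1)"]
  exI[of _ "%x. x 0"]) (use Euclidean_space_tuple[of 1] in auto)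
qed

section \<open>Subsets of coordinate spaces and products\<close>

lemma top_of_coordinate_space:
 "top_of (coordinate_space E c) = topology_generated_by (insert E {{x : E. u x : S} | u S. u : c & open S})"
 by (simp add: coordinate_space_def Let_def)

lemma pts_coordinate_space [simp]: "pts (coordinate_space E c) = E"
 unfolding top_of_coordinate_space topology_generated_by_topspace by auto

lemma continuous_map_coordinate:
 assumes "u : c" shows "continuous_map (top_of (coordinate_space E c)) euclideanreal u"
 unfolding continuous_map_def
proof (intro conjI allI impI)
 fix S assume "openin euclideanreal S"
 then have "{x : E. u x : S} : insert E {{x : E. u x : S} | u S. u : c & open S}"
  using assms by auto
 then have "openin (top_of (coordinate_space E c)) {x : E. u x : S}"
  unfolding top_of_coordinate_space by (rule topology_generated_by_Basis)
 then show "openin (top_of (coordinate_space E c)) {x : pts (coordinate_space E c). u x : S}" by simp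
qed simp

lemma continuous_map_into_coordinate_space:
 assumes "!!x. x : topspace X ==> \<phi> x : E"
  and "!!u. u : c ==> continuous_map X euclideanreal (%x. u (\<phi> x))"
 shows "continuous_map X (top_of (coordinate_space E c)) \<phi>"
 unfolding top_of_coordinate_space
proof (rule continuous_on_generated_topo)
 fix U assume "U : insert E {{x : E. u x : S} | u S. u : c & open S}"
 then consider "U = E" | u S where "U = {x : E. u x : S}" "u : c" "open S" by auto
 then show "openin X (\<phi> -` U \<inter> topspace X)"
 proof cases
  case 1
  then have "\<phi> -` U \<inter> topspace X = topspace X" using assms(1) by auto
  then show ?thesis by simp
 next
  case (2 u S)
  then have "\<phi> -` U \<inter> topspace X = {x : topspace X. u (\<phi> x) : S}" using assms(1) by auto
  then show ?thesis using openin_continuous_map_preimage[OF assms(2)[OF 2(2)]] 2(3) by simp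
 qed
qed (use assms(1) in auto)

lemma smooth_sheaf_coordinate_space: "smooth_sheaf (coordinate_space E c)"
proof -
 let ?T = "top_of (coordinate_space E c)"
 have "smooth_sheaf \<lparr>top_of = ?T, smooth_funs = generated_funs ?T (%_. c)\<rparr>"
  by (rule smooth_sheaf_generated)
  (auto intro: continuous_map_from_subtopology continuous_map_coordinate)
 then show ?thesis by (simp add: coordinate_space_def Let_def)
qed

lemma smooth_funs_coordinate:
 assumes "u : c" "openin (top_of (coordinate_space E c)) W"
 shows "u : smooth_funs (coordinate_space E c) W"
proof -
 have "u : generated_funs (top_of (coordinate_space E c)) (%_. c) W"
  by (rule generated_funs_generator) (use assms in auto)
 then show ?thesis by (simp add: coordinate_space_def Let_def)
qed

text \<open>The generators on U are smooth functions on the projections of U. They make sense as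
  such because projections from a product are open maps, and they restrict because images are
  monotone.\<close>

lemma smooth_sheaf_product:
 assumes X: "smooth_sheaf X" and Y: "smooth_sheaf Y"
 shows "smooth_sheaf (product_space X Y)"
 unfolding product_space_def Let_def
proof (rule smooth_sheaf_generated)
 let ?T = "prod_topology (top_of X) (top_of Y)"
 have op1: "openin (top_of X) (fst ` U)" and op2: "openin (top_of Y) (snd ` U)" if "openin ?T U" for U
  using that open_map_fst[of "top_of X" "top_of Y"] open_map_snd[of "top_of X" "top_of Y"]
  by (auto simp: open_map_def)
 have c1: "continuous_map (subtopology ?T U) (subtopology (top_of X) (fst ` U)) fst"
  and c2: "continuous_map (subtopology ?T U) (subtopology (top_of Y) (snd ` U)) snd" if "openin ?T U" for U
  by (auto simp: continuous_map_in_subtopology intro: continuous_map_from_subtopology continuous_map_fst continuous_map_snd)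
 fix U g assume U: "openin ?T U"
  and g: "g : {f \<circ> fst | f. f : smooth_funs X (fst ` U)} \<union> {f \<circ> snd | f. f : smooth_funs Y (snd ` U)}"
 then show "continuous_map (subtopology ?T U) euclideanreal g"
  using continuous_map_compose[OF c1[OF U]] continuous_map_compose[OF c2[OF U]]
  smooth_funs_continuous[OF X _ op1[OF U]] smooth_funs_continuous[OF Y _ op2[OF U]] by blast
 fix U' assume U': "openin ?T U'" "U' \<subseteq> U"
 show "g : {f \<circ> fst | f. f : smooth_funs X (fst ` U')} \<union> {f \<circ> snd | f. f : smooth_funs Y (snd ` U')}"
  using g smooth_funs_mono[OF X _ op1[OF U] op1[OF U'(1)] image_mono[OF U'(2)]]
  smooth_funs_mono[OF Y _ op2[OF U] op2[OF U'(1)] image_mono[OF U'(2)]] by blast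
qed

section \<open>Quotients as smooth spaces\<close>

lemma topology_quotient_space:
 "openin (top_of (quotient_space X q)) U \<longleftrightarrow> U \<subseteq> q ` pts X & openin (top_of X) {x : pts X. q x : U}"
 unfolding quotient_space_def smooth_space.simps topology_inverse'[OF istopology_quotient_open]
 by (simp add: quotient_open_def)

lemma pts_quotient_space [simp]: "pts (quotient_space X q) = q ` pts X"
proof -
 have "openin (top_of (quotient_space X q)) (q ` pts X)"
 proof -
  have "{x : pts X. q x : q ` pts X} = pts X" by auto
  then show ?thesis by (simp add: topology_quotient_space)
 qed
 then have "q ` pts X \<subseteq> pts (quotient_space X q)" by (rule openin_subset)
 moreover have "pts (quotient_space X q) \<subseteq> q ` pts X"
  using topology_quotient_space[of X q "pts (quotient_space X q)"] by simp
 ultimately show ?thesis by blast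
qed

lemma smooth_funs_quotient_space:
 "f : smooth_funs (quotient_space X q) W \<longleftrightarrow> f \<circ> q : smooth_funs X {x : pts X. q x : W}"
 by (simp add: quotient_space_def)

lemma continuous_map_quotient_projection: "continuous_map (top_of X) (top_of (quotient_space X q)) q"
 unfolding continuous_map_def by (auto simp: topology_quotient_space)

lemma smooth_sheaf_quotient_space:
 assumes X: "smooth_sheaf X" shows "smooth_sheaf (quotient_space X q)"
proof -
 let ?Q = "quotient_space X q" and ?P = "%W. {x : pts X. q x : W}"
 have P: "openin (top_of X) (?P W)" if "openin (top_of ?Q) W" for W
  using that by (simp add: topology_quotient_space)
 show ?thesis
  unfolding smooth_sheaf_def smooth_funs_quotient_space
 proof (intro conjI allI impI; elim conjE)
  fix W f g assume "openin (top_of ?Q) W" "f \<circ> q : smooth_funs X (?P W)" "\<forall>x\<in>W. f x = g x"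
  then show "g \<circ> q : smooth_funs X (?P W)"
  by (rule_tac smooth_funs_cong[OF X _ P, of "f \<circ> q"]) auto
 next
  fix W W' f assume "openin (top_of ?Q) W" "openin (top_of ?Q) W'" "W' \<subseteq> W" "f \<circ> q : smooth_funs X (?P W)"
  then show "f \<circ> q : smooth_funs X (?P W')"
  by (rule_tac smooth_funs_mono[OF X _ P P, of _ W]) auto
 next
  fix W f assume W: "openin (top_of ?Q) W"
  and *: "\<forall>x\<in>W. \<exists>U. openin (top_of ?Q) U & x : U & U \<subseteq> W & f \<circ> q : smooth_funs X (?P U)"
  show "f \<circ> q : smooth_funs X (?P W)"
  proof (rule smooth_funs_glue[OF X P[OF W]])
  fix x assume x: "x : ?P W"
  then obtain U where U: "openin (top_of ?Q) U" "q x : U" "U \<subseteq> W" "f \<circ> q : smooth_funs X (?P U)"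
  using * by blast
  show "\<exists>U. openin (top_of X) U & x : U & U \<subseteq> ?P W & f \<circ> q : smooth_funs X U"
  using P[OF U(1)] U x by (intro exI[of _ "?P U"]) auto
  qed
 next
  fix W f assume W: "openin (top_of ?Q) W" and f: "f \<circ> q : smooth_funs X (?P W)"
  show "continuous_map (subtopology (top_of ?Q) W) euclideanreal f"
  unfolding continuous_map_def
  proof (intro conjI allI impI)
  fix S assume S: "openin euclideanreal S"
  have "openin (subtopology (top_of X) (?P W)) {x : topspace (subtopology (top_of X) (?P W)). (f \<circ> q) x : S}"
  by (rule openin_continuous_map_preimage[OF smooth_funs_continuous[OF X f P[OF W]] S])
  then have "openin (top_of X) {x : topspace (subtopology (top_of X) (?P W)). (f \<circ> q) x : S}"
  by (rule openin_trans_full[OF _ P[OF W]])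
  moreover have "{x : topspace (subtopology (top_of X) (?P W)). (f \<circ> q) x : S}
  = ?P {x : topspace (subtopology (top_of ?Q) W). f x : S}" by auto
  moreover have "{x : topspace (subtopology (top_of ?Q) W). f x : S} \<subseteq> q ` pts X" by auto
  ultimately have "openin (top_of ?Q) {x : topspace (subtopology (top_of ?Q) W). f x : S}"
  unfolding topology_quotient_space by simp
  then show "openin (subtopology (top_of ?Q) W) {x : topspace (subtopology (top_of ?Q) W). f x : S}"
  using openin_open_subtopology[OF W] by auto
  qed simp
 next
  fix W n u D F assume "openin (top_of ?Q) W" "\<forall>i<n. u i \<circ> q : smooth_funs X (?P W)"
  "openin (Euclidean_space n) D" "smooth_on_Rn n D F" "\<forall>y\<in>W. (%i. if i < n then u i y else 0) : D"
  then have "(%y. F (%i. if i < n then u i (q y) else 0)) : smooth_funs X (?P W)"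
  by (rule_tac smooth_funs_compose[OF X P, of W n "%i y. u i (q y)" D F]) (simp_all add: o_def)
  then show "(%y. F (%i. if i < n then u i y else 0)) \<circ> q : smooth_funs X (?P W)"
  unfolding o_def .
 qed
qed

section \<open>Smooth maps\<close>

lemma smooth_funs_open_subspace [simp]: "smooth_funs (open_subspace X U) = smooth_funs X"
 and top_of_open_subspace [simp]: "top_of (open_subspace X U) = subtopology (top_of X) U"
 by (simp_all add: open_subspace_def)

lemma top_of_product_space [simp]: "top_of (product_space X Y) = prod_topology (top_of X) (top_of Y)"
 by (simp add: product_space_def Let_def)

lemma top_of_Rn_space [simp]: "top_of (Rn_space n) = Euclidean_space n"
 by (simp add: Rn_space_def)

lemma smooth_mapD:
 assumes "smooth_map X Y \<phi>"
 shows smooth_map_continuous: "continuous_map (top_of X) (top_of Y) \<phi>"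
  and smooth_map_pullback: "openin (top_of Y) W ==> f : smooth_funs Y W ==>
  (%x. f (\<phi> x)) : smooth_funs X {x : pts X. \<phi> x : W}"
  and smooth_map_pts: "x : pts X ==> \<phi> x : pts Y"
proof -
 show c: "continuous_map (top_of X) (top_of Y) \<phi>" using assms by (simp add: smooth_map_def)
 show "\<phi> x : pts Y" if "x : pts X" using c that by (auto simp: continuous_map_def Pi_iff)
 show "(%x. f (\<phi> x)) : smooth_funs X {x : pts X. \<phi> x : W}"
  if "openin (top_of Y) W" "f : smooth_funs Y W"
  using assms[unfolded smooth_map_def, THEN conjunct2, THEN spec, THEN spec, of W f] that
  by (simp add: o_def)
qed

lemma smooth_mapI:
 assumes "continuous_map (top_of X) (top_of Y) \<phi>"
  and "!!W f. openin (top_of Y) W ==> f : smooth_funs Y W ==>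
  openin (top_of X) {x : pts X. \<phi> x : W} ==>
  (%x. f (\<phi> x)) : smooth_funs X {x : pts X. \<phi> x : W}"
 shows "smooth_map X Y \<phi>"
 unfolding smooth_map_def
proof (intro conjI allI impI; (elim conjE)?)
 fix W f assume W: "openin (top_of Y) W" "f : smooth_funs Y W"
 show "f \<circ> \<phi> : smooth_funs X {x : pts X. \<phi> x : W}"
  unfolding o_def by (rule assms(2)[OF W openin_continuous_map_preimage[OF assms(1) W(1)]])
qed (rule assms(1))

lemma smooth_map_pullback_pts:
 assumes "smooth_map X Y \<phi>" "f : smooth_funs Y (pts Y)"
 shows "(%x. f (\<phi> x)) : smooth_funs X (pts X)"
proof -
 have "{x : pts X. \<phi> x : pts Y} = pts X" using smooth_map_pts[OF assms(1)] by blast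
 then show ?thesis using smooth_map_pullback[OF assms(1) openin_topspace assms(2)] by simp
qed

lemma smooth_map_comp:
 assumes "smooth_map X Y \<phi>" "smooth_map Y Z \<psi>"
 shows "smooth_map X Z (%x. \<psi> (\<phi> x))"
proof (rule smooth_mapI)
 show "continuous_map (top_of X) (top_of Z) (%x. \<psi> (\<phi> x))"
  using continuous_map_compose[OF smooth_map_continuous[OF assms(1)] smooth_map_continuous[OF assms(2)]]
  by (simp add: o_def)
 fix W f assume W: "openin (top_of Z) W" and f: "f : smooth_funs Z W"
 let ?V = "{y : pts Y. \<psi> y : W}"
 have V: "openin (top_of Y) ?V"
  by (rule openin_continuous_map_preimage[OF smooth_map_continuous[OF assms(2)] W])
 have "{x : pts X. \<phi> x : ?V} = {x : pts X. \<psi> (\<phi> x) : W}"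
  using smooth_map_pts[OF assms(1)] by blast
 then show "(%x. f (\<psi> (\<phi> x))) : smooth_funs X {x : pts X. \<psi> (\<phi> x) : W}"
  using smooth_map_pullback[OF assms(1) V smooth_map_pullback[OF assms(2) W f]] by simp
qed

lemma smooth_map_cong:
 assumes X: "smooth_sheaf X" and \<phi>: "smooth_map X Y \<phi>" and eq: "!!x. x : pts X ==> \<phi> x = \<phi>' x"
 shows "smooth_map X Y \<phi>'"
proof (rule smooth_mapI)
 show "continuous_map (top_of X) (top_of Y) \<phi>'"
  by (rule continuous_map_eq[OF smooth_map_continuous[OF \<phi>] eq])
 fix W f assume W: "openin (top_of Y) W" and f: "f : smooth_funs Y W"
  and op: "openin (top_of X) {x : pts X. \<phi>' x : W}"
 have "{x : pts X. \<phi>' x : W} = {x : pts X. \<phi> x : W}" using eq by auto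
 then have "(%x. f (\<phi> x)) : smooth_funs X {x : pts X. \<phi>' x : W}"
  using smooth_map_pullback[OF \<phi> W f] by simp
 then show "(%x. f (\<phi>' x)) : smooth_funs X {x : pts X. \<phi>' x : W}"
  by (rule smooth_funs_cong[OF X _ op]) (use eq in simp)
qed

lemma smooth_map_ident: "smooth_map X X (%x. x)"
proof (rule smooth_mapI)
 fix W f assume W: "openin (top_of X) W" "f : smooth_funs X W"
 have "{x : pts X. x : W} = W" using openin_subset[OF W(1)] by blast
 then show "f : smooth_funs X {x : pts X. x : W}" using W(2) by simp
qed simp

lemma smooth_map_into_open:
 assumes \<phi>: "smooth_map X Y \<phi>" and im: "!!x. x : pts X ==> \<phi> x : U" and U: "openin (top_of Y) U"
 shows "smooth_map X (open_subspace Y U) \<phi>"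
proof (rule smooth_mapI)
 show "continuous_map (top_of X) (top_of (open_subspace Y U)) \<phi>"
  using smooth_map_continuous[OF \<phi>] im by (auto simp: continuous_map_in_subtopology)
 fix W f assume "openin (top_of (open_subspace Y U)) W" "f : smooth_funs (open_subspace Y U) W"
 then show "(%x. f (\<phi> x)) : smooth_funs X {x : pts X. \<phi> x : W}"
  using smooth_map_pullback[OF \<phi>] openin_open_subtopology[OF U] by simp
qed

lemma smooth_map_from_open:
 assumes X: "smooth_sheaf X" and \<phi>: "smooth_map X Y \<phi>" and U: "openin (top_of X) U"
 shows "smooth_map (open_subspace X U) Y \<phi>"
proof (rule smooth_mapI)
 show "continuous_map (top_of (open_subspace X U)) (top_of Y) \<phi>"
  using continuous_map_from_subtopology[OF smooth_map_continuous[OF \<phi>]] by simp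
 fix W f assume W: "openin (top_of Y) W" and f: "f : smooth_funs Y W"
  and op: "openin (top_of (open_subspace X U)) {x : pts (open_subspace X U). \<phi> x : W}"
 have 1: "openin (top_of X) {x : pts X. \<phi> x : W}"
  by (rule openin_continuous_map_preimage[OF smooth_map_continuous[OF \<phi>] W])
 show "(%x. f (\<phi> x)) : smooth_funs (open_subspace X U) {x : pts (open_subspace X U). \<phi> x : W}"
  unfolding smooth_funs_open_subspace
  by (rule smooth_funs_mono[OF X smooth_map_pullback[OF \<phi> W f] 1])
  (use op openin_open_subtopology[OF U] in auto)
qed

lemma smooth_map_open_inclusion:
 "smooth_sheaf X ==> openin (top_of X) U ==> smooth_map (open_subspace X U) X (%x. x)"
 by (rule smooth_map_from_open[OF _ smooth_map_ident])

lemma smooth_map_local: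
 assumes X: "smooth_sheaf X"
  and loc: "!!x. x : pts X ==> \<exists>U. openin (top_of X) U & x : U & smooth_map (open_subspace X U) Y \<phi>"
 shows "smooth_map X Y \<phi>"
proof (rule smooth_mapI)
 show "continuous_map (top_of X) (top_of Y) \<phi>"
 proof (rule continuous_map_local)
  fix x assume "x : pts X"
  from loc[OF this] obtain U where "openin (top_of X) U" "x : U" "smooth_map (open_subspace X U) Y \<phi>" by blast
  then show "\<exists>U. openin (top_of X) U & x : U & continuous_map (subtopology (top_of X) U) (top_of Y) \<phi>"
  using smooth_map_continuous by (intro exI[of _ U]) fastforce
 qed
 fix W f assume W: "openin (top_of Y) W" and f: "f : smooth_funs Y W"
  and op: "openin (top_of X) {x : pts X. \<phi> x : W}"
 show "(%x. f (\<phi> x)) : smooth_funs X {x : pts X. \<phi> x : W}"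
 proof (rule smooth_funs_glue[OF X op])
  fix x assume x: "x : {x : pts X. \<phi> x : W}"
  then have "x : pts X" by simp
  from loc[OF this] obtain U where U: "openin (top_of X) U" "x : U" "smooth_map (open_subspace X U) Y \<phi>" by blast
  let ?V = "{x : pts (open_subspace X U). \<phi> x : W}"
  have "openin (top_of (open_subspace X U)) ?V"
  by (rule openin_continuous_map_preimage[OF smooth_map_continuous[OF U(3)] W])
  then have V: "openin (top_of X) ?V" using openin_open_subtopology[OF U(1)] by simp
  have "(%x. f (\<phi> x)) : smooth_funs X ?V"
  using smooth_map_pullback[OF U(3) W f] by simp
  with V x U(2) show "\<exists>U. openin (top_of X) U & x : U & U \<subseteq> {x : pts X. \<phi> x : W} &
  (%x. f (\<phi> x)) : smooth_funs X U"
  by (intro exI[of _ ?V]) auto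
 qed
qed

text \<open>Functions in a generated sheaf are locally smooth functions of generators, so testing a
  continuous map on the generators suffices. Maps into matrix spaces are thereby tested entry by
  entry.\<close>

lemma smooth_map_into_generated:
 assumes X: "smooth_sheaf X" and c: "continuous_map (top_of X) T \<phi>"
  and g: "!!U g. openin T U ==> g : \<G> U ==> openin (top_of X) {x : pts X. \<phi> x : U} ==>
  (%x. g (\<phi> x)) : smooth_funs X {x : pts X. \<phi> x : U}"
 shows "smooth_map X \<lparr>top_of = T, smooth_funs = generated_funs T \<G>\<rparr> \<phi>"
proof (rule smooth_mapI; unfold smooth_space.simps)
 fix W f assume W: "openin T W" and f: "f : generated_funs T \<G> W"
  and op: "openin (top_of X) {x : pts X. \<phi> x : W}"
 show "(%x. f (\<phi> x)) : smooth_funs X {x : pts X. \<phi> x : W}"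
 proof (rule smooth_funs_glue[OF X op])
  fix x assume x: "x : {x : pts X. \<phi> x : W}"
  then have "\<exists>U n u D F. openin T U & \<phi> x : U & U \<subseteq> W & (\<forall>i<n. u i : \<G> U) &
  openin (Euclidean_space n) D & smooth_on_Rn n D F &
  (\<forall>y\<in>U. (%i. if i < n then u i y else 0) : D & f y = F (%i. if i < n then u i y else (0::real)))"
  using f unfolding generated_funs_def by simp
  then obtain U n u D F where U: "openin T U" "\<phi> x : U" "U \<subseteq> W" "\<forall>i<n. u i : \<G> U"
  "openin (Euclidean_space n) D" "smooth_on_Rn n D F"
  "\<forall>y\<in>U. (%i. if i < n then u i y else 0) : D & f y = F (%i. if i < n then u i y else (0::real))"
  by (elim exE conjE) (rule that)
  let ?V = "{x : pts X. \<phi> x : U}"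
  have V: "openin (top_of X) ?V" by (rule openin_continuous_map_preimage[OF c U(1)])
  have "(%x. F (%i. if i < n then u i (\<phi> x) else 0)) : smooth_funs X ?V"
  by (rule smooth_funs_compose[OF X V, of n "%i x. u i (\<phi> x)", OF _ U(5,6)])
  (use g[OF U(1) _ V] U(4,7) in auto)
  then have "(%x. f (\<phi> x)) : smooth_funs X ?V"
  by (rule smooth_funs_cong[OF X _ V]) (use U(7) in simp)
  with V x U(2,3) show "\<exists>U. openin (top_of X) U & x : U & U \<subseteq> {x : pts X. \<phi> x : W} &
  (%x. f (\<phi> x)) : smooth_funs X U"
  by (intro exI[of _ ?V]) auto
 qed
qed (rule c)

lemma smooth_map_into_coordinate:
 assumes X: "smooth_sheaf X" and E: "!!x. x : pts X ==> \<phi> x : E"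
  and u: "!!u. u : c ==> (%x. u (\<phi> x)) : smooth_funs X (pts X)"
 shows "smooth_map X (coordinate_space E c) \<phi>"
proof -
 let ?T = "top_of (coordinate_space E c)"
 have "smooth_map X \<lparr>top_of = ?T, smooth_funs = generated_funs ?T (%_. c)\<rparr> \<phi>"
 proof (rule smooth_map_into_generated[OF X])
  show "continuous_map (top_of X) ?T \<phi>"
  by (rule continuous_map_into_coordinate_space[OF E])
  (use smooth_funs_continuous[OF X u openin_topspace] in auto)
  fix U g assume "g : c" "openin (top_of X) {x : pts X. \<phi> x : U}"
  then show "(%x. g (\<phi> x)) : smooth_funs X {x : pts X. \<phi> x : U}"
  using smooth_funs_mono[OF X u openin_topspace] by auto
 qed
 then show ?thesis by (simp add: coordinate_space_def Let_def)
qed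

lemma smooth_map_into_product:
 assumes X: "smooth_sheaf X" and Y: "smooth_sheaf Y" and Z: "smooth_sheaf Z"
  and 1: "smooth_map X Y (%x. fst (\<phi> x))" and 2: "smooth_map X Z (%x. snd (\<phi> x))"
 shows "smooth_map X (product_space Y Z) \<phi>"
 unfolding product_space_def Let_def
proof (rule smooth_map_into_generated[OF X])
 let ?T = "prod_topology (top_of Y) (top_of Z)"
 show "continuous_map (top_of X) ?T \<phi>"
  using smooth_map_continuous[OF 1] smooth_map_continuous[OF 2]
  by (simp add: continuous_map_pairwise o_def)
 fix U g assume U: "openin ?T U"
  and g: "g : {f \<circ> fst | f. f : smooth_funs Y (fst ` U)} \<union> {f \<circ> snd | f. f : smooth_funs Z (snd ` U)}"
  and V: "openin (top_of X) {x : pts X. \<phi> x : U}"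
 have op1: "openin (top_of Y) (fst ` U)" and op2: "openin (top_of Z) (snd ` U)"
  using U open_map_fst[of "top_of Y" "top_of Z"] open_map_snd[of "top_of Y" "top_of Z"]
  by (auto simp: open_map_def)
 have V1: "openin (top_of X) {x : pts X. fst (\<phi> x) : fst ` U}"
  by (rule openin_continuous_map_preimage[OF smooth_map_continuous[OF 1] op1])
 have V2: "openin (top_of X) {x : pts X. snd (\<phi> x) : snd ` U}"
  by (rule openin_continuous_map_preimage[OF smooth_map_continuous[OF 2] op2])
 from g consider f where "g = f \<circ> fst" "f : smooth_funs Y (fst ` U)"
  | f where "g = f \<circ> snd" "f : smooth_funs Z (snd ` U)" by auto
 then show "(%x. g (\<phi> x)) : smooth_funs X {x : pts X. \<phi> x : U}"
 proof cases
  case (1 f)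
  have "(%x. f (fst (\<phi> x))) : smooth_funs X {x : pts X. \<phi> x : U}"
  by (rule smooth_funs_mono[OF X smooth_map_pullback[OF assms(4) op1 1(2)] V1 V]) auto
  then show ?thesis using 1(1) by simp
 next
  case (2 f)
  have "(%x. f (snd (\<phi> x))) : smooth_funs X {x : pts X. \<phi> x : U}"
  by (rule smooth_funs_mono[OF X smooth_map_pullback[OF assms(5) op2 2(2)] V2 V]) auto
  then show ?thesis using 2(1) by simp
 qed
qed

lemma smooth_map_product_projections:
 assumes X: "smooth_sheaf X" and Y: "smooth_sheaf Y"
 shows smooth_map_fst: "smooth_map (product_space X Y) X fst"
  and smooth_map_snd: "smooth_map (product_space X Y) Y snd"
proof -
 let ?T = "prod_topology (top_of X) (top_of Y)"
 have op1: "openin (top_of X) (fst ` U)" and op2: "openin (top_of Y) (snd ` U)" if "openin ?T U" for U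
  using that open_map_fst[of "top_of X" "top_of Y"] open_map_snd[of "top_of X" "top_of Y"]
  by (auto simp: open_map_def)
 show "smooth_map (product_space X Y) X fst"
 proof (rule smooth_mapI)
  show "continuous_map (top_of (product_space X Y)) (top_of X) fst" by (simp add: continuous_map_fst)
  fix W f assume W: "openin (top_of X) W" "f : smooth_funs X W"
  and op: "openin (top_of (product_space X Y)) {x : pts (product_space X Y). fst x : W}"
  let ?U = "{x : pts (product_space X Y). fst x : W}"
  have op': "openin ?T ?U" using op by simp
  have "f : smooth_funs X (fst ` ?U)"
  by (rule smooth_funs_mono[OF X W(2,1) op1[OF op']]) auto
  then have "f \<circ> fst : generated_funs ?T (%W. {f \<circ> fst | f. f : smooth_funs X (fst ` W)} \<union>
  {f \<circ> snd | f. f : smooth_funs Y (snd ` W)}) ?U"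
  using op' by (intro generated_funs_generator) blast+
  then show "(%x. f (fst x)) : smooth_funs (product_space X Y) ?U"
  by (simp add: product_space_def Let_def o_def)
 qed
 show "smooth_map (product_space X Y) Y snd"
 proof (rule smooth_mapI)
  show "continuous_map (top_of (product_space X Y)) (top_of Y) snd" by (simp add: continuous_map_snd)
  fix W f assume W: "openin (top_of Y) W" "f : smooth_funs Y W"
  and op: "openin (top_of (product_space X Y)) {x : pts (product_space X Y). snd x : W}"
  let ?U = "{x : pts (product_space X Y). snd x : W}"
  have op': "openin ?T ?U" using op by simp
  have "f : smooth_funs Y (snd ` ?U)"
  by (rule smooth_funs_mono[OF Y W(2,1) op2[OF op']]) auto
  then have "f \<circ> snd : generated_funs ?T (%W. {f \<circ> fst | f. f : smooth_funs X (fst ` W)} \<union>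
  {f \<circ> snd | f. f : smooth_funs Y (snd ` W)}) ?U"
  using op' by (intro generated_funs_generator) blast+
  then show "(%x. f (snd x)) : smooth_funs (product_space X Y) ?U"
  by (simp add: product_space_def Let_def o_def)
 qed
qed

lemma smooth_map_into_Rn:
 assumes X: "smooth_sheaf X" and E: "!!x i. x : pts X ==> i \<ge> n ==> \<phi> x i = 0"
  and u: "!!i. i < n ==> (%x. \<phi> x i) : smooth_funs X (pts X)"
 shows "smooth_map X (Rn_space n) \<phi>"
proof (rule smooth_mapI)
 have eq: "\<phi> x = (%i. if i < n then \<phi> x i else 0)" if "x : pts X" for x
  using E[OF that] by (auto simp: fun_eq_iff)
 have "continuous_map (top_of X) (Euclidean_space n) (%x i. if i < n then \<phi> x i else 0)"
  unfolding continuous_map_componentwise_Euclidean_space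
  using smooth_funs_continuous[OF X u openin_topspace] by simp
 then show "continuous_map (top_of X) (top_of (Rn_space n)) \<phi>"
  unfolding top_of_Rn_space by (rule continuous_map_eq) (use eq in simp)
 fix W f assume W: "openin (top_of (Rn_space n)) W" "f : smooth_funs (Rn_space n) W"
  and V: "openin (top_of X) {x : pts X. \<phi> x : W}"
 have "(%x. f (%i. if i < n then \<phi> x i else 0)) : smooth_funs X {x : pts X. \<phi> x : W}"
 proof (rule smooth_funs_compose[OF X V, of n "%i x. \<phi> x i" W f])
  show "(%x. \<phi> x i) : smooth_funs X {x : pts X. \<phi> x : W}" if "i < n" for i
  by (rule smooth_funs_mono[OF X u[OF that] openin_topspace V]) auto
  show "openin (Euclidean_space n) W" using W(1) by simp
  show "smooth_on_Rn n W f" using W(2) by (simp add: Rn_space_def)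
  show "(%i. if i < n then \<phi> x i else 0) : W" if "x : {x : pts X. \<phi> x : W}" for x
  using that eq[of x] by simp
 qed
 then show "(%x. f (\<phi> x)) : smooth_funs X {x : pts X. \<phi> x : W}"
  by (rule smooth_funs_cong[OF X _ V]) (use eq in simp)
qed

lemma smooth_funs_Rn_coord: "openin (Euclidean_space n) W ==> (%x. x i) : smooth_funs (Rn_space n) W"
 by (simp add: Rn_space_def smooth_on_Rn_coord)

lemma smooth_funs_Rn_coord_pts: "(%x. x i) : smooth_funs (Rn_space n) (pts (Rn_space n))"
 by (simp add: smooth_funs_Rn_coord)

lemma smooth_map_quotient_projection: "smooth_map X (quotient_space X q) q"
 by (rule smooth_mapI[OF continuous_map_quotient_projection]) (simp add: smooth_funs_quotient_space o_def)

text \<open>The universal property of the quotient over an open set U of it: preimages in the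
  quotient are open, and functions smooth, exactly when their pullbacks to the saturated preimage of
  U are.\<close>

lemma smooth_map_from_quotient:
 assumes X: "smooth_sheaf X" and U: "openin (top_of (quotient_space X q)) U"
  and \<phi>: "smooth_map (open_subspace X {x : pts X. q x : U}) Y (%x. \<phi> (q x))"
 shows "smooth_map (open_subspace (quotient_space X q) U) Y \<phi>"
proof -
 let ?Q = "quotient_space X q" and ?P = "{x : pts X. q x : U}"
 have P: "openin (top_of X) ?P" and sub: "U \<subseteq> q ` pts X" using U by (simp_all add: topology_quotient_space)
 have pre: "{x : pts X. q x : {y : pts (open_subspace ?Q U). \<phi> y : W}}
  = {x : pts (open_subspace X ?P). \<phi> (q x) : W}" for W by auto
 have op: "openin (top_of (open_subspace ?Q U)) {y : pts (open_subspace ?Q U). \<phi> y : W}"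
  if W: "openin (top_of Y) W" for W
 proof -
  have "openin (top_of (open_subspace X ?P)) {x : pts (open_subspace X ?P). \<phi> (q x) : W}"
  by (rule openin_continuous_map_preimage[OF smooth_map_continuous[OF \<phi>] W])
  then have "openin (top_of X) {x : pts (open_subspace X ?P). \<phi> (q x) : W}"
  using openin_open_subtopology[OF P] by simp
  then have "openin (top_of ?Q) {y : pts (open_subspace ?Q U). \<phi> y : W}"
  unfolding topology_quotient_space pre by auto
  then show ?thesis using openin_open_subtopology[OF U] by auto
 qed
 show ?thesis
 proof (rule smooth_mapI)
  show "continuous_map (top_of (open_subspace ?Q U)) (top_of Y) \<phi>"
  unfolding continuous_map_def
  proof (intro conjI allI impI Pi_I)
  fix y assume "y : pts (open_subspace ?Q U)"
  then obtain x where "x : pts (open_subspace X ?P)" "y = q x" by auto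
  then show "\<phi> y : pts Y" using smooth_map_pts[OF \<phi>] by simp
  qed (rule op)
  fix W f assume W: "openin (top_of Y) W" "f : smooth_funs Y W"
  show "(%y. f (\<phi> y)) : smooth_funs (open_subspace ?Q U) {y : pts (open_subspace ?Q U). \<phi> y : W}"
  unfolding smooth_funs_open_subspace smooth_funs_quotient_space pre
  using smooth_map_pullback[OF \<phi> W] by (simp add: o_def)
 qed
qed

section \<open>Diffeomorphisms and manifolds\<close>

lemma diffeomorphismI:
 assumes "smooth_map X Y \<phi>" "smooth_map Y X \<psi>" "!!x. x : pts X ==> \<psi> (\<phi> x) = x" "!!y. y : pts Y ==> \<phi> (\<psi> y) = y"
 shows "diffeomorphism X Y \<phi>"
 using assms unfolding diffeomorphism_def by blast

lemma diffeomorphismE: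
 assumes "diffeomorphism X Y \<phi>"
 obtains \<psi> where "smooth_map X Y \<phi>" "smooth_map Y X \<psi>" "!!x. x : pts X ==> \<psi> (\<phi> x) = x" "!!y. y : pts Y ==> \<phi> (\<psi> y) = y"
 using assms unfolding diffeomorphism_def by (elim conjE exE) (rule that, auto)

lemma diffeomorphism_comp:
 assumes "diffeomorphism X Y \<phi>" "diffeomorphism Y Z \<phi>'"
 shows "diffeomorphism X Z (%x. \<phi>' (\<phi> x))"
proof -
 obtain \<psi> where 1: "smooth_map X Y \<phi>" "smooth_map Y X \<psi>" "!!x. x : pts X ==> \<psi> (\<phi> x) = x" "!!y. y : pts Y ==> \<phi> (\<psi> y) = y"
  by (rule diffeomorphismE[OF assms(1)]) (rule that)
 obtain \<psi>' where 2: "smooth_map Y Z \<phi>'" "smooth_map Z Y \<psi>'" "!!x. x : pts Y ==> \<psi>' (\<phi>' x) = x" "!!y. y : pts Z ==> \<phi>' (\<psi>' y) = y"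
  by (rule diffeomorphismE[OF assms(2)]) (rule that)
 show ?thesis
  by (rule diffeomorphismI[of _ _ _ "%z. \<psi> (\<psi>' z)"])
  (use smooth_map_comp[OF 1(1) 2(1)] smooth_map_comp[OF 2(2) 1(2)] 1(3,4) 2(3,4)
  smooth_map_pts[OF 1(1)] smooth_map_pts[OF 2(2)] in auto)
qed

lemma diffeomorphism_product:
 assumes sh: "smooth_sheaf X" "smooth_sheaf X'" "smooth_sheaf Y" "smooth_sheaf Y'"
  and d: "diffeomorphism X X' \<phi>" "diffeomorphism Y Y' \<phi>'"
 shows "diffeomorphism (product_space X Y) (product_space X' Y') (%z. (\<phi> (fst z), \<phi>' (snd z)))"
proof -
 obtain \<psi> where 1: "smooth_map X X' \<phi>" "smooth_map X' X \<psi>" "!!x. x : pts X ==> \<psi> (\<phi> x) = x" "!!y. y : pts X' ==> \<phi> (\<psi> y) = y"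
  by (rule diffeomorphismE[OF d(1)]) (rule that)
 obtain \<psi>' where 2: "smooth_map Y Y' \<phi>'" "smooth_map Y' Y \<psi>'" "!!x. x : pts Y ==> \<psi>' (\<phi>' x) = x" "!!y. y : pts Y' ==> \<phi>' (\<psi>' y) = y"
  by (rule diffeomorphismE[OF d(2)]) (rule that)
 have m: "smooth_map (product_space A B) (product_space A' B') (%z. (f (fst z), g (snd z)))"
  if "smooth_sheaf A" "smooth_sheaf B" "smooth_sheaf A'" "smooth_sheaf B'" "smooth_map A A' f" "smooth_map B B' g"
  for A B A' B' f g
  by (rule smooth_map_into_product[OF smooth_sheaf_product[OF that(1,2)] that(3,4)])
  (use smooth_map_comp[OF smooth_map_fst[OF that(1,2)] that(5)]
  smooth_map_comp[OF smooth_map_snd[OF that(1,2)] that(6)] in simp_all)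
 show ?thesis
  by (rule diffeomorphismI[OF m[OF sh(1,3,2,4) 1(1) 2(1)] m[OF sh(2,4,1,3) 1(2) 2(2)]])
  (use 1(3,4) 2(3,4) in auto)
qed

lemma diffeomorphism_Rn_product:
 "diffeomorphism (product_space (Rn_space a) (Rn_space b)) (Rn_space (a + b))
  (%z i. if i < a then fst z i else if i < a + b then snd z (i - a) else 0)"
proof (rule diffeomorphismI)
 let ?P = "product_space (Rn_space a) (Rn_space b)"
 have P: "smooth_sheaf ?P" by (intro smooth_sheaf_product smooth_sheaf_Rn)
 have f: "(%z. fst z i) : smooth_funs ?P (pts ?P)" for i
  by (rule smooth_map_pullback_pts[OF smooth_map_fst[OF smooth_sheaf_Rn smooth_sheaf_Rn] smooth_funs_Rn_coord_pts])
 have s: "(%z. snd z i) : smooth_funs ?P (pts ?P)" for i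
  by (rule smooth_map_pullback_pts[OF smooth_map_snd[OF smooth_sheaf_Rn smooth_sheaf_Rn] smooth_funs_Rn_coord_pts])
 show "smooth_map ?P (Rn_space (a + b)) (%z i. if i < a then fst z i else if i < a + b then snd z (i - a) else 0)"
 proof (rule smooth_map_into_Rn[OF P])
  fix i assume "i < a + b"
  then show "(%z. if i < a then fst z i else if i < a + b then snd z (i - a) else 0) : smooth_funs ?P (pts ?P)"
  using f s by (cases "i < a") simp_all
 qed simp
 let ?\<psi> = "%z. (%i. if i < a then z i else 0, %i. if i < b then z (a + i) else (0::real))"
 show "smooth_map (Rn_space (a + b)) ?P ?\<psi>"
 proof (rule smooth_map_into_product[OF smooth_sheaf_Rn smooth_sheaf_Rn smooth_sheaf_Rn])
  show "smooth_map (Rn_space (a + b)) (Rn_space a) (%x. fst (?\<psi> x))"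
  by (rule smooth_map_into_Rn[OF smooth_sheaf_Rn]) (use smooth_funs_Rn_coord_pts[of _ "a + b"] in simp_all)
  show "smooth_map (Rn_space (a + b)) (Rn_space b) (%x. snd (?\<psi> x))"
  by (rule smooth_map_into_Rn[OF smooth_sheaf_Rn]) (use smooth_funs_Rn_coord_pts[of _ "a + b"] in simp_all)
 qed
qed (auto simp: topspace_Euclidean_space fun_eq_iff)

text \<open>The charts constructed below are onto all of R^n, so the target can be stated without an
  open subset; the identity between \<open>Rn_space n\<close> and its improper open subspace bridges
  the gap.\<close>

lemma smooth_manifoldI:
 assumes X: "smooth_sheaf X" and "Hausdorff_space (top_of X)" "second_countable (top_of X)"
  and ch: "!!x. x : pts X ==> \<exists>U \<phi>. openin (top_of X) U & x : U & diffeomorphism (open_subspace X U) (Rn_space n) \<phi>"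
 shows "smooth_manifold n X"
 unfolding smooth_manifold_def
proof (intro conjI ballI)
 fix x assume "x : pts X"
 from ch[OF this] obtain U \<phi> where U: "openin (top_of X) U" "x : U" "diffeomorphism (open_subspace X U) (Rn_space n) \<phi>"
  by blast
 let ?V = "topspace (Euclidean_space n)" and ?R = "open_subspace (Rn_space n) (topspace (Euclidean_space n))"
 have V: "openin (top_of (Rn_space n)) ?V" by simp
 have "diffeomorphism (Rn_space n) ?R (%x. x)"
 proof (rule diffeomorphismI)
  show "smooth_map (Rn_space n) ?R (%x. x)"
  by (rule smooth_map_into_open[OF smooth_map_ident _ V]) simp
  show "smooth_map ?R (Rn_space n) (%x. x)"
  by (rule smooth_map_open_inclusion[OF smooth_sheaf_Rn V])
 qed simp_all
 from diffeomorphism_comp[OF U(3) this] U(1,2)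
 show "\<exists>U V \<phi>. openin (top_of X) U & x : U & openin (Euclidean_space n) V &
  diffeomorphism (open_subspace X U) (open_subspace (Rn_space n) V) \<phi>"
  by (intro exI[of _ U] exI[of _ ?V] exI[of _ \<phi>]) simp
qed (use assms in auto)

section \<open>Separation and countability\<close>

lemma Hausdorff_space_separating_funs:
 assumes "!!x y. x : topspace X ==> y : topspace X ==> x ~= y ==>
  \<exists>f. continuous_map X euclideanreal f & f x ~= f y"
 shows "Hausdorff_space X"
 unfolding Hausdorff_space_def
proof (intro allI impI; elim conjE)
 fix x y assume xy: "x : topspace X" "y : topspace X" "x ~= y"
 obtain f where f: "continuous_map X euclideanreal f" "f x ~= f y" using assms[OF xy] by blast
 obtain A B where AB: "open A" "open B" "f x : A" "f y : B" "A \<inter> B = {}"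
  using hausdorff[OF f(2)] by blast
 show "\<exists>U V. openin X U & openin X V & x : U & y : V & disjnt U V"
 proof (intro exI conjI)
  show "openin X {x : topspace X. f x : A}" "openin X {x : topspace X. f x : B}"
  using openin_continuous_map_preimage[OF f(1)] AB by auto
 qed (use xy AB in \<open>auto simp: disjnt_def\<close>)
qed

lemma second_countable_Euclidean_space: "second_countable (Euclidean_space n)"
proof -
 obtain B :: "(nat => real) set set" where B: "countable B" "topological_basis B"
  using ex_countable_basis by blast
 have "second_countable (euclidean :: (nat => real) topology)"
  unfolding second_countable_def
 proof (intro exI[of _ B] conjI ballI allI impI)
  show "openin euclidean V" if "V : B" for V using topological_basis_open[OF B(2) that] by simp
  fix U :: "(nat => real) set" and x assume "openin euclidean U & x : U"
  then have "open U" "x : U" by simp_all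
  from topological_basisE[OF B(2) this] obtain V where "V : B" "x : V" "V \<subseteq> U" .
  then show "\<exists>V\<in>B. x : V & V \<subseteq> U" by blast
 qed (rule B(1))
 then show ?thesis unfolding Euclidean_space_eq by (rule second_countable_subtopology)
qed

text \<open>Finitely many coordinates map E to some R^N. By induction on the generation of open
  sets, \<open>pull\<close> shows that each of them is a preimage under this map, so a countable
  base of R^N pulls back to one of E.\<close>

lemma second_countable_coordinate_space:
 assumes "finite c" shows "second_countable (top_of (coordinate_space E c))"
proof -
 obtain N u where u: "c = u ` {i. i < (N::nat)}"
  using finite_imp_nat_seg_image_inj_on[OF assms] by blast
 let ?T = "top_of (coordinate_space E c)"
 define \<iota> where "\<iota> x = (%i. if i < N then u i x else 0)" for x
 have \<iota>: "continuous_map ?T (Euclidean_space N) \<iota>"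
  unfolding \<iota>_def continuous_map_componentwise_Euclidean_space
 proof (intro allI impI)
  fix i assume "i < N"
  then have "u i : c" using u by blast
  then show "continuous_map ?T euclideanreal (%x. u i x)" by (rule continuous_map_coordinate)
 qed
 let ?P = "%U. \<exists>W. openin (Euclidean_space N) W & U = {x : E. \<iota> x : W}"
 have pull: "?P U" if "generate_topology_on (insert E {{x : E. u x : S} | u S. u : c & open S}) U" for U
  using that
 proof induction
  case Empty show ?case by (rule exI[of _ "{}"]) simp
 next
  case (Int a b)
  then obtain A B where "openin (Euclidean_space N) A" "a = {x : E. \<iota> x : A}"
  "openin (Euclidean_space N) B" "b = {x : E. \<iota> x : B}" by blast
  then show ?case by (intro exI[of _ "A \<inter> B"]) auto
 next
  case (UN K)
  have "\<forall>k\<in>K. \<exists>W. openin (Euclidean_space N) W & k = {x : E. \<iota> x : W}" using UN.IH by blast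
  from bchoice[OF this] obtain w where w: "\<forall>k\<in>K. openin (Euclidean_space N) (w k) & k = {x : E. \<iota> x : w k}" by blast
  show ?case
  proof (intro exI conjI)
  show "openin (Euclidean_space N) (\<Union>k\<in>K. w k)" using w by blast
  show "\<Union>K = {x : E. \<iota> x : (\<Union>k\<in>K. w k)}" using w by blast
  qed
 next
  case (Basis s)
  then consider "s = E" | j S where "s = {x : E. u j x : S}" "j < N" "open S" using u by auto
  then show ?case
  proof cases
  case 1
  then show ?thesis by (intro exI[of _ "topspace (Euclidean_space N)"]) (simp add: \<iota>_def)
  next
  case (2 j S)
  have "openin (Euclidean_space N) {z : topspace (Euclidean_space N). z j : S}"
  by (rule openin_continuous_map_preimage[OF continuous_map_Euclidean_coord]) (use 2(3) in simp)
  moreover have "s = {x : E. \<iota> x : {z : topspace (Euclidean_space N). z j : S}}"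
  using 2(1,2) by (auto simp: \<iota>_def)
  ultimately show ?thesis by blast
  qed
 qed
 obtain B where B: "countable B" "\<forall>V\<in>B. openin (Euclidean_space N) V"
  "\<forall>U x. openin (Euclidean_space N) U & x : U --> (\<exists>V\<in>B. x : V & V \<subseteq> U)"
  using second_countable_Euclidean_space[of N] unfolding second_countable_def by blast
 show ?thesis
  unfolding second_countable_def
 proof (intro exI[of _ "(%V. {x : E. \<iota> x : V}) ` B"] conjI ballI allI impI)
  show "countable ((%V. {x : E. \<iota> x : V}) ` B)" using B(1) by simp
  show "openin ?T U" if "U : (%V. {x : E. \<iota> x : V}) ` B" for U
  proof -
  from that obtain V where V: "V : B" "U = {x : E. \<iota> x : V}" by blast
  then show ?thesis using openin_continuous_map_preimage[OF \<iota>, of V] B(2) by simp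
  qed
  fix U x assume Ux: "openin ?T U & x : U"
  then obtain W where W: "openin (Euclidean_space N) W" "U = {x : E. \<iota> x : W}"
  using pull[of U] unfolding top_of_coordinate_space openin_topology_generated_by_iff by blast
  then obtain V where V: "V : B" "\<iota> x : V" "V \<subseteq> W" using B(3) Ux by blast
  show "\<exists>V\<in>(%V. {x : E. \<iota> x : V}) ` B. x : V & V \<subseteq> U"
  by (rule bexI[OF _ imageI[OF V(1)]]) (use V W(2) Ux in auto)
 qed
qed

text \<open>The second hypothesis says that saturations of open sets are open, that is, that q is an
  open map; an open continuous image inherits a countable base.\<close>

lemma second_countable_quotient_space:
 assumes "second_countable (top_of X)"
  and "!!U. openin (top_of X) U ==> openin (top_of X) {x : pts X. q x : q ` U}"
 shows "second_countable (top_of (quotient_space X q))"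
proof (rule second_countable_open_map_image[OF continuous_map_quotient_projection _ _ assms(1)])
 show "open_map (top_of X) (top_of (quotient_space X q)) q"
  unfolding open_map_def topology_quotient_space using assms(2) openin_subset by blast
qed simp

section \<open>Smooth matrix-valued functions\<close>

definition smooth_mat :: "'a smooth_space => 'a set => nat => nat => ('a => real mat) => bool" where
 "smooth_mat X W nr nc f \<longleftrightarrow> (\<forall>x\<in>W. f x : carrier_mat nr nc) &
  (\<forall>i<nr. \<forall>j<nc. (%x. f x $$ (i, j)) : smooth_funs X W)"

lemma smooth_matI:
 "(!!x. x : W ==> f x : carrier_mat nr nc) ==>
  (!!i j. i < nr ==> j < nc ==> (%x. f x $$ (i, j)) : smooth_funs X W) ==> smooth_mat X W nr nc f"
 by (simp add: smooth_mat_def)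

lemma smooth_mat_carrier: "smooth_mat X W nr nc f ==> x : W ==> f x : carrier_mat nr nc"
 and smooth_mat_entry: "smooth_mat X W nr nc f ==> i < nr ==> j < nc ==> (%x. f x $$ (i, j)) : smooth_funs X W"
 by (simp_all add: smooth_mat_def)

context
 fixes X :: "'a smooth_space" and W :: "'a set"
 assumes X: "smooth_sheaf X" and W: "openin (top_of X) W"
begin

lemma smooth_mat_const: "A : carrier_mat nr nc ==> smooth_mat X W nr nc (%x. A)"
 by (simp add: smooth_mat_def smooth_const[OF X W])

lemma smooth_mat_mat:
 assumes "!!i j. i < nr ==> j < nc ==> (%x. f x i j) : smooth_funs X W"
 shows "smooth_mat X W nr nc (%x. Matrix.mat nr nc (%(i, j). f x i j))"
 using assms by (simp add: smooth_mat_def)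

lemma smooth_mat_transpose:
 assumes f: "smooth_mat X W nr nc f"
 shows "smooth_mat X W nc nr (%x. tr_mat (f x))"
proof (rule smooth_matI)
 fix i j assume ij: "i < nc" "j < nr"
 show "(%x. tr_mat (f x) $$ (i, j)) : smooth_funs X W"
 proof (rule smooth_funs_cong[OF X smooth_mat_entry[OF f ij(2,1)] W])
  fix x assume "x : W"
  from carrier_matD[OF smooth_mat_carrier[OF f this]] ij
  show "f x $$ (j, i) = tr_mat (f x) $$ (i, j)" by simp
 qed
qed (use smooth_mat_carrier[OF f] in auto)

lemma smooth_mat_mult:
 assumes f: "smooth_mat X W nr n f" and g: "smooth_mat X W n nc g"
 shows "smooth_mat X W nr nc (%x. f x * g x)"
proof (rule smooth_matI)
 fix i j assume ij: "i < nr" "j < nc"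
 have "(%x. \<Sum>k<n. f x $$ (i, k) * g x $$ (k, j)) : smooth_funs X W"
  using ij by (intro smooth_sum[OF X W] smooth_mult[OF X W] smooth_mat_entry[OF f] smooth_mat_entry[OF g]) auto
 then show "(%x. (f x * g x) $$ (i, j)) : smooth_funs X W"
 proof (rule smooth_funs_cong[OF X _ W])
  fix x assume "x : W"
  with ij smooth_mat_carrier[OF f this] smooth_mat_carrier[OF g this]
  show "(\<Sum>k<n. f x $$ (i, k) * g x $$ (k, j)) = (f x * g x) $$ (i, j)"
  by (auto simp: scalar_prod_def lessThan_atLeast0)
 qed
qed (rule mult_carrier_mat[OF smooth_mat_carrier[OF f] smooth_mat_carrier[OF g]])

lemma smooth_det:
 assumes f: "smooth_mat X W n n f"
 shows "(%x. mdet (f x)) : smooth_funs X W"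
proof -
 have "(%x. \<Sum>p\<in>{p. p permutes {0..<n}}. signof p * (\<Prod>i=0..<n. f x $$ (i, p i))) : smooth_funs X W"
 proof (intro smooth_sum[OF X W] smooth_mult[OF X W] smooth_prod[OF X W] smooth_const[OF X W])
  fix p i assume "p : {p. p permutes {0..<n}}" "i : {0..<n}"
  then show "(%x. f x $$ (i, p i)) : smooth_funs X W"
  using permutes_in_image[of p "{0..<n}" i] by (intro smooth_mat_entry[OF f]) auto
 qed
 then show ?thesis
  by (rule smooth_funs_cong[OF X _ W]) (use det_def'[OF smooth_mat_carrier[OF f]] in simp)
qed

text \<open>The entries are signed minors, hence polynomials. Divided by the determinant they give
  the inverse matrix, which is how inversion enters \<open>smooth_uni\<close>.\<close>

lemma smooth_adj_mat:
 assumes f: "smooth_mat X W n n f"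
 shows "smooth_mat X W n n (%x. adj_mat (f x))"
proof (rule smooth_matI)
 fix i j assume ij: "i < n" "j < n"
 have c: "f x : carrier_mat n n" if "x : W" for x using smooth_mat_carrier[OF f that] .
 have "smooth_mat X W (n - 1) (n - 1) (%x. mat_delete (f x) j i)"
 proof (rule smooth_matI)
  fix k l assume kl: "k < n - 1" "l < n - 1"
  have "(%x. f x $$ (if k < j then k else Suc k, if l < i then l else Suc l)) : smooth_funs X W"
  using kl by (intro smooth_mat_entry[OF f]) auto
  then show "(%x. mat_delete (f x) j i $$ (k, l)) : smooth_funs X W"
  proof (rule smooth_funs_cong[OF X _ W])
  fix x assume "x : W"
  from carrier_matD[OF c[OF this]] kl
  show "f x $$ (if k < j then k else Suc k, if l < i then l else Suc l) = mat_delete (f x) j i $$ (k, l)"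
  by (simp add: mat_delete_def)
  qed
 next
  fix x assume "x : W"
  from c[OF this] show "mat_delete (f x) j i : carrier_mat (n - 1) (n - 1)"
  by (intro carrier_matI) (simp_all add: mat_delete_def)
 qed
 then have "(%x. (-1) ^ (j + i) * mdet (mat_delete (f x) j i)) : smooth_funs X W"
  by (intro smooth_mult[OF X W] smooth_const[OF X W] smooth_det)
 then show "(%x. adj_mat (f x) $$ (i, j)) : smooth_funs X W"
 proof (rule smooth_funs_cong[OF X _ W])
  fix x assume "x : W"
  from carrier_matD[OF c[OF this]] ij
  show "(-1) ^ (j + i) * mdet (mat_delete (f x) j i) = adj_mat (f x) $$ (i, j)"
  by (simp add: adj_mat_def cofactor_def)
 qed
qed (use smooth_mat_carrier[OF f] adj_mat(1) in blast)

end

lemma smooth_mat_coordinate: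
 assumes "openin (top_of (coordinate_space E (mat_entries nr nc))) W" "E \<subseteq> carrier_mat nr nc"
 shows "smooth_mat (coordinate_space E (mat_entries nr nc)) W nr nc (%x. x)"
proof (rule smooth_matI)
 show "x : carrier_mat nr nc" if "x : W" for x using that assms openin_subset by fastforce
 show "(%x. x $$ (i, j)) : smooth_funs (coordinate_space E (mat_entries nr nc)) W" if "i < nr" "j < nc" for i j
  by (rule smooth_funs_coordinate[OF _ assms(1)]) (use that in \<open>auto simp: mat_entries_def\<close>)
qed

lemma smooth_map_into_matrices:
 assumes X: "smooth_sheaf X" and f: "smooth_mat X (pts X) nr nc f" and E: "!!x. x : pts X ==> f x : E"
 shows "smooth_map X (coordinate_space E (mat_entries nr nc)) f"
 by (rule smooth_map_into_coordinate[OF X E])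
  (use smooth_mat_entry[OF f] in \<open>auto simp: mat_entries_def\<close>)

lemma finite_mat_entries: "finite (mat_entries nr nc)"
proof -
 have "mat_entries nr nc = (%(i, j) A. A $$ (i, j)) ` ({..<nr} \<times> {..<nc})"
  by (auto simp: mat_entries_def)
 then show ?thesis by simp
qed

section \<open>Gram--Schmidt orthonormalization\<close>

text \<open>A general form b is kept because Gram-Schmidt is run twice: with the standard form for
  sections of the flag manifold, and with the matrix B for the Rayleigh quotient. Only the first m
  coordinates of the vectors count.\<close>

definition bil :: "nat => (nat => nat => real) => (nat => real) => (nat => real) => real" where
 "bil m b x y = (\<Sum>s<m. \<Sum>t<m. x s * b s t * y t)"

lemma bil_sum_left:
 "bil m b (%j. \<Sum>k\<in>K. c k * x k j) y = (\<Sum>k\<in>K. c k * bil m b (x k) y)"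
proof -
 have "bil m b (%j. \<Sum>k\<in>K. c k * x k j) y = (\<Sum>s<m. \<Sum>t<m. \<Sum>k\<in>K. c k * (x k s * b s t * y t))"
  by (simp add: bil_def sum_distrib_right sum_distrib_left mult_ac)
 also have "\<dots> = (\<Sum>s<m. \<Sum>k\<in>K. \<Sum>t<m. c k * (x k s * b s t * y t))"
  by (intro sum.cong refl sum.swap)
 also have "\<dots> = (\<Sum>k\<in>K. \<Sum>s<m. \<Sum>t<m. c k * (x k s * b s t * y t))"
  by (rule sum.swap)
 finally show ?thesis by (simp add: bil_def sum_distrib_left)
qed

lemma bil_diff_left: "bil m b (%j. x j - x' j) y = bil m b x y - bil m b x' y"
 by (simp add: bil_def algebra_simps sum_subtractf)

lemma bil_divide_left: "bil m b (%j. x j / c) y = bil m b x y / c"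
 by (simp add: bil_def sum_divide_distrib)

lemma bil_divide_right: "bil m b x (%j. y j / c) = bil m b x y / c"
 by (simp add: bil_def sum_divide_distrib)

lemma bil_commute:
 assumes "!!s t. s < m ==> t < m ==> b s t = b t s"
 shows "bil m b x y = bil m b y x"
proof -
 have "bil m b x y = (\<Sum>t<m. \<Sum>s<m. x s * b s t * y t)" unfolding bil_def by (rule sum.swap)
 also have "\<dots> = bil m b y x" unfolding bil_def
  by (intro sum.cong refl) (use assms in \<open>simp add: mult_ac\<close>)
 finally show ?thesis .
qed

definition gs_residual ::
  "nat => (nat => nat => real) => (nat => nat => real) => (nat => nat => real) => nat => nat => real" where
 "gs_residual m b Y q i = (%j. Y i j - (\<Sum>k<i. bil m b (Y i) (q k) * q k j))"

fun gs :: "nat => (nat => nat => real) => (nat => nat => real) => nat => (nat => real)" where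
 "gs m b Y i = (let w = (%j. Y i j - (\<Sum>k<i. bil m b (Y i) (gs m b Y k) * gs m b Y k j))
  in (%j. w j / sqrt (bil m b w w)))"

declare gs.simps [simp del]

lemma gs_eq: "gs m b Y i j = gs_residual m b Y (gs m b Y) i j /
  sqrt (bil m b (gs_residual m b Y (gs m b Y) i) (gs_residual m b Y (gs m b Y) i))"
 by (subst gs.simps) (simp add: gs_residual_def Let_def)

context
 fixes m n :: nat and b :: "nat => nat => real" and Y :: "nat => nat => real"
 assumes sym: "!!s t. s < m ==> t < m ==> b s t = b t s"
  and pos: "!!x j. j < m ==> x j ~= 0 ==> bil m b x x > 0"
  and indep: "!!c. (!!j. j < m ==> (\<Sum>i<n. c i * Y i j) = 0) ==> (!!i. i < n ==> c i = 0)"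
begin

text \<open>Four facts are proved in one induction because they feed each other: the triangular
  expressions of the earlier vectors show that the residual is a combination of the rows of Y with
  coefficient 1 at Y i, so it is nonzero by independence; its norm is then positive, which allows
  normalization, and orthogonality to the earlier vectors uses their orthonormality.\<close>

lemma gs_step:
 "i < n ==> bil m b (gs_residual m b Y (gs m b Y) i) (gs_residual m b Y (gs m b Y) i) > 0 &
  (\<exists>r. r i > 0 & (\<forall>l>i. r l = 0) & (\<forall>j. gs m b Y i j = (\<Sum>l<n. r l * Y l j))) &
  bil m b (gs m b Y i) (gs m b Y i) = 1 & (\<forall>k<i. bil m b (gs m b Y i) (gs m b Y k) = 0)"
proof (induction i rule: less_induct)
 case (less i)
 let ?q = "gs m b Y"
 define w where "w = gs_residual m b Y ?q i"
 define c where "c k = bil m b (Y i) (?q k)" for k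
 have ex: "\<forall>k. \<exists>r. k < i --> ((\<forall>l>k. r l = 0) & (\<forall>j. ?q k j = (\<Sum>l<n. r l * Y l j)))"
 proof
  fix k
  show "\<exists>r. k < i --> ((\<forall>l>k. r l = 0) & (\<forall>j. ?q k j = (\<Sum>l<n. r l * Y l j)))"
  proof (cases "k < i")
  case True
  then have "k < n" using less.prems by simp
  from less.IH[OF True this] show ?thesis by blast
  qed simp
 qed
 from choice[OF ex] obtain r where r: "!!k l. k < i ==> l > k ==> r k l = 0"
  "!!k j. k < i ==> ?q k j = (\<Sum>l<n. r k l * Y l j)" by blast
 \<comment> \<open>Coefficients of the residual in terms of the original rows. The coefficient at i
   is 1, since the earlier vectors involve only rows before i.\<close>
 define r' where "r' l = (if l = i then 1 else 0) - (\<Sum>k<i. c k * r k l)" for l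
 have r'i: "r' i = 1" using r(1) by (simp add: r'_def)
 have r'l: "r' l = 0" if "l > i" for l using r(1) that by (simp add: r'_def)
 have w_eq: "w j = (\<Sum>l<n. r' l * Y l j)" for j
 proof -
  have "(\<Sum>k<i. c k * ?q k j) = (\<Sum>k<i. \<Sum>l<n. c k * r k l * Y l j)"
  using r(2) by (simp add: sum_distrib_left mult.assoc)
  also have "\<dots> = (\<Sum>l<n. (\<Sum>k<i. c k * r k l) * Y l j)"
  by (subst sum.swap) (simp add: sum_distrib_right)
  finally have "w j = Y i j - (\<Sum>l<n. (\<Sum>k<i. c k * r k l) * Y l j)"
  by (simp add: w_def gs_residual_def c_def)
  also have "Y i j = (\<Sum>l<n. (if l = i then 1 else 0) * Y l j)"
  using less.prems by (simp add: if_distrib[of "%x. x * _"] cong: if_cong)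
  finally show ?thesis by (simp add: r'_def sum_subtractf algebra_simps)
 qed
 have "\<exists>j<m. w j ~= 0"
 proof (rule ccontr)
  assume "\<not> (\<exists>j<m. w j ~= 0)"
  then have "r' i = 0" using indep[of r' i] w_eq less.prems by simp
  then show False using r'i by simp
 qed
 then have wpos: "bil m b w w > 0" using pos by blast
 have qi: "?q i j = w j / sqrt (bil m b w w)" for j by (simp add: gs_eq w_def)
 then have qi': "?q i = (%j. w j / sqrt (bil m b w w))" by auto
 have "bil m b (?q i) (?q i) = 1"
  unfolding qi' bil_divide_left bil_divide_right using wpos by simp
 moreover have "bil m b (?q i) (?q k) = 0" if k: "k < i" for k
 proof -
  have orth: "bil m b (?q l) (?q k) = (if l = k then 1 else 0)" if "l < i" for l
  using less.IH[of l] less.IH[of k] less.prems that k bil_commute[of m b "?q l" "?q k", OF sym]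
  by (cases l k rule: linorder_cases) auto
  have "bil m b w (?q k) = bil m b (Y i) (?q k) - (\<Sum>l<i. c l * bil m b (?q l) (?q k))"
  by (simp add: w_def gs_residual_def c_def bil_diff_left bil_sum_left)
  also have "(\<Sum>l<i. c l * bil m b (?q l) (?q k)) = c k"
  using orth k by (simp add: if_distrib[of "%x. _ * x"] cong: if_cong)
  finally have "bil m b w (?q k) = 0" by (simp add: c_def)
  then show ?thesis unfolding qi' bil_divide_left by simp
 qed
 moreover have "\<exists>r. r i > 0 & (\<forall>l>i. r l = 0) & (\<forall>j. ?q i j = (\<Sum>l<n. r l * Y l j))"
  using r'i r'l wpos qi w_eq
  by (intro exI[of _ "%l. r' l / sqrt (bil m b w w)"]) (simp add: sum_divide_distrib)
 ultimately show ?case using wpos by (simp add: w_def)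
qed

lemma gs_orthonormal:
 assumes "i < n" "k < n"
 shows "bil m b (gs m b Y i) (gs m b Y k) = (if i = k then 1 else 0)"
 using gs_step[OF assms(1)] gs_step[OF assms(2)] bil_commute[of m b "gs m b Y i" "gs m b Y k", OF sym]
 by (cases i k rule: linorder_cases) auto

lemma gs_triangular:
 obtains R where "R : carrier_mat n n" "!!i l. i < l ==> l < n ==> R $$ (i, l) = 0"
  "!!i. i < n ==> R $$ (i, i) > 0"
  "!!i j. i < n ==> gs m b Y i j = (\<Sum>l<n. R $$ (i, l) * Y l j)"
proof -
 have "\<forall>i. \<exists>r. i < n --> r i > 0 & (\<forall>l>i. r l = 0) & (\<forall>j. gs m b Y i j = (\<Sum>l<n. r l * Y l j))"
 proof
  fix i
  show "\<exists>r. i < n --> r i > 0 & (\<forall>l>i. r l = 0) & (\<forall>j. gs m b Y i j = (\<Sum>l<n. r l * Y l j))"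
  using gs_step[of i] by (cases "i < n") auto
 qed
 from choice[OF this] obtain r where r: "!!i. i < n ==> r i i > 0"
  "!!i l. i < n ==> i < l ==> r i l = 0" "!!i j. i < n ==> gs m b Y i j = (\<Sum>l<n. r i l * Y l j)" by blast
 show thesis
  by (rule that[of "Matrix.mat n n (%(i, l). r i l)"]) (use r in auto)
qed

end

lemma det_lower_triangular_nonzero:
 assumes "R : carrier_mat n n" "!!i l. i < l ==> l < n ==> R $$ (i, l) = 0"
  "!!i. i < n ==> R $$ (i, i) ~= (0::real)"
 shows "mdet R ~= 0"
proof -
 have "mdet R = prod_list (diag_mat R)"
  by (rule det_lower_triangular[OF assms(2,1)])
 also have "\<dots> ~= 0" using assms(1,3) by (auto simp: prod_list_zero_iff diag_mat_def)
 finally show ?thesis .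
qed

text \<open>Positivity of the squared residual norms is the only condition for the square roots and
  divisions of the recursion to be smooth; independence of the rows supplies it through
  \<open>gs_step\<close>.\<close>

lemma smooth_gs:
 assumes X: "smooth_sheaf X" and W: "openin (top_of X) W"
  and sm: "!!i j. i < n ==> j < m ==> (%x. Y x i j) : smooth_funs X W"
  and nz: "!!x i. x : W ==> i < n ==>
  bil m b (gs_residual m b (Y x) (gs m b (Y x)) i) (gs_residual m b (Y x) (gs m b (Y x)) i) > 0"
 shows "i < n ==> j < m ==> (%x. gs m b (Y x) i j) : smooth_funs X W"
proof (induction i arbitrary: j rule: less_induct)
 case (less i)
 have bs: "(%x. bil m b (f x) (g x)) : smooth_funs X W"
  if "!!s. s < m ==> (%x. f x s) : smooth_funs X W" "!!s. s < m ==> (%x. g x s) : smooth_funs X W" for f g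
  unfolding bil_def
 proof (rule smooth_sum[OF X W], rule smooth_sum[OF X W])
  fix s t assume "s : {..<m}" "t : {..<m}"
  then show "(%x. f x s * b s t * g x t) : smooth_funs X W"
  using smooth_mult[OF X W smooth_mult[OF X W that(1) smooth_const[OF X W]] that(2)] by simp
 qed
 have w: "(%x. gs_residual m b (Y x) (gs m b (Y x)) i j) : smooth_funs X W" if j: "j < m" for j
  unfolding gs_residual_def
 proof (rule smooth_diff[OF X W sm[OF less.prems(1) j]], rule smooth_sum[OF X W])
  fix k assume "k : {..<i}"
  then have k: "k < i" "k < n" using less.prems by auto
  show "(%x. bil m b (Y x i) (gs m b (Y x) k) * gs m b (Y x) k j) : smooth_funs X W"
  by (rule smooth_mult[OF X W bs[OF sm[OF less.prems(1)] less.IH[OF k]] less.IH[OF k j]])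
 qed
 have ww: "(%x. bil m b (gs_residual m b (Y x) (gs m b (Y x)) i) (gs_residual m b (Y x) (gs m b (Y x)) i)) : smooth_funs X W"
  by (rule bs[OF w w])
 have pos: "bil m b (gs_residual m b (Y x) (gs m b (Y x)) i) (gs_residual m b (Y x) (gs m b (Y x)) i) > 0"
  if "x : W" for x using nz[OF that less.prems(1)] .
 have sq: "(%x. sqrt (bil m b (gs_residual m b (Y x) (gs m b (Y x)) i) (gs_residual m b (Y x) (gs m b (Y x)) i))) : smooth_funs X W"
  by (rule smooth_sqrt[OF X W ww pos])
 have nz: "sqrt (bil m b (gs_residual m b (Y x) (gs m b (Y x)) i) (gs_residual m b (Y x) (gs m b (Y x)) i)) ~= 0"
  if "x : W" for x using pos[OF that] by simp
 show ?case
  by (rule smooth_funs_cong[OF X smooth_divide[OF X W w[OF less.prems(2)] sq nz] W]) (simp_all only: gs_eq[symmetric])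
qed

lemma det_nonzero_imp_rows_independent:
 assumes A: "A : carrier_mat n n" and d: "mdet A ~= (0::real)"
  and c: "!!j. j < n ==> (\<Sum>i<n. c i * A $$ (i, j)) = 0" and i: "i < n"
 shows "c i = 0"
proof -
 have At: "tr_mat A : carrier_mat n n" using A by simp
 have v: "Matrix.vec n c : carrier_vec n" by simp
 have "tr_mat A *\<^sub>v Matrix.vec n c = 0\<^sub>v n"
 proof (rule eq_vecI)
  fix j assume "j < dim_vec (0\<^sub>v n :: real Matrix.vec)"
  then have j: "j < n" by simp
  have "(\<Sum>i\<in>{0..<n}. A $$ (i, j) * c i) = (\<Sum>i<n. c i * A $$ (i, j))"
  by (simp add: lessThan_atLeast0 mult.commute)
  then show "vec_index (tr_mat A *\<^sub>v Matrix.vec n c) j = vec_index (0\<^sub>v n) j"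
  using A j c[OF j] by (auto simp: scalar_prod_def)
 qed (use A in auto)
 moreover have "mdet (tr_mat A) ~= 0" using d det_transpose[OF A] by simp
 ultimately have "Matrix.vec n c = 0\<^sub>v n" using det_0_iff_vec_prod_zero[OF At] v by blast
 then have "vec_index (Matrix.vec n c) i = vec_index (0\<^sub>v n) i" by simp
 then show ?thesis using i by simp
qed

section \<open>Gram-Schmidt for the rows of a square matrix\<close>

definition std_form :: "nat => nat => real" where
 "std_form s t = (if s = t then 1 else 0)"

lemma bil_std_form: "bil m std_form x y = (\<Sum>s<m. x s * y s)"
 unfolding bil_def std_form_def
 by (intro sum.cong refl) (simp add: if_distrib if_distribR cong: if_cong)

lemma bil_std_form_pos: "j < m ==> x j ~= 0 ==> bil m std_form x x > 0"
proof -
 assume j: "j < m" "x j ~= 0"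
 have "0 < x j * x j" using j(2) by (auto simp: zero_less_mult_iff neq_iff)
 also have "\<dots> <= (\<Sum>s<m. x s * x s)" by (rule member_le_sum) (use j in auto)
 finally show ?thesis by (simp add: bil_std_form)
qed

definition gs_mat :: "nat => real mat => real mat" where
 "gs_mat m Y = Matrix.mat m m (%(i, j). gs m std_form (%i j. Y $$ (i, j)) i j)"

lemma orth_matsD: "A : orth_mats n ==> A : carrier_mat n n" "A : orth_mats n ==> A * tr_mat A = 1\<^sub>m n"
 by (simp_all add: orth_mats_def)

lemma orth_mats_transpose_mult: "A : orth_mats n ==> tr_mat A * A = 1\<^sub>m n"
 using mat_mult_left_right_inverse[of A n "tr_mat A"] by (simp add: orth_mats_def)

lemma mult_transpose_entry:
 assumes "A : carrier_mat n m" "B : carrier_mat n' m" "i < n" "j < n'"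
 shows "(A * tr_mat B) $$ (i, j) = (\<Sum>s<m. A $$ (i, s) * B $$ (j, s))"
 using assms by (auto simp: scalar_prod_def lessThan_atLeast0)

lemma mult_entry:
 assumes "A : carrier_mat n m" "B : carrier_mat m n'" "i < n" "j < n'"
 shows "(A * B) $$ (i, j) = (\<Sum>s<m. A $$ (i, s) * B $$ (s, j))"
 using assms by (auto simp: scalar_prod_def lessThan_atLeast0)

lemma orth_mats_iff_rows:
 assumes "A : carrier_mat m m"
 shows "A : orth_mats m \<longleftrightarrow> (\<forall>i<m. \<forall>j<m. (\<Sum>s<m. A $$ (i, s) * A $$ (j, s)) = (if i = j then 1 else 0))"
proof
 assume "A : orth_mats m"
 then have "A * tr_mat A = 1\<^sub>m m" by (simp add: orth_mats_def)
 then show "\<forall>i<m. \<forall>j<m. (\<Sum>s<m. A $$ (i, s) * A $$ (j, s)) = (if i = j then 1 else 0)"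
  using mult_transpose_entry[OF assms assms] by (metis index_one_mat(1))
next
 assume "\<forall>i<m. \<forall>j<m. (\<Sum>s<m. A $$ (i, s) * A $$ (j, s)) = (if i = j then 1 else 0)"
 then have "A * tr_mat A = 1\<^sub>m m"
  using assms mult_transpose_entry[OF assms assms] by (intro eq_matI) auto
 then show "A : orth_mats m" using assms by (simp add: orth_mats_def)
qed

lemma gs_mat_orth:
 assumes Y: "Y : carrier_mat m m" "mdet Y ~= 0"
 shows "gs_mat m Y : orth_mats m"
proof (subst orth_mats_iff_rows)
 show "\<forall>i<m. \<forall>j<m. (\<Sum>s<m. gs_mat m Y $$ (i, s) * gs_mat m Y $$ (j, s)) = (if i = j then 1 else 0)"
 proof (intro allI impI)
  fix i j assume ij: "i < m" "j < m"
  have "bil m std_form (gs m std_form (%i j. Y $$ (i, j)) i) (gs m std_form (%i j. Y $$ (i, j)) j)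
  = (if i = j then 1 else 0)"
  by (rule gs_orthonormal[where m = m and b = std_form and n = m])
  (use ij bil_std_form_pos det_nonzero_imp_rows_independent[OF Y] in \<open>auto simp: std_form_def\<close>)
  then show "(\<Sum>s<m. gs_mat m Y $$ (i, s) * gs_mat m Y $$ (j, s)) = (if i = j then 1 else 0)"
  using ij by (simp add: bil_std_form gs_mat_def)
 qed
qed (simp add: gs_mat_def)

lemma gs_mat_triangular:
 assumes Y: "Y : carrier_mat m m" "mdet Y ~= 0"
 obtains R where "R : carrier_mat m m" "!!i l. i < l ==> l < m ==> R $$ (i, l) = 0"
  "!!i. i < m ==> R $$ (i, i) > 0" "gs_mat m Y = R * Y"
proof -
 obtain R where R: "R : carrier_mat m m" "!!i l. i < l ==> l < m ==> R $$ (i, l) = 0"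
  "!!i. i < m ==> R $$ (i, i) > 0"
  "!!i j. i < m ==> gs m std_form (%i j. Y $$ (i, j)) i j = (\<Sum>l<m. R $$ (i, l) * Y $$ (l, j))"
  by (rule gs_triangular[where m = m and b = std_form and n = m and Y = "%i j. Y $$ (i, j)"])
  (use bil_std_form_pos det_nonzero_imp_rows_independent[OF Y] in \<open>auto simp: std_form_def\<close>)
 have "gs_mat m Y = R * Y"
  by (rule eq_matI) (use R(1,4) Y(1) mult_entry[OF R(1) Y(1)] in \<open>auto simp: gs_mat_def\<close>)
 with R that show thesis by blast
qed

lemma smooth_gs_mat:
 assumes X: "smooth_sheaf X" and W: "openin (top_of X) W"
  and f: "smooth_mat X W m m f" and d: "!!x. x : W ==> mdet (f x) ~= 0"
 shows "smooth_mat X W m m (%x. gs_mat m (f x))"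
 unfolding gs_mat_def
proof (rule smooth_mat_mat[OF X W])
 fix i j assume ij: "i < m" "j < m"
 show "(%x. gs m std_form (%i j. f x $$ (i, j)) i j) : smooth_funs X W"
 proof (rule smooth_gs[OF X W _ _ ij])
  show "(%x. f x $$ (i, j)) : smooth_funs X W" if "i < m" "j < m" for i j
  by (rule smooth_mat_entry[OF f that])
  fix x i assume x: "x : W" and i: "i < m"
  show "0 < bil m std_form (gs_residual m std_form (%i j. f x $$ (i, j)) (gs m std_form (%i j. f x $$ (i, j))) i)
  (gs_residual m std_form (%i j. f x $$ (i, j)) (gs m std_form (%i j. f x $$ (i, j))) i)"
  proof (rule gs_step[where m = m and b = std_form and n = m, THEN conjunct1])
  fix c k assume "!!j. j < m ==> (\<Sum>i<m. c i * f x $$ (i, j)) = 0" "k < m"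
  then show "c k = 0"
  by (rule det_nonzero_imp_rows_independent[OF smooth_mat_carrier[OF f x] d[OF x]])
  qed (use i bil_std_form_pos in \<open>auto simp: std_form_def\<close>)
 qed
qed

section \<open>Quotients by group actions\<close>

lemma smooth_funs_descend:
 assumes X: "smooth_sheaf X" and g: "g : smooth_funs X (pts X)"
  and inv: "!!x y. x : pts X ==> y : pts X ==> q x = q y ==> g x = g y"
 obtains f where "f : smooth_funs (quotient_space X q) (pts (quotient_space X q))"
  "!!x. x : pts X ==> f (q x) = g x"
proof
 define f where "f y = g (SOME x. x : pts X & q x = y)" for y
 show f: "f (q x) = g x" if "x : pts X" for x
 proof -
  have "\<exists>z. z : pts X & q z = q x" using that by blast
  then have "(SOME z. z : pts X & q z = q x) : pts X & q (SOME z. z : pts X & q z = q x) = q x"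
  by (rule someI_ex)
  then show ?thesis unfolding f_def using inv that by blast
 qed
 have "{x : pts X. q x : pts (quotient_space X q)} = pts X" by auto
 moreover have "f \<circ> q : smooth_funs X (pts X)"
  by (rule smooth_funs_cong[OF X g openin_topspace]) (simp add: f)
 ultimately show "f : smooth_funs (quotient_space X q) (pts (quotient_space X q))"
  unfolding smooth_funs_quotient_space by simp
qed

text \<open>A family G of smooth invariants that separates the fibers of q descends to continuous
  functions that separate the points of the quotient.\<close>

lemma Hausdorff_quotient_space:
 assumes X: "smooth_sheaf X" and g: "!!g. g : G ==> g : smooth_funs X (pts X)"
  and inv: "!!x y g. x : pts X ==> y : pts X ==> q x = q y ==> g : G ==> g x = g y"
  and sep: "!!x y. x : pts X ==> y : pts X ==> (!!g. g : G ==> g x = g y) ==> q x = q y"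
 shows "Hausdorff_space (top_of (quotient_space X q))"
proof (rule Hausdorff_space_separating_funs)
 fix a b assume ab: "a : pts (quotient_space X q)" "b : pts (quotient_space X q)" "a ~= b"
 then obtain x y where xy: "x : pts X" "y : pts X" "a = q x" "b = q y" by auto
 then obtain g0 where g0: "g0 : G" "g0 x ~= g0 y" using sep[of x y] ab(3) by blast
 obtain f where f: "f : smooth_funs (quotient_space X q) (pts (quotient_space X q))"
  "!!x. x : pts X ==> f (q x) = g0 x"
  using smooth_funs_descend[OF X g[OF g0(1)], of q] inv g0(1) by blast
 have "continuous_map (top_of (quotient_space X q)) euclideanreal f"
  using smooth_funs_continuous[OF smooth_sheaf_quotient_space[OF X] f(1) openin_topspace]
  unfolding subtopology_topspace .
 then show "\<exists>f. continuous_map (top_of (quotient_space X q)) euclideanreal f & f a ~= f b"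
  using f(2) xy g0(2) by (intro exI[of _ f]) simp
qed

text \<open>If the fibers of q are the orbits of a set of continuous maps, the saturation of U is
  the union of the preimages of U under these maps.\<close>

lemma openin_saturation:
 assumes act: "!!a. a : A ==> continuous_map (top_of X) (top_of X) (a :: 'a => 'a)"
  and orb: "!!x y. x : pts X ==> y : pts X ==> q x = q y \<longleftrightarrow> (\<exists>a\<in>A. y = a x)"
  and U: "openin (top_of X) U"
 shows "openin (top_of X) {x : pts X. q x : q ` U}"
proof -
 have "{x : pts X. q x : q ` U} = (\<Union>a\<in>A. {x : pts X. a x : U})"
 proof (intro equalityI subsetI)
  fix x assume "x : {x : pts X. q x : q ` U}"
  then obtain u where u: "x : pts X" "u : U" "q x = q u" by blast
  then have "u : pts X" using openin_subset[OF U] by blast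
  then obtain a where "a : A" "u = a x" using orb u by blast
  then show "x : (\<Union>a\<in>A. {x : pts X. a x : U})" using u by blast
 next
  fix x assume "x : (\<Union>a\<in>A. {x : pts X. a x : U})"
  then obtain a where a: "a : A" "x : pts X" "a x : U" by blast
  then have "q x = q (a x)" using orb[OF a(2), of "a x"] openin_subset[OF U] by blast
  then show "x : {x : pts X. q x : q ` U}" using a by blast
 qed
 also have "openin (top_of X) \<dots>"
  using openin_continuous_map_preimage[OF act U] by (intro openin_Union) auto
 finally show ?thesis .
qed

section \<open>Block triangular decomposition\<close>

text \<open>\<open>\<beta>\<close> assigns to each row index its block label; labels decrease from top to bottom.\<close>

locale block_index =
 fixes m :: nat and \<beta> :: "nat => nat"
 assumes antimono: "i <= j ==> j < m ==> \<beta> j <= \<beta> i"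
begin

text \<open>The product of the orthogonal groups of the blocks, including the block with label 0.
  Its left orbits in O(m) are the points of the flag manifold, see
  \<open>flag_group_eq\<close>.\<close>

definition stab :: "real mat set" where
 "stab = {h : orth_mats m. \<forall>i<m. \<forall>j<m. \<beta> i ~= \<beta> j --> h $$ (i, j) = 0}"

text \<open>Rows with label r are combined only from rows with labels at least r, so left
  multiplication by such a matrix keeps the rows above any block boundary inside their span. Nothing
  is required of the rows with label 0.\<close>

definition block_lower :: "real mat => bool" where
 "block_lower g \<longleftrightarrow> g : carrier_mat m m & (\<forall>s<m. \<forall>t<m. \<beta> t < \<beta> s --> g $$ (s, t) = 0)"

text \<open>The free entries are those with \<beta> t < \<beta> s, to the right of the diagonal
  blocks; they become the coordinates of the flag manifold.\<close>

definition unipotent :: "real mat => bool" where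
 "unipotent M \<longleftrightarrow> M : carrier_mat m m &
  (\<forall>s<m. \<forall>t<m. \<beta> s <= \<beta> t --> M $$ (s, t) = (if s = t then 1 else 0))"

text \<open>For a = 0 no row is leading. Then \<open>corner\<close> and \<open>toprows\<close> are
  identity matrices, so the bottom rows of \<open>uni\<close> are unit vectors whatever X is. This
  is what lets the construction run on data that do not determine the last block.\<close>

definition lead :: "nat => nat => bool" where
 "lead a s \<longleftrightarrow> 0 < a & a <= \<beta> s"

text \<open>The leading block of X, padded by an identity to full size m: its determinant is the
  leading block minor, and matrices belonging to different labels can be multiplied without changing
  dimensions.\<close>

definition corner :: "nat => real mat => real mat" where
 "corner a X = Matrix.mat m m (%(s, t). if lead a s & lead a t then X $$ (s, t) else if s = t then 1 else 0)"

definition toprows :: "nat => real mat => real mat" where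
 "toprows a X = Matrix.mat m m (%(s, t). if lead a s then X $$ (s, t) else if s = t then 1 else 0)"

definition corner_inv :: "nat => real mat => real mat" where
 "corner_inv a X = (1 / mdet (corner a X)) \<cdot>\<^sub>m adj_mat (corner a X)"

text \<open>The unipotent factor of the block decomposition \<open>X = (lower) \<cdot> (diagonal) \<cdot> (upper unipotent)\<close>, which
  exists if the leading block minors do not vanish: writing the rows of \<open>X\<close> up to block \<open>a\<close> as
  \<open>(A | B)\<close>, the rows of the unipotent factor in block \<open>a\<close> are those of \<open>(1 | A\<^sup>-\<^sup>1 B)\<close>. The bottom
  block (label \<open>0\<close>) is not read.\<close>

definition uni :: "real mat => real mat" where
 "uni X = Matrix.mat m m (%(i, j). (corner_inv (\<beta> i) X * toprows (\<beta> i) X) $$ (i, j))"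

text \<open>Each leading block minor occurs as often as the corresponding block has rows. Only
  nonvanishing and multiplicativity matter, and indexing by rows skips empty blocks.\<close>

definition minors :: "real mat => real" where
 "minors X = (\<Prod>i<m. mdet (corner (\<beta> i) X))"

lemma corner_carrier [simp]: "corner a X : carrier_mat m m"
 and toprows_carrier [simp]: "toprows a X : carrier_mat m m"
 and uni_carrier [simp]: "uni X : carrier_mat m m"
 by (simp_all add: corner_def toprows_def uni_def)

lemma corner_dims [simp]:
 "dim_row (corner a X) = m" "dim_col (corner a X) = m" "dim_row (toprows a X) = m" "dim_col (toprows a X) = m"
 by (simp_all add: corner_def toprows_def)

lemma corner_inv_carrier [simp]: "corner_inv a X : carrier_mat m m"
 using adj_mat(1)[OF corner_carrier] by (simp add: corner_inv_def)

lemma minors_nonzero: "minors X ~= 0 ==> i < m ==> mdet (corner (\<beta> i) X) ~= 0"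
 by (auto simp: minors_def)

lemma corner_inv_mult:
 assumes "mdet (corner a X) ~= 0"
 shows "corner_inv a X * corner a X = 1\<^sub>m m" "corner a X * corner_inv a X = 1\<^sub>m m"
proof -
 have "corner_inv a X * corner a X = (1 / mdet (corner a X)) \<cdot>\<^sub>m (adj_mat (corner a X) * corner a X)"
  unfolding corner_inv_def by (rule mult_smult_assoc_mat[OF adj_mat(1)[OF corner_carrier] corner_carrier])
 also have "\<dots> = 1\<^sub>m m" unfolding adj_mat(3)[OF corner_carrier] using assms by (intro eq_matI) auto
 finally show "corner_inv a X * corner a X = 1\<^sub>m m" .
 then show "corner a X * corner_inv a X = 1\<^sub>m m"
  by (rule mat_mult_left_right_inverse[OF corner_inv_carrier corner_carrier])
qed

text \<open>In a leading row, a block lower matrix has zeros in all columns that are not leading, so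
  the sum over the full row reduces to the leading part.\<close>

lemma corner_mult:
 assumes g: "block_lower g" and X: "X : carrier_mat m m"
 shows "corner a (g * X) = corner a g * corner a X"
proof (rule eq_matI)
 fix s t assume "s < dim_row (corner a g * corner a X)" "t < dim_col (corner a g * corner a X)"
 then have st: "s < m" "t < m" by auto
 have gc: "g : carrier_mat m m" using g by (simp add: block_lower_def)
 have "(corner a g * corner a X) $$ (s, t) = (\<Sum>u<m. corner a g $$ (s, u) * corner a X $$ (u, t))"
  by (rule mult_entry[OF corner_carrier corner_carrier st])
 also have "\<dots> = corner a (g * X) $$ (s, t)"
 proof (cases "lead a s")
  case False
  then have "(\<Sum>u<m. corner a g $$ (s, u) * corner a X $$ (u, t)) = (\<Sum>u<m. if u = s then corner a X $$ (u, t) else 0)"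
  using st by (intro sum.cong refl) (auto simp: corner_def)
  then show ?thesis using False st by (simp add: corner_def)
 next
  case s: True
  show ?thesis
  proof (cases "lead a t")
  case True
  have "(\<Sum>u<m. corner a g $$ (s, u) * corner a X $$ (u, t)) = (\<Sum>u<m. g $$ (s, u) * X $$ (u, t))"
  proof (intro sum.cong refl)
  fix u assume "u : {..<m}"
  then have u: "u < m" by simp
  show "corner a g $$ (s, u) * corner a X $$ (u, t) = g $$ (s, u) * X $$ (u, t)"
  proof (cases "lead a u")
  case False
  then have "\<beta> u < \<beta> s" "u ~= s" using s by (auto simp: lead_def)
  then show ?thesis using g u st False by (auto simp: block_lower_def corner_def)
  qed (use s True u st in \<open>simp add: corner_def\<close>)
  qed
  then show ?thesis using s True st mult_entry[OF gc X st] by (simp add: corner_def)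
  next
  case False
  have "corner a g $$ (s, u) * corner a X $$ (u, t) = 0" if "u < m" for u
  using s False st that by (cases "lead a u") (auto simp: corner_def)
  then have "(\<Sum>u<m. corner a g $$ (s, u) * corner a X $$ (u, t)) = 0" by (intro sum.neutral ballI) simp
  then show ?thesis using s False st by (auto simp: corner_def)
  qed
 qed
 finally show "corner a (g * X) $$ (s, t) = (corner a g * corner a X) $$ (s, t)" by simp
qed simp_all

lemma toprows_mult:
 assumes g: "block_lower g" and X: "X : carrier_mat m m"
 shows "toprows a (g * X) = corner a g * toprows a X"
proof (rule eq_matI)
 fix s t assume "s < dim_row (corner a g * toprows a X)" "t < dim_col (corner a g * toprows a X)"
 then have st: "s < m" "t < m" using corner_carrier[of a g] toprows_carrier[of a X] by auto
 have gc: "g : carrier_mat m m" using g by (simp add: block_lower_def)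
 have "(corner a g * toprows a X) $$ (s, t) = (\<Sum>u<m. corner a g $$ (s, u) * toprows a X $$ (u, t))"
  by (rule mult_entry[OF corner_carrier toprows_carrier st])
 also have "\<dots> = toprows a (g * X) $$ (s, t)"
 proof (cases "lead a s")
  case False
  then have "(\<Sum>u<m. corner a g $$ (s, u) * toprows a X $$ (u, t)) = (\<Sum>u<m. if u = s then toprows a X $$ (u, t) else 0)"
  using st by (intro sum.cong refl) (auto simp: corner_def)
  then show ?thesis using False st by (simp add: toprows_def)
 next
  case s: True
  have "(\<Sum>u<m. corner a g $$ (s, u) * toprows a X $$ (u, t)) = (\<Sum>u<m. g $$ (s, u) * X $$ (u, t))"
  proof (intro sum.cong refl)
  fix u assume "u : {..<m}"
  then have u: "u < m" by simp
  show "corner a g $$ (s, u) * toprows a X $$ (u, t) = g $$ (s, u) * X $$ (u, t)"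
  proof (cases "lead a u")
  case False
  then have "\<beta> u < \<beta> s" "u ~= s" using s by (auto simp: lead_def)
  then show ?thesis using g u st False by (auto simp: block_lower_def corner_def)
  qed (use s u st in \<open>simp add: corner_def toprows_def\<close>)
  qed
  then show ?thesis using s st mult_entry[OF gc X st] by (simp add: toprows_def)
 qed
 finally show "toprows a (g * X) $$ (s, t) = (corner a g * toprows a X) $$ (s, t)" by simp
qed simp_all

lemma det_corner_mult:
 assumes "block_lower g" "X : carrier_mat m m"
 shows "mdet (corner a (g * X)) = mdet (corner a g) * mdet (corner a X)"
 unfolding corner_mult[OF assms] by (rule det_mult[OF corner_carrier corner_carrier])

lemma minors_mult:
 assumes "block_lower g" "X : carrier_mat m m"
 shows "minors (g * X) = minors g * minors X"
 unfolding minors_def det_corner_mult[OF assms] by (rule prod.distrib)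

text \<open>Passing from X to g X multiplies both the corner and the top rows by the corner of g,
  which cancels against the inverse. Hence \<open>uni\<close> is constant on orbits of
  \<open>stab\<close>, and a chart can be read off from it.\<close>

lemma uni_mult:
 assumes g: "block_lower g" and X: "X : carrier_mat m m" and gX: "minors (g * X) ~= 0"
 shows "uni (g * X) = uni X"
proof -
 have "corner_inv a (g * X) * toprows a (g * X) = corner_inv a X * toprows a X"
  if d: "mdet (corner a (g * X)) ~= 0" for a
 proof -
  have dX: "mdet (corner a X) ~= 0" using d det_corner_mult[OF g X, of a] by auto
  let ?G = "corner a g" and ?X = "corner a X" and ?Xi = "corner_inv a X" and ?Ii = "corner_inv a (g * X)"
  and ?T = "toprows a X"
  have G: "?G = corner a (g * X) * ?Xi"
  proof -
  have "?G = ?G * (?X * ?Xi)" unfolding corner_inv_mult(2)[OF dX] right_mult_one_mat[OF corner_carrier] ..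
  also have "\<dots> = corner a (g * X) * ?Xi" unfolding corner_mult[OF g X]
  by (simp add: assoc_mult_mat[OF corner_carrier corner_carrier corner_inv_carrier])
  finally show ?thesis .
  qed
  have "?Ii * toprows a (g * X) = ?Ii * (?G * ?T)" by (simp add: toprows_mult[OF g X])
  also have "?G * ?T = corner a (g * X) * (?Xi * ?T)"
  unfolding G by (rule assoc_mult_mat[OF corner_carrier corner_inv_carrier toprows_carrier])
  also have "?Ii * \<dots> = (?Ii * corner a (g * X)) * (?Xi * ?T)"
  by (rule assoc_mult_mat[symmetric, of _ m m _ m _ m])
  (simp_all add: mult_carrier_mat[OF corner_inv_carrier toprows_carrier])
  also have "\<dots> = ?Xi * ?T"
  unfolding corner_inv_mult(1)[OF d]
  by (rule left_mult_one_mat[OF mult_carrier_mat[OF corner_inv_carrier toprows_carrier]])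
  finally show ?thesis .
 qed
 then show ?thesis unfolding uni_def using minors_nonzero[OF gX] by (intro eq_matI) auto
qed

text \<open>In a column t with label at least \<beta> i, the matrices
  \<open>toprows (\<beta> i) X\<close> and \<open>corner (\<beta> i) X\<close> coincide, so the
  entry is one of an inverse times its matrix.\<close>

lemma uni_unipotent:
 assumes "minors X ~= 0" shows "unipotent (uni X)"
 unfolding unipotent_def
proof (intro conjI allI impI)
 fix i t assume it: "i < m" "t < m" "\<beta> i <= \<beta> t"
 let ?a = "\<beta> i"
 have d: "mdet (corner ?a X) ~= 0" by (rule minors_nonzero[OF assms it(1)])
 have "toprows ?a X $$ (s, t) = corner ?a X $$ (s, t)" if "s < m" for s
  using that it by (auto simp: toprows_def corner_def lead_def)
 then have "(corner_inv ?a X * toprows ?a X) $$ (i, t) = (corner_inv ?a X * corner ?a X) $$ (i, t)"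
  using it(1,2) by (simp add: mult_entry[OF corner_inv_carrier toprows_carrier] mult_entry[OF corner_inv_carrier corner_carrier])
 also have "\<dots> = (if i = t then 1 else 0)" using corner_inv_mult(1)[OF d] it by simp
 finally show "uni X $$ (i, t) = (if i = t then 1 else 0)" using it by (simp add: uni_def)
qed simp

lemma det_upper_unitriangular:
 assumes "A : carrier_mat m m" "!!s t. s < m ==> t <= s ==> A $$ (s, t) = (if s = t then 1 else (0::real))"
 shows "mdet A = 1"
proof -
 have "upper_triangular A" using assms by (auto simp: upper_triangular_def)
 then have "mdet A = prod_list (diag_mat A)" by (rule det_upper_triangular[OF _ assms(1)])
 also have "diag_mat A = map (%i. 1) [0..<m]"
  unfolding diag_mat_def using assms by (intro map_cong) auto
 finally show ?thesis by (simp add: map_replicate_const)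
qed

lemma unipotent_det: "unipotent M ==> mdet M = 1"
 by (rule det_upper_unitriangular) (use antimono in \<open>auto simp: unipotent_def\<close>)

lemma unipotent_minors:
 assumes "unipotent M" shows "minors M = 1"
proof -
 have "mdet (corner a M) = 1" for a
  by (rule det_upper_unitriangular) (use assms antimono in \<open>auto simp: unipotent_def corner_def\<close>)
 then show ?thesis by (simp add: minors_def)
qed

text \<open>Row i of the corner for its own label is a unit vector, so row i of the inverse corner
  is one too, and the product returns row i of M.\<close>

lemma uni_of_unipotent:
 assumes M: "unipotent M" shows "uni M = M"
proof (rule eq_matI)
 have Mc: "M : carrier_mat m m" using M by (simp add: unipotent_def)
 fix i j assume "i < dim_row M" "j < dim_col M"
 then have ij: "i < m" "j < m" using Mc by auto
 let ?a = "\<beta> i"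
 have d: "mdet (corner ?a M) ~= 0"
  using minors_nonzero[OF _ ij(1), of M] unipotent_minors[OF M] by simp
 have row: "corner ?a M $$ (i, u) = (if i = u then 1 else 0)" if "u < m" for u
  using that ij M by (auto simp: corner_def unipotent_def lead_def)
 have inv: "corner_inv ?a M $$ (i, t) = (if i = t then 1 else 0)" if t: "t < m" for t
 proof -
  have "(corner ?a M * corner_inv ?a M) $$ (i, t) = (\<Sum>u<m. (if i = u then 1 else 0) * corner_inv ?a M $$ (u, t))"
  by (simp add: mult_entry[OF corner_carrier corner_inv_carrier ij(1) t] row)
  also have "\<dots> = corner_inv ?a M $$ (i, t)" using ij by (simp add: if_distrib[of "%x. x * _"] cong: if_cong)
  finally show ?thesis using corner_inv_mult(2)[OF d] ij t by simp
 qed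
 have "(corner_inv ?a M * toprows ?a M) $$ (i, j) = (\<Sum>u<m. (if i = u then 1 else 0) * toprows ?a M $$ (u, j))"
  by (simp add: mult_entry[OF corner_inv_carrier toprows_carrier ij] inv)
 also have "\<dots> = toprows ?a M $$ (i, j)" using ij by (simp add: if_distrib[of "%x. x * _"] cong: if_cong)
 also have "\<dots> = M $$ (i, j)" using ij M by (auto simp: toprows_def lead_def unipotent_def)
 finally show "uni M $$ (i, j) = M $$ (i, j)" using ij by (simp add: uni_def)
qed (use M in \<open>auto simp: unipotent_def uni_def\<close>)

text \<open>Orthogonality of X serves the bottom block: there the rows of \<open>uni X\<close> are
  unit vectors, and X' X = 1 writes a unit vector as a combination of the rows of X.\<close>

lemma uni_factor:
 assumes X: "X : orth_mats m" and d: "minors X ~= 0"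
 obtains g where "block_lower g" "uni X = g * X"
proof
 \<comment> \<open>Above the bottom block, the rows of the inverse corner, cut off to the leading
   columns, where alone they are nonzero; in the bottom block, the columns of X. The latter may be
   arbitrary, as block lower matrices are unrestricted there.\<close>
 let ?g = "Matrix.mat m m (%(i, s). if 0 < \<beta> i then (if lead (\<beta> i) s then corner_inv (\<beta> i) X $$ (i, s) else 0) else X $$ (s, i))"
 have Xc: "X : carrier_mat m m" using X by (rule orth_matsD)
 show "block_lower ?g" by (auto simp: block_lower_def lead_def)
 show "uni X = ?g * X"
 proof (rule eq_matI)
  fix i j assume "i < dim_row (?g * X)" "j < dim_col (?g * X)"
  then have ij: "i < m" "j < m" using Xc by auto
  let ?a = "\<beta> i"
  have gX: "(?g * X) $$ (i, j) = (\<Sum>s<m. ?g $$ (i, s) * X $$ (s, j))"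
  by (rule mult_entry[OF _ Xc ij]) simp
  have uX: "uni X $$ (i, j) = (\<Sum>s<m. corner_inv ?a X $$ (i, s) * toprows ?a X $$ (s, j))"
  using ij by (simp add: uni_def mult_entry[OF corner_inv_carrier toprows_carrier ij])
  show "uni X $$ (i, j) = (?g * X) $$ (i, j)"
  proof (cases "0 < ?a")
  case True
  have D: "mdet (corner ?a X) ~= 0" by (rule minors_nonzero[OF d ij(1)])
  have z: "corner_inv ?a X $$ (i, s) = 0" if s: "s < m" "\<not> lead ?a s" for s
  proof -
  have "i ~= s" using s True by (auto simp: lead_def)
  have "(corner_inv ?a X * corner ?a X) $$ (i, s) = (\<Sum>u<m. corner_inv ?a X $$ (i, u) * (if u = s then 1 else 0))"
  unfolding mult_entry[OF corner_inv_carrier corner_carrier ij(1) s(1)]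
  using s by (intro sum.cong refl) (auto simp: corner_def)
  also have "\<dots> = corner_inv ?a X $$ (i, s)" using s by (simp add: if_distrib[of "%x. _ * x"] cong: if_cong)
  finally show ?thesis using corner_inv_mult(1)[OF D] ij s \<open>i ~= s\<close> by simp
  qed
  have "corner_inv ?a X $$ (i, s) * toprows ?a X $$ (s, j) = ?g $$ (i, s) * X $$ (s, j)" if "s < m" for s
  using z[OF that] ij that True by (cases "lead ?a s") (auto simp: toprows_def)
  then show ?thesis unfolding gX uX by simp
  next
  case False
  have "corner_inv ?a X $$ (i, s) * toprows ?a X $$ (s, j) = (if s = j then corner_inv ?a X $$ (i, s) else 0)" if "s < m" for s
  using False that ij by (auto simp: toprows_def lead_def)
  then have 1: "uni X $$ (i, j) = corner_inv ?a X $$ (i, j)" unfolding uX using ij by simp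
  have "corner ?a X = 1\<^sub>m m" using False by (intro eq_matI) (auto simp: corner_def lead_def)
  then have 2: "corner_inv ?a X = 1\<^sub>m m"
  using corner_inv_mult(1)[OF minors_nonzero[OF d ij(1)]] right_mult_one_mat[OF corner_inv_carrier] by simp
  have "(\<Sum>s<m. X $$ (s, i) * X $$ (s, j)) = (tr_mat X * X) $$ (i, j)"
  using ij Xc by (subst mult_entry[of _ m m _ m]) auto
  then have "(?g * X) $$ (i, j) = 1\<^sub>m m $$ (i, j)"
  unfolding gX using False ij orth_mats_transpose_mult[OF X] by simp
  then show ?thesis using 1 2 by simp
  qed
 qed (use Xc in \<open>auto simp: uni_def\<close>)
qed

section \<open>Block triangular and block diagonal orthogonal matrices\<close>

lemma block_lower_mult:
 assumes "block_lower g" "block_lower h" shows "block_lower (g * h)"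
 unfolding block_lower_def
proof (intro conjI allI impI)
 have c: "g : carrier_mat m m" "h : carrier_mat m m" using assms by (simp_all add: block_lower_def)
 then show "g * h : carrier_mat m m" by simp
 fix s t assume st: "s < m" "t < m" "\<beta> t < \<beta> s"
 have "g $$ (s, u) * h $$ (u, t) = 0" if "u < m" for u
  using assms st that by (cases "\<beta> u < \<beta> s") (auto simp: block_lower_def)
 then show "(g * h) $$ (s, t) = 0" unfolding mult_entry[OF c st(1,2)] by (intro sum.neutral ballI) simp
qed

lemma triangular_block_lower:
 assumes "R : carrier_mat m m" "!!i l. i < l ==> l < m ==> R $$ (i, l) = 0"
 shows "block_lower R"
 unfolding block_lower_def
proof (intro conjI allI impI)
 fix s t assume "s < m" "t < m" "\<beta> t < \<beta> s"
 then have "s < t" using antimono[of t s] by (cases "s < t") auto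
 then show "R $$ (s, t) = 0" using assms(2) \<open>t < m\<close> by blast
qed (rule assms)

text \<open>An orthogonal block triangular matrix is block diagonal: the sum of the squared entries of the rows in
  the leading blocks equals that of the columns in the leading blocks.\<close>

lemma orth_block_lower_stab:
 assumes g: "g : orth_mats m" "block_lower g"
 shows "g : stab"
proof -
 have gc: "g : carrier_mat m m" using g(1) by (rule orth_matsD)
 have z: "g $$ (s, t) = 0" if st: "s < m" "t < m" "\<beta> s < \<beta> t" for s t
 proof -
  define L where "L = {u. u < m & \<beta> t <= \<beta> u}"
  have fin: "finite L" "L \<subseteq> {..<m}" by (auto simp: L_def)
  have rows: "(\<Sum>v<m. g $$ (u, v) * g $$ (u, v)) = 1" if "u < m" for u
  using g(1) that orth_mats_iff_rows[OF gc] by simp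
  have cols: "(\<Sum>u<m. g $$ (u, v) * g $$ (u, v)) = 1" if "v < m" for v
  proof -
  have "(tr_mat g * g) $$ (v, v) = (\<Sum>u<m. g $$ (u, v) * g $$ (u, v))"
  using gc that by (subst mult_entry[of _ m m _ m]) auto
  then show ?thesis using orth_mats_transpose_mult[OF g(1)] that by simp
  qed
  have "(\<Sum>u\<in>L. \<Sum>v<m. g $$ (u, v) * g $$ (u, v)) = (\<Sum>u\<in>L. \<Sum>v\<in>L. g $$ (u, v) * g $$ (u, v))"
  proof (rule sum.cong[OF refl])
  fix u assume u: "u : L"
  have "\<forall>v\<in>{..<m} - L. g $$ (u, v) * g $$ (u, v) = 0"
  proof
  fix v assume "v : {..<m} - L"
  then have "v < m" "u < m" "\<beta> v < \<beta> u" using u by (auto simp: L_def)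
  then show "g $$ (u, v) * g $$ (u, v) = 0" using g(2) by (simp add: block_lower_def)
  qed
  then show "(\<Sum>v<m. g $$ (u, v) * g $$ (u, v)) = (\<Sum>v\<in>L. g $$ (u, v) * g $$ (u, v))"
  by (rule sum.mono_neutral_right[OF finite_lessThan fin(2)])
  qed
  then have 1: "(\<Sum>u\<in>L. \<Sum>v\<in>L. g $$ (u, v) * g $$ (u, v)) = real (card L)"
  using rows by (simp add: L_def)
  have "(\<Sum>v\<in>L. \<Sum>u<m. g $$ (u, v) * g $$ (u, v))
  = (\<Sum>v\<in>L. (\<Sum>u\<in>L. g $$ (u, v) * g $$ (u, v)) + (\<Sum>u\<in>{..<m} - L. g $$ (u, v) * g $$ (u, v)))"
  using sum.subset_diff[OF fin(2) finite_lessThan] by (intro sum.cong refl) (simp add: add.commute)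
  then have 2: "real (card L) = (\<Sum>v\<in>L. \<Sum>u\<in>L. g $$ (u, v) * g $$ (u, v))
  + (\<Sum>v\<in>L. \<Sum>u\<in>{..<m} - L. g $$ (u, v) * g $$ (u, v))"
  using cols by (simp add: L_def sum.distrib)
  have "(\<Sum>v\<in>L. \<Sum>u\<in>L. g $$ (u, v) * g $$ (u, v)) = real (card L)" using 1 by (subst sum.swap)
  then have "(\<Sum>v\<in>L. \<Sum>u\<in>{..<m} - L. g $$ (u, v) * g $$ (u, v)) = 0" using 2 by simp
  then have "\<forall>v\<in>L. (\<Sum>u\<in>{..<m} - L. g $$ (u, v) * g $$ (u, v)) = 0"
  by (subst (asm) sum_nonneg_eq_0_iff[OF fin(1)]) (auto intro: sum_nonneg)
  then have "(\<Sum>u\<in>{..<m} - L. g $$ (u, t) * g $$ (u, t)) = 0" using st by (simp add: L_def)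
  then have "\<forall>u\<in>{..<m} - L. g $$ (u, t) * g $$ (u, t) = 0"
  by (subst (asm) sum_nonneg_eq_0_iff) auto
  then show ?thesis using st by (auto simp: L_def)
 qed
 have "g $$ (s, t) = 0" if "s < m" "t < m" "\<beta> s ~= \<beta> t" for s t
  using that z g(2) by (cases "\<beta> s < \<beta> t") (auto simp: block_lower_def)
 then show ?thesis using g(1) by (simp add: stab_def)
qed

lemma stab_block_lower: "h : stab ==> block_lower h"
 by (auto simp: stab_def block_lower_def orth_mats_def)

lemma stab_orth: "h : stab ==> h : orth_mats m"
 by (simp add: stab_def)

lemma orth_mats_mult:
 assumes "A : orth_mats n" "B : orth_mats n" shows "A * B : orth_mats n"
proof -
 have c: "A : carrier_mat n n" "B : carrier_mat n n" using assms by (simp_all add: orth_mats_def)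
 have "(A * B) * tr_mat (A * B) = A * (B * tr_mat B) * tr_mat A"
  using c by (simp add: transpose_mult[OF c] assoc_mult_mat[of _ n n _ n _ n])
 also have "\<dots> = 1\<^sub>m n" using assms c by (simp add: orth_mats_def)
 finally show ?thesis using c by (simp add: orth_mats_def)
qed

lemma orth_mats_transpose: "A : orth_mats n ==> tr_mat A : orth_mats n"
 using orth_mats_transpose_mult[of A n] by (simp add: orth_mats_def)

lemma orth_mats_one: "1\<^sub>m n : orth_mats n"
 by (simp add: orth_mats_def)

lemma stab_one: "1\<^sub>m m : stab" using orth_mats_one by (auto simp: stab_def)

lemma stab_mult: "g : stab ==> h : stab ==> g * h : stab"
 by (rule orth_block_lower_stab[OF orth_mats_mult[OF stab_orth stab_orth] block_lower_mult[OF stab_block_lower stab_block_lower]])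

lemma stab_transpose: "h : stab ==> tr_mat h : stab"
 using orth_mats_transpose by (auto simp: stab_def orth_mats_def)

text \<open>\<open>minors\<close> is multiplicative on block lower matrices, and both h and its
  transpose are such, with product 1.\<close>

lemma stab_minors:
 assumes h: "h : stab" shows "minors h ~= 0"
proof -
 have hc: "tr_mat h : carrier_mat m m" using orth_matsD(1)[OF stab_orth[OF h]] by simp
 have "h * tr_mat h = 1\<^sub>m m" using orth_matsD(2)[OF stab_orth[OF h]] .
 then have "minors h * minors (tr_mat h) = minors (1\<^sub>m m)"
  using minors_mult[OF stab_block_lower[OF h] hc] by simp
 moreover have "minors (1\<^sub>m m) = 1" by (rule unipotent_minors) (auto simp: unipotent_def)
 ultimately show ?thesis by auto
qed

text \<open>With \<open>uni X = g * X\<close> and Gram-Schmidt acting as a lower triangular R, the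
  result is (R g) X. The factor R g is block lower, and orthogonal as a quotient of orthogonal
  matrices, hence block diagonal: orthonormalizing the unipotent factor stays in the orbit of
  X.\<close>

lemma gs_mat_uni:
 assumes X: "X : orth_mats m" and d: "minors X ~= 0"
 obtains h where "h : stab" "gs_mat m (uni X) = h * X"
proof -
 have U: "unipotent (uni X)" by (rule uni_unipotent[OF d])
 have dU: "mdet (uni X) ~= 0" using unipotent_det[OF U] by simp
 obtain R where R: "R : carrier_mat m m" "!!i l. i < l ==> l < m ==> R $$ (i, l) = 0"
  "!!i. i < m ==> R $$ (i, i) > 0" "gs_mat m (uni X) = R * uni X"
  by (rule gs_mat_triangular[OF uni_carrier dU]) (rule that)
 obtain g where g: "block_lower g" "uni X = g * X" by (rule uni_factor[OF X d])
 have c: "g : carrier_mat m m" "X : carrier_mat m m" using g X by (simp_all add: block_lower_def orth_mats_def)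
 have "gs_mat m (uni X) = R * (g * X)" using R(4) g(2) by simp
 then have eq: "gs_mat m (uni X) = (R * g) * X" using R(1) c by (simp add: assoc_mult_mat[of _ m m _ m _ m])
 have "(R * g) = gs_mat m (uni X) * tr_mat X"
  unfolding eq using X c R(1) by (simp add: assoc_mult_mat[of _ m m _ m _ m] orth_mats_def)
 then have "R * g : orth_mats m"
  using orth_mats_mult[OF gs_mat_orth[OF uni_carrier dU] orth_mats_transpose[OF X]] by simp
 then have "R * g : stab"
  using block_lower_mult[OF triangular_block_lower[OF R(1,2)] g(1)] by (intro orth_block_lower_stab)
 with eq that show thesis by blast
qed

text \<open>The triangular factor of Gram-Schmidt is block lower with positive diagonal, so it
  neither destroys the minors nor changes \<open>uni\<close>; the unipotent matrix is recovered from
  its orthonormalization. This makes the chart surjective.\<close>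

lemma uni_gs_mat:
 assumes M: "unipotent M"
 shows "gs_mat m M : orth_mats m" "minors (gs_mat m M) ~= 0" "uni (gs_mat m M) = M"
proof -
 have Mc: "M : carrier_mat m m" using M by (simp add: unipotent_def)
 have dM: "mdet M ~= 0" using unipotent_det[OF M] by simp
 show "gs_mat m M : orth_mats m" by (rule gs_mat_orth[OF Mc dM])
 obtain R where R: "R : carrier_mat m m" "!!i l. i < l ==> l < m ==> R $$ (i, l) = 0"
  "!!i. i < m ==> R $$ (i, i) > 0" "gs_mat m M = R * M"
  by (rule gs_mat_triangular[OF Mc dM]) (rule that)
 have bl: "block_lower R" by (rule triangular_block_lower[OF R(1,2)])
 have "mdet (corner a R) ~= 0" for a
 proof (rule det_lower_triangular_nonzero[OF corner_carrier])
  show "corner a R $$ (i, l) = 0" if "i < l" "l < m" for i l using that R(2) by (simp add: corner_def)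
  show "corner a R $$ (i, i) ~= 0" if "i < m" for i using that R(3)[OF that] by (simp add: corner_def)
 qed
 then have "minors R ~= 0" by (simp add: minors_def)
 then show mn: "minors (gs_mat m M) ~= 0"
  unfolding R(4) minors_mult[OF bl Mc] using unipotent_minors[OF M] by simp
 show "uni (gs_mat m M) = M"
  using uni_mult[OF bl Mc] mn uni_of_unipotent[OF M] unfolding R(4) by simp
qed

lemma uni_cong_toprows:
 assumes "!!i j. i < m ==> j < m ==> 0 < \<beta> i ==> X $$ (i, j) = X' $$ (i, j)"
 shows "uni X = uni X'" "minors X = minors X'"
proof -
 have c: "corner a X = corner a X'" for a
  using assms by (intro eq_matI) (auto simp: corner_def lead_def)
 have t: "toprows a X = toprows a X'" for a
  using assms by (intro eq_matI) (auto simp: toprows_def lead_def)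
 show "minors X = minors X'" by (simp add: minors_def c)
 show "uni X = uni X'" by (simp add: uni_def corner_inv_def c t)
qed

section \<open>Local sections of the flag manifold\<close>

text \<open>O0 is translated to the identity, the unipotent factor of the translate is
  orthonormalized, and the result is translated back. \<open>sdom\<close> describes the open cell on
  which the unipotent factor exists.\<close>

definition sect :: "real mat => real mat => real mat" where
 "sect O0 Om = gs_mat m (uni (Om * tr_mat O0)) * O0"

definition sdom :: "real mat => real mat => bool" where
 "sdom O0 Om \<longleftrightarrow> minors (Om * tr_mat O0) ~= 0"

lemma sect_orth: "O0 : orth_mats m ==> sdom O0 Om ==> sect O0 Om : orth_mats m"
 unfolding sect_def sdom_def by (intro orth_mats_mult uni_gs_mat(1) uni_unipotent)

lemma sect_in_orbit:
 assumes O0: "O0 : orth_mats m" and Om: "Om : orth_mats m" and d: "sdom O0 Om"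
 obtains h where "h : stab" "sect O0 Om = h * Om"
proof -
 have X: "Om * tr_mat O0 : orth_mats m" by (intro orth_mats_mult orth_mats_transpose O0 Om)
 obtain h where h: "h : stab" "gs_mat m (uni (Om * tr_mat O0)) = h * (Om * tr_mat O0)"
  using gs_mat_uni[OF X] d by (auto simp: sdom_def)
 have c: "h : carrier_mat m m" "Om : carrier_mat m m" "O0 : carrier_mat m m"
  using stab_orth[OF h(1)] O0 Om by (simp_all add: orth_mats_def)
 have "sect O0 Om = h * Om * (tr_mat O0 * O0)"
  unfolding sect_def h(2) using c by (simp add: assoc_mult_mat[of _ m m _ m _ m])
 also have "\<dots> = h * Om" using orth_mats_transpose_mult[OF O0] c by simp
 finally show thesis using h(1) that by blast
qed

text \<open>Both the domain and the value depend only on the orbit, because \<open>uni\<close> is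
  unchanged under block lower factors. So \<open>sect O0\<close> is a section over the part of the
  flag manifold where it is defined.\<close>

lemma sect_stab:
 assumes O0: "O0 : orth_mats m" and Om: "Om : orth_mats m" and h: "h : stab"
 shows "sdom O0 (h * Om) \<longleftrightarrow> sdom O0 Om" "sdom O0 Om ==> sect O0 (h * Om) = sect O0 Om"
proof -
 have c: "h : carrier_mat m m" "Om : carrier_mat m m" "O0 : carrier_mat m m"
  using stab_orth[OF h] O0 Om by (simp_all add: orth_mats_def)
 have eq: "h * Om * tr_mat O0 = h * (Om * tr_mat O0)" using c by (simp add: assoc_mult_mat[of _ m m _ m _ m])
 have Xc: "Om * tr_mat O0 : carrier_mat m m" using c by simp
 have mm: "minors (h * (Om * tr_mat O0)) = minors h * minors (Om * tr_mat O0)"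
  by (rule minors_mult[OF stab_block_lower[OF h] Xc])
 show s: "sdom O0 (h * Om) \<longleftrightarrow> sdom O0 Om" unfolding sdom_def eq mm using stab_minors[OF h] by simp
 show "sect O0 (h * Om) = sect O0 Om" if "sdom O0 Om"
 proof -
  have "minors (h * (Om * tr_mat O0)) ~= 0" using that s unfolding sdom_def eq by simp
  then show ?thesis unfolding sect_def eq by (simp add: uni_mult[OF stab_block_lower[OF h] Xc])
 qed
qed

text \<open>Only rows with positive label are read. Therefore the section can be applied to
  \<open>top G\<close>, which has zeros in place of the rows that G does not determine.\<close>

lemma sect_cong:
 assumes A: "A : carrier_mat m m" and B: "B : carrier_mat m m" and O0: "O0 : carrier_mat m m"
  and eq: "!!i j. i < m ==> j < m ==> 0 < \<beta> i ==> A $$ (i, j) = B $$ (i, j)"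
 shows "sect O0 A = sect O0 B" "sdom O0 A \<longleftrightarrow> sdom O0 B"
proof -
 have e: "(A * tr_mat O0) $$ (i, j) = (B * tr_mat O0) $$ (i, j)" if "i < m" "j < m" "0 < \<beta> i" for i j
  using that eq by (simp add: mult_transpose_entry[OF A O0] mult_transpose_entry[OF B O0])
 show "sect O0 A = sect O0 B" "sdom O0 A \<longleftrightarrow> sdom O0 B"
  unfolding sect_def sdom_def using uni_cong_toprows[of "A * tr_mat O0" "B * tr_mat O0"] e by simp_all
qed

text \<open>The image of the section consists of the matrices obtained from unipotent ones; they are
  its fixed points, with the given matrix as coordinate.\<close>

lemma sect_unipotent:
 assumes O0: "O0 : orth_mats m" and M: "unipotent M"
 defines "Om \<equiv> gs_mat m M * O0"
 shows "Om : orth_mats m" "sdom O0 Om" "uni (Om * tr_mat O0) = M" "sect O0 Om = Om"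
proof -
 have c: "gs_mat m M : carrier_mat m m" "O0 : carrier_mat m m"
  using uni_gs_mat(1)[OF M] O0 by (simp_all add: orth_mats_def)
 have eq: "Om * tr_mat O0 = gs_mat m M"
  unfolding Om_def using c orth_matsD(2)[OF O0] by (simp add: assoc_mult_mat[of _ m m _ m _ m])
 show "Om : orth_mats m" unfolding Om_def by (intro orth_mats_mult uni_gs_mat(1) M O0)
 show "sdom O0 Om" unfolding sdom_def eq by (rule uni_gs_mat(2)[OF M])
 show u: "uni (Om * tr_mat O0) = M" unfolding eq by (rule uni_gs_mat(3)[OF M])
 show "sect O0 Om = Om" unfolding sect_def u by (simp add: Om_def)
qed

lemma sect_idem:
 assumes O0: "O0 : orth_mats m" and d: "sdom O0 Om"
 shows "sdom O0 (sect O0 Om)" "sect O0 (sect O0 Om) = sect O0 Om"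
 using sect_unipotent(2,4)[OF O0 uni_unipotent] d unfolding sect_def sdom_def by simp_all

lemma sdom_self:
 assumes "O0 : orth_mats m" shows "sdom O0 O0"
proof -
 have "unipotent (1\<^sub>m m)" by (auto simp: unipotent_def)
 then show ?thesis unfolding sdom_def orth_matsD(2)[OF assms] using unipotent_minors by simp
qed

section \<open>Smooth dependence of the local section\<close>

context
 fixes X :: "'a smooth_space" and W :: "'a set" and f :: "'a => real mat"
 assumes X: "smooth_sheaf X" and W: "openin (top_of X) W" and f: "smooth_mat X W m m f"
begin

lemma smooth_corner: "smooth_mat X W m m (%x. corner a (f x))"
 unfolding corner_def
proof (rule smooth_mat_mat[OF X W])
 fix s t assume "s < m" "t < m"
 then show "(%x. if lead a s & lead a t then f x $$ (s, t) else if s = t then 1 else 0) : smooth_funs X W"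
  using smooth_mat_entry[OF f] smooth_const[OF X W]
  by (cases "lead a s"; cases "lead a t"; cases "s = t") simp_all
qed

lemma smooth_toprows: "smooth_mat X W m m (%x. toprows a (f x))"
 unfolding toprows_def
proof (rule smooth_mat_mat[OF X W])
 fix s t assume "s < m" "t < m"
 then show "(%x. if lead a s then f x $$ (s, t) else if s = t then 1 else 0) : smooth_funs X W"
  using smooth_mat_entry[OF f] smooth_const[OF X W] by (cases "lead a s"; cases "s = t") simp_all
qed

lemma smooth_minors: "(%x. minors (f x)) : smooth_funs X W"
 unfolding minors_def by (intro smooth_prod[OF X W] smooth_det[OF X W smooth_corner])

lemma smooth_uni:
 assumes d: "!!x. x : W ==> minors (f x) ~= 0"
 shows "smooth_mat X W m m (%x. uni (f x))"
 unfolding uni_def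
proof (rule smooth_mat_mat[OF X W])
 fix i j assume ij: "i < m" "j < m"
 have D: "mdet (corner (\<beta> i) (f x)) ~= 0" if "x : W" for x
  using minors_nonzero[OF d[OF that] ij(1)] .
 have inv: "smooth_mat X W m m (%x. corner_inv (\<beta> i) (f x))"
 proof (rule smooth_matI)
  fix s t assume st: "s < m" "t < m"
  have "(%x. 1 / mdet (corner (\<beta> i) (f x)) * adj_mat (corner (\<beta> i) (f x)) $$ (s, t)) : smooth_funs X W"
  by (rule smooth_mult[OF X W smooth_divide[OF X W smooth_const[OF X W] smooth_det[OF X W smooth_corner] D]
  smooth_mat_entry[OF smooth_adj_mat[OF X W smooth_corner] st]])
  then show "(%x. corner_inv (\<beta> i) (f x) $$ (s, t)) : smooth_funs X W"
  by (rule smooth_funs_cong[OF X _ W])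
  (use st carrier_matD[OF adj_mat(1)[OF corner_carrier]] in \<open>simp add: corner_inv_def\<close>)
 qed simp
 show "(%x. (corner_inv (\<beta> i) (f x) * toprows (\<beta> i) (f x)) $$ (i, j)) : smooth_funs X W"
  by (rule smooth_mat_entry[OF smooth_mat_mult[OF X W inv smooth_toprows] ij])
qed

end

lemma smooth_sect:
 assumes X: "smooth_sheaf X" and W: "openin (top_of X) W" and f: "smooth_mat X W m m f"
  and O0: "O0 : orth_mats m" and d: "!!x. x : W ==> sdom O0 (f x)"
 shows "smooth_mat X W m m (%x. sect O0 (f x))"
proof -
 have c: "O0 : carrier_mat m m" using O0 by (rule orth_matsD)
 have g: "smooth_mat X W m m (%x. f x * tr_mat O0)"
  by (rule smooth_mat_mult[OF X W f smooth_mat_const[OF X W]]) (use c in simp)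
 have u: "smooth_mat X W m m (%x. uni (f x * tr_mat O0))"
  by (rule smooth_uni[OF X W g]) (use d in \<open>simp add: sdom_def\<close>)
 have "smooth_mat X W m m (%x. gs_mat m (uni (f x * tr_mat O0)))"
  by (rule smooth_gs_mat[OF X W u])
  (use d unipotent_det[OF uni_unipotent] in \<open>simp add: sdom_def\<close>)
 then show ?thesis unfolding sect_def
  by (rule smooth_mat_mult[OF X W _ smooth_mat_const[OF X W c]])
qed

end

section \<open>The flag manifold\<close>

lemma smooth_map_descend:
 assumes X: "smooth_sheaf X" and U: "openin (top_of (quotient_space X q)) U"
  and \<Phi>: "smooth_map (open_subspace X {x : pts X. q x : U}) Y \<Phi>"
  and inv: "!!x y. x : pts X ==> y : pts X ==> q x : U ==> q x = q y ==> \<Phi> x = \<Phi> y"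
 obtains \<phi> where "smooth_map (open_subspace (quotient_space X q) U) Y \<phi>"
  "!!x. x : pts X ==> q x : U ==> \<phi> (q x) = \<Phi> x"
proof
 define \<phi> where "\<phi> y = \<Phi> (SOME x. x : pts X & q x = y)" for y
 show \<phi>: "\<phi> (q x) = \<Phi> x" if "x : pts X" "q x : U" for x
 proof -
  have "\<exists>z. z : pts X & q z = q x" using that by blast
  then have "(SOME z. z : pts X & q z = q x) : pts X & q (SOME z. z : pts X & q z = q x) = q x"
  by (rule someI_ex)
  then show ?thesis unfolding \<phi>_def using inv[OF that(1), of "SOME z. z : pts X & q z = q x"] that by simp
 qed
 have P: "openin (top_of X) {x : pts X. q x : U}" using U by (simp add: topology_quotient_space)
 show "smooth_map (open_subspace (quotient_space X q) U) Y \<phi>"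
  by (rule smooth_map_from_quotient[OF X U smooth_map_cong[OF smooth_sheaf_open_subspace[OF X P] \<Phi>]])
  (simp add: \<phi>)
qed

text \<open>Stated for a group H of square matrices acting on rectangular ones, because it serves
  the flags, the classes of normal forms and the cosets of the orthogonal group of the last rows
  alike.\<close>

lemma left_orbit_eq_iff:
 assumes one: "1\<^sub>m n : H" and mult: "!!g h. g : H ==> h : H ==> g * h : H"
  and inv: "!!h. h : H ==> h' h : H & h' h * h = 1\<^sub>m n"
  and H: "H \<subseteq> carrier_mat n n" and A: "A : carrier_mat n c" and B: "B : carrier_mat n c"
 shows "left_orbit H A = left_orbit H B \<longleftrightarrow> (\<exists>h\<in>H. B = h * A)"
proof
 assume "left_orbit H A = left_orbit H B"
 moreover have "B : left_orbit H B" unfolding left_orbit_def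
  by (intro CollectI exI[of _ "1\<^sub>m n"] conjI) (simp_all add: one left_mult_one_mat[OF B])
 ultimately show "\<exists>h\<in>H. B = h * A" by (auto simp: left_orbit_def)
next
 assume "\<exists>h\<in>H. B = h * A"
 then obtain h where h: "h : H" "B = h * A" by blast
 have hc: "h' h : carrier_mat n n" "h : carrier_mat n n" using inv[OF h(1)] H h(1) by blast+
 have "h' h * B = (h' h * h) * A" unfolding h(2) by (rule assoc_mult_mat[OF hc A, symmetric])
 also have "\<dots> = A" using inv[OF h(1)] left_mult_one_mat[OF A] by simp
 finally have "A = h' h * B" by simp
 have sub: "left_orbit H X \<subseteq> left_orbit H Y" if k: "k : H" "X = k * Y" "Y : carrier_mat n c" for X Y k
 proof
  fix Z assume "Z : left_orbit H X"
  then obtain g where g: "g : H" "Z = g * X" unfolding left_orbit_def by blast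
  have c: "g : carrier_mat n n" "k : carrier_mat n n" using g k H by blast+
  have "Z = (g * k) * Y" unfolding g(2) k(2) by (rule assoc_mult_mat[OF c k(3), symmetric])
  then show "Z : left_orbit H Y" unfolding left_orbit_def using mult[OF g(1) k(1)] by blast
 qed
 show "left_orbit H A = left_orbit H B"
  using sub[OF h(1,2) A] sub[of "h' h" A B] inv[OF h(1)] \<open>A = h' h * B\<close> B by blast
qed

section \<open>The quotient of O(m) by the block diagonal orthogonal matrices\<close>

context block_index
begin

definition OX :: "real mat smooth_space" where
 "OX = coordinate_space (orth_mats m) (mat_entries m m)"

definition FX :: "real mat set smooth_space" where
 "FX = quotient_space OX (left_orbit stab)"

lemma pts_OX [simp]: "pts OX = orth_mats m" by (simp add: OX_def)
lemma pts_FX [simp]: "pts FX = left_orbit stab ` orth_mats m" by (simp add: FX_def)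
lemma sheaf_OX: "smooth_sheaf OX" unfolding OX_def by (rule smooth_sheaf_coordinate_space)
lemma sheaf_FX: "smooth_sheaf FX" unfolding FX_def by (rule smooth_sheaf_quotient_space[OF sheaf_OX])

lemma smooth_mat_OX: "openin (top_of OX) W ==> smooth_mat OX W m m (%A. A)"
 unfolding OX_def by (rule smooth_mat_coordinate) (auto simp: orth_mats_def)

lemma stab_orbit_eq:
 assumes "A : orth_mats m" "B : orth_mats m"
 shows "left_orbit stab A = left_orbit stab B \<longleftrightarrow> (\<exists>h\<in>stab. B = h * A)"
 by (rule left_orbit_eq_iff[where h' = tr_mat and c = m])
  (use assms stab_one stab_mult stab_transpose orth_mats_transpose_mult[OF stab_orth] in \<open>auto simp: orth_mats_def stab_def\<close>)

lemma stab_orbit_mult: "A : orth_mats m ==> h : stab ==> left_orbit stab (h * A) = left_orbit stab A"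
 using stab_orbit_eq[of A "h * A"] orth_mats_mult[OF stab_orth] by metis

lemma smooth_map_left_mult:
 assumes h: "h : orth_mats m" shows "smooth_map OX OX (%A. h * A)"
proof -
 have "smooth_mat OX (pts OX) m m (%A. h * A)"
  by (rule smooth_mat_mult[OF sheaf_OX openin_topspace smooth_mat_const[OF sheaf_OX openin_topspace]
  smooth_mat_OX[OF openin_topspace]]) (rule orth_matsD[OF h])
 then have "smooth_map OX (coordinate_space (orth_mats m) (mat_entries m m)) (%A. h * A)"
  by (rule smooth_map_into_matrices[OF sheaf_OX]) (simp add: orth_mats_mult[OF h])
 then show ?thesis by (simp add: OX_def)
qed

lemma second_countable_FX: "second_countable (top_of FX)"
 unfolding FX_def
proof (rule second_countable_quotient_space)
 show "second_countable (top_of OX)"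
  unfolding OX_def by (rule second_countable_coordinate_space[OF finite_mat_entries])
 fix U assume U: "openin (top_of OX) U"
 show "openin (top_of OX) {x : pts OX. left_orbit stab x : left_orbit stab ` U}"
 proof (rule openin_saturation[of "(%h A. h * A) ` stab" OX])
  fix a assume "a : (%h A. h * A) ` stab"
  then obtain h where "h : stab" "a = (%A. h * A)" by blast
  then show "continuous_map (top_of OX) (top_of OX) a"
  using smooth_map_continuous[OF smooth_map_left_mult[OF stab_orth]] by simp
 next
  fix x y assume "x : pts OX" "y : pts OX"
  then show "left_orbit stab x = left_orbit stab y \<longleftrightarrow> (\<exists>a\<in>(%h A. h * A) ` stab. y = a x)"
  using stab_orbit_eq[of x y] by simp
 qed (rule U)
qed

definition blockdiag :: "nat => real mat" where
 "blockdiag r = Matrix.mat m m (%(i, j). if i = j & \<beta> i = r then 1 else 0)"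

lemma blockdiag_mult:
 assumes "h : carrier_mat m m" "i < m" "j < m"
 shows "(blockdiag r * h) $$ (i, j) = (if \<beta> i = r then h $$ (i, j) else 0)"
  "(h * blockdiag r) $$ (i, j) = (if \<beta> j = r then h $$ (i, j) else 0)"
proof -
 have c: "blockdiag r : carrier_mat m m" by (simp add: blockdiag_def)
 have "(blockdiag r * h) $$ (i, j) = (\<Sum>s<m. if s = i then (if \<beta> i = r then h $$ (i, j) else 0) else 0)"
  unfolding mult_entry[OF c assms] using assms by (intro sum.cong refl) (auto simp: blockdiag_def)
 then show "(blockdiag r * h) $$ (i, j) = (if \<beta> i = r then h $$ (i, j) else 0)" using assms by simp
 have "(h * blockdiag r) $$ (i, j) = (\<Sum>s<m. if s = j then (if \<beta> j = r then h $$ (i, j) else 0) else 0)"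
  unfolding mult_entry[OF assms(1) c assms(2,3)] using assms by (intro sum.cong refl) (auto simp: blockdiag_def)
 then show "(h * blockdiag r) $$ (i, j) = (if \<beta> j = r then h $$ (i, j) else 0)" using assms by simp
qed

text \<open>A matrix commuting with the coordinate projections of all blocks has no entries between
  different blocks. This turns the separation of orbits into matrix algebra.\<close>

lemma stab_iff_commute:
 assumes h: "h : orth_mats m"
 shows "h : stab \<longleftrightarrow> (\<forall>r. blockdiag r * h = h * blockdiag r)"
proof
 have c: "h : carrier_mat m m" "blockdiag r : carrier_mat m m" for r
  using h by (simp_all add: orth_mats_def blockdiag_def)
 show "\<forall>r. blockdiag r * h = h * blockdiag r" if "h : stab"
 proof
  fix r show "blockdiag r * h = h * blockdiag r"
  proof (rule eq_matI)
  fix i j assume "i < dim_row (h * blockdiag r)" "j < dim_col (h * blockdiag r)"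
  then have ij: "i < m" "j < m" using carrier_matD[OF c(1)] carrier_matD[OF c(2)[of r]] by auto
  then show "(blockdiag r * h) $$ (i, j) = (h * blockdiag r) $$ (i, j)"
  unfolding blockdiag_mult[OF c(1) ij] using that by (auto simp: stab_def)
  qed (use carrier_matD[OF c(1)] carrier_matD[OF c(2)[of r]] in auto)
 qed
 show "h : stab" if comm: "\<forall>r. blockdiag r * h = h * blockdiag r"
  unfolding stab_def
 proof (intro CollectI conjI allI impI h)
  fix i j assume ij: "i < m" "j < m" "\<beta> i ~= \<beta> j"
  have "(blockdiag (\<beta> i) * h) $$ (i, j) = (h * blockdiag (\<beta> i)) $$ (i, j)" using comm by simp
  then show "h $$ (i, j) = 0" unfolding blockdiag_mult[OF c(1) ij(1,2)] using ij by simp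
 qed
qed

text \<open>The class of an orthogonal matrix is separated by the orthogonal projections onto the spans of its row blocks.\<close>

lemma Hausdorff_FX: "Hausdorff_space (top_of FX)"
 unfolding FX_def
proof (rule Hausdorff_quotient_space[OF sheaf_OX,
  of "{%A. (tr_mat A * (blockdiag r * A)) $$ (s, t) | r s t. s < m & t < m}"])
 have bc: "blockdiag r : carrier_mat m m" for r by (simp add: blockdiag_def)
 show "g : smooth_funs OX (pts OX)"
  if "g : {%A. (tr_mat A * (blockdiag r * A)) $$ (s, t) | r s t. s < m & t < m}" for g
 proof -
  from that obtain r s t where g: "g = (%A. (tr_mat A * (blockdiag r * A)) $$ (s, t))" "s < m" "t < m" by blast
  note sm = smooth_mat_OX[OF openin_topspace] and OT = sheaf_OX openin_topspace
  show ?thesis unfolding g(1)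
  by (rule smooth_mat_entry[OF smooth_mat_mult[OF OT smooth_mat_transpose[OF OT sm]
  smooth_mat_mult[OF OT smooth_mat_const[OF OT bc] sm]] g(2,3)])
 qed
 fix x y assume xy: "x : pts OX" "y : pts OX"
 then have c: "x : carrier_mat m m" "y : carrier_mat m m" and o: "x : orth_mats m" "y : orth_mats m"
  by (simp_all add: orth_mats_def)
 have mc: "A * B : carrier_mat m m" if "A : carrier_mat m m" "B : carrier_mat m m" for A B :: "real mat"
  using that by simp
 note assoc = mc assoc_mult_mat[of _ m m _ m _ m] left_mult_one_mat[of _ m m] right_mult_one_mat[of _ m m]
 {
  fix g assume eq: "left_orbit stab x = left_orbit stab y"
  and "g : {%A. (tr_mat A * (blockdiag r * A)) $$ (s, t) | r s t. s < m & t < m}"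
  then obtain r s t where g: "g = (%A. (tr_mat A * (blockdiag r * A)) $$ (s, t))" by blast
  obtain h where h: "h : stab" "y = h * x" using eq stab_orbit_eq[OF o] by blast
  have hc: "h : carrier_mat m m" using h(1) by (simp add: stab_def orth_mats_def)
  have "tr_mat y * (blockdiag r * y) = tr_mat x * (tr_mat h * ((blockdiag r * h) * x))"
  unfolding h(2) using hc c bc by (simp add: transpose_mult[of _ m m _ m] assoc)
  also have "blockdiag r * h = h * blockdiag r" using h(1) stab_iff_commute[OF stab_orth[OF h(1)]] by blast
  also have "tr_mat h * (h * blockdiag r * x) = (tr_mat h * h) * (blockdiag r * x)"
  using hc c bc by (simp add: assoc)
  also have "\<dots> = blockdiag r * x"
  using orth_mats_transpose_mult[OF stab_orth[OF h(1)]] c bc by (simp add: assoc)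
  finally show "g x = g y" unfolding g by simp
 next
  assume sep: "!!g. g : {%A. (tr_mat A * (blockdiag r * A)) $$ (s, t) | r s t. s < m & t < m} ==> g x = g y"
  \<comment> \<open>The only candidate with y = h x. If the projections of x and y agree, h commutes
    with all block projections and so is block diagonal.\<close>
  define h where "h = y * tr_mat x"
  have hc: "h : carrier_mat m m" using c by (simp add: h_def)
  have P: "tr_mat x * (blockdiag r * x) = tr_mat y * (blockdiag r * y)" for r
  proof (rule eq_matI)
  fix s t assume "s < dim_row (tr_mat y * (blockdiag r * y))" "t < dim_col (tr_mat y * (blockdiag r * y))"
  then have "s < m" "t < m" using c bc by auto
  then show "(tr_mat x * (blockdiag r * x)) $$ (s, t) = (tr_mat y * (blockdiag r * y)) $$ (s, t)"
  using sep[of "%A. (tr_mat A * (blockdiag r * A)) $$ (s, t)"] by blast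
  qed (use c bc in auto)
  have "blockdiag r * h = h * blockdiag r" for r
  proof -
  have "blockdiag r * h = (y * tr_mat y) * (blockdiag r * y) * tr_mat x"
  using c bc o by (simp add: h_def assoc orth_mats_def)
  also have "\<dots> = y * (tr_mat y * (blockdiag r * y)) * tr_mat x"
  using c bc by (simp add: assoc)
  also have "\<dots> = y * (tr_mat x * (blockdiag r * x)) * tr_mat x" by (simp add: P)
  also have "\<dots> = y * tr_mat x * blockdiag r * (x * tr_mat x)"
  using c bc by (simp add: assoc)
  also have "\<dots> = h * blockdiag r" using c bc o by (simp add: h_def assoc orth_mats_def)
  finally show ?thesis .
  qed
  then have "h : stab"
  using stab_iff_commute[of h] orth_mats_mult[OF o(2) orth_mats_transpose[OF o(1)]] by (simp add: h_def)
  moreover have "y = h * x"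
  using c orth_mats_transpose_mult[OF o(1)] by (simp add: h_def assoc)
  ultimately show "left_orbit stab x = left_orbit stab y" using stab_orbit_eq[OF o] by blast
 }
qed

section \<open>Charts of the flag manifold\<close>

definition chart_dom :: "real mat => real mat set set" where
 "chart_dom O0 = left_orbit stab ` {A : orth_mats m. sdom O0 A}"

lemma in_chart_dom:
 assumes "O0 : orth_mats m" "A : orth_mats m"
 shows "left_orbit stab A : chart_dom O0 \<longleftrightarrow> sdom O0 A"
 using assms stab_orbit_eq sect_stab(1)[OF assms(1)] unfolding chart_dom_def by blast

lemma smooth_funs_sdom:
 assumes X: "smooth_sheaf X" and f: "smooth_mat X (pts X) m m f" and O0: "O0 : orth_mats m"
 shows "openin (top_of X) {x : pts X. sdom O0 (f x)}"
proof -
 have "smooth_mat X (pts X) m m (%x. f x * tr_mat O0)"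
  by (rule smooth_mat_mult[OF X openin_topspace f smooth_mat_const[OF X openin_topspace]])
  (use O0 in \<open>simp add: orth_mats_def\<close>)
 then have "(%x. minors (f x * tr_mat O0)) : smooth_funs X (pts X)"
  by (rule smooth_minors[OF X openin_topspace])
 then have "continuous_map (top_of X) euclideanreal (%x. minors (f x * tr_mat O0))"
  using smooth_funs_continuous[OF X _ openin_topspace] unfolding subtopology_topspace by blast
 then have "openin (top_of X) {x : pts X. minors (f x * tr_mat O0) : - {0}}"
  by (rule openin_continuous_map_preimage) (simp add: open_Compl)
 then show ?thesis by (simp add: sdom_def)
qed

lemma openin_chart_dom:
 assumes "O0 : orth_mats m" shows "openin (top_of FX) (chart_dom O0)"
proof -
 have "{A : pts OX. left_orbit stab A : chart_dom O0} = {A : pts OX. sdom O0 A}"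
  using in_chart_dom[OF assms] by auto
 moreover have "openin (top_of OX) {A : pts OX. sdom O0 A}"
  by (rule smooth_funs_sdom[OF sheaf_OX smooth_mat_OX[OF openin_topspace] assms])
 moreover have "chart_dom O0 \<subseteq> left_orbit stab ` pts OX" by (auto simp: chart_dom_def)
 ultimately show ?thesis unfolding FX_def topology_quotient_space by simp
qed

text \<open>The positions of the free entries of a unipotent matrix; their number is the dimension
  of the flag manifold.\<close>

definition upper_pairs :: "(nat \<times> nat) set" where
 "upper_pairs = {(i, j). i < m & j < m & \<beta> j < \<beta> i}"

text \<open>The coordinates of the class of A are the free entries of
  \<open>uni (A * tr_mat O0)\<close>. The inverse fills a vector into a unipotent matrix,
  orthonormalizes it and multiplies by O0; this works for every vector, so the chart is
  onto.\<close>

lemma flag_chart: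
 assumes O0: "O0 : orth_mats m"
 shows "\<exists>\<phi>. diffeomorphism (open_subspace FX (chart_dom O0)) (Rn_space (card upper_pairs)) \<phi>"
proof -
 let ?n = "card upper_pairs"
 have fin: "finite upper_pairs"
  by (rule finite_subset[of _ "{..<m} \<times> {..<m}"]) (auto simp: upper_pairs_def)
 obtain e where e: "bij_betw e {0..<?n} upper_pairs" using ex_bij_betw_nat_finite[OF fin] by blast
 define e' where "e' = inv_into {0..<?n} e"
 have e'e: "e' (e k) = k" if "k < ?n" for k
  unfolding e'_def using inv_into_f_f[OF bij_betw_imp_inj_on[OF e]] that by simp
 have ee': "e (e' x) = x" "e' x < ?n" if "x : upper_pairs" for x
 proof -
  have x: "x : e ` {0..<?n}" using that bij_betw_imp_surj_on[OF e] by simp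
  show "e (e' x) = x" unfolding e'_def by (rule f_inv_into_f[OF x])
  show "e' x < ?n" unfolding e'_def using inv_into_into[OF x] by simp
 qed
 have eU: "fst (e k) < m" "snd (e k) < m" "\<beta> (snd (e k)) < \<beta> (fst (e k))" if "k < ?n" for k
 proof -
  have "e k : upper_pairs" using bij_betwE[OF e] that by simp
  then show "fst (e k) < m" "snd (e k) < m" "\<beta> (snd (e k)) < \<beta> (fst (e k))"
  by (cases "e k"; simp add: upper_pairs_def)+
 qed
 \<comment> \<open>The unipotent matrix with prescribed free entries, enumerated through the
   bijection \<open>e\<close>.\<close>
 define unip where "unip z = Matrix.mat m m (%(i, j). if \<beta> i <= \<beta> j then (if i = j then 1 else 0) else z (e' (i, j)))"
  for z :: "nat => real"
 have unip: "unipotent (unip z)" for z by (auto simp: unip_def unipotent_def)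
 have unip_e: "unip z $$ e k = z k" if "k < ?n" for z k
  using eU[OF that] e'e[OF that] by (cases "e k") (auto simp: unip_def)
 define \<Phi> where "\<Phi> A = (%k. if k < ?n then uni (A * tr_mat O0) $$ e k else 0)" for A
 let ?D = "{A : pts OX. left_orbit stab A : chart_dom O0}"
 have D: "?D = {A : orth_mats m. sdom O0 A}" using in_chart_dom[OF O0] by auto
 have oD: "openin (top_of OX) ?D"
  using openin_chart_dom[OF O0] unfolding FX_def topology_quotient_space by blast
 let ?XD = "open_subspace OX ?D"
 have sD: "smooth_sheaf ?XD" by (rule smooth_sheaf_open_subspace[OF sheaf_OX oD])
 have pD: "pts ?XD = ?D" by auto
 have smA: "smooth_mat ?XD (pts ?XD) m m (%A. A)"
  using smooth_mat_OX[OF oD] unfolding pD smooth_mat_def by simp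
 have smu: "smooth_mat ?XD (pts ?XD) m m (%A. uni (A * tr_mat O0))"
 proof (rule smooth_uni[OF sD openin_topspace])
  show "smooth_mat ?XD (pts ?XD) m m (%A. A * tr_mat O0)"
  by (rule smooth_mat_mult[OF sD openin_topspace smA smooth_mat_const[OF sD openin_topspace]])
  (use O0 in \<open>simp add: orth_mats_def\<close>)
  show "minors (A * tr_mat O0) ~= 0" if "A : pts ?XD" for A
  using that unfolding pD D by (simp add: sdom_def)
 qed
 have \<Phi>: "smooth_map ?XD (Rn_space ?n) \<Phi>"
 proof (rule smooth_map_into_Rn[OF sD])
  fix k assume k: "k < ?n"
  have "(%A. uni (A * tr_mat O0) $$ (fst (e k), snd (e k))) : smooth_funs ?XD (pts ?XD)"
  by (rule smooth_mat_entry[OF smu eU(1,2)[OF k]])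
  then show "(%A. \<Phi> A k) : smooth_funs ?XD (pts ?XD)" using k by (simp add: \<Phi>_def)
 qed (simp add: \<Phi>_def)
 have inv: "\<Phi> A = \<Phi> B" if AB: "A : pts OX" "B : pts OX" "left_orbit stab A : chart_dom O0" "left_orbit stab A = left_orbit stab B" for A B
 proof -
  have o: "A : orth_mats m" "B : orth_mats m" using AB by simp_all
  obtain h where h: "h : stab" "B = h * A" using AB(4) stab_orbit_eq[OF o] by blast
  have d: "sdom O0 B" using AB(3,4) in_chart_dom[OF O0 o(2)] by simp
  have c: "h : carrier_mat m m" "A : carrier_mat m m" "tr_mat O0 : carrier_mat m m"
  using h(1) o O0 by (simp_all add: stab_def orth_mats_def)
  have eq: "B * tr_mat O0 = h * (A * tr_mat O0)" unfolding h(2) by (rule assoc_mult_mat[OF c])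
  have "uni (B * tr_mat O0) = uni (A * tr_mat O0)"
  unfolding eq by (rule uni_mult[OF stab_block_lower[OF h(1)] mult_carrier_mat[OF c(2,3)]])
  (use d in \<open>simp add: sdom_def eq\<close>)
  then show ?thesis unfolding \<Phi>_def by (simp cong: if_cong)
 qed
 obtain \<phi> where \<phi>: "smooth_map (open_subspace FX (chart_dom O0)) (Rn_space ?n) \<phi>"
  "!!A. A : pts OX ==> left_orbit stab A : chart_dom O0 ==> \<phi> (left_orbit stab A) = \<Phi> A"
  using smooth_map_descend[OF sheaf_OX openin_chart_dom[OF O0, unfolded FX_def] \<Phi> inv, folded FX_def] by blast
 define \<Psi> where "\<Psi> z = gs_mat m (unip z) * O0" for z
 note RT = smooth_sheaf_Rn openin_topspace
 have "smooth_mat (Rn_space ?n) (pts (Rn_space ?n)) m m unip"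
  unfolding unip_def
 proof (rule smooth_mat_mat[OF RT])
  fix i j
  show "(%z. if \<beta> i <= \<beta> j then if i = j then 1 else 0 else z (e' (i, j))) : smooth_funs (Rn_space ?n) (pts (Rn_space ?n))"
  using smooth_const[OF RT] smooth_funs_Rn_coord_pts by (cases "\<beta> i <= \<beta> j"; cases "i = j") simp_all
 qed
 then have "smooth_mat (Rn_space ?n) (pts (Rn_space ?n)) m m (%z. gs_mat m (unip z))"
  by (rule smooth_gs_mat[OF RT]) (use unipotent_det[OF unip] in simp)
 then have "smooth_mat (Rn_space ?n) (pts (Rn_space ?n)) m m \<Psi>"
  unfolding \<Psi>_def by (rule smooth_mat_mult[OF RT _ smooth_mat_const[OF RT orth_matsD(1)[OF O0]]])
 then have "smooth_map (Rn_space ?n) OX \<Psi>"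
  unfolding OX_def by (rule smooth_map_into_matrices[OF smooth_sheaf_Rn])
  (simp add: \<Psi>_def sect_unipotent(1)[OF O0 unip])
 then have "smooth_map (Rn_space ?n) FX (%z. left_orbit stab (\<Psi> z))"
  unfolding FX_def by (rule smooth_map_comp[OF _ smooth_map_quotient_projection])
 moreover have \<Psi>d: "left_orbit stab (\<Psi> z) : chart_dom O0" for z
  using in_chart_dom[OF O0 sect_unipotent(1)[OF O0 unip]] sect_unipotent(2)[OF O0 unip] by (simp add: \<Psi>_def)
 ultimately have \<psi>: "smooth_map (Rn_space ?n) (open_subspace FX (chart_dom O0)) (%z. left_orbit stab (\<Psi> z))"
  by (rule smooth_map_into_open) (rule openin_chart_dom[OF O0])
 have "diffeomorphism (open_subspace FX (chart_dom O0)) (Rn_space ?n) \<phi>"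
 proof (rule diffeomorphismI[OF \<phi>(1) \<psi>])
  fix y assume "y : pts (open_subspace FX (chart_dom O0))"
  then obtain A where A: "A : orth_mats m" "y = left_orbit stab A" "y : chart_dom O0" by auto
  have d: "sdom O0 A" using A in_chart_dom[OF O0 A(1)] by simp
  have U: "unipotent (uni (A * tr_mat O0))" using uni_unipotent d by (simp add: sdom_def)
  have "unip (\<Phi> A) = uni (A * tr_mat O0)"
  proof (rule eq_matI)
  fix i j assume "i < dim_row (uni (A * tr_mat O0))" "j < dim_col (uni (A * tr_mat O0))"
  then have ij: "i < m" "j < m" by (simp_all add: uni_def)
  show "unip (\<Phi> A) $$ (i, j) = uni (A * tr_mat O0) $$ (i, j)"
  proof (cases "\<beta> i <= \<beta> j")
  case True then show ?thesis using U ij by (simp add: unip_def unipotent_def)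
  next
  case False
  then have "(i, j) : upper_pairs" using ij by (simp add: upper_pairs_def)
  from ee'[OF this] show ?thesis using False ij by (simp add: unip_def \<Phi>_def)
  qed
  qed (simp_all add: unip_def uni_def)
  then have "\<Psi> (\<phi> y) = sect O0 A" using \<phi>(2)[of A] A by (simp add: \<Psi>_def sect_def)
  moreover obtain h where "h : stab" "sect O0 A = h * A" by (rule sect_in_orbit[OF O0 A(1) d])
  ultimately show "left_orbit stab (\<Psi> (\<phi> y)) = y" using stab_orbit_mult[OF A(1)] A(2) by simp
 next
  fix z assume z: "z : pts (Rn_space ?n)"
  have "\<phi> (left_orbit stab (\<Psi> z)) = \<Phi> (\<Psi> z)"
  by (rule \<phi>(2)) (use \<Psi>d sect_unipotent(1)[OF O0 unip] in \<open>simp_all add: \<Psi>_def\<close>)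
  also have "\<dots> = z"
  proof
  fix k show "\<Phi> (\<Psi> z) k = z k"
  using sect_unipotent(3)[OF O0 unip, of z] unip_e[of k z] z
  by (cases "k < ?n") (auto simp: \<Phi>_def \<Psi>_def topspace_Euclidean_space)
  qed
  finally show "\<phi> (left_orbit stab (\<Psi> z)) = z" .
 qed
 then show ?thesis by blast
qed

lemma smooth_manifold_FX: "smooth_manifold (card upper_pairs) FX"
proof (rule smooth_manifoldI[OF sheaf_FX Hausdorff_FX second_countable_FX])
 fix y assume "y : pts FX"
 then obtain O0 where O0: "O0 : orth_mats m" "y = left_orbit stab O0" by auto
 have "y : chart_dom O0" using in_chart_dom[OF O0(1,1)] sdom_self[OF O0(1)] O0(2) by simp
 then show "\<exists>U \<phi>. openin (top_of FX) U & y : U & diffeomorphism (open_subspace FX U) (Rn_space (card upper_pairs)) \<phi>"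
  using openin_chart_dom[OF O0(1)] flag_chart[OF O0(1)] by blast
qed

end

declare upt_Suc [simp del]

section \<open>Stacked and block diagonal matrices\<close>

lemma append_rows_dims [simp]:
 "dim_row (append_rows A B) = dim_row A + dim_row B" "dim_col (append_rows A B) = dim_col A"
 by (simp_all add: append_rows_def)

lemma append_rows_entry:
 assumes "i < dim_row A + dim_row B" "j < dim_col A" "dim_col B = dim_col A"
 shows "append_rows A B $$ (i, j) = (if i < dim_row A then A $$ (i, j) else B $$ (i - dim_row A, j))"
 using assms by (simp add: append_rows_def)

lemma vstack_simps [simp]: "vstack nc [] = 0\<^sub>m 0 nc" "vstack nc (A # As) = append_rows A (vstack nc As)"
 by (simp_all add: vstack_def)

lemma vstack_dims:
 "dim_row (vstack nc As) = sum_list (map dim_row As)"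
 "(!!A. A : set As ==> dim_col A = nc) ==> dim_col (vstack nc As) = nc"
 by (induction As) auto

lemma vstack_entry:
 assumes "!!A. A : set (xs @ y # ys) ==> dim_col A = nc" "a < dim_row y" "b < nc"
 shows "vstack nc (xs @ y # ys) $$ (sum_list (map dim_row xs) + a, b) = y $$ (a, b)"
 using assms(1)
proof (induction xs)
 case Nil
 then have "dim_col (vstack nc ys) = nc" "dim_col y = nc" by (auto intro: vstack_dims)
 then show ?case using assms(2,3) by (simp add: append_rows_entry)
next
 case (Cons x xs)
 have d: "dim_col x = nc" "dim_col (vstack nc (xs @ y # ys)) = nc"
  using Cons.prems by (auto intro!: vstack_dims(2))
 have r: "sum_list (map dim_row xs) + a < dim_row (vstack nc (xs @ y # ys))"
  using assms(2) by (simp add: vstack_dims(1))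
 have IH: "vstack nc (xs @ y # ys) $$ (sum_list (map dim_row xs) + a, b) = y $$ (a, b)"
  using Cons.IH Cons.prems by simp
 have "vstack nc ((x # xs) @ y # ys) $$ (dim_row x + (sum_list (map dim_row xs) + a), b)
  = vstack nc (xs @ y # ys) $$ (sum_list (map dim_row xs) + a, b)"
  unfolding append_Cons vstack_simps(2)
  by (subst append_rows_entry) (use d r assms(3) in auto)
 then show ?case using IH by (simp add: add.assoc)
qed

lemma diag_block_mat_dims:
 "dim_row (diag_block_mat As) = sum_list (map dim_row As)" "dim_col (diag_block_mat As) = sum_list (map dim_col As)"
 by (induction As) (simp_all add: Let_def)

lemma diag_block_mat_row:
 assumes "!!A. A : set (xs @ y # ys) ==> dim_col A = dim_row A" "a < dim_row y"
  and "j < sum_list (map dim_row (xs @ y # ys))"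
 shows "diag_block_mat (xs @ y # ys) $$ (sum_list (map dim_row xs) + a, j) =
  (if sum_list (map dim_row xs) <= j & j < sum_list (map dim_row xs) + dim_row y
  then y $$ (a, j - sum_list (map dim_row xs)) else (0 :: real))"
 using assms(1,3)
proof (induction xs arbitrary: j)
 case Nil
 have "map dim_col ys = map dim_row ys" using Nil.prems(1) by simp
 then have "dim_col (diag_block_mat ys) = sum_list (map dim_row ys)" unfolding diag_block_mat_dims by (rule arg_cong)
 then show ?case using Nil.prems assms(2) by (simp add: Let_def diag_block_mat_dims)
next
 case (Cons x xs)
 have "map dim_col (xs @ y # ys) = map dim_row (xs @ y # ys)" using Cons.prems(1) by simp
 then have dc: "dim_col (diag_block_mat (xs @ y # ys)) = sum_list (map dim_row (xs @ y # ys))"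
  unfolding diag_block_mat_dims by (rule arg_cong)
 have dx: "dim_col x = dim_row x" using Cons.prems(1) by simp
 show ?case
 proof (cases "j < dim_row x")
  case True
  then show ?thesis using dx dc assms(2) Cons.prems(2) by (simp add: Let_def diag_block_mat_dims)
 next
  case False
  have "diag_block_mat ((x # xs) @ y # ys) $$ (dim_row x + (sum_list (map dim_row xs) + a), j)
  = diag_block_mat (xs @ y # ys) $$ (sum_list (map dim_row xs) + a, j - dim_row x)"
  using False dx dc assms(2) Cons.prems(2) by (simp add: Let_def diag_block_mat_dims)
  also have "\<dots> = (if sum_list (map dim_row xs) <= j - dim_row x & j - dim_row x < sum_list (map dim_row xs) + dim_row y
  then y $$ (a, j - dim_row x - sum_list (map dim_row xs)) else 0)"
  using Cons.prems False by (intro Cons.IH) auto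
  finally show ?thesis using False by (auto simp: add.assoc)
 qed
qed

lemma diag_block_mat_filter:
 assumes "!!A. A : set As ==> dim_col A = dim_row A"
 shows "diag_block_mat (filter (%A. 0 < dim_row A) As) = (diag_block_mat As :: real mat)"
 using assms
proof (induction As)
 case (Cons A As)
 show ?case
 proof (cases "0 < dim_row A")
  case True then show ?thesis using Cons by (simp add: Let_def)
 next
  case False
  then have "diag_block_mat (A # As) = diag_block_mat As"
  using Cons.prems by (intro eq_matI) (auto simp: Let_def)
  then show ?thesis using Cons False by simp
 qed
qed simp

lemma rev_upt_split: "l <= r ==> r < u ==> rev [l..<u] = rev [Suc r..<u] @ r # rev [l..<r]"
proof -
 assume "l <= r" "r < u"
 then have "[l..<u] = [l..<r] @ r # [Suc r..<u]"
  using upt_add_eq_append[of l r "u - r"] upt_conv_Cons[of r u] by simp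
 then show ?thesis by simp
qed

lemma sum_list_map_rev_upt: "sum_list (map f (rev [Suc r..<Suc p])) = (\<Sum>s=Suc r..p. f s :: nat)"
proof -
 have "sum_list (map f (rev [Suc r..<Suc p])) = sum_list (map f [Suc r..<Suc p])"
  by (metis rev_map sum_list_rev)
 then show ?thesis by (simp only: interv_sum_list_conv_sum_set_nat set_upt atLeastLessThanSuc_atLeastAtMost)
qed

section \<open>Block indices\<close>

locale blocks =
 fixes p m :: nat and d :: "nat => nat"
 assumes p1: "1 <= p" and ltot_le: "ltot p d <= m" and d0: "d 0 = m - ltot p d"
begin

definition ooff :: "nat => nat" where "ooff r = (\<Sum>s=Suc r..p. d s)"

text \<open>\<open>ooff\<close> is nonincreasing in r, and row i lies in block r if
  \<open>ooff r <= i\<close> while i is below \<open>ooff (r - 1)\<close>; the least r is the right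
  one. Empty blocks are never selected, since their offset equals that of the next smaller
  label.\<close>

definition lab :: "nat => nat" where "lab i = (LEAST r. ooff r <= i)"

lemma ooff_p [simp]: "ooff p = 0" and ooff_0: "ooff 0 = ltot p d"
 by (simp_all add: ooff_def ltot_def)

lemma ooff_Suc: "r < p ==> ooff r = ooff (Suc r) + d (Suc r)"
 unfolding ooff_def by (subst sum.atLeast_Suc_atMost) auto

lemma ooff_mono: "y < r ==> r <= p ==> ooff r + d r <= ooff y"
proof -
 assume "y < r" "r <= p"
 then have "ooff r + d r = (\<Sum>s\<in>insert r {Suc r..p}. d s)" by (simp add: ooff_def)
 also have "\<dots> <= ooff y" unfolding ooff_def using \<open>y < r\<close> \<open>r <= p\<close> by (intro sum_mono2) auto
 finally show ?thesis .
qed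

lemma ooff_le: "r <= p ==> ooff r + d r <= m"
 using ooff_mono[of 0 r] ooff_0 ltot_le d0 by (cases "r = 0") auto

lemma lab_ooff: "r <= p ==> a < d r ==> lab (ooff r + a) = r"
 unfolding lab_def by (rule Least_equality) (use ooff_mono in \<open>force simp: not_le[symmetric]\<close>)+

lemma lab_decode:
 assumes "i < m" shows "lab i <= p" "ooff (lab i) <= i" "i < ooff (lab i) + d (lab i)"
proof -
 have 0: "ooff p <= i" by simp
 show 1: "lab i <= p" unfolding lab_def using Least_le[of "%r. ooff r <= i" p] 0 by simp
 show "ooff (lab i) <= i" unfolding lab_def by (rule LeastI[of _ p]) simp
 show "i < ooff (lab i) + d (lab i)"
 proof (cases "lab i")
  case 0
  then show ?thesis using assms ooff_0 d0 ltot_le by simp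
 next
  case (Suc r)
  then have "\<not> ooff r <= i" using not_less_Least[of r "%r. ooff r <= i"] by (simp add: lab_def)
  then show ?thesis using ooff_Suc[of r] Suc 1 by simp
 qed
qed

lemma lab_pos: "i < m ==> 0 < lab i \<longleftrightarrow> i < ltot p d"
proof -
 assume i: "i < m"
 have "lab i = 0 \<longleftrightarrow> ooff 0 <= i"
 proof
  show "ooff 0 <= i" if "lab i = 0" using lab_decode(2)[OF i] that by simp
  show "lab i = 0" if "ooff 0 <= i" unfolding lab_def using Least_le[of "%r. ooff r <= i" 0] that by simp
 qed
 then show ?thesis by (auto simp: ooff_0)
qed

sublocale block_index m lab
proof
 fix i j :: nat assume "i <= j" "j < m"
 have "ooff (lab i) <= i" unfolding lab_def by (rule LeastI[of _ p]) simp
 then have "ooff (lab i) <= j" using \<open>i <= j\<close> by simp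
 then show "lab j <= lab i" unfolding lab_def[of j] by (rule Least_le)
qed

lemma lab_cases:
 assumes "i < m" obtains r a where "r <= p" "a < d r" "i = ooff r + a" "lab i = r"
proof
 show "lab i <= p" "i - ooff (lab i) < d (lab i)" "i = ooff (lab i) + (i - ooff (lab i))"
  using lab_decode[OF assms] by auto
qed simp

section \<open>Row indices of matrices with n_min rows\<close>

definition nn :: nat where "nn = nmin p d"

text \<open>A row is addressed by its block r, the shift j and the position a inside the block.
  After \<open>ridx_bij\<close>, sums over rows become sums over such triples, and offset arithmetic
  disappears from the later proofs.\<close>

definition ridx :: "nat \<times> nat \<times> nat => nat" where
 "ridx = (%(r, j, a). row_off p d r j + a)"

definition rset :: "(nat \<times> nat \<times> nat) set" where
 "rset = {(r, j, a). 1 <= r & r <= p & j < r & a < d r}"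

lemma mem_rset [simp]: "(r, j, a) : rset \<longleftrightarrow> 1 <= r & r <= p & j < r & a < d r"
 by (simp add: rset_def)

definition goff :: "nat => nat" where "goff r = (\<Sum>s=Suc r..p. s * d s)"

lemma goff_mono: "y < r ==> r <= p ==> goff r + r * d r <= goff y"
proof -
 assume "y < r" "r <= p"
 then have "goff r + r * d r = (\<Sum>s\<in>insert r {Suc r..p}. s * d s)" by (simp add: goff_def)
 also have "\<dots> <= goff y" unfolding goff_def using \<open>y < r\<close> \<open>r <= p\<close> by (intro sum_mono2) auto
 finally show ?thesis .
qed

lemma goff_0: "goff 0 = nn" by (simp add: goff_def nn_def nmin_def)

lemma ridx_eq: "ridx (r, j, a) = goff r + ((r - 1 - j) * d r + a)"
 by (simp add: ridx_def row_off_def goff_def)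

lemma ridx_range:
 assumes "(r, j, a) : rset"
 shows "goff r <= ridx (r, j, a)" "ridx (r, j, a) < goff r + r * d r" "ridx (r, j, a) < nn"
proof -
 have "(r - 1 - j) * d r + a < (r - 1 - j) * d r + d r" using assms by simp
 also have "\<dots> = Suc (r - 1 - j) * d r" by simp
 also have "\<dots> <= r * d r" using assms by (intro mult_le_mono) auto
 finally show b: "ridx (r, j, a) < goff r + r * d r" by (simp add: ridx_eq)
 then show "ridx (r, j, a) < nn" using goff_mono[of 0 r] assms goff_0 by simp
qed (simp add: ridx_eq)

lemma ridx_same_block:
 assumes "(r, j, a) : rset" "r' <= p" "goff r' <= ridx (r, j, a)" "ridx (r, j, a) < goff r' + r' * d r'"
 shows "r' = r"
 using ridx_range[OF assms(1)] goff_mono[of r r'] goff_mono[of r' r] assms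
 by (cases r r' rule: linorder_cases) auto

lemma ridx_inj: "inj_on ridx rset"
proof (rule inj_onI)
 fix x y assume xy: "x : rset" "y : rset" "ridx x = ridx y"
 obtain r j a where x: "x = (r, j, a)" by (cases x)
 obtain r' j' a' where y: "y = (r', j', a')" by (cases y)
 have r: "r' = r"
  using ridx_same_block[of r j a r'] ridx_range[of r' j' a'] xy by (auto simp: x y)
 have lt: "a < d r" "a' < d r" "j < r" "j' < r" using xy r by (auto simp: x y)
 have eq: "(r - 1 - j) * d r + a = (r - 1 - j') * d r + a'" using xy(3) r by (simp add: x y ridx_eq)
 from arg_cong[OF this, of "%z. z div d r"] arg_cong[OF this, of "%z. z mod d r"] lt
 have "r - 1 - j = r - 1 - j'" "a = a'" by simp_all
 then show "x = y" using r lt by (simp add: x y)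
qed

text \<open>Surjectivity comes by counting: the triples are n_min in number and are mapped
  injectively into n_min rows.\<close>

lemma ridx_bij: "bij_betw ridx rset {..<nn}"
proof -
 have fin: "rset = (SIGMA r:{1..p}. {..<r} \<times> {..<d r})" by auto
 have "card rset = (\<Sum>r\<in>{1..p}. card ({..<r} \<times> {..<d r}))" unfolding fin by (rule card_SigmaI) auto
 then have card: "card rset = nn" by (simp add: nn_def nmin_def card_cartesian_product)
 have "ridx ` rset \<subseteq> {..<nn}" using ridx_range(3) by auto
 moreover have "card (ridx ` rset) = card {..<nn}" using card_image[OF ridx_inj] card by simp
 ultimately have "ridx ` rset = {..<nn}" by (intro card_subset_eq) auto
 then show ?thesis using ridx_inj by (simp add: bij_betw_def)
qed

lemma ridx_cases:
 assumes "i < nn" obtains r j a where "(r, j, a) : rset" "i = ridx (r, j, a)"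
proof -
 have "i : ridx ` rset" using bij_betw_imp_surj_on[OF ridx_bij] assms by simp
 then show thesis using that by auto
qed

definition dec :: "nat => nat \<times> nat \<times> nat" where "dec = inv_into rset ridx"

lemma dec_ridx: "x : rset ==> dec (ridx x) = x"
 unfolding dec_def by (rule inv_into_f_f[OF ridx_inj])

definition gmat :: "(nat => nat => nat => nat => real) => real mat" where
 "gmat e = Matrix.mat nn m (%(i, b). case dec i of (r, j, a) => e r j a b)"

lemma gmat_carrier [simp]: "gmat e : carrier_mat nn m" by (simp add: gmat_def)

lemma gmat_entry: "(r, j, a) : rset ==> b < m ==> gmat e $$ (ridx (r, j, a), b) = e r j a b"
 using ridx_range(3)[of r j a] dec_ridx[of "(r, j, a)"] by (simp add: gmat_def)

lemma gmat_eqI: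
 assumes "G : carrier_mat nn m" "H : carrier_mat nn m"
  and "!!r j a b. (r, j, a) : rset ==> b < m ==> G $$ (ridx (r, j, a), b) = H $$ (ridx (r, j, a), b)"
 shows "G = H"
proof (rule eq_matI)
 fix i b assume "i < dim_row H" "b < dim_col H"
 then have ib: "i < nn" "b < m" using assms by auto
 obtain r j a where "(r, j, a) : rset" "i = ridx (r, j, a)" by (rule ridx_cases[OF ib(1)])
 then show "G $$ (i, b) = H $$ (i, b)" using assms(3) ib by simp
qed (use assms in auto)

lemma rblk_entry:
 assumes "G : carrier_mat n m" "a < d r" "b < m"
 shows "rblk p d G r j $$ (a, b) = G $$ (ridx (r, j, a), b)"
 using assms by (simp add: rblk_def ridx_def)

lemma rblk_carrier: "G : carrier_mat n m ==> rblk p d G r j : carrier_mat (d r) m"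
 by (simp add: rblk_def)

lemma zero_part_carrier:
 assumes "G : carrier_mat n m" shows "zero_part p d G : carrier_mat (ltot p d) m"
proof -
 have "dim_row (zero_part p d G) = sum_list (map d (rev [Suc 0..<Suc p]))"
  by (simp add: zero_part_def vstack_dims rblk_def o_def)
 then have "dim_row (zero_part p d G) = ltot p d"
  unfolding sum_list_map_rev_upt by (simp add: ltot_def)
 moreover have "dim_col (zero_part p d G) = m"
  unfolding zero_part_def using assms by (subst vstack_dims(2)) (auto simp: rblk_def)
 ultimately show ?thesis by auto
qed

lemma zero_part_entry:
 assumes G: "G : carrier_mat n m" and r: "1 <= r" "r <= p" and a: "a < d r" and b: "b < m"
 shows "zero_part p d G $$ (ooff r + a, b) = G $$ (ridx (r, 0, a), b)"
proof -
 let ?f = "%r. rblk p d G r 0"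
 have "vstack m (map ?f (rev [Suc r..<Suc p]) @ ?f r # map ?f (rev [1..<r])) $$
  (sum_list (map dim_row (map ?f (rev [Suc r..<Suc p]))) + a, b) = ?f r $$ (a, b)"
  by (rule vstack_entry) (use G a b in \<open>auto simp: rblk_def\<close>)
 moreover have "sum_list (map dim_row (map ?f (rev [Suc r..<Suc p]))) = ooff r"
  unfolding ooff_def sum_list_map_rev_upt[symmetric] by (simp add: rblk_def o_def)
 moreover have "rev [1..<Suc p] = rev [Suc r..<Suc p] @ r # rev [1..<r]"
  by (rule rev_upt_split) (use r in auto)
 ultimately show ?thesis using G rblk_entry[OF G a b] by (simp add: zero_part_def)
qed

lemma oblk_entry: "Om : carrier_mat n m ==> a < d r ==> b < m ==> oblk p d Om r $$ (a, b) = Om $$ (ooff r + a, b)"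
 by (simp add: oblk_def ooff_def)

lemma oblk_carrier: "Om : carrier_mat n m ==> oblk p d Om r : carrier_mat (d r) m"
 by (simp add: oblk_def)

text \<open>Number of rows of \<open>M\<^bsub>r,l\<^esub>\<close>, as a function of \<open>r - l\<close>; these are the last rows of the orthogonal matrix.\<close>

definition wid :: "nat => nat" where "wid n = (\<Sum>j<n. d j)"

lemma sum_split_wid:
 assumes "n <= Suc p" shows "wid n + (\<Sum>s=n..p. d s) = m"
proof -
 have "(\<Sum>j\<in>{..<n} \<union> {n..p}. d j) = wid n + (\<Sum>s=n..p. d s)"
  unfolding wid_def by (rule sum.union_disjoint) auto
 moreover have "{..<n} \<union> {n..p} = insert 0 {1..p}" using assms by auto
 ultimately have "wid n + (\<Sum>s=n..p. d s) = d 0 + ltot p d" by (simp add: ltot_def)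
 then show ?thesis using d0 ltot_le by simp
qed

lemma wid_ooff: "r <= p ==> wid (Suc r) + ooff r = m"
 using sum_split_wid[of "Suc r"] by (simp add: ooff_def)

lemma wid_le: "n <= Suc p ==> wid n <= m"
 using sum_split_wid[of n] by simp

lemma M_mat_carrier:
 assumes "Om : carrier_mat n m" shows "M_mat p d Om r l : carrier_mat (wid (r - l)) m"
proof -
 have "dim_row (M_mat p d Om r l) = sum_list (map d (rev [0..<r - l]))"
  by (simp add: M_mat_def vstack_dims oblk_def o_def)
 also have "\<dots> = sum_list (map d [0..<r - l])" by (metis rev_map sum_list_rev)
 also have "\<dots> = wid (r - l)" by (simp add: wid_def interv_sum_list_conv_sum_set_nat lessThan_atLeast0)
 finally have "dim_row (M_mat p d Om r l) = wid (r - l)" .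
 moreover have "dim_col (M_mat p d Om r l) = m"
  unfolding M_mat_def using assms by (subst vstack_dims(2)) (auto simp: oblk_def)
 ultimately show ?thesis by (rule carrier_matI)
qed

lemma lab_less_iff:
 assumes "i < m" "1 <= n" "n <= Suc p" shows "lab i < n \<longleftrightarrow> m - wid n <= i"
proof -
 have "n - 1 <= p" "Suc (n - 1) = n" using assms by auto
 then have n: "m - wid n = ooff (n - 1)" using wid_ooff[of "n - 1"] by simp
 show ?thesis
 proof
  assume "lab i < n"
  then have "ooff (n - 1) <= ooff (lab i)"
  proof (cases "lab i = n - 1")
  case False
  then have "lab i < n - 1" using \<open>lab i < n\<close> by linarith
  from ooff_mono[OF this \<open>n - 1 <= p\<close>] show ?thesis by simp
  qed simp
  then show "m - wid n <= i" using lab_decode(2)[OF assms(1)] n by simp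
 next
  assume "m - wid n <= i"
  then have "lab i <= n - 1" unfolding lab_def n by (rule Least_le)
  then show "lab i < n" using assms(2) by simp
 qed
qed

lemma M_mat_entry:
 assumes Om: "Om : carrier_mat n m" and rl: "l < r" "r <= p" and t: "t < wid (r - l)" and b: "b < m"
 shows "M_mat p d Om r l $$ (t, b) = Om $$ (m - wid (r - l) + t, b)"
proof -
 let ?N = "r - l" and ?i = "m - wid (r - l) + t"
 have N: "1 <= ?N" "?N <= p" using rl by auto
 have i: "?i < m" using t wid_le[of ?N] N by simp
 obtain r' a where ra: "r' <= p" "a < d r'" "?i = ooff r' + a" "lab ?i = r'" by (rule lab_cases[OF i])
 have r'N: "r' < ?N" using lab_less_iff[OF i N(1)] N ra by simp
 have "vstack m (map (oblk p d Om) (rev [Suc r'..<?N]) @ oblk p d Om r' # map (oblk p d Om) (rev [0..<r'])) $$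
  (sum_list (map dim_row (map (oblk p d Om) (rev [Suc r'..<?N]))) + a, b) = oblk p d Om r' $$ (a, b)"
  by (rule vstack_entry) (use Om ra b in \<open>auto simp: oblk_def\<close>)
 moreover have "sum_list (map dim_row (map (oblk p d Om) (rev [Suc r'..<?N]))) + a = t"
 proof -
  have "sum_list (map dim_row (map (oblk p d Om) (rev [Suc r'..<?N]))) = sum_list (map d (rev [Suc r'..<Suc (?N - 1)]))"
  proof -
  have "Suc (?N - 1) = ?N" using N by linarith
  then show ?thesis by (simp only: map_map o_def oblk_def dim_row_mat)
  qed
  also have "\<dots> = (\<Sum>s=Suc r'..?N - 1. d s)" by (rule sum_list_map_rev_upt)
  finally have off: "sum_list (map dim_row (map (oblk p d Om) (rev [Suc r'..<?N]))) = (\<Sum>s=Suc r'..?N - 1. d s)" .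
  have "ooff r' = (\<Sum>s\<in>{Suc r'..?N - 1} \<union> {?N..p}. d s)"
  unfolding ooff_def using r'N N by (intro sum.cong) auto
  also have "\<dots> = (\<Sum>s=Suc r'..?N - 1. d s) + (\<Sum>s=?N..p. d s)" by (rule sum.union_disjoint) auto
  also have "(\<Sum>s=?N..p. d s) = m - wid ?N" using sum_split_wid[of ?N] N by simp
  finally show ?thesis using ra(3) off by simp
 qed
 moreover have "rev [0..<?N] = rev [Suc r'..<?N] @ r' # rev [0..<r']" by (rule rev_upt_split) (use r'N in auto)
 ultimately show ?thesis using Om ra b oblk_entry[OF Om ra(2) b] by (simp add: M_mat_def)
qed

text \<open>The width n is free because the same block order occurs twice: with n = m for
  \<open>stack_blocks\<close> and with n = p m for \<open>kappa\<close>.\<close>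

lemma vstack_blocks:
 assumes X: "!!r j. 1 <= r ==> r <= p ==> j < r ==> X r j : carrier_mat (d r) n"
 defines "S \<equiv> vstack n (concat (map (%r. map (%j. X r j) (rev [0..<r])) (rev [1..<Suc p])))"
 shows "S : carrier_mat nn n"
  "(r, j, a) : rset ==> b < n ==> S $$ (ridx (r, j, a), b) = X r j $$ (a, b)"
proof -
 let ?L = "%rs. concat (map (%r. map (%j. X r j) (rev [0..<r])) rs)"
 have Xd: "dim_row (X r j) = d r" "dim_col (X r j) = n" if "r <= p" "j < r" for r j
  using X[of r j] that by auto
 have cols: "dim_col A = n" if "A : set (?L (rev [1..<Suc p]))" for A using that Xd(2) by auto
 have len: "sum_list (map dim_row (?L (rev [Suc r..<Suc p]))) = goff r" for r
 proof -
  have *: "sum_list (map dim_row (?L rs)) = sum_list (map (%s. s * d s) rs)" if "\<forall>s\<in>set rs. 1 <= s & s <= p" for rs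
  using that
  proof (induction rs)
  case (Cons s rs)
  have "map dim_row (map (%j. X s j) (rev [0..<s])) = map (%j. d s) (rev [0..<s])"
  using Xd(1) Cons.prems by auto
  then have "sum_list (map dim_row (map (%j. X s j) (rev [0..<s]))) = s * d s"
  by (simp only: map_replicate_const length_rev length_upt sum_list_replicate) simp
  then show ?case using Cons by simp
  qed simp
  show ?thesis unfolding goff_def sum_list_map_rev_upt[symmetric] by (rule *) auto
 qed
 have "sum_list (map dim_row (?L (rev [1..<Suc p]))) = nn"
  using len[of 0] goff_0 by simp
 then show "S : carrier_mat nn n"
  unfolding S_def by (intro carrier_matI vstack_dims(2) cols) (simp_all only: vstack_dims(1))
 assume r: "(r, j, a) : rset" and b: "b < n"
 then have r': "1 <= r" "r <= p" "j < r" "a < d r" by auto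
 have s1: "rev [1..<Suc p] = rev [Suc r..<Suc p] @ r # rev [1..<r]" by (rule rev_upt_split) (use r' in auto)
 have s2: "rev [0..<r] = rev [Suc j..<r] @ j # rev [0..<j]" by (rule rev_upt_split) (use r' in auto)
 let ?xs = "?L (rev [Suc r..<Suc p]) @ map (%j. X r j) (rev [Suc j..<r])"
  and ?ys = "map (%j. X r j) (rev [0..<j]) @ ?L (rev [1..<r])"
 have L: "?L (rev [1..<Suc p]) = ?xs @ X r j # ?ys" unfolding s1 by (simp only: map_append concat_append list.map concat.simps s2) simp
 have "map dim_row (map (%j. X r j) (rev [Suc j..<r])) = map (%j. d r) (rev [Suc j..<r])" using Xd(1) r' by auto
 then have "sum_list (map dim_row (map (%j. X r j) (rev [Suc j..<r]))) = (r - 1 - j) * d r"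
  by (simp only: map_replicate_const length_rev length_upt sum_list_replicate) simp
 then have off: "sum_list (map dim_row ?xs) = goff r + (r - 1 - j) * d r"
  unfolding map_append sum_list_append len by simp
 have dr: "dim_row (X r j) = d r" using Xd(1) r' by blast
 have "vstack n (?xs @ X r j # ?ys) $$ (sum_list (map dim_row ?xs) + a, b) = X r j $$ (a, b)"
  by (rule vstack_entry) (use cols[unfolded L] r' b dr in blast, use r' dr b in simp_all)
 then show "S $$ (ridx (r, j, a), b) = X r j $$ (a, b)"
  unfolding S_def L off ridx_eq by (simp add: add.assoc)
qed

lemma stack_blocks_eq:
 assumes X: "!!r j. 1 <= r ==> r <= p ==> j < r ==> X r j : carrier_mat (d r) m"
 shows "stack_blocks p m X = gmat (%r j a b. X r j $$ (a, b))"
 using vstack_blocks[OF X] unfolding stack_blocks_def by (intro gmat_eqI) (simp_all add: gmat_entry)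

section \<open>The group actions\<close>

text \<open>The index 0 is included in the list: it stands for the factor that acts on the last
  rows, of size \<open>d 0\<close>.\<close>

lemma diag_blocks_entry:
 fixes H :: "nat => real mat"
 assumes H: "!!s. s <= p ==> H s : carrier_mat (d s) (d s)"
 shows "diag_block_mat (map H (rev [0..<Suc p])) : carrier_mat m m"
  "r <= p ==> a < d r ==> r' <= p ==> a' < d r' ==>
  diag_block_mat (map H (rev [0..<Suc p])) $$ (ooff r + a, ooff r' + a') = (if r = r' then H r $$ (a, a') else 0)"
proof -
 have dims: "dim_row (H s) = d s" "dim_col (H s) = d s" if "s <= p" for s using H[OF that] by auto
 have tot: "sum_list (map dim_row (map H (rev [0..<Suc p]))) = m"
 proof -
  have "rev [0..<Suc p] = rev [Suc 0..<Suc p] @ [0]" using rev_upt_split[of 0 0 "Suc p"] by simp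
  moreover have "map dim_row (map H (rev [Suc 0..<Suc p])) = map d (rev [Suc 0..<Suc p])" using dims by auto
  then have "sum_list (map dim_row (map H (rev [Suc 0..<Suc p]))) = ltot p d"
  unfolding ltot_def by (simp only: sum_list_map_rev_upt) simp
  ultimately show ?thesis using dims d0 ltot_le by simp
 qed
 moreover have "map dim_col (map H (rev [0..<Suc p])) = map dim_row (map H (rev [0..<Suc p]))" using dims by auto
 ultimately show "diag_block_mat (map H (rev [0..<Suc p])) : carrier_mat m m"
  by (intro carrier_matI) (simp_all only: diag_block_mat_dims)
 assume r: "r <= p" "a < d r" and r': "r' <= p" "a' < d r'"
 have s: "rev [0..<Suc p] = rev [Suc r..<Suc p] @ r # rev [0..<r]" by (rule rev_upt_split) (use r in auto)
 let ?xs = "map H (rev [Suc r..<Suc p])" and ?ys = "map H (rev [0..<r])"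
 have L: "map H (rev [0..<Suc p]) = ?xs @ H r # ?ys" unfolding s by simp
 have "map dim_row ?xs = map d (rev [Suc r..<Suc p])" using dims by auto
 then have off: "sum_list (map dim_row ?xs) = ooff r" by (simp only: sum_list_map_rev_upt ooff_def)
 have jm: "ooff r' + a' < m" using ooff_le[OF r'(1)] r'(2) by simp
 have "diag_block_mat (?xs @ H r # ?ys) $$ (sum_list (map dim_row ?xs) + a, ooff r' + a') =
  (if sum_list (map dim_row ?xs) <= ooff r' + a' & ooff r' + a' < sum_list (map dim_row ?xs) + dim_row (H r)
  then H r $$ (a, ooff r' + a' - sum_list (map dim_row ?xs)) else 0)"
 proof (rule diag_block_mat_row)
  show "dim_col A = dim_row A" if "A : set (?xs @ H r # ?ys)" for A
  using that dims r by auto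
  show "a < dim_row (H r)" using r dims by simp
  show "ooff r' + a' < sum_list (map dim_row (?xs @ H r # ?ys))" using jm tot unfolding L by simp
 qed
 then have e: "diag_block_mat (map H (rev [0..<Suc p])) $$ (ooff r + a, ooff r' + a') =
  (if ooff r <= ooff r' + a' & ooff r' + a' < ooff r + d r then H r $$ (a, ooff r' + a' - ooff r) else 0)"
  unfolding off L[symmetric] using dims r by simp
 have "ooff r <= ooff r' + a' & ooff r' + a' < ooff r + d r \<longleftrightarrow> r = r'"
  using ooff_mono[of r r'] ooff_mono[of r' r] r r' by (cases r r' rule: linorder_cases) auto
 then show "diag_block_mat (map H (rev [0..<Suc p])) $$ (ooff r + a, ooff r' + a') = (if r = r' then H r $$ (a, a') else 0)"
  unfolding e by auto
qed

lemma sum_over_blocks: "(\<Sum>i<m. f i) = (\<Sum>r\<le>p. \<Sum>a<d r. f (ooff r + a) :: 'b :: comm_monoid_add)"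
proof -
  have bij: "bij_betw (%x. ooff (fst x) + snd x) (SIGMA r:{..p}. {..<d r}) {..<m}"
  unfolding bij_betw_def
  proof
  show "inj_on (%x. ooff (fst x) + snd x) (SIGMA r:{..p}. {..<d r})"
  proof (rule inj_onI)
  fix x y assume xy: "x : (SIGMA r:{..p}. {..<d r})" "y : (SIGMA r:{..p}. {..<d r})"
  "ooff (fst x) + snd x = ooff (fst y) + snd y"
  then have "fst x = fst y" using lab_ooff[of "fst x" "snd x"] lab_ooff[of "fst y" "snd y"] by auto
  then show "x = y" using xy(3) by (simp add: prod_eq_iff)
  qed
  show "(%x. ooff (fst x) + snd x) ` (SIGMA r:{..p}. {..<d r}) = {..<m}"
  proof (intro equalityI subsetI)
  fix i assume "i : {..<m}"
  then have "i < m" by simp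
  then obtain r a where "r <= p" "a < d r" "i = ooff r + a" by (rule lab_cases)
  then show "i : (%x. ooff (fst x) + snd x) ` (SIGMA r:{..p}. {..<d r})"
  by (intro image_eqI[of _ _ "(r, a)"]) auto
  next
  fix i assume "i : (%x. ooff (fst x) + snd x) ` (SIGMA r:{..p}. {..<d r})"
  then show "i : {..<m}" using ooff_le by (auto, fastforce)
  qed
  qed
 have "(\<Sum>r\<le>p. \<Sum>a<d r. f (ooff r + a)) = (\<Sum>x\<in>(SIGMA r:{..p}. {..<d r}). f (ooff (fst x) + snd x))"
  by (subst sum.Sigma) (auto simp: case_prod_beta)
 then show ?thesis using sum.reindex_bij_betw[OF bij, of f] by simp
qed


lemma orth_mats_eqI:
 assumes "A : carrier_mat n n"
  "!!a a'. a < n ==> a' < n ==> (\<Sum>s<n. A $$ (a, s) * A $$ (a', s)) = (if a = a' then 1 else 0)"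
 shows "A : orth_mats n"
 using orth_mats_iff_rows[OF assms(1)] assms(2) by blast

lemma orth_mats_rows:
 "A : orth_mats n ==> a < n ==> a' < n ==> (\<Sum>s<n. A $$ (a, s) * A $$ (a', s)) = (if a = a' then 1 else 0)"
 using orth_mats_iff_rows[of A n] orth_matsD(1)[of A n] by blast

lemma sum_block_support:
 assumes r: "r <= p" and f: "!!i. i < m ==> lab i ~= r ==> f i = (0 :: real)"
 shows "(\<Sum>i<m. f i) = (\<Sum>a<d r. f (ooff r + a))"
proof -
 have z: "f (ooff s + a) = 0" if "s <= p" "s ~= r" "a < d s" for s a
  using f[of "ooff s + a"] lab_ooff[OF that(1,3)] ooff_le[OF that(1)] that by simp
 have "(\<Sum>i<m. f i) = (\<Sum>s\<le>p. \<Sum>a<d s. f (ooff s + a))" by (rule sum_over_blocks)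
 also have "\<dots> = (\<Sum>s\<le>p. if s = r then (\<Sum>a<d r. f (ooff r + a)) else 0)"
  using z by (intro sum.cong refl) auto
 also have "\<dots> = (\<Sum>a<d r. f (ooff r + a))" using r by simp
 finally show ?thesis .
qed

text \<open>All entries between different labels vanish, so inner products of rows reduce to inner
  products inside one block, and orthogonality of the whole matrix is orthogonality of its diagonal
  blocks.\<close>

lemma stab_eq_blocks:
 "stab = {diag_block_mat (map H (rev [0..<Suc p])) | H. \<forall>r\<le>p. H r : orth_mats (d r)}"
proof (intro equalityI subsetI)
 fix D assume "D : {diag_block_mat (map H (rev [0..<Suc p])) | H. \<forall>r\<le>p. H r : orth_mats (d r)}"
 then obtain H where D: "D = diag_block_mat (map H (rev [0..<Suc p]))" and H: "\<forall>r\<le>p. H r : orth_mats (d r)" by blast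
 have Hc: "H s : carrier_mat (d s) (d s)" if "s <= p" for s using H that by (auto simp: orth_mats_def)
 note e = diag_blocks_entry(2)[of H, OF Hc, folded D]
 have Dc: "D : carrier_mat m m" using diag_blocks_entry(1)[of H, OF Hc] D by simp
 have z: "D $$ (i, j) = 0" if "i < m" "j < m" "lab i ~= lab j" for i j
  using that by (elim lab_cases) (simp add: e)
 have "D : orth_mats m"
 proof (rule orth_mats_eqI[OF Dc])
  fix i j assume ij: "i < m" "j < m"
  obtain r a where i: "r <= p" "a < d r" "i = ooff r + a" "lab i = r" by (rule lab_cases[OF ij(1)])
  have 1: "(\<Sum>s<m. D $$ (i, s) * D $$ (j, s)) = (\<Sum>b<d r. D $$ (i, ooff r + b) * D $$ (j, ooff r + b))"
  by (rule sum_block_support[OF i(1)]) (use z[OF ij(1)] i(4) in auto)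
  show "(\<Sum>s<m. D $$ (i, s) * D $$ (j, s)) = (if i = j then 1 else 0)"
  proof (cases "lab j = r")
  case True
  obtain a' where j: "a' < d r" "j = ooff r + a'" using lab_cases[OF ij(2)] True by metis
  have "(\<Sum>b<d r. D $$ (i, ooff r + b) * D $$ (j, ooff r + b)) = (\<Sum>b<d r. H r $$ (a, b) * H r $$ (a', b))"
  using i j by (intro sum.cong refl) (simp add: e)
  then show ?thesis unfolding 1 using orth_mats_rows[of "H r" "d r" a a'] H i j by simp
  next
  case False
  then have "D $$ (j, ooff r + b) = 0" if "b < d r" for b
  using z[of j "ooff r + b"] ij lab_ooff[OF i(1) that] ooff_le[OF i(1)] that by simp
  then show ?thesis unfolding 1 using False i by auto
  qed
 qed
 then show "D : stab" using z by (simp add: stab_def)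
next
 fix h assume h: "h : stab"
 then have o: "h : orth_mats m" by (rule stab_orth)
 then have hc: "h : carrier_mat m m" by (rule orth_matsD)
 define H where "H r = Matrix.mat (d r) (d r) (%(a, a'). h $$ (ooff r + a, ooff r + a'))" for r
 have Hc: "H r : carrier_mat (d r) (d r)" for r by (simp add: H_def)
 have z: "h $$ (i, j) = 0" if "i < m" "j < m" "lab i ~= lab j" for i j using h that by (simp add: stab_def)
 have Ho: "H r : orth_mats (d r)" if r: "r <= p" for r
 proof (rule orth_mats_eqI[OF Hc])
  fix a a' assume a: "a < d r" "a' < d r"
  have im: "ooff r + a < m" "ooff r + a' < m" using ooff_le[OF r] a by auto
  have "(\<Sum>s<m. h $$ (ooff r + a, s) * h $$ (ooff r + a', s)) = (\<Sum>b<d r. h $$ (ooff r + a, ooff r + b) * h $$ (ooff r + a', ooff r + b))"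
  by (rule sum_block_support[OF r]) (use z[OF im(1)] lab_ooff[OF r a(1)] in auto)
  also have "\<dots> = (\<Sum>b<d r. H r $$ (a, b) * H r $$ (a', b))" using a by (simp add: H_def)
  finally show "(\<Sum>s<d r. H r $$ (a, s) * H r $$ (a', s)) = (if a = a' then 1 else 0)"
  using orth_mats_rows[OF o im] by simp
 qed
 have "diag_block_mat (map H (rev [0..<Suc p])) = h"
 proof (rule eq_matI)
  fix i j assume "i < dim_row h" "j < dim_col h"
  then have ij: "i < m" "j < m" using hc by auto
  obtain r a where i: "r <= p" "a < d r" "i = ooff r + a" "lab i = r" by (rule lab_cases[OF ij(1)])
  obtain r' a' where j: "r' <= p" "a' < d r'" "j = ooff r' + a'" "lab j = r'" by (rule lab_cases[OF ij(2)])
  show "diag_block_mat (map H (rev [0..<Suc p])) $$ (i, j) = h $$ (i, j)"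
  using diag_blocks_entry(2)[of H r a r' a', OF Hc i(1,2) j(1,2)] z[OF ij] i j by (auto simp: H_def)
 qed (use hc diag_blocks_entry(1)[of H, OF Hc] in auto)
 then show "h : {diag_block_mat (map H (rev [0..<Suc p])) | H. \<forall>r\<le>p. H r : orth_mats (d r)}"
  using Ho by blast
qed

definition rl :: "nat list" where "rl = r_list p d"

lemma rl_facts: "distinct rl" "set rl = {r : {1..p}. 0 < d r}" "length rl = g_num p d"
 by (auto simp: rl_def r_list_def g_num_def)

text \<open>Converts a family indexed by 1, ..., g into one indexed by all r in 1, ..., p. For d r =
  0 the value is the only matrix of size 0; the successor appears because list positions start at 0
  and the family at 1.\<close>

definition ofseq :: "(nat => real mat) => nat => real mat" where
 "ofseq h r = (if r : set rl then h (Suc (the_inv_into {..<length rl} ((!) rl) r)) else 1\<^sub>m 0)"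

lemma ofseq_nth: "k < length rl ==> ofseq h (rl ! k) = h (Suc k)"
 using the_inv_into_f_f[of "(!) rl" "{..<length rl}" k] rl_facts(1)
 by (simp add: ofseq_def inj_on_nth)

lemma ofseq_orth:
 assumes "\<forall>i\<in>{1..g_num p d}. h i : orth_mats (l_seq p d i)" "r : {1..p}"
 shows "ofseq h r : orth_mats (d r)"
proof (cases "r : set rl")
 case True
 then obtain k where k: "k < length rl" "r = rl ! k" by (metis in_set_conv_nth)
 then have "h (Suc k) : orth_mats (l_seq p d (Suc k))" using assms(1) rl_facts(3) by simp
 then show ?thesis using k ofseq_nth by (simp add: l_seq_def rl_def)
next
 case False
 then have "d r = 0" using assms(2) rl_facts(2) by auto
 then show ?thesis using False orth_mats_one[of 0] by (simp add: ofseq_def)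
qed

text \<open>The left side runs over all labels, the right side over the nonempty ones and the last
  block; both lists lose the same empty blocks under \<open>diag_block_mat_filter\<close>.\<close>

lemma diag_seq_blocks:
 fixes H :: "nat => real mat"
 assumes H: "!!r. r <= p ==> H r : carrier_mat (d r) (d r)"
 shows "diag_block_mat (map H (rev [0..<Suc p])) = diag_block_mat (map (%i. H (rl ! (i - 1))) (rev [1..<Suc (g_num p d)]) @ [H 0])"
proof -
 have dims: "dim_row (H s) = d s" "dim_col (H s) = d s" if "s <= p" for s using H[OF that] by auto
 have "map (%i. H (rl ! (i - 1))) [1..<Suc (g_num p d)] = map H rl"
  by (rule nth_equalityI) (simp_all add: rl_facts(3))
 then have seq: "map (%i. H (rl ! (i - 1))) (rev [1..<Suc (g_num p d)]) = map H (rev rl)"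
  by (simp only: rev_map[symmetric])
 let ?c = "%A :: real mat. 0 < dim_row A"
 have f: "filter ?c (map H rs) = map H (filter (%r. 0 < d r) rs)" if "\<forall>r\<in>set rs. r <= p" for rs
  using that by (induction rs) (auto simp: dims)
 have "rev [0..<Suc p] = rev [1..<Suc p] @ [0]" using rev_upt_split[of 0 0 "Suc p"] by simp
 then have "diag_block_mat (map H (rev [0..<Suc p])) = diag_block_mat (map H (rev [1..<Suc p]) @ [H 0])" by simp
 also have "\<dots> = diag_block_mat (filter ?c (map H (rev [1..<Suc p]) @ [H 0]))"
  by (rule diag_block_mat_filter[symmetric]) (auto simp: dims)
 also have "filter ?c (map H (rev [1..<Suc p]) @ [H 0]) = filter ?c (map H (rev rl) @ [H 0])"
  using f[of "rev [1..<Suc p]"] f[of "rev rl"] rl_facts(2) by (simp add: rev_filter[symmetric] rl_def r_list_def)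
 also have "diag_block_mat \<dots> = diag_block_mat (map H (rev rl) @ [H 0])"
 proof (rule diag_block_mat_filter)
  fix A assume "A : set (map H (rev rl) @ [H 0])"
  then consider r where "r : set rl" "A = H r" | "A = H 0" by auto
  then show "dim_col A = dim_row A"
  proof cases
  case (1 r)
  then have "r <= p" using rl_facts(2) by simp
  then show ?thesis using dims 1(2) by simp
  qed (simp add: dims)
 qed
 finally show ?thesis unfolding seq .
qed

lemma flag_group_eq: "flag_group p m d = stab"
proof (intro equalityI subsetI)
 fix D assume "D : flag_group p m d"
 then obtain h h' where D: "D = diag_block_mat (map h (rev [1..<Suc (g_num p d)]) @ [h'])"
  and h: "\<forall>i\<in>{1..g_num p d}. h i : orth_mats (l_seq p d i)" "h' : orth_mats (m - ltot p d)"
  by (auto simp: flag_group_def)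
 define H where "H r = (if r = 0 then h' else ofseq h r)" for r
 have Ho: "\<forall>r\<le>p. H r : orth_mats (d r)" using h(2) d0 ofseq_orth[OF h(1)] by (simp add: H_def)
 then have Hc: "!!r. r <= p ==> H r : carrier_mat (d r) (d r)" by (auto simp: orth_mats_def)
 have e: "map (%i. H (rl ! (i - 1))) (rev [1..<Suc (g_num p d)]) = map h (rev [1..<Suc (g_num p d)])"
 proof (rule map_cong[OF refl])
  fix i assume "i : set (rev [1..<Suc (g_num p d)])"
  then have i: "i - 1 < length rl" "i = Suc (i - 1)" by (auto simp: rl_facts(3))
  then have "rl ! (i - 1) : set rl" by simp
  then have "rl ! (i - 1) ~= 0" using rl_facts(2) by auto
  then show "H (rl ! (i - 1)) = h i" using ofseq_nth[OF i(1), of h] i(2) by (simp add: H_def)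
 qed
 have "H 0 = h'" by (simp add: H_def)
 then have "D = diag_block_mat (map H (rev [0..<Suc p]))"
  by (simp only: diag_seq_blocks[of H, OF Hc] D e)
 then show "D : stab" unfolding stab_eq_blocks using Ho by blast
next
 fix D assume "D : stab"
 then obtain H where D: "D = diag_block_mat (map H (rev [0..<Suc p]))" and H: "\<forall>r\<le>p. H r : orth_mats (d r)"
  unfolding stab_eq_blocks by blast
 then have Hc: "!!r. r <= p ==> H r : carrier_mat (d r) (d r)" by (auto simp: orth_mats_def)
 have "H (rl ! (i - 1)) : orth_mats (l_seq p d i)" if "i : {1..g_num p d}" for i
 proof -
  have "rl ! (i - 1) : set rl" using that rl_facts(3) by (intro nth_mem) auto
  then have "rl ! (i - 1) <= p" using rl_facts(2) by simp
  then have "H (rl ! (i - 1)) : orth_mats (d (rl ! (i - 1)))" using H by blast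
  then show ?thesis unfolding l_seq_def rl_def .
 qed
 moreover have "H 0 : orth_mats (m - ltot p d)" using H d0 by (metis le0)
 ultimately show "D : flag_group p m d"
  unfolding flag_group_def mem_Collect_eq D
  by (intro exI[of _ "%i. H (rl ! (i - 1))"] exI[of _ "H 0"] conjI ballI
  diag_seq_blocks[of H, OF Hc])
qed

lemma flag_class_eq: "flag_class p m d = left_orbit stab" and flag_manifold_eq: "flag_manifold p m d = FX"
 by (simp_all add: flag_group_eq flag_manifold_def FX_def OX_def)

section \<open>The group acting on normal forms\<close>

lemma sum_rows: "(\<Sum>i<nn. f i) = (\<Sum>x\<in>rset. f (ridx x) :: 'b :: comm_monoid_add)"
 using sum.reindex_bij_betw[OF ridx_bij, of f] by simp

lemma finite_rset: "finite rset"
 using bij_betw_finite[OF ridx_bij] by simp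

lemma sum_rset_fixed:
 assumes "1 <= r" "r <= p" "j < r"
  and z: "!!r' j' a'. (r', j', a') : rset ==> (r', j') ~= (r, j) ==> f (r', j', a') = (0 :: real)"
 shows "(\<Sum>x\<in>rset. f x) = (\<Sum>a<d r. f (r, j, a))"
proof -
 let ?S = "(%a. (r, j, a)) ` {..<d r}"
 have "(\<Sum>x\<in>rset. f x) = (\<Sum>x\<in>?S. f x)"
 proof (rule sum.mono_neutral_right[OF finite_rset])
  show "?S \<subseteq> rset" using assms by auto
  show "\<forall>x\<in>rset - ?S. f x = 0"
  proof
  fix x assume x: "x : rset - ?S"
  obtain r' j' a' where x': "x = (r', j', a')" by (cases x)
  have "(r', j') ~= (r, j)" using x by (auto simp: x')
  then show "f x = 0" using z[of r' j' a'] x by (simp add: x')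
  qed
 qed
 also have "\<dots> = (\<Sum>a<d r. f (r, j, a))" by (subst sum.reindex) (auto simp: inj_on_def)
 finally show ?thesis .
qed

text \<open>The block diagonal matrix in which \<open>q r\<close> is repeated r times, once for each
  shift j; by \<open>Qset_eq\<close> these are the elements of the acting group when every
  \<open>q r\<close> is orthogonal.\<close>

definition qm :: "(nat => real mat) => real mat" where
 "qm q = Matrix.mat nn nn (%(i, i'). case (dec i, dec i') of ((r, j, a), (r', j', a')) =>
  if r = r' & j = j' then q r $$ (a, a') else 0)"

lemma qm_carrier [simp]: "qm q : carrier_mat nn nn" by (simp add: qm_def)

lemma qm_entry:
 "(r, j, a) : rset ==> (r', j', a') : rset ==>
  qm q $$ (ridx (r, j, a), ridx (r', j', a')) = (if r = r' & j = j' then q r $$ (a, a') else 0)"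
 using ridx_range(3)[of r j a] ridx_range(3)[of r' j' a'] dec_ridx[of "(r, j, a)"] dec_ridx[of "(r', j', a')"]
 by (simp add: qm_def del: mem_rset)

lemma nmat_eqI:
 assumes "A : carrier_mat nn nn" "B : carrier_mat nn nn"
  and "!!x y. x : rset ==> y : rset ==> A $$ (ridx x, ridx y) = B $$ (ridx x, ridx y)"
 shows "A = B"
proof (rule eq_matI)
 fix i j assume "i < dim_row B" "j < dim_col B"
 then have "i < nn" "j < nn" using assms by auto
 then show "A $$ (i, j) = B $$ (i, j)" using assms(3) by (metis ridx_cases)
qed (use assms in auto)

lemma qm_cong: "(!!r. r : {1..p} ==> q r = q' r) ==> qm q = qm q'"
 by (rule nmat_eqI) (auto simp: qm_entry split: prod.splits)

text \<open>Left multiplication acts on each block with label r by the same matrix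
  \<open>q r\<close>, whatever the shift. All computations with the action go through this
  formula.\<close>

lemma qm_mult_entry:
 assumes A: "A : carrier_mat nn n" and r: "(r, j, a) : rset" and b: "b < n"
 shows "(qm q * A) $$ (ridx (r, j, a), b) = (\<Sum>a'<d r. q r $$ (a, a') * A $$ (ridx (r, j, a'), b))"
proof -
 have "(qm q * A) $$ (ridx (r, j, a), b) = (\<Sum>x\<in>rset. qm q $$ (ridx (r, j, a), ridx x) * A $$ (ridx x, b))"
  unfolding mult_entry[OF qm_carrier A ridx_range(3)[OF r] b] sum_rows ..
 also have "\<dots> = (\<Sum>a'<d r. qm q $$ (ridx (r, j, a), ridx (r, j, a')) * A $$ (ridx (r, j, a'), b))"
  by (rule sum_rset_fixed) (use r qm_entry in auto)
 also have "\<dots> = (\<Sum>a'<d r. q r $$ (a, a') * A $$ (ridx (r, j, a'), b))"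
  using r by (intro sum.cong refl) (simp add: qm_entry)
 finally show ?thesis .
qed

lemma qm_mult:
 assumes "!!r. r : {1..p} ==> q r : carrier_mat (d r) (d r)" "!!r. r : {1..p} ==> q' r : carrier_mat (d r) (d r)"
 shows "qm q * qm q' = qm (%r. q r * q' r)"
proof (rule nmat_eqI)
 fix x y assume xy: "x : rset" "y : rset"
 obtain r j a where x: "x = (r, j, a)" by (cases x)
 obtain r' j' a' where y: "y = (r', j', a')" by (cases y)
 have c: "q r : carrier_mat (d r) (d r)" "q' r : carrier_mat (d r) (d r)" using assms xy by (auto simp: x)
 have "(qm q * qm q') $$ (ridx x, ridx y) = (\<Sum>b<d r. q r $$ (a, b) * qm q' $$ (ridx (r, j, b), ridx y))"
  unfolding x by (rule qm_mult_entry[OF qm_carrier]) (use xy ridx_range(3) in \<open>auto simp: x y\<close>)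
 also have "\<dots> = (if r = r' & j = j' then (\<Sum>b<d r. q r $$ (a, b) * q' r $$ (b, a')) else 0)"
  using xy by (auto simp: x y qm_entry)
 also have "\<dots> = qm (%r. q r * q' r) $$ (ridx x, ridx y)"
  using xy mult_entry[OF c, of a a'] by (auto simp: x y qm_entry)
 finally show "(qm q * qm q') $$ (ridx x, ridx y) = qm (%r. q r * q' r) $$ (ridx x, ridx y)" .
qed (simp_all add: mult_carrier_mat[OF qm_carrier qm_carrier])

lemma qm_one: "qm (%r. 1\<^sub>m (d r)) = 1\<^sub>m nn"
proof (rule nmat_eqI)
 fix x y assume xy: "x : rset" "y : rset"
 then have "ridx x = ridx y \<longleftrightarrow> x = y" using inj_onD[OF ridx_inj] by blast
 then show "qm (%r. 1\<^sub>m (d r)) $$ (ridx x, ridx y) = 1\<^sub>m nn $$ (ridx x, ridx y)"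
  using xy ridx_range(3) by (cases x; cases y) (auto simp: qm_entry)
qed simp_all

text \<open>Shifts descend along the rows, so the superdiagonal of J_r, which points one block
  further, leads from shift j to j - 1; hence the condition j = Suc j'.\<close>

lemma F_mat_entry:
 assumes x: "(r, j, a) : rset" and y: "(r', j', a') : rset"
 shows "F_mat p d $$ (ridx (r, j, a), ridx (r', j', a')) = (if r = r' & j = Suc j' & a = a' then 1 else 0)"
  "F_mat p d : carrier_mat nn nn"
proof -
 define K where "K r = kronecker (Matrix.mat r r (%(i, j). if j = i + 1 then 1 else 0)) (1\<^sub>m (d r))" for r
 have F: "F_mat p d = diag_block_mat (map K (rev [1..<Suc p]))" by (simp add: F_mat_def K_def[abs_def])
 have dims: "dim_row (K s) = s * d s" "dim_col (K s) = s * d s" for s by (simp_all add: K_def kronecker_def)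
 have len: "sum_list (map dim_row (map K (rev [Suc s..<Suc p]))) = goff s" for s
  unfolding goff_def sum_list_map_rev_upt[symmetric] by (simp add: dims o_def)
 have tot: "sum_list (map dim_row (map K (rev [1..<Suc p]))) = nn" using len[of 0] goff_0 by simp
 have "map dim_col (map K (rev [1..<Suc p])) = map dim_row (map K (rev [1..<Suc p]))" by (simp add: dims)
 then show "F_mat p d : carrier_mat nn nn"
  unfolding F by (intro carrier_matI) (simp_all only: diag_block_mat_dims tot)
 have r: "1 <= r" "r <= p" "j < r" "a < d r" and r': "1 <= r'" "r' <= p" "j' < r'" "a' < d r'" using x y by auto
 have s: "rev [1..<Suc p] = rev [Suc r..<Suc p] @ r # rev [1..<r]" by (rule rev_upt_split) (use r in auto)
 let ?xs = "map K (rev [Suc r..<Suc p])" and ?ys = "map K (rev [1..<r])"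
 have L: "map K (rev [1..<Suc p]) = ?xs @ K r # ?ys" unfolding s by simp
 let ?k = "(r - 1 - j) * d r + a"
 have k: "?k < r * d r" using ridx_range(2)[OF x] by (simp add: ridx_eq)
 have e: "F_mat p d $$ (ridx (r, j, a), ridx (r', j', a')) =
  (if goff r <= ridx (r', j', a') & ridx (r', j', a') < goff r + r * d r then K r $$ (?k, ridx (r', j', a') - goff r) else 0)"
 proof -
  have "diag_block_mat (?xs @ K r # ?ys) $$ (sum_list (map dim_row ?xs) + ?k, ridx (r', j', a')) =
  (if sum_list (map dim_row ?xs) <= ridx (r', j', a') & ridx (r', j', a') < sum_list (map dim_row ?xs) + dim_row (K r)
  then K r $$ (?k, ridx (r', j', a') - sum_list (map dim_row ?xs)) else 0)"
  proof (rule diag_block_mat_row)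
  show "dim_col A = dim_row A" if "A : set (?xs @ K r # ?ys)" for A using that by (auto simp: dims)
  show "?k < dim_row (K r)" using k by (simp add: dims)
  show "ridx (r', j', a') < sum_list (map dim_row (?xs @ K r # ?ys))"
  using ridx_range(3)[OF y] unfolding L[symmetric] tot .
  qed
  then show ?thesis unfolding len dims L[symmetric] F[symmetric] ridx_eq[of r j a] .
 qed
 show "F_mat p d $$ (ridx (r, j, a), ridx (r', j', a')) = (if r = r' & j = Suc j' & a = a' then 1 else 0)"
 proof (cases "r = r'")
  case False
  then have "\<not> (goff r <= ridx (r', j', a') & ridx (r', j', a') < goff r + r * d r)"
  using ridx_same_block[OF y, of r] r by auto
  then show ?thesis using False unfolding e by (simp only: if_False) simp
 next
  case True
  let ?k' = "(r - 1 - j') * d r + a'"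
  have k': "?k' < r * d r" using ridx_range(2)[OF y] True by (simp add: ridx_eq)
  have "F_mat p d $$ (ridx (r, j, a), ridx (r', j', a')) = K r $$ (?k, ?k')"
  unfolding e using k' True by (simp add: ridx_eq)
  also have "\<dots> = (if r - 1 - j' = r - 1 - j + 1 then 1 else 0) * (if a = a' then 1 else 0)"
  using k k' r r' True by (simp add: K_def kronecker_def)
  also have "r - 1 - j' = r - 1 - j + 1 \<longleftrightarrow> j = Suc j'" using r r' True by auto
  finally show ?thesis using True by simp
 qed
qed

lemma F_mat_carrier: "F_mat p d : carrier_mat nn nn"
proof -
 define K where "K r = kronecker (Matrix.mat r r (%(i, j). if j = i + 1 then 1 else (0::real))) (1\<^sub>m (d r))" for r
 have F: "F_mat p d = diag_block_mat (map K (rev [1..<Suc p]))" by (simp add: F_mat_def K_def[abs_def])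
 have dims: "dim_row (K s) = s * d s" "dim_col (K s) = s * d s" for s by (simp_all add: K_def kronecker_def)
 have "sum_list (map dim_row (map K (rev [Suc 0..<Suc p]))) = goff 0"
  unfolding goff_def sum_list_map_rev_upt[symmetric] by (simp add: dims o_def)
 then have tot: "sum_list (map dim_row (map K (rev [1..<Suc p]))) = nn" using goff_0 by simp
 have "map dim_col (map K (rev [1..<Suc p])) = map dim_row (map K (rev [1..<Suc p]))" by (simp add: dims)
 then show ?thesis unfolding F by (intro carrier_matI) (simp_all only: diag_block_mat_dims tot)
qed

lemma sqblk_entry:
 "a < d r1 ==> b < d r2 ==> sqblk p d Q r1 j1 r2 j2 $$ (a, b) = Q $$ (ridx (r1, j1, a), ridx (r2, j2, b))"
 by (simp add: sqblk_def ridx_def)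

lemma sqblk_carrier [simp]: "sqblk p d Q r1 j1 r2 j2 : carrier_mat (d r1) (d r2)"
 by (simp add: sqblk_def)

lemma sqblk_qm:
 assumes "r1 : {1..p}" "r2 : {1..p}" "j1 < r1" "j2 < r2" "q r1 : carrier_mat (d r1) (d r1)"
 shows "sqblk p d (qm q) r1 j1 r2 j2 = (if r1 = r2 & j1 = j2 then q r1 else 0\<^sub>m (d r1) (d r2))"
 using assms by (intro eq_matI) (auto simp: sqblk_entry qm_entry sqblk_def[of _ _ _ r1 j1 r2 j2, THEN arg_cong[of _ _ dim_row]]
  sqblk_def[of _ _ _ r1 j1 r2 j2, THEN arg_cong[of _ _ dim_col]])

lemma qm_commute_F:
 assumes q: "!!r. r : {1..p} ==> q r : carrier_mat (d r) (d r)"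
 shows "qm q * F_mat p d = F_mat p d * qm q"
proof (rule nmat_eqI)
 fix x y assume xy: "x : rset" "y : rset"
 obtain r j a where x: "x = (r, j, a)" by (cases x)
 obtain r' j' a' where y: "y = (r', j', a')" by (cases y)
 note r = xy[unfolded x y]
 have "(F_mat p d * qm q) $$ (ridx x, ridx y) = (\<Sum>z\<in>rset. F_mat p d $$ (ridx x, ridx z) * qm q $$ (ridx z, ridx y))"
  unfolding mult_entry[OF F_mat_carrier qm_carrier ridx_range(3)[OF r(1), folded x] ridx_range(3)[OF r(2), folded y]] sum_rows ..
 also have "\<dots> = (\<Sum>z\<in>rset. if z = (r, j - 1, a) then (if j = 0 then 0 else qm q $$ (ridx z, ridx y)) else 0)"
  using r by (intro sum.cong refl) (auto simp: x F_mat_entry(1) split: if_splits)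
 also have "\<dots> = (if j = 0 then 0 else qm q $$ (ridx (r, j - 1, a), ridx y))"
  using r finite_rset by auto
 finally have 1: "(F_mat p d * qm q) $$ (ridx x, ridx y) = (if j = 0 then 0 else qm q $$ (ridx (r, j - 1, a), ridx y))" .
 have "(qm q * F_mat p d) $$ (ridx x, ridx y) = (\<Sum>b<d r. q r $$ (a, b) * F_mat p d $$ (ridx (r, j, b), ridx y))"
  unfolding x by (rule qm_mult_entry[OF F_mat_carrier r(1) ridx_range(3)[OF r(2), folded y]])
 also have "\<dots> = (\<Sum>b<d r. if b = a' then (if r = r' & j = Suc j' then q r $$ (a, b) else 0) else 0)"
  using r by (intro sum.cong refl) (auto simp: y F_mat_entry(1))
 also have "\<dots> = (if r = r' & j = Suc j' then q r $$ (a, a') else 0)" using r by auto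
 also have "\<dots> = (if j = 0 then 0 else qm q $$ (ridx (r, j - 1, a), ridx y))"
  using r by (auto simp: y qm_entry)
 finally show "(qm q * F_mat p d) $$ (ridx x, ridx y) = (F_mat p d * qm q) $$ (ridx x, ridx y)" using 1 by simp
qed (simp_all add: mult_carrier_mat[OF qm_carrier F_mat_carrier] mult_carrier_mat[OF F_mat_carrier qm_carrier])

text \<open>Vanishing off-diagonal blocks and equal diagonal blocks leave one orthogonal matrix for
  each r. Conversely, such a repetition commutes with F, since F only shifts j.\<close>

lemma Qset_eq: "Qset p d = {qm q | q. \<forall>r\<in>{1..p}. q r : orth_mats (d r)}"
proof (intro equalityI subsetI)
 fix Q assume Q: "Q : Qset p d"
 define q where "q r = sqblk p d Q r 0 r 0" for r
 note Q' = Q[unfolded Qset_def mem_Collect_eq]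
 have Qc: "Q : carrier_mat nn nn" using Q'[THEN conjunct1] by (simp only: nn_def)
 have off: "sqblk p d Q r1 j1 r2 j2 = 0\<^sub>m (d r1) (d r2)"
  if "r1 : {1..p}" "r2 : {1..p}" "j1 < r1" "j2 < r2" "(r1, j1) ~= (r2, j2)" for r1 j1 r2 j2
  using Q'[THEN conjunct2, THEN conjunct1] that by blast
 note QD = Q'[THEN conjunct2, THEN conjunct2, THEN conjunct2, rule_format]
 have "q r : orth_mats (d r)" if "r : {1..p}" for r
  using QD[OF that] by (simp only: q_def orth_mats_def mem_Collect_eq sqblk_carrier)
 moreover have "Q = qm q"
 proof (rule nmat_eqI[OF Qc qm_carrier])
  fix x y assume xy: "x : rset" "y : rset"
  obtain r j a where x: "x = (r, j, a)" by (cases x)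
  obtain r' j' a' where y: "y = (r', j', a')" by (cases y)
  have r: "r : {1..p}" "r' : {1..p}" "j < r" "j' < r'" "a < d r" "a' < d r'" using xy by (auto simp: x y)
  have "Q $$ (ridx x, ridx y) = sqblk p d Q r j r' j' $$ (a, a')" using r by (simp add: x y sqblk_entry)
  also have "\<dots> = (if r = r' & j = j' then q r $$ (a, a') else 0)"
  proof (cases "r = r' & j = j'")
  case True
  then show ?thesis using QD[OF r(1), THEN conjunct1, rule_format, OF r(3)] by (simp only: q_def) simp
  next
  case False
  then have "sqblk p d Q r j r' j' = 0\<^sub>m (d r) (d r')" using off[OF r(1-4)] by simp
  then show ?thesis using False r by auto
  qed
  finally show "Q $$ (ridx x, ridx y) = qm q $$ (ridx x, ridx y)" using xy by (simp add: x y qm_entry)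
 qed
 ultimately show "Q : {qm q | q. \<forall>r\<in>{1..p}. q r : orth_mats (d r)}" by blast
next
 fix Q assume "Q : {qm q | q. \<forall>r\<in>{1..p}. q r : orth_mats (d r)}"
 then obtain q where Q: "Q = qm q" and q: "\<forall>r\<in>{1..p}. q r : orth_mats (d r)" by blast
 have qc: "q r : carrier_mat (d r) (d r)" if "r : {1..p}" for r using q that by (auto simp: orth_mats_def)
 show "Q : Qset p d"
  unfolding Qset_def Q
 proof (intro CollectI conjI ballI allI impI)
  show "qm q : carrier_mat (nmin p d) (nmin p d)" using qm_carrier[of q] by (simp add: nn_def)
  show "qm q * F_mat p d = F_mat p d * qm q" by (rule qm_commute_F[OF qc])
  fix r assume r: "r : {1..p}"
  show "sqblk p d (qm q) r 0 r 0 * tr_mat (sqblk p d (qm q) r 0 r 0) = 1\<^sub>m (d r)"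
  using sqblk_qm[of r r 0 0 q] qc[OF r] r q by (simp add: orth_mats_def)
  show "sqblk p d (qm q) r j r j = sqblk p d (qm q) r 0 r 0" if "j < r" for j
  using sqblk_qm[of r r j j q] sqblk_qm[of r r 0 0 q] qc[OF r] r that by simp
  fix r2 j1 j2 assume "r2 : {1..p}" "j1 < r" "j2 < r2" "(r, j1) ~= (r2, j2)"
  then show "sqblk p d (qm q) r j1 r2 j2 = 0\<^sub>m (d r) (d r2)"
  using sqblk_qm[of r r2 j1 j2 q] qc[OF r] r by auto
 qed
qed

end

section \<open>Real vector spaces\<close>

text \<open>The additive inverse is required in the form (-1) x, so that only operations present in
  the records of the fibers occur. \<open>real_vectorspaceD\<close> returns the same list of
  laws.\<close>

lemma real_vectorspaceI:
 fixes M :: "(real, 'a) module"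
 assumes add: "!!x y. x : carrier M ==> y : carrier M ==> x \<oplus>\<^bsub>M\<^esub> y : carrier M"
  and zero: "\<zero>\<^bsub>M\<^esub> : carrier M"
  and assoc: "!!x y z. x : carrier M ==> y : carrier M ==> z : carrier M ==> (x \<oplus>\<^bsub>M\<^esub> y) \<oplus>\<^bsub>M\<^esub> z = x \<oplus>\<^bsub>M\<^esub> (y \<oplus>\<^bsub>M\<^esub> z)"
  and comm: "!!x y. x : carrier M ==> y : carrier M ==> x \<oplus>\<^bsub>M\<^esub> y = y \<oplus>\<^bsub>M\<^esub> x"
  and l_zero: "!!x. x : carrier M ==> \<zero>\<^bsub>M\<^esub> \<oplus>\<^bsub>M\<^esub> x = x"
  and l_inv: "!!x. x : carrier M ==> ((-1) \<odot>\<^bsub>M\<^esub> x) \<oplus>\<^bsub>M\<^esub> x = \<zero>\<^bsub>M\<^esub>"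
  and smult: "!!c x. x : carrier M ==> c \<odot>\<^bsub>M\<^esub> x : carrier M"
  and l_distr: "!!b c x. x : carrier M ==> (b + c) \<odot>\<^bsub>M\<^esub> x = (b \<odot>\<^bsub>M\<^esub> x) \<oplus>\<^bsub>M\<^esub> (c \<odot>\<^bsub>M\<^esub> x)"
  and r_distr: "!!c x y. x : carrier M ==> y : carrier M ==> c \<odot>\<^bsub>M\<^esub> (x \<oplus>\<^bsub>M\<^esub> y) = (c \<odot>\<^bsub>M\<^esub> x) \<oplus>\<^bsub>M\<^esub> (c \<odot>\<^bsub>M\<^esub> y)"
  and massoc: "!!b c x. x : carrier M ==> (b * c) \<odot>\<^bsub>M\<^esub> x = b \<odot>\<^bsub>M\<^esub> (c \<odot>\<^bsub>M\<^esub> x)"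
  and one: "!!x. x : carrier M ==> 1 \<odot>\<^bsub>M\<^esub> x = x"
 shows "vectorspace class_ring M"
proof -
 have "abelian_group M"
  by (rule abelian_groupI[OF add zero assoc comm l_zero]) (use smult l_inv in blast)+
 then have "Module.module class_ring M"
  by (intro moduleI VS_Connect.class_cring.is_cring) (simp_all add: class_ring_simps smult l_distr r_distr massoc one)
 then show ?thesis using VS_Connect.class_field by (simp add: vectorspace_def)
qed

lemma real_vectorspaceD:
 fixes M :: "(real, 'a) module"
 assumes "vectorspace class_ring M"
 shows "!!x y. x : carrier M ==> y : carrier M ==> x \<oplus>\<^bsub>M\<^esub> y : carrier M"
  and "\<zero>\<^bsub>M\<^esub> : carrier M"
  and "!!x y z. x : carrier M ==> y : carrier M ==> z : carrier M ==> (x \<oplus>\<^bsub>M\<^esub> y) \<oplus>\<^bsub>M\<^esub> z = x \<oplus>\<^bsub>M\<^esub> (y \<oplus>\<^bsub>M\<^esub> z)"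
  and "!!x y. x : carrier M ==> y : carrier M ==> x \<oplus>\<^bsub>M\<^esub> y = y \<oplus>\<^bsub>M\<^esub> x"
  and "!!x. x : carrier M ==> \<zero>\<^bsub>M\<^esub> \<oplus>\<^bsub>M\<^esub> x = x"
  and "!!x. x : carrier M ==> ((-1) \<odot>\<^bsub>M\<^esub> x) \<oplus>\<^bsub>M\<^esub> x = \<zero>\<^bsub>M\<^esub>"
  and "!!c x. x : carrier M ==> c \<odot>\<^bsub>M\<^esub> x : carrier M"
  and "!!b c x. x : carrier M ==> (b + c) \<odot>\<^bsub>M\<^esub> x = (b \<odot>\<^bsub>M\<^esub> x) \<oplus>\<^bsub>M\<^esub> (c \<odot>\<^bsub>M\<^esub> x)"
  and "!!c x y. x : carrier M ==> y : carrier M ==> c \<odot>\<^bsub>M\<^esub> (x \<oplus>\<^bsub>M\<^esub> y) = (c \<odot>\<^bsub>M\<^esub> x) \<oplus>\<^bsub>M\<^esub> (c \<odot>\<^bsub>M\<^esub> y)"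
  and "!!b c x. x : carrier M ==> (b * c) \<odot>\<^bsub>M\<^esub> x = b \<odot>\<^bsub>M\<^esub> (c \<odot>\<^bsub>M\<^esub> x)"
  and "!!x. x : carrier M ==> 1 \<odot>\<^bsub>M\<^esub> x = x"
proof -
 interpret vectorspace class_ring M by (rule assms)
 have R: "carrier (class_ring :: real ring) = UNIV" "!!a b. a \<oplus>\<^bsub>(class_ring :: real ring)\<^esub> b = a + b"
  "!!a b. a \<otimes>\<^bsub>(class_ring :: real ring)\<^esub> b = a * b" "\<one>\<^bsub>(class_ring :: real ring)\<^esub> = 1"
  by (simp_all add: class_ring_simps)
 show add: "!!x y. x : carrier M ==> y : carrier M ==> x \<oplus>\<^bsub>M\<^esub> y : carrier M" by (rule M.add.m_closed)
 show zero: "\<zero>\<^bsub>M\<^esub> : carrier M" by (rule M.zero_closed)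
 show as: "!!x y z. x : carrier M ==> y : carrier M ==> z : carrier M ==> (x \<oplus>\<^bsub>M\<^esub> y) \<oplus>\<^bsub>M\<^esub> z = x \<oplus>\<^bsub>M\<^esub> (y \<oplus>\<^bsub>M\<^esub> z)"
  by (rule M.add.m_assoc)
 show "!!x y. x : carrier M ==> y : carrier M ==> x \<oplus>\<^bsub>M\<^esub> y = y \<oplus>\<^bsub>M\<^esub> x" by (rule M.add.m_comm)
 show lz: "!!x. x : carrier M ==> \<zero>\<^bsub>M\<^esub> \<oplus>\<^bsub>M\<^esub> x = x" by (rule M.l_zero)
 show sm: "!!c x. x : carrier M ==> c \<odot>\<^bsub>M\<^esub> x : carrier M" using smult_closed R(1) by blast
 show ld: "!!b c x. x : carrier M ==> (b + c) \<odot>\<^bsub>M\<^esub> x = (b \<odot>\<^bsub>M\<^esub> x) \<oplus>\<^bsub>M\<^esub> (c \<odot>\<^bsub>M\<^esub> x)"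
  using smult_l_distr unfolding R by blast
 show "!!c x y. x : carrier M ==> y : carrier M ==> c \<odot>\<^bsub>M\<^esub> (x \<oplus>\<^bsub>M\<^esub> y) = (c \<odot>\<^bsub>M\<^esub> x) \<oplus>\<^bsub>M\<^esub> (c \<odot>\<^bsub>M\<^esub> y)"
  using smult_r_distr unfolding R by blast
 show "!!b c x. x : carrier M ==> (b * c) \<odot>\<^bsub>M\<^esub> x = b \<odot>\<^bsub>M\<^esub> (c \<odot>\<^bsub>M\<^esub> x)"
  using smult_assoc1 unfolding R by blast
 show on: "!!x. x : carrier M ==> 1 \<odot>\<^bsub>M\<^esub> x = x" using smult_one unfolding R by blast
 have z: "0 \<odot>\<^bsub>M\<^esub> x = \<zero>\<^bsub>M\<^esub>" if x: "x : carrier M" for x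
 proof -
  have "0 \<odot>\<^bsub>M\<^esub> x \<oplus>\<^bsub>M\<^esub> 0 \<odot>\<^bsub>M\<^esub> x = 0 \<odot>\<^bsub>M\<^esub> x" using ld[OF x, of 0 0] by simp
  then show ?thesis using M.add.r_cancel_one[OF sm[OF x, of 0] sm[OF x, of 0]] by simp
 qed
 show "!!x. x : carrier M ==> ((-1) \<odot>\<^bsub>M\<^esub> x) \<oplus>\<^bsub>M\<^esub> x = \<zero>\<^bsub>M\<^esub>"
 proof -
  fix x assume x: "x : carrier M"
  show "((-1) \<odot>\<^bsub>M\<^esub> x) \<oplus>\<^bsub>M\<^esub> x = \<zero>\<^bsub>M\<^esub>" using ld[OF x, of "-1" 1] on[OF x] z[OF x] by simp
 qed
qed

text \<open>Vector space laws pass along any bijection compatible with the operations. The fibers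
  get their laws this way from the model of matrix tuples, and set-level addition of classes never
  has to be handled directly.\<close>

lemma transfer_vectorspace:
 fixes M :: "(real, 'a) module" and N :: "(real, 'b) module"
 assumes N: "vectorspace class_ring N" and \<rho>: "bij_betw \<rho> (carrier N) (carrier M)"
  and add: "!!x y. x : carrier N ==> y : carrier N ==> \<rho> x \<oplus>\<^bsub>M\<^esub> \<rho> y = \<rho> (x \<oplus>\<^bsub>N\<^esub> y)"
  and zero: "\<zero>\<^bsub>M\<^esub> = \<rho> \<zero>\<^bsub>N\<^esub>"
  and smult: "!!c x. x : carrier N ==> c \<odot>\<^bsub>M\<^esub> \<rho> x = \<rho> (c \<odot>\<^bsub>N\<^esub> x)"
 shows "vectorspace class_ring M"
proof -
 note ND = real_vectorspaceD[OF N]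
 have ex: "\<exists>z\<in>carrier N. x = \<rho> z" if "x : carrier M" for x
  using bij_betw_imp_surj_on[OF \<rho>] that by blast
 have mem: "\<rho> z : carrier M" if "z : carrier N" for z using bij_betwE[OF \<rho>] that by blast
 show ?thesis
 proof (rule real_vectorspaceI)
  show "x \<oplus>\<^bsub>M\<^esub> y : carrier M" if "x : carrier M" "y : carrier M" for x y
  using ex[OF that(1)] ex[OF that(2)] add mem ND(1) by auto
  show "\<zero>\<^bsub>M\<^esub> : carrier M" using zero mem ND(2) by simp
  show "(x \<oplus>\<^bsub>M\<^esub> y) \<oplus>\<^bsub>M\<^esub> z = x \<oplus>\<^bsub>M\<^esub> (y \<oplus>\<^bsub>M\<^esub> z)" if "x : carrier M" "y : carrier M" "z : carrier M" for x y z
  using ex[OF that(1)] ex[OF that(2)] ex[OF that(3)] add ND(1,3) by auto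
  show "x \<oplus>\<^bsub>M\<^esub> y = y \<oplus>\<^bsub>M\<^esub> x" if "x : carrier M" "y : carrier M" for x y
  using ex[OF that(1)] ex[OF that(2)] add ND(4) by auto
  show "\<zero>\<^bsub>M\<^esub> \<oplus>\<^bsub>M\<^esub> x = x" if "x : carrier M" for x
  using ex[OF that] add zero ND(2,5) by auto
  show "(-1) \<odot>\<^bsub>M\<^esub> x \<oplus>\<^bsub>M\<^esub> x = \<zero>\<^bsub>M\<^esub>" if "x : carrier M" for x
  using ex[OF that] add zero smult ND(6,7) by auto
  show "c \<odot>\<^bsub>M\<^esub> x : carrier M" if "x : carrier M" for c x
  using ex[OF that] smult mem ND(7) by auto
  show "(b + c) \<odot>\<^bsub>M\<^esub> x = b \<odot>\<^bsub>M\<^esub> x \<oplus>\<^bsub>M\<^esub> c \<odot>\<^bsub>M\<^esub> x" if "x : carrier M" for b c x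
  using ex[OF that] smult add ND(7,8) by auto
  show "c \<odot>\<^bsub>M\<^esub> (x \<oplus>\<^bsub>M\<^esub> y) = c \<odot>\<^bsub>M\<^esub> x \<oplus>\<^bsub>M\<^esub> c \<odot>\<^bsub>M\<^esub> y" if "x : carrier M" "y : carrier M" for c x y
  using ex[OF that(1)] ex[OF that(2)] smult add ND(1,7,9) by auto
  show "(b * c) \<odot>\<^bsub>M\<^esub> x = b \<odot>\<^bsub>M\<^esub> (c \<odot>\<^bsub>M\<^esub> x)" if "x : carrier M" for b c x
  using ex[OF that] smult ND(7,10) by auto
  show "1 \<odot>\<^bsub>M\<^esub> x = x" if "x : carrier M" for x
  using ex[OF that] smult ND(11) by auto
 qed
qed

lemma direct_sum_vectorspace:
 assumes M: "!!i. i : I ==> vectorspace class_ring (M i)"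
 shows "vectorspace class_ring (direct_sum_module I M)"
proof -
 note D = real_vectorspaceD[OF M]
 show ?thesis
  by (rule real_vectorspaceI)
  (use D in \<open>auto simp: direct_sum_module_def PiE_iff fun_eq_iff restrict_def extensional_def\<close>)
qed

context blocks
begin

section \<open>The space of normal forms\<close>

definition toprow :: "nat => nat" where
 "toprow i = ridx (lab i, 0, i - ooff (lab i))"

text \<open>The blocks of G with shift 0, placed like the upper rows of an orthogonal matrix, with
  zeros for the rows that G leaves open. Its size m by m makes \<open>sect\<close> and
  \<open>sdom\<close> applicable.\<close>

definition top :: "real mat => real mat" where
 "top G = Matrix.mat m m (%(i, b). if i < ltot p d then G $$ (toprow i, b) else 0)"

lemma toprow_ooff: "r <= p ==> a < d r ==> toprow (ooff r + a) = ridx (r, 0, a)"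
 using lab_ooff by (simp add: toprow_def)

lemma ooff_ltot: "1 <= r ==> r <= p ==> a < d r ==> ooff r + a < ltot p d"
 using ooff_mono[of 0 r] ooff_0 by simp

lemma ltot_cases:
 assumes "i < ltot p d" obtains r a where "1 <= r" "r <= p" "a < d r" "i = ooff r + a" "lab i = r"
proof -
 have im: "i < m" using assms ltot_le by simp
 obtain r a where *: "r <= p" "a < d r" "i = ooff r + a" "lab i = r" by (rule lab_cases[OF im])
 then have "1 <= r" using lab_pos[OF im] assms by simp
 with * that show thesis by blast
qed

lemma top_carrier [simp]: "top G : carrier_mat m m" by (simp add: top_def)

lemma top_entry: "1 <= r ==> r <= p ==> a < d r ==> b < m ==> top G $$ (ooff r + a, b) = G $$ (ridx (r, 0, a), b)"
 using ooff_ltot[of r a] ltot_le toprow_ooff[of r a] by (simp add: top_def)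

lemma zero_part_top:
 assumes "G : carrier_mat n m" "i < ltot p d" "b < m"
 shows "zero_part p d G $$ (i, b) = top G $$ (i, b)"
 using assms(2) by (elim ltot_cases) (simp add: zero_part_entry[OF assms(1) _ _ _ assms(3)] top_entry assms(3))

lemma zero_part_eq_iff:
 assumes G: "G : carrier_mat n m" and H: "H : carrier_mat n m"
 shows "zero_part p d G = zero_part p d H \<longleftrightarrow> top G = top H"
proof
 have c: "zero_part p d G : carrier_mat (ltot p d) m" "zero_part p d H : carrier_mat (ltot p d) m"
  using zero_part_carrier G H by auto
 show "top G = top H" if "zero_part p d G = zero_part p d H"
 proof (rule eq_matI)
  fix i b assume "i < dim_row (top H)" "b < dim_col (top H)"
  then have ib: "i < m" "b < m" by (auto simp: top_def)
  show "top G $$ (i, b) = top H $$ (i, b)"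
  using zero_part_top[OF G _ ib(2), of i] zero_part_top[OF H _ ib(2), of i] that ib
  by (cases "i < ltot p d") (simp_all add: top_def)
 qed (simp_all add: top_def)
 show "zero_part p d G = zero_part p d H" if "top G = top H"
  by (rule eq_matI) (use c zero_part_top[OF G] zero_part_top[OF H] that in auto)
qed

definition GOX :: "real mat set" where "GOX = GO p m d"

text \<open>An entrywise form. The integer condition l > max(0, r - r' - 1) becomes l > 0 together
  with r <= r' + l, where r' is the label of row j.\<close>

lemma GO_iff:
 "G : GOX \<longleftrightarrow> G : carrier_mat nn m &
  (\<forall>i<ltot p d. \<forall>j<ltot p d. (\<Sum>b<m. top G $$ (i, b) * top G $$ (j, b)) = (if i = j then 1 else 0)) &
  (\<forall>r l a j. (r, l, a) : rset --> 0 < l --> j < ltot p d --> r <= lab j + l -->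
  (\<Sum>b<m. G $$ (ridx (r, l, a), b) * top G $$ (j, b)) = 0)"
proof (cases "G : carrier_mat nn m")
 case False
 then show ?thesis by (auto simp: GOX_def GO_def nn_def)
next
 case True
 let ?Z = "zero_part p d G"
 have Zc: "?Z : carrier_mat (ltot p d) m" by (rule zero_part_carrier[OF True])
 have A: "?Z * tr_mat ?Z = 1\<^sub>m (ltot p d) \<longleftrightarrow>
  (\<forall>i<ltot p d. \<forall>j<ltot p d. (\<Sum>b<m. top G $$ (i, b) * top G $$ (j, b)) = (if i = j then 1 else 0))"
  (is "_ \<longleftrightarrow> ?A")
 proof -
  have e: "(?Z * tr_mat ?Z) $$ (i, j) = (\<Sum>b<m. top G $$ (i, b) * top G $$ (j, b))"
  if "i < ltot p d" "j < ltot p d" for i j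
  unfolding mult_transpose_entry[OF Zc Zc that] using zero_part_top[OF True] that by simp
  show ?thesis
  proof
  show ?A if "?Z * tr_mat ?Z = 1\<^sub>m (ltot p d)" using e that by (metis index_one_mat(1))
  show "?Z * tr_mat ?Z = 1\<^sub>m (ltot p d)" if ?A
  by (rule eq_matI) (use e that Zc in auto)
  qed
 qed
 have e: "(rblk p d G \<rho> l * tr_mat (rblk p d G \<rho>' 0)) $$ (a, a') = (\<Sum>b<m. G $$ (ridx (\<rho>, l, a), b) * top G $$ (ooff \<rho>' + a', b))"
  if "a < d \<rho>" "a' < d \<rho>'" "1 <= \<rho>'" "\<rho>' <= p" for \<rho> l \<rho>' a a'
  unfolding mult_transpose_entry[OF rblk_carrier[OF True] rblk_carrier[OF True] that(1,2)]
  using that rblk_entry[OF True] by (simp add: top_entry)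
 have "(\<forall>\<rho>\<in>{1..p}. \<forall>\<rho>\<^sub>1\<in>{1..p}. \<forall>l<\<rho>. int l > max 0 (int \<rho> - int \<rho>\<^sub>1 - 1) -->
  rblk p d G \<rho> l * tr_mat (rblk p d G \<rho>\<^sub>1 0) = 0\<^sub>m (d \<rho>) (d \<rho>\<^sub>1)) \<longleftrightarrow>
  (\<forall>r l a j. (r, l, a) : rset --> 0 < l --> j < ltot p d --> r <= lab j + l -->
  (\<Sum>b<m. G $$ (ridx (r, l, a), b) * top G $$ (j, b)) = 0)" (is "?L \<longleftrightarrow> ?R")
 proof
  assume L: ?L
  show ?R
  proof (intro allI impI)
  fix r l a j assume r: "(r, l, a) : rset" "0 < l" "j < ltot p d" "r <= lab j + l"
  obtain r' a' where j: "1 <= r'" "r' <= p" "a' < d r'" "j = ooff r' + a'" "lab j = r'" by (rule ltot_cases[OF r(3)])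
  have "int l > max 0 (int r - int r' - 1)" using r(2,4) j(5) by linarith
  then have "rblk p d G r l * tr_mat (rblk p d G r' 0) = 0\<^sub>m (d r) (d r')"
  using L r(1) j by auto
  then show "(\<Sum>b<m. G $$ (ridx (r, l, a), b) * top G $$ (j, b)) = 0"
  using e[of a r a' r' l] r(1) j by simp
  qed
 next
  assume R: ?R
  show ?L
  proof (intro ballI allI impI)
  fix r r' l assume r: "r : {1..p}" "r' : {1..p}" "l < r" "max 0 (int r - int r' - 1) < int l"
  show "rblk p d G r l * tr_mat (rblk p d G r' 0) = 0\<^sub>m (d r) (d r')"
  proof (rule eq_matI)
  fix a a' assume "a < dim_row (0\<^sub>m (d r) (d r') :: real mat)" "a' < dim_col (0\<^sub>m (d r) (d r') :: real mat)"
  then have aa: "a < d r" "a' < d r'" by auto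
  have l: "lab (ooff r' + a') = r'" using lab_ooff aa r by simp
  have "(\<Sum>b<m. G $$ (ridx (r, l, a), b) * top G $$ (ooff r' + a', b)) = 0"
  using R[rule_format, of r l a "ooff r' + a'"] r aa ooff_ltot[of r' a'] l by auto
  then show "(rblk p d G r l * tr_mat (rblk p d G r' 0)) $$ (a, a') = 0\<^sub>m (d r) (d r') $$ (a, a')"
  using e[of a r a' r' l] aa r by simp
  qed (simp_all add: rblk_def)
  qed
 qed
 then show ?thesis unfolding GOX_def GO_def mem_Collect_eq using A True by (simp add: nn_def)
qed

lemma GO_carrier: "G : GOX ==> G : carrier_mat nn m" by (simp add: GO_iff)

definition agrees :: "real mat => real mat => bool" where
 "agrees Om G \<longleftrightarrow> (\<forall>i<ltot p d. \<forall>b<m. Om $$ (i, b) = top G $$ (i, b))"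

lemma agrees_blocks:
 "agrees Om G \<longleftrightarrow> (\<forall>r a b. 1 <= r --> r <= p --> a < d r --> b < m --> Om $$ (ooff r + a, b) = G $$ (ridx (r, 0, a), b))"
proof
 show "agrees Om G ==> \<forall>r a b. 1 <= r --> r <= p --> a < d r --> b < m --> Om $$ (ooff r + a, b) = G $$ (ridx (r, 0, a), b)"
  using ooff_ltot top_entry by (auto simp: agrees_def)
 assume *: "\<forall>r a b. 1 <= r --> r <= p --> a < d r --> b < m --> Om $$ (ooff r + a, b) = G $$ (ridx (r, 0, a), b)"
 show "agrees Om G"
  unfolding agrees_def
 proof (intro allI impI)
  fix i b assume i: "i < ltot p d" and b: "b < m"
  obtain r a where "1 <= r" "r <= p" "a < d r" "i = ooff r + a" by (rule ltot_cases[OF i])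
  then show "Om $$ (i, b) = top G $$ (i, b)" using * b by (simp add: top_entry)
 qed
qed

text \<open>Rows are added one at a time: fewer than m rows, padded by zero rows, form a singular
  square matrix, and a normalized kernel vector is orthogonal to all of them.\<close>

lemma extend_orthonormal:
 fixes R :: "nat => nat => real"
 assumes "k <= m" "!!i j. i < k ==> j < k ==> (\<Sum>b<m. R i b * R j b) = (if i = j then 1 else 0)"
 shows "\<exists>R'. (\<forall>i<k. \<forall>b<m. R' i b = R i b) & (\<forall>i<m. \<forall>j<m. (\<Sum>b<m. R' i b * R' j b) = (if i = j then 1 else 0))"
 using assms
proof (induction "m - k" arbitrary: k R)
 case 0
 then have "k = m" by simp
 then show ?case using 0(3) by (intro exI[of _ R]) auto
next
 case (Suc n)
 then have k: "k < m" by simp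
 \<comment> \<open>Row k is zero since k < m, which forces the determinant to vanish.\<close>
 let ?A = "Matrix.mat m m (%(i, j). if i < k then R i j else 0)"
 have Ac: "?A : carrier_mat m m" by simp
 have "mdet ?A = 0"
 proof (rule ccontr)
  assume "mdet ?A ~= 0"
  then have "(if k = k then 1 else (0::real)) = 0"
  by (rule det_nonzero_imp_rows_independent[OF Ac, of "%i. if i = k then 1 else 0" k])
  (use k in \<open>auto intro!: sum.neutral\<close>)
  then show False by simp
 qed
 then obtain v where v: "v : carrier_vec m" "v ~= 0\<^sub>v m" "?A *\<^sub>v v = 0\<^sub>v m"
  using det_0_iff_vec_prod_zero[OF Ac] by blast
 define x where "x b = vec_index v b" for b
 have perp: "(\<Sum>b<m. R i b * x b) = 0" if "i < k" for i
 proof -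
  have "vec_index (?A *\<^sub>v v) i = vec_index (0\<^sub>v m) i" using v(3) by simp
  then show ?thesis using that k v(1) by (auto simp: scalar_prod_def x_def lessThan_atLeast0)
 qed
 have "\<exists>b<m. x b ~= 0"
 proof (rule ccontr)
  assume "\<not> (\<exists>b<m. x b ~= 0)"
  then have "v = 0\<^sub>v m" using v(1) by (intro eq_vecI) (auto simp: x_def)
  then show False using v(2) by simp
 qed
 then have N: "(\<Sum>b<m. x b * x b) > 0" using bil_std_form_pos[of _ m x] by (auto simp: bil_std_form)
 define N where "N = (\<Sum>b<m. x b * x b)"
 define R1 where "R1 i b = (if i = k then x b / sqrt N else R i b)" for i b
 have Nk: "(\<Sum>b<m. x b / sqrt N * (x b / sqrt N)) = 1"
 proof -
  have N0: "N > 0" using N by (simp add: N_def)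
  then have "sqrt N * sqrt N = N" by simp
  then have "(\<Sum>b<m. x b / sqrt N * (x b / sqrt N)) = (\<Sum>b<m. x b * x b) / N"
  unfolding sum_divide_distrib by (intro sum.cong refl) (metis times_divide_times_eq)
  then show ?thesis using N0 by (simp add: N_def)
 qed
 have p1: "(\<Sum>b<m. R i b * (x b / sqrt N)) = 0" "(\<Sum>b<m. (x b / sqrt N) * R i b) = 0" if "i < k" for i
  using perp[OF that] by (simp_all add: sum_divide_distrib[symmetric] mult.commute)
 have orth: "(\<Sum>b<m. R1 i b * R1 j b) = (if i = j then 1 else 0)" if "i < Suc k" "j < Suc k" for i j
  using that Suc.prems(2)[of i j] Nk p1[of i] p1[of j] by (auto simp: R1_def less_Suc_eq)
 have "n = m - Suc k" "Suc k <= m" using Suc.hyps(2) k by auto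
 from Suc.hyps(1)[OF this orth] obtain R' where R': "\<forall>i<Suc k. \<forall>b<m. R' i b = R1 i b"
  "\<forall>i<m. \<forall>j<m. (\<Sum>b<m. R' i b * R' j b) = (if i = j then 1 else 0)" by blast
 then show ?case by (intro exI[of _ R']) (simp add: R1_def)
qed

lemma agrees_exists:
 assumes G: "G : GOX" obtains Om where "Om : orth_mats m" "agrees Om G"
proof -
 have "(\<Sum>b<m. top G $$ (i, b) * top G $$ (j, b)) = (if i = j then 1 else 0)" if "i < ltot p d" "j < ltot p d" for i j
  using G that by (simp add: GO_iff)
 from extend_orthonormal[OF ltot_le this] obtain R where
  R: "\<forall>i<ltot p d. \<forall>b<m. R i b = top G $$ (i, b)" "\<forall>i<m. \<forall>j<m. (\<Sum>b<m. R i b * R j b) = (if i = j then 1 else 0)"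
  by blast
 let ?O = "Matrix.mat m m (%(i, b). R i b)"
 have "?O : orth_mats m" by (rule orth_mats_eqI) (use R(2) in auto)
 moreover have "agrees ?O G" using R(1) ltot_le by (auto simp: agrees_def)
 ultimately show thesis by (rule that)
qed

lemma orth_expand:
 assumes s: "s : orth_mats m" and b: "b < m"
 shows "(\<Sum>i<m. (\<Sum>c<m. v c * s $$ (i, c)) * s $$ (i, b)) = v b"
proof -
 have sc: "s : carrier_mat m m" using s by (rule orth_matsD)
 have col: "(\<Sum>i<m. s $$ (i, c) * s $$ (i, b)) = (if c = b then 1 else 0)" if "c < m" for c
 proof -
  have "(tr_mat s * s) $$ (c, b) = (\<Sum>i<m. s $$ (i, c) * s $$ (i, b))"
  using sc b that by (subst mult_entry[of _ m m _ m]) auto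
  then show ?thesis using orth_mats_transpose_mult[OF s] b that by simp
 qed
 have "(\<Sum>i<m. (\<Sum>c<m. v c * s $$ (i, c)) * s $$ (i, b)) = (\<Sum>i<m. \<Sum>c<m. v c * (s $$ (i, c) * s $$ (i, b)))"
  by (simp add: sum_distrib_right mult.assoc)
 also have "\<dots> = (\<Sum>c<m. v c * (\<Sum>i<m. s $$ (i, c) * s $$ (i, b)))"
  by (subst sum.swap) (simp add: sum_distrib_left)
 also have "\<dots> = (\<Sum>c<m. if c = b then v c else 0)" using col by (intro sum.cong refl) simp
 finally show ?thesis using b by simp
qed

text \<open>Expand the row in the orthonormal basis s. The coefficients at rows with label at least
  r - l vanish by the orthogonality conditions, and the rows with smaller label are the last
  \<open>wid (r - l)\<close> ones. So the inner products with those rows are the coefficients of a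
  representation.\<close>

lemma GO_expand:
 assumes s: "s : orth_mats m" and G: "G : GOX" and ag: "agrees s G" and r: "(r, l, a) : rset" and l: "0 < l" and b: "b < m"
 shows "(\<Sum>t<wid (r - l). (\<Sum>c<m. G $$ (ridx (r, l, a), c) * s $$ (m - wid (r - l) + t, c)) * s $$ (m - wid (r - l) + t, b))
  = G $$ (ridx (r, l, a), b)"
proof -
 let ?w = "wid (r - l)" and ?f = "%i. (\<Sum>c<m. G $$ (ridx (r, l, a), c) * s $$ (i, c)) * s $$ (i, b)"
 have rl: "1 <= r - l" "r - l <= Suc p" using r by auto
 have w: "?w <= m" by (rule wid_le[OF rl(2)])
 have z: "?f i = 0" if i: "i < m - ?w" for i
 proof -
  have im: "i < m" and nl: "\<not> lab i < r - l" using lab_less_iff[of i "r - l"] rl i by auto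
  then have "0 < lab i" using rl(1) by simp
  then have il: "i < ltot p d" using lab_pos[OF im] by simp
  have "r <= lab i + l" using nl by simp
  then have "(\<Sum>b<m. G $$ (ridx (r, l, a), b) * top G $$ (i, b)) = 0" 
  by (rule G[unfolded GO_iff, THEN conjunct2, THEN conjunct2, rule_format, OF r l il])
  moreover have "(\<Sum>c<m. G $$ (ridx (r, l, a), c) * s $$ (i, c)) = (\<Sum>b<m. G $$ (ridx (r, l, a), b) * top G $$ (i, b))"
  using ag il by (intro sum.cong refl) (simp add: agrees_def)
  ultimately show ?thesis by simp
 qed
 have "G $$ (ridx (r, l, a), b) = (\<Sum>i<m. ?f i)" using orth_expand[OF s b, of "%c. G $$ (ridx (r, l, a), c)"] by simp
 moreover have "(\<Sum>i<m. ?f i) = (\<Sum>i\<in>{m - ?w..<m}. ?f i)"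
 proof (rule sum.mono_neutral_right)
  show "\<forall>i\<in>{..<m} - {m - ?w..<m}. ?f i = 0"
  proof
  fix i assume "i : {..<m} - {m - ?w..<m}"
  then have "i < m - ?w" by auto
  then show "?f i = 0" by (rule z)
  qed
 qed auto
 moreover have "(\<Sum>i\<in>{m - ?w..<m}. ?f i) = (\<Sum>t<?w. ?f (m - ?w + t))"
  using sum.shift_bounds_nat_ivl[of ?f 0 "m - ?w" ?w] w by (simp add: lessThan_atLeast0 add.commute)
 ultimately show ?thesis by simp
qed

lemma GO_perp:
 assumes s: "s : orth_mats m" and j: "j < m - wid (r - l)" and t: "t < wid (r - l)" and rl: "l < r" "r <= p"
 shows "(\<Sum>b<m. s $$ (m - wid (r - l) + t, b) * s $$ (j, b)) = 0"
proof -
 have "wid (r - l) <= m" using rl by (intro wid_le) auto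
 then show ?thesis using orth_mats_rows[OF s, of "m - wid (r - l) + t" j] j t by simp
qed

section \<open>Coordinates of the fibers\<close>

text \<open>For each r the matrices C_{r,1}, ..., C_{r,r-1} are glued side by side into one matrix
  of width \<open>fiber_width d r\<close>; this is the first column of C_{r,l}. \<open>cdec\<close>
  inverts the column numbering.\<close>

definition coff :: "nat => nat => nat" where "coff r l = (\<Sum>k=1..<l. wid (r - k))"

lemma fiber_width_eq: "fiber_width d r = (\<Sum>k=1..<r. wid (r - k))"
proof -
 have "fiber_width d r = (\<Sum>k=1..r - 1. wid (r - k))"
  unfolding fiber_width_def wid_def
 proof (rule sum.cong[OF refl])
  fix k assume "k : {1..r - 1}"
  then have "{0..r - k - 1} = {..<r - k}" by auto
  then show "(\<Sum>j=0..r - k - 1. d j) = (\<Sum>j<r - k. d j)" by simp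
 qed
 also have "{1..r - 1} = {1..<r}" by auto
 finally show ?thesis .
qed

definition cset :: "nat => (nat \<times> nat) set" where
 "cset r = (SIGMA l:{1..<r}. {..<wid (r - l)})"

lemma coff_mono: "1 <= l ==> l < l' ==> coff r l + wid (r - l) <= coff r l'"
proof -
 assume l: "1 <= l" "l < l'"
 then have "coff r l + wid (r - l) = (\<Sum>k=1..<Suc l. wid (r - k))" by (simp add: coff_def)
 also have "\<dots> <= coff r l'" unfolding coff_def using l by (intro sum_mono2) auto
 finally show ?thesis .
qed

lemma coff_bij: "bij_betw (%(l, t). coff r l + t) (cset r) {..<fiber_width d r}"
proof -
 let ?f = "%(l, t). coff r l + t"
 have inj: "inj_on ?f (cset r)"
 proof (rule inj_onI)
  fix x y assume xy: "x : cset r" "y : cset r" "?f x = ?f y"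
  obtain l t where x: "x = (l, t)" by (cases x)
  obtain l' t' where y: "y = (l', t')" by (cases y)
  show "x = y" using xy coff_mono[of l l' r] coff_mono[of l' l r]
  by (cases l l' rule: linorder_cases) (auto simp: x y cset_def)
 qed
 have "?f ` cset r \<subseteq> {..<fiber_width d r}"
 proof
  fix c assume "c : ?f ` cset r"
  then obtain l t where lt: "1 <= l" "l < r" "t < wid (r - l)" "c = coff r l + t" by (auto simp: cset_def)
  have "coff r l + wid (r - l) <= coff r r" by (rule coff_mono) (use lt in auto)
  then show "c : {..<fiber_width d r}" using lt by (simp add: coff_def fiber_width_eq)
 qed
 moreover have "card (?f ` cset r) = card {..<fiber_width d r}"
  unfolding card_image[OF inj] by (simp add: cset_def fiber_width_eq card_SigmaI)
 ultimately have "?f ` cset r = {..<fiber_width d r}" by (intro card_subset_eq) auto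
 then show ?thesis using inj by (simp add: bij_betw_def)
qed

definition cdec :: "nat => nat => nat \<times> nat" where "cdec r = inv_into (cset r) (%(l, t). coff r l + t)"

lemma cdec_coff: "1 <= l ==> l < r ==> t < wid (r - l) ==> cdec r (coff r l + t) = (l, t)"
 using inv_into_f_f[OF bij_betw_imp_inj_on[OF coff_bij], of "(l, t)" r] by (simp add: cdec_def cset_def)

lemma coff_less: "1 <= l ==> l < r ==> t < wid (r - l) ==> coff r l + t < fiber_width d r"
 using bij_betwE[OF coff_bij, of r] by (auto simp: cset_def)

lemma coff_cases:
 assumes "c < fiber_width d r" obtains l t where "1 <= l" "l < r" "t < wid (r - l)" "c = coff r l + t" "cdec r c = (l, t)"
proof -
 have "c : (%(l, t). coff r l + t) ` cset r" using bij_betw_imp_surj_on[OF coff_bij, of r] assms by simp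
 then obtain l t where lt: "1 <= l" "l < r" "t < wid (r - l)" "c = coff r l + t" by (auto simp: cset_def)
 then show thesis using that cdec_coff by blast
qed

definition VC :: "(nat => real mat) set" where "VC = carrier (model_fiber_module p d)"

lemma VC_eq: "VC = (\<Pi>\<^sub>E r\<in>{1..p}. carrier_mat (d r) (fiber_width d r))"
 by (simp add: VC_def model_fiber_module_def direct_sum_module_def module_mat_simps)

lemma VC_eqI:
 assumes "C : VC" "D : VC"
  "!!r l t a. 1 <= l ==> l < r ==> r <= p ==> a < d r ==> t < wid (r - l) ==> C r $$ (a, coff r l + t) = D r $$ (a, coff r l + t)"
 shows "C = D"
proof (rule PiE_ext[OF assms(1,2)[unfolded VC_eq]])
 fix r assume r: "r : {1..p}"
 then have c: "C r : carrier_mat (d r) (fiber_width d r)" "D r : carrier_mat (d r) (fiber_width d r)"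
  using assms(1,2) by (auto simp: VC_eq)
 show "C r = D r"
 proof (rule eq_matI)
  fix a e assume "a < dim_row (D r)" "e < dim_col (D r)"
  then have ae: "a < d r" "e < fiber_width d r" using c by auto
  obtain l t where "1 <= l" "l < r" "t < wid (r - l)" "e = coff r l + t" by (rule coff_cases[OF ae(2)])
  then show "C r $$ (a, e) = D r $$ (a, e)" using assms(3) ae r by simp
 qed (use c in auto)
qed

text \<open>The normal form represented by frame s and coefficients C. \<open>Cof\<close> takes
  inner products with the last rows of s and is its inverse on normal forms with frame s.\<close>

definition Gof :: "real mat => (nat => real mat) => real mat" where
 "Gof s C = gmat (%r l a b. if l = 0 then s $$ (ooff r + a, b)
  else (\<Sum>t<wid (r - l). C r $$ (a, coff r l + t) * s $$ (m - wid (r - l) + t, b)))"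

definition Cof :: "real mat => real mat => nat => real mat" where
 "Cof s G = (\<lambda>r\<in>{1..p}. Matrix.mat (d r) (fiber_width d r)
  (%(a, c). case cdec r c of (l, t) => \<Sum>b<m. G $$ (ridx (r, l, a), b) * s $$ (m - wid (r - l) + t, b)))"

lemma Cof_VC: "Cof s G : VC" by (auto simp: VC_eq Cof_def)

lemma Cof_entry:
 "1 <= l ==> l < r ==> r <= p ==> a < d r ==> t < wid (r - l) ==>
  Cof s G r $$ (a, coff r l + t) = (\<Sum>b<m. G $$ (ridx (r, l, a), b) * s $$ (m - wid (r - l) + t, b))"
 using coff_less[of l r t] cdec_coff[of l r t] by (simp add: Cof_def)

lemma Gof_carrier [simp]: "Gof s C : carrier_mat nn m" by (simp add: Gof_def)

lemma Gof_entry0: "1 <= r ==> r <= p ==> a < d r ==> b < m ==> Gof s C $$ (ridx (r, 0, a), b) = s $$ (ooff r + a, b)"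
 unfolding Gof_def by (subst gmat_entry) auto

lemma Gof_entry:
 "(r, l, a) : rset ==> 0 < l ==> b < m ==>
  Gof s C $$ (ridx (r, l, a), b) = (\<Sum>t<wid (r - l). C r $$ (a, coff r l + t) * s $$ (m - wid (r - l) + t, b))"
 unfolding Gof_def by (subst gmat_entry) auto

lemma Gof_agrees: "agrees s (Gof s C)"
 unfolding agrees_blocks using Gof_entry0 by simp

lemma Gof_Cof:
 assumes s: "s : orth_mats m" and G: "G : GOX" and ag: "agrees s G"
 shows "Gof s (Cof s G) = G"
proof (rule gmat_eqI[OF Gof_carrier GO_carrier[OF G]])
 fix r l a b assume r: "(r, l, a) : rset" and b: "b < m"
 show "Gof s (Cof s G) $$ (ridx (r, l, a), b) = G $$ (ridx (r, l, a), b)"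
 proof (cases "l = 0")
  case True
  then show ?thesis using r b ag by (simp add: Gof_entry0 agrees_blocks)
 next
  case False
  have "Gof s (Cof s G) $$ (ridx (r, l, a), b) = (\<Sum>t<wid (r - l). Cof s G r $$ (a, coff r l + t) * s $$ (m - wid (r - l) + t, b))"
  by (rule Gof_entry[OF r _ b]) (use False in simp)
  also have "\<dots> = G $$ (ridx (r, l, a), b)"
  using GO_expand[OF s G ag r _ b] False r Cof_entry by simp
  finally show ?thesis .
 qed
qed

lemma Gof_GO:
 assumes s: "s : orth_mats m" shows "Gof s C : GOX"
proof -
 have t: "top (Gof s C) $$ (i, b) = s $$ (i, b)" if "i < ltot p d" "b < m" for i b
  using Gof_agrees[of s C] that by (simp add: agrees_def)
 show ?thesis
  unfolding GO_iff
 proof (intro conjI allI impI)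
  fix i j assume "i < ltot p d" "j < ltot p d"
  then show "(\<Sum>b<m. top (Gof s C) $$ (i, b) * top (Gof s C) $$ (j, b)) = (if i = j then 1 else 0)"
  using t orth_mats_rows[OF s, of i j] ltot_le by simp
 next
  fix r l a j assume r: "(r, l, a) : rset" "0 < l" "j < ltot p d" "r <= lab j + l"
  have jm: "j < m" using r ltot_le by simp
  have "1 <= r - l" "r - l <= Suc p" "\<not> lab j < r - l" using r by auto
  then have jw: "j < m - wid (r - l)" using lab_less_iff[OF jm, of "r - l"] by simp
  have "(\<Sum>b<m. Gof s C $$ (ridx (r, l, a), b) * top (Gof s C) $$ (j, b))
  = (\<Sum>b<m. \<Sum>t<wid (r - l). C r $$ (a, coff r l + t) * (s $$ (m - wid (r - l) + t, b) * s $$ (j, b)))"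
  using r t by (intro sum.cong refl) (simp add: Gof_entry sum_distrib_right mult.assoc)
  also have "\<dots> = (\<Sum>t<wid (r - l). C r $$ (a, coff r l + t) * (\<Sum>b<m. s $$ (m - wid (r - l) + t, b) * s $$ (j, b)))"
  by (subst sum.swap) (simp add: sum_distrib_left)
  also have "\<dots> = 0" using GO_perp[OF s jw] r by (intro sum.neutral) auto
  finally show "(\<Sum>b<m. Gof s C $$ (ridx (r, l, a), b) * top (Gof s C) $$ (j, b)) = 0" .
 qed simp
qed

lemma Cof_Gof:
 assumes s: "s : orth_mats m" and C: "C : VC" shows "Cof s (Gof s C) = C"
proof (rule VC_eqI[OF Cof_VC C])
 fix r l t a assume r: "1 <= l" "l < r" "r <= p" "a < d r" "t < wid (r - l)"
 have rs: "(r, l, a) : rset" "0 < l" using r by auto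
 let ?w = "wid (r - l)"
 have w: "?w <= m" using r by (intro wid_le) auto
 have "Cof s (Gof s C) r $$ (a, coff r l + t) = (\<Sum>b<m. (\<Sum>t'<?w. C r $$ (a, coff r l + t') * s $$ (m - ?w + t', b)) * s $$ (m - ?w + t, b))"
  unfolding Cof_entry[OF r] using Gof_entry[OF rs] by (intro sum.cong refl) simp
 also have "\<dots> = (\<Sum>t'<?w. C r $$ (a, coff r l + t') * (\<Sum>b<m. s $$ (m - ?w + t', b) * s $$ (m - ?w + t, b)))"
  by (simp only: sum_distrib_right sum_distrib_left mult.assoc) (rule sum.swap)
 also have "\<dots> = (\<Sum>t'<?w. if t' = t then C r $$ (a, coff r l + t') else 0)"
  using orth_mats_rows[OF s] w r by (intro sum.cong refl) auto
 also have "\<dots> = C r $$ (a, coff r l + t)" using r by simp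
 finally show "Cof s (Gof s C) r $$ (a, coff r l + t) = C r $$ (a, coff r l + t)" .
qed


abbreviation (input) Kcls :: "real mat => real mat set" where "Kcls == K_class p d"

section \<open>The group action on normal forms\<close>

definition qfam :: "(nat => real mat) => bool" where
 "qfam q \<longleftrightarrow> (\<forall>r\<in>{1..p}. q r : orth_mats (d r))"

lemma qfam_orth: "qfam q ==> r : {1..p} ==> q r : orth_mats (d r)" by (simp add: qfam_def)

lemma qfam_carrier: "qfam q ==> r : {1..p} ==> q r : carrier_mat (d r) (d r)"
 using qfam_orth orth_matsD(1) by blast

lemma qfam_one: "qfam (%r. 1\<^sub>m (d r))" by (simp add: qfam_def orth_mats_one)

lemma qfam_inverse:
 assumes q: "qfam q"
 shows "qfam (%r. tr_mat (q r))" "qm (%r. tr_mat (q r)) * qm q = 1\<^sub>m nn"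
proof -
 show "qfam (%r. tr_mat (q r))" using q orth_mats_transpose by (simp add: qfam_def)
 have "qm (%r. tr_mat (q r)) * qm q = qm (%r. tr_mat (q r) * q r)"
  by (rule qm_mult) (use qfam_carrier[OF q] in auto)
 also have "\<dots> = qm (%r. 1\<^sub>m (d r))"
  by (rule qm_cong) (use orth_mats_transpose_mult qfam_orth[OF q] in blast)
 finally show "qm (%r. tr_mat (q r)) * qm q = 1\<^sub>m nn" by (simp add: qm_one)
qed

lemma Qset_qfam: "Qset p d = {qm q | q. qfam q}" by (simp add: Qset_eq qfam_def)

lemma Qset_mult: "g : Qset p d ==> h : Qset p d ==> g * h : Qset p d"
proof -
 assume "g : Qset p d" "h : Qset p d"
 then obtain q q' where q: "qfam q" "g = qm q" and q': "qfam q'" "h = qm q'" by (auto simp: Qset_qfam)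
 have "g * h = qm (%r. q r * q' r)" unfolding q q' by (rule qm_mult) (use qfam_carrier q q' in auto)
 moreover have "qfam (%r. q r * q' r)" using q q' orth_mats_mult by (simp add: qfam_def)
 ultimately show ?thesis by (auto simp: Qset_qfam)
qed

lemma K_class_eq:
 assumes G: "G : carrier_mat nn m" and G': "G' : carrier_mat nn m"
 shows "Kcls G = Kcls G' \<longleftrightarrow> (\<exists>q. qfam q & G' = qm q * G)"
proof -
 define h' where "h' h = (SOME g. g : Qset p d & g * h = 1\<^sub>m nn)" for h
 have "\<exists>g. g : Qset p d & g * h = 1\<^sub>m nn" if "h : Qset p d" for h
  using that qfam_inverse by (auto simp: Qset_qfam)
 then have inv: "h' h : Qset p d & h' h * h = 1\<^sub>m nn" if "h : Qset p d" for h
  unfolding h'_def by (rule someI_ex) (rule that)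
 have one: "1\<^sub>m nn : Qset p d" using qfam_one qm_one by (auto simp: Qset_qfam) (metis)
 have sub: "Qset p d \<subseteq> carrier_mat nn nn" by (auto simp: Qset_qfam)
 have "Kcls G = Kcls G' \<longleftrightarrow> (\<exists>h\<in>Qset p d. G' = h * G)"
  by (rule left_orbit_eq_iff[OF one Qset_mult inv sub G G'])
 also have "\<dots> \<longleftrightarrow> (\<exists>q. qfam q & G' = qm q * G)" unfolding Qset_qfam by blast
 finally show ?thesis .
qed

lemma qm_mult_carrier [simp]: "G : carrier_mat nn m ==> qm q * G : carrier_mat nn m"
 using qm_carrier by (rule mult_carrier_mat)

lemma K_class_qm: "G : carrier_mat nn m ==> qfam q ==> Kcls (qm q * G) = Kcls G"
 using K_class_eq[of G "qm q * G"] by auto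

lemma top_qm:
 assumes G: "G : carrier_mat nn m" and r: "1 <= r" "r <= p" "a < d r" "b < m"
 shows "top (qm q * G) $$ (ooff r + a, b) = (\<Sum>a'<d r. q r $$ (a, a') * top G $$ (ooff r + a', b))"
proof -
 have "top (qm q * G) $$ (ooff r + a, b) = (qm q * G) $$ (ridx (r, 0, a), b)" by (rule top_entry[OF r])
 also have "\<dots> = (\<Sum>a'<d r. q r $$ (a, a') * G $$ (ridx (r, 0, a'), b))"
  by (rule qm_mult_entry[OF G _ r(4)]) (use r in simp)
 also have "\<dots> = (\<Sum>a'<d r. q r $$ (a, a') * top G $$ (ooff r + a', b))"
  using r by (intro sum.cong refl) (simp add: top_entry)
 finally show ?thesis .
qed

lemma sum_bilinear:
 fixes x y :: "nat => nat => real"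
 shows "(\<Sum>b<m. (\<Sum>a<n. u a * x a b) * (\<Sum>c<n'. v c * y c b)) = (\<Sum>a<n. \<Sum>c<n'. u a * v c * (\<Sum>b<m. x a b * y c b))"
proof -
 have "(\<Sum>b<m. (\<Sum>a<n. u a * x a b) * (\<Sum>c<n'. v c * y c b)) = (\<Sum>b<m. \<Sum>a<n. \<Sum>c<n'. u a * v c * (x a b * y c b))"
  by (simp add: sum_product mult.assoc mult.left_commute)
 also have "\<dots> = (\<Sum>a<n. \<Sum>b<m. \<Sum>c<n'. u a * v c * (x a b * y c b))" by (rule sum.swap)
 also have "\<dots> = (\<Sum>a<n. \<Sum>c<n'. \<Sum>b<m. u a * v c * (x a b * y c b))"
  by (rule sum.cong[OF refl], rule sum.swap)
 finally show ?thesis by (simp add: sum_distrib_left)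
qed

lemma ooff_eq_iff:
 assumes "r <= p" "r' <= p" "a < d r" "c < d r'"
 shows "ooff r + a = ooff r' + c \<longleftrightarrow> r = r' & a = c"
 using lab_ooff[OF assms(1,3)] lab_ooff[OF assms(2,4)] by auto

lemma qm_GOX:
 assumes q: "qfam q" and G: "G : GOX" shows "qm q * G : GOX"
proof -
 have Gc: "G : carrier_mat nn m" using G by (rule GO_carrier)
 have orth: "(\<Sum>b<m. top G $$ (i, b) * top G $$ (j, b)) = (if i = j then 1 else 0)" if "i < ltot p d" "j < ltot p d" for i j
  using G that by (simp add: GO_iff)
 have perp: "(\<Sum>b<m. G $$ (ridx (r, l, a), b) * top G $$ (j, b)) = 0"
  if "(r, l, a) : rset" "0 < l" "j < ltot p d" "r <= lab j + l" for r l a j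
  by (rule G[unfolded GO_iff, THEN conjunct2, THEN conjunct2, rule_format, OF that])
 show ?thesis
  unfolding GO_iff
 proof (intro conjI allI impI)
  show "qm q * G : carrier_mat nn m" using Gc by simp
 next
  fix i j assume i: "i < ltot p d" and j: "j < ltot p d"
  obtain r a where r: "1 <= r" "r <= p" "a < d r" "i = ooff r + a" by (rule ltot_cases[OF i])
  obtain r' c where r': "1 <= r'" "r' <= p" "c < d r'" "j = ooff r' + c" by (rule ltot_cases[OF j])
  have "(\<Sum>b<m. top (qm q * G) $$ (i, b) * top (qm q * G) $$ (j, b)) =
  (\<Sum>b<m. (\<Sum>a'<d r. q r $$ (a, a') * top G $$ (ooff r + a', b)) * (\<Sum>c'<d r'. q r' $$ (c, c') * top G $$ (ooff r' + c', b)))"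
  unfolding r(4) r'(4) using top_qm[OF Gc] r r' by (intro sum.cong refl) simp
  also have "\<dots> = (\<Sum>a'<d r. \<Sum>c'<d r'. q r $$ (a, a') * q r' $$ (c, c') * (\<Sum>b<m. top G $$ (ooff r + a', b) * top G $$ (ooff r' + c', b)))"
  by (rule sum_bilinear)
  also have "\<dots> = (\<Sum>a'<d r. \<Sum>c'<d r'. if r = r' & a' = c' then q r $$ (a, a') * q r' $$ (c, c') else 0)"
  using orth ooff_ltot r r' ooff_eq_iff by (intro sum.cong refl) auto
  also have "\<dots> = (if i = j then 1 else 0)"
  proof (cases "r = r'")
  case True
  then show ?thesis using orth_mats_rows[OF qfam_orth[OF q], of r a c] r r' by simp
  next
  case False
  then have "i ~= j" using ooff_eq_iff[of r r' a c] r r' by simp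
  then show ?thesis using False by simp
  qed
  finally show "(\<Sum>b<m. top (qm q * G) $$ (i, b) * top (qm q * G) $$ (j, b)) = (if i = j then 1 else 0)" .
 next
  fix r l a j assume ra: "(r, l, a) : rset" and l: "0 < l" and j: "j < ltot p d" and rl: "r <= lab j + l"
  obtain r' c where r': "1 <= r'" "r' <= p" "c < d r'" "j = ooff r' + c" "lab j = r'" by (rule ltot_cases[OF j])
  have "(\<Sum>b<m. (qm q * G) $$ (ridx (r, l, a), b) * top (qm q * G) $$ (j, b)) =
  (\<Sum>b<m. (\<Sum>a'<d r. q r $$ (a, a') * G $$ (ridx (r, l, a'), b)) * (\<Sum>c'<d r'. q r' $$ (c, c') * top G $$ (ooff r' + c', b)))"
  unfolding r'(4) using top_qm[OF Gc] r' qm_mult_entry[OF Gc ra] by (intro sum.cong refl) simp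
  also have "\<dots> = (\<Sum>a'<d r. \<Sum>c'<d r'. q r $$ (a, a') * q r' $$ (c, c') * (\<Sum>b<m. G $$ (ridx (r, l, a'), b) * top G $$ (ooff r' + c', b)))"
  by (rule sum_bilinear)
  also have "\<dots> = 0"
  proof (intro sum.neutral ballI)
  fix a' c' assume "a' : {..<d r}" "c' : {..<d r'}"
  then have "(\<Sum>b<m. G $$ (ridx (r, l, a'), b) * top G $$ (ooff r' + c', b)) = 0"
  using ra l rl r' lab_ooff ooff_ltot by (intro perp) auto
  then show "q r $$ (a, a') * q r' $$ (c, c') * (\<Sum>b<m. G $$ (ridx (r, l, a'), b) * top G $$ (ooff r' + c', b)) = 0" by simp
  qed
  finally show "(\<Sum>b<m. (qm q * G) $$ (ridx (r, l, a), b) * top (qm q * G) $$ (j, b)) = 0" .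
 qed
qed

lemma agreesD: "agrees Om G ==> 1 <= r ==> r <= p ==> a < d r ==> b < m ==> top G $$ (ooff r + a, b) = Om $$ (ooff r + a, b)"
 using ooff_ltot by (simp add: agrees_def)

text \<open>Rows of Om' in block r are combinations of the rows of Om in the same block, so Om'
  times the transpose of Om is block lower. Being orthogonal it is block diagonal, although nothing
  is known about how the last rows of the two matrices are related.\<close>

lemma agrees_flag:
 assumes Om: "Om : orth_mats m" and Om': "Om' : orth_mats m" and ag: "agrees Om G" and ag': "agrees Om' (qm q * G)"
  and q: "qfam q" and G: "G : carrier_mat nn m"
 shows "left_orbit stab Om' = left_orbit stab Om"
proof -
 have c: "Om : carrier_mat m m" "Om' : carrier_mat m m" using Om Om' orth_matsD by auto
 let ?g = "Om' * tr_mat Om"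
 have g: "?g : orth_mats m" by (intro orth_mats_mult orth_mats_transpose Om Om')
 have "block_lower ?g"
  unfolding block_lower_def
 proof (intro conjI allI impI)
  show "?g : carrier_mat m m" using g by (rule orth_matsD)
  fix s t assume st: "s < m" "t < m" "lab t < lab s"
  then have "s < ltot p d" using lab_pos[of s] by simp
  from ltot_cases[OF this] obtain r a where r: "1 <= r" "r <= p" "a < d r" "s = ooff r + a" "lab s = r" by blast
  have "?g $$ (s, t) = (\<Sum>b<m. Om' $$ (s, b) * Om $$ (t, b))" by (rule mult_transpose_entry[OF c(2,1) st(1,2)])
  also have "\<dots> = (\<Sum>b<m. (\<Sum>a'<d r. q r $$ (a, a') * Om $$ (ooff r + a', b)) * Om $$ (t, b))"
  using agreesD[OF ag'] agreesD[OF ag] top_qm[OF G] r by (intro sum.cong refl) simp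
  also have "\<dots> = (\<Sum>a'<d r. q r $$ (a, a') * (\<Sum>b<m. Om $$ (ooff r + a', b) * Om $$ (t, b)))"
  by (simp only: sum_distrib_right sum_distrib_left mult.assoc) (rule sum.swap)
  also have "\<dots> = 0"
  proof (intro sum.neutral ballI)
  fix a' assume a': "a' : {..<d r}"
  then have "ooff r + a' ~= t" "ooff r + a' < m" using lab_ooff[of r a'] st r ooff_le[of r] by auto
  then show "q r $$ (a, a') * (\<Sum>b<m. Om $$ (ooff r + a', b) * Om $$ (t, b)) = 0"
  using orth_mats_rows[OF Om, of "ooff r + a'" t] st by simp
  qed
  finally show "?g $$ (s, t) = 0" .
 qed
 then have gs: "?g : stab" by (rule orth_block_lower_stab[OF g])
 have "?g * Om = Om' * (tr_mat Om * Om)" by (rule assoc_mult_mat) (use c in auto)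
 then have "?g * Om = Om'" using orth_mats_transpose_mult[OF Om] c by simp
 then show ?thesis using stab_orbit_mult[OF Om gs] by simp
qed

text \<open>The block diagonal factor and the group element built from the same blocks move the
  frame in the same way. The block with index 0 changes only rows that the normal form does not
  contain.\<close>

lemma agrees_diag:
 assumes H: "\<forall>r\<le>p. H r : orth_mats (d r)" and Om: "Om : carrier_mat m m" and ag: "agrees Om G" and G: "G : carrier_mat nn m"
 shows "agrees (diag_block_mat (map H (rev [0..<Suc p])) * Om) (qm H * G)"
 unfolding agrees_blocks
proof (intro allI impI)
 fix r a b assume r: "1 <= r" "r <= p" and a: "a < d r" and b: "b < m"
 let ?D = "diag_block_mat (map H (rev [0..<Suc p]))"
 have Hc: "H r : carrier_mat (d r) (d r)" if "r <= p" for r using H that orth_matsD by blast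
 note D = diag_blocks_entry[OF Hc]
 have i: "ooff r + a < m" using ooff_le[of r] r a by simp
 have "(?D * Om) $$ (ooff r + a, b) = (\<Sum>s<m. ?D $$ (ooff r + a, s) * Om $$ (s, b))"
  by (rule mult_entry[OF D(1) Om i b])
 also have "\<dots> = (\<Sum>a'<d r. ?D $$ (ooff r + a, ooff r + a') * Om $$ (ooff r + a', b))"
 proof (rule sum_block_support[OF r(2)])
  fix s assume s: "s < m" "lab s ~= r"
  obtain r' a' where "r' <= p" "a' < d r'" "s = ooff r' + a'" "lab s = r'" by (rule lab_cases[OF s(1)])
  then show "?D $$ (ooff r + a, s) * Om $$ (s, b) = 0" using D(2)[OF _ r(2) a, of r' a'] s by simp
 qed
 also have "\<dots> = (\<Sum>a'<d r. H r $$ (a, a') * G $$ (ridx (r, 0, a'), b))"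
  using D(2)[OF _ r(2) a r(2)] ag r b by (intro sum.cong refl) (simp add: agrees_blocks)
 also have "\<dots> = (qm H * G) $$ (ridx (r, 0, a), b)"
  by (rule qm_mult_entry[OF G _ b, symmetric]) (use r a in simp)
 finally show "(?D * Om) $$ (ooff r + a, b) = (qm H * G) $$ (ridx (r, 0, a), b)" .
qed

text \<open>As the rows of shift 0 are orthonormal, the group element taking G to frame s is
  determined: its block r is s_r times the transpose of G_{r,0}. This gives both freeness of the
  action and the formula in \<open>norm_form\<close>.\<close>

lemma agrees_family:
 assumes s: "s : orth_mats m" and ag: "agrees Om G" and ag': "agrees s (qm q * G)" and q: "qfam q" and G: "G : carrier_mat nn m"
  and Om: "Om : orth_mats m" and r: "1 <= r" "r <= p" "a < d r" "c < d r"
 shows "(\<Sum>b<m. s $$ (ooff r + a, b) * G $$ (ridx (r, 0, c), b)) = q r $$ (a, c)"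
proof -
 have "(\<Sum>b<m. s $$ (ooff r + a, b) * G $$ (ridx (r, 0, c), b)) =
  (\<Sum>b<m. (\<Sum>a'<d r. q r $$ (a, a') * Om $$ (ooff r + a', b)) * Om $$ (ooff r + c, b))"
 proof (intro sum.cong refl)
  fix b assume "b : {..<m}"
  then have b: "b < m" by simp
  show "s $$ (ooff r + a, b) * G $$ (ridx (r, 0, c), b) = (\<Sum>a'<d r. q r $$ (a, a') * Om $$ (ooff r + a', b)) * Om $$ (ooff r + c, b)"
  using agreesD[OF ag' r(1-3) b] agreesD[OF ag r(1,2) _ b] top_qm[OF G r(1-3) b] top_entry[OF r(1,2,4) b, of G] r(4) by simp
 qed
 also have "\<dots> = (\<Sum>a'<d r. q r $$ (a, a') * (\<Sum>b<m. Om $$ (ooff r + a', b) * Om $$ (ooff r + c, b)))"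
  by (simp only: sum_distrib_right sum_distrib_left mult.assoc) (rule sum.swap)
 also have "\<dots> = (\<Sum>a'<d r. if a' = c then q r $$ (a, a') else 0)"
  using orth_mats_rows[OF Om] ooff_le[of r] r by (intro sum.cong refl) auto
 finally show ?thesis using r by simp
qed

text \<open>Freeness of the action: with the same frame before and after, the formula of
  \<open>agrees_family\<close> gives identity matrices.\<close>

lemma agrees_unique:
 assumes s: "s : orth_mats m" and ag: "agrees s G" "agrees s (qm q * G)" and q: "qfam q" and G: "G : carrier_mat nn m"
 shows "qm q * G = G"
proof -
 have "q r = 1\<^sub>m (d r)" if "r : {1..p}" for r
 proof (rule eq_matI)
  fix a c assume "a < dim_row (1\<^sub>m (d r) :: real mat)" "c < dim_col (1\<^sub>m (d r) :: real mat)"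
  then have ac: "a < d r" "c < d r" by auto
  have r: "1 <= r" "r <= p" using that by auto
  have i: "ooff r + a < m" "ooff r + c < m" using ooff_le[OF r(2)] ac by auto
  have "q r $$ (a, c) = (\<Sum>b<m. s $$ (ooff r + a, b) * G $$ (ridx (r, 0, c), b))"
  by (rule agrees_family[OF s ag q G s r ac, symmetric])
  also have "\<dots> = (\<Sum>b<m. s $$ (ooff r + a, b) * s $$ (ooff r + c, b))"
  using ag(1) r ac by (intro sum.cong refl) (simp add: agrees_blocks)
  also have "\<dots> = (if a = c then 1 else 0)" using orth_mats_rows[OF s i] by simp
  finally show "q r $$ (a, c) = 1\<^sub>m (d r) $$ (a, c)" using ac by simp
 qed (use qfam_carrier[OF q that] in auto)
 then have "qm q = qm (%r. 1\<^sub>m (d r))" by (intro qm_cong)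
 then show ?thesis using G by (simp add: qm_one)
qed

text \<open>Moves G to the frame s by the explicit group element of \<open>agrees_family\<close>. A
  formula rather than a choice is used so that smoothness in G and s is visible.\<close>

definition norm_form :: "real mat => real mat => real mat" where
 "norm_form s G = qm (%r. Matrix.mat (d r) (d r) (%(a, c). \<Sum>b<m. s $$ (ooff r + a, b) * G $$ (ridx (r, 0, c), b))) * G"

lemma norm_form:
 assumes G: "G : GOX" and Om: "Om : orth_mats m" and ag: "agrees Om G" and h: "h : stab" and s: "s = h * Om"
 shows "\<exists>q. qfam q & norm_form s G = qm q * G & agrees s (qm q * G)"
proof -
 obtain H where H: "\<forall>r\<le>p. H r : orth_mats (d r)" and hH: "h = diag_block_mat (map H (rev [0..<Suc p]))"
  using h unfolding stab_eq_blocks by blast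
 have Gc: "G : carrier_mat nn m" using G by (rule GO_carrier)
 have Omc: "Om : carrier_mat m m" using Om by (rule orth_matsD)
 have q: "qfam H" using H by (simp add: qfam_def)
 have a: "agrees s (qm H * G)" unfolding s hH by (rule agrees_diag[OF H Omc ag Gc])
 have so: "s : orth_mats m" unfolding s by (rule orth_mats_mult[OF stab_orth[OF h] Om])
 have "norm_form s G = qm H * G"
  unfolding norm_form_def
 proof (rule arg_cong[where f = "%Q. Q * G"], rule qm_cong)
  fix r assume r: "r : {1..p}"
  then show "Matrix.mat (d r) (d r) (%(a, c). \<Sum>b<m. s $$ (ooff r + a, b) * G $$ (ridx (r, 0, c), b)) = H r"
  using agrees_family[OF so ag a q Gc Om] qfam_carrier[OF q r] by (intro eq_matI) auto
 qed
 then show ?thesis using q a by blast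
qed

text \<open>The projection on classes, through an arbitrary orthogonal matrix extending the frame of
  an arbitrary representative; \<open>pi_eq\<close> shows that the choice does not matter.\<close>

definition bproj :: "real mat set => real mat set" where
 "bproj y = left_orbit stab (SOME Om. Om : orth_mats m & (\<exists>G\<in>GOX. Kcls G = y & agrees Om G))"

lemma pi_eq:
 assumes G: "G : GOX" and Om: "Om : orth_mats m" and ag: "agrees Om G"
 shows "bproj (Kcls G) = left_orbit stab Om"
proof -
 let ?P = "%Om. Om : orth_mats m & (\<exists>G'\<in>GOX. Kcls G' = Kcls G & agrees Om G')"
 define Om' where "Om' = (SOME Om. ?P Om)"
 have "?P Om" using assms by blast
 then have "?P Om'" unfolding Om'_def by (rule someI)
 then obtain G' where G': "G' : GOX" "Kcls G' = Kcls G" "agrees Om' G'" and o': "Om' : orth_mats m" by blast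
 obtain q where q: "qfam q" "G' = qm q * G"
  using G'(2)[symmetric] K_class_eq[OF GO_carrier[OF G] GO_carrier[OF G'(1)]] by blast
 have "left_orbit stab Om' = left_orbit stab Om"
  by (rule agrees_flag[OF Om o' ag _ q(1) GO_carrier[OF G]]) (use G' q in simp)
 then show ?thesis by (simp add: bproj_def Om'_def)
qed

lemma represents_agrees:
 assumes "represents p m d C Om G" and G: "G : carrier_mat nn m"
 shows "Om : orth_mats m" "agrees Om G"
proof -
 show Om: "Om : orth_mats m" using assms by (simp add: represents_def)
 then have Omc: "Om : carrier_mat m m" by (rule orth_matsD)
 show "agrees Om G"
  unfolding agrees_blocks
 proof (intro allI impI)
  fix r a b assume r: "1 <= r" "r <= p" and a: "a < d r" and b: "b < m"
  then have "rblk p d G r 0 = oblk p d Om r" using assms by (simp add: represents_def)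
  then have "rblk p d G r 0 $$ (a, b) = oblk p d Om r $$ (a, b)" by simp
  then show "Om $$ (ooff r + a, b) = G $$ (ridx (r, 0, a), b)"
  using rblk_entry[OF G a b, of 0] oblk_entry[OF Omc a b] by simp
 qed
qed

text \<open>Extend the frame to an orthogonal matrix and take as coefficients the inner products
  from \<open>GO_expand\<close>.\<close>

lemma represents_exists:
 assumes G: "G : GOX" shows "\<exists>C Om. represents p m d C Om G"
proof -
 obtain s where s: "s : orth_mats m" "agrees s G" by (rule agrees_exists[OF G])
 have Gc: "G : carrier_mat nn m" using G by (rule GO_carrier)
 have sc: "s : carrier_mat m m" using s(1) by (rule orth_matsD)
 define C where "C r l = Matrix.mat (d r) (wid (r - l)) (%(a, t). \<Sum>c<m. G $$ (ridx (r, l, a), c) * s $$ (m - wid (r - l) + t, c))" for r l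
 have "rblk p d G r 0 = oblk p d s r" if r: "r : {1..p}" for r
 proof (rule eq_matI)
  have c: "rblk p d G r 0 : carrier_mat (d r) m" "oblk p d s r : carrier_mat (d r) m"
  using rblk_carrier[OF Gc] oblk_carrier[OF sc] by auto
  show "dim_row (rblk p d G r 0) = dim_row (oblk p d s r)" "dim_col (rblk p d G r 0) = dim_col (oblk p d s r)"
  using c by auto
  fix a b assume "a < dim_row (oblk p d s r)" "b < dim_col (oblk p d s r)"
  then have ab: "a < d r" "b < m" using c by auto
  then show "rblk p d G r 0 $$ (a, b) = oblk p d s r $$ (a, b)"
  using s(2)[unfolded agrees_blocks] rblk_entry[OF Gc ab, of 0] oblk_entry[OF sc ab] r by simp
 qed
 moreover have "rblk p d G r l = C r l * M_mat p d s r l" if r: "r : {1..p}" and l: "0 < l" "l < r" for r l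
 proof (rule eq_matI)
  have Mc: "M_mat p d s r l : carrier_mat (wid (r - l)) m" by (rule M_mat_carrier[OF sc])
  have Cc: "C r l : carrier_mat (d r) (wid (r - l))" by (simp add: C_def)
  show "dim_row (rblk p d G r l) = dim_row (C r l * M_mat p d s r l)" "dim_col (rblk p d G r l) = dim_col (C r l * M_mat p d s r l)"
  using rblk_carrier[OF Gc, of r l] Mc Cc by auto
  fix a b assume "a < dim_row (C r l * M_mat p d s r l)" "b < dim_col (C r l * M_mat p d s r l)"
  then have ab: "a < d r" "b < m" using Mc Cc by auto
  have rs: "(r, l, a) : rset" using r l ab by auto
  have "(C r l * M_mat p d s r l) $$ (a, b) = (\<Sum>t<wid (r - l). C r l $$ (a, t) * M_mat p d s r l $$ (t, b))"
  by (rule mult_entry[OF Cc Mc ab])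
  also have "\<dots> = (\<Sum>t<wid (r - l). (\<Sum>c<m. G $$ (ridx (r, l, a), c) * s $$ (m - wid (r - l) + t, c)) * s $$ (m - wid (r - l) + t, b))"
  using r l ab M_mat_entry[OF sc] by (intro sum.cong refl) (simp add: C_def)
  also have "\<dots> = G $$ (ridx (r, l, a), b)" by (rule GO_expand[OF s(1) G s(2) rs l(1) ab(2)])
  finally show "rblk p d G r l $$ (a, b) = (C r l * M_mat p d s r l) $$ (a, b)" using rblk_entry[OF Gc ab, of l] by simp
 qed
 moreover have "C r l : carrier_mat (d r) (\<Sum>j<r - l. d j)" for r l by (simp add: C_def wid_def)
 ultimately have "represents p m d C s G" using s(1) by (simp add: represents_def)
 then show ?thesis by blast
qed


section \<open>The quotient of the normal forms as a bundle\<close>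

definition GX :: "real mat smooth_space" where
 "GX = coordinate_space GOX (mat_entries nn m)"

definition KX :: "real mat set smooth_space" where
 "KX = quotient_space GX (Kcls)"

definition VX :: "(nat => real mat) smooth_space" where "VX = model_fiber_space p d"

lemma K_space_eq: "K_space p m d = KX"
 by (simp add: K_space_def KX_def GX_def GOX_def nn_def)

lemma pts_GX [simp]: "pts GX = GOX" by (simp add: GX_def)
lemma pts_KX [simp]: "pts KX = Kcls ` GOX" by (simp add: KX_def)
lemma pts_VX [simp]: "pts VX = VC" by (simp add: VX_def model_fiber_space_def VC_def)
lemma sheaf_GX: "smooth_sheaf GX" unfolding GX_def by (rule smooth_sheaf_coordinate_space)
lemma sheaf_KX: "smooth_sheaf KX" unfolding KX_def by (rule smooth_sheaf_quotient_space[OF sheaf_GX])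
lemma sheaf_VX: "smooth_sheaf VX" unfolding VX_def model_fiber_space_def by (rule smooth_sheaf_coordinate_space)

lemma GOX_carrier: "GOX \<subseteq> carrier_mat nn m" using GO_carrier by blast

lemma smooth_mat_GX: "openin (top_of GX) W ==> smooth_mat GX W nn m (%G. G)"
 unfolding GX_def by (rule smooth_mat_coordinate[OF _ GOX_carrier])

lemma smooth_GX_entry: "openin (top_of GX) W ==> x : rset ==> b < m ==> (%G. G $$ (ridx x, b)) : smooth_funs GX W"
 using smooth_mat_entry[OF smooth_mat_GX] ridx_range(3) by (cases x) blast

lemma toprow_less: "i < ltot p d ==> toprow i < nn"
 using toprow_ooff ridx_range(3) by (elim ltot_cases) auto

lemma smooth_mat_top: "openin (top_of GX) W ==> smooth_mat GX W m m top"
proof -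
 assume W: "openin (top_of GX) W"
 have "smooth_mat GX W m m (%G. Matrix.mat m m (%(i, b). if i < ltot p d then G $$ (toprow i, b) else 0))"
 proof (rule smooth_mat_mat[OF sheaf_GX W])
  fix i b assume "i < m" "b < m"
  then show "(%G. if i < ltot p d then G $$ (toprow i, b) else 0) : smooth_funs GX W"
  using smooth_mat_entry[OF smooth_mat_GX[OF W], of "toprow i" b] smooth_const[OF sheaf_GX W, of 0] toprow_less
  by (cases "i < ltot p d") simp_all
 qed
 then show ?thesis by (simp add: top_def[abs_def])
qed

lemma K_class_GOX_eq:
 assumes "G : GOX" "G' : GOX"
 shows "Kcls G = Kcls G' \<longleftrightarrow> (\<exists>q. qfam q & G' = qm q * G)"
 using K_class_eq[OF GO_carrier GO_carrier] assms by blast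

lemma second_countable_KX: "second_countable (top_of KX)"
 unfolding KX_def
proof (rule second_countable_quotient_space)
 show "second_countable (top_of GX)"
  unfolding GX_def by (rule second_countable_coordinate_space[OF finite_mat_entries])
 fix U assume U: "openin (top_of GX) U"
 show "openin (top_of GX) {x : pts GX. Kcls x : Kcls ` U}"
 proof (rule openin_saturation[where A = "{(%G. qm q * G) | q. qfam q}", OF _ _ U])
  fix a assume "a : {(%G. qm q * G) | q. qfam q}"
  then obtain q where q: "qfam q" "a = (%G. qm q * G)" by blast
  have "smooth_map GX GX a"
  unfolding q(2)
  proof (subst (2) GX_def, rule smooth_map_into_matrices[OF sheaf_GX])
  show "smooth_mat GX (pts GX) nn m ((*) (qm q))"
  by (rule smooth_mat_mult[OF sheaf_GX openin_topspace smooth_mat_const[OF sheaf_GX openin_topspace qm_carrier] smooth_mat_GX[OF openin_topspace]])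
  show "qm q * x : GOX" if "x : pts GX" for x using qm_GOX[OF q(1)] that by simp
  qed
  then show "continuous_map (top_of GX) (top_of GX) a" by (rule smooth_map_continuous)
 next
  fix x y assume "x : pts GX" "y : pts GX"
  then show "(Kcls x = Kcls y) \<longleftrightarrow> (\<exists>a\<in>{(%G. qm q * G) | q. qfam q}. y = a x)"
  using K_class_GOX_eq[of x y] by auto
 qed
qed

section \<open>Invariants of the action and the Hausdorff property\<close>

definition invariant :: "nat => nat => nat => nat => real mat => real" where
 "invariant r j b c G = (\<Sum>a<d r. G $$ (ridx (r, j, a), b) * G $$ (ridx (r, 0, a), c))"

lemma invariant_qm:
 assumes q: "qfam q" and G: "G : carrier_mat nn m" and r: "1 <= r" "r <= p" "j < r" "b < m" "c < m"
 shows "invariant r j b c (qm q * G) = invariant r j b c G"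
proof -
 have qr: "tr_mat (q r) : orth_mats (d r)" using orth_mats_transpose qfam_orth[OF q] r by simp
 have c: "q r : carrier_mat (d r) (d r)" using qfam_carrier[OF q] r by simp
 have "invariant r j b c (qm q * G) = (\<Sum>a<d r. (\<Sum>x<d r. G $$ (ridx (r, j, x), b) * q r $$ (a, x)) * (\<Sum>y<d r. G $$ (ridx (r, 0, y), c) * q r $$ (a, y)))"
  unfolding invariant_def using r qm_mult_entry[OF G, of r] by (intro sum.cong refl) (simp add: mult.commute)
 also have "\<dots> = (\<Sum>a<d r. \<Sum>x<d r. \<Sum>y<d r. G $$ (ridx (r, j, x), b) * G $$ (ridx (r, 0, y), c) * (q r $$ (a, x) * q r $$ (a, y)))"
  by (simp add: sum_product mult.assoc mult.left_commute)
 also have "\<dots> = (\<Sum>x<d r. \<Sum>a<d r. \<Sum>y<d r. G $$ (ridx (r, j, x), b) * G $$ (ridx (r, 0, y), c) * (q r $$ (a, x) * q r $$ (a, y)))"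
  by (rule sum.swap)
 also have "\<dots> = (\<Sum>x<d r. \<Sum>y<d r. \<Sum>a<d r. G $$ (ridx (r, j, x), b) * G $$ (ridx (r, 0, y), c) * (q r $$ (a, x) * q r $$ (a, y)))"
  by (rule sum.cong[OF refl], rule sum.swap)
 also have "\<dots> = (\<Sum>x<d r. \<Sum>y<d r. G $$ (ridx (r, j, x), b) * G $$ (ridx (r, 0, y), c) * (if x = y then 1 else 0))"
  using orth_mats_rows[OF qr] c by (intro sum.cong refl) (simp add: sum_distrib_left[symmetric])
 also have "\<dots> = invariant r j b c G" by (simp add: invariant_def if_distrib cong: if_cong)
 finally show ?thesis .
qed

text \<open>The candidate is q_r = G'_{r,0} times the transpose of G_{r,0}. Applied to G_{r,j} it
  contains the invariant of G, which may be replaced by that of G'; the orthonormal rows of G'_{r,0}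
  then collapse the product to G'_{r,j}.\<close>

lemma invariant_separates:
 assumes G: "G : GOX" and G': "G' : GOX"
  and inv: "!!r j b c. 1 <= r ==> r <= p ==> j < r ==> b < m ==> c < m ==> invariant r j b c G = invariant r j b c G'"
 shows "\<exists>q. qfam q & G' = qm q * G"
proof -
 have Gc: "G : carrier_mat nn m" "G' : carrier_mat nn m" using GO_carrier G G' by auto
 have orth: "(\<Sum>b<m. H $$ (ridx (r, 0, a), b) * H $$ (ridx (r, 0, a'), b)) = (if a = a' then 1 else 0)"
  if H: "H : GOX" and r: "1 <= r" "r <= p" "a < d r" "a' < d r" for H r a a'
 proof -
  have "(\<Sum>b<m. top H $$ (ooff r + a, b) * top H $$ (ooff r + a', b)) = (if ooff r + a = ooff r + a' then 1 else 0)"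
  using H ooff_ltot r unfolding GO_iff by blast
  then show ?thesis using r by (simp add: top_entry)
 qed
 define q where "q r = Matrix.mat (d r) (d r) (%(a, x). \<Sum>c<m. G' $$ (ridx (r, 0, a), c) * G $$ (ridx (r, 0, x), c))" for r
 have key: "(\<Sum>x<d r. q r $$ (a, x) * G $$ (ridx (r, j, x), b)) = G' $$ (ridx (r, j, a), b)"
  if r: "1 <= r" "r <= p" "j < r" "a < d r" "b < m" for r j a b
 proof -
  have "(\<Sum>x<d r. q r $$ (a, x) * G $$ (ridx (r, j, x), b)) = (\<Sum>x<d r. \<Sum>c<m. G' $$ (ridx (r, 0, a), c) * (G $$ (ridx (r, j, x), b) * G $$ (ridx (r, 0, x), c)))"
  using r by (intro sum.cong refl) (simp add: q_def sum_distrib_left sum_distrib_right mult_ac)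
  also have "\<dots> = (\<Sum>c<m. G' $$ (ridx (r, 0, a), c) * invariant r j b c G)"
  by (subst sum.swap) (simp add: invariant_def sum_distrib_left)
  also have "\<dots> = (\<Sum>c<m. G' $$ (ridx (r, 0, a), c) * invariant r j b c G')"
  using inv r by (intro sum.cong refl) simp
  also have "\<dots> = (\<Sum>x<d r. \<Sum>c<m. G' $$ (ridx (r, 0, a), c) * (G' $$ (ridx (r, j, x), b) * G' $$ (ridx (r, 0, x), c)))"
  by (subst sum.swap) (simp add: invariant_def sum_distrib_left)
  also have "\<dots> = (\<Sum>x<d r. G' $$ (ridx (r, j, x), b) * (\<Sum>c<m. G' $$ (ridx (r, 0, a), c) * G' $$ (ridx (r, 0, x), c)))"
  by (simp add: sum_distrib_left mult_ac)
  also have "\<dots> = (\<Sum>x<d r. if a = x then G' $$ (ridx (r, j, x), b) else 0)"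
  using orth[OF G'] r by (intro sum.cong refl) simp
  also have "\<dots> = G' $$ (ridx (r, j, a), b)" using r by simp
  finally show ?thesis .
 qed
 have q: "qfam q"
  unfolding qfam_def
 proof (intro ballI orth_mats_eqI)
  fix r assume r: "r : {1..p}"
  show "q r : carrier_mat (d r) (d r)" by (simp add: q_def)
  fix a a' assume a: "a < d r" "a' < d r"
  \<comment> \<open>Expanding only the second factor and using \<open>key\<close> for shift 0 turns
    this into an inner product of rows of G'_{r,0}.\<close>
  have "(\<Sum>s<d r. q r $$ (a, s) * q r $$ (a', s)) = (\<Sum>s<d r. \<Sum>c<m. G' $$ (ridx (r, 0, a'), c) * (q r $$ (a, s) * G $$ (ridx (r, 0, s), c)))"
  using a by (intro sum.cong refl) (simp add: q_def[of r, THEN arg_cong[of _ _ "%M. M $$ (a', _)"]] sum_distrib_left mult_ac)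
  also have "\<dots> = (\<Sum>c<m. G' $$ (ridx (r, 0, a'), c) * (\<Sum>s<d r. q r $$ (a, s) * G $$ (ridx (r, 0, s), c)))"
  by (subst sum.swap) (simp add: sum_distrib_left)
  also have "\<dots> = (\<Sum>c<m. G' $$ (ridx (r, 0, a'), c) * G' $$ (ridx (r, 0, a), c))"
  using key[of r 0 a] r a by (intro sum.cong refl) simp
  also have "\<dots> = (if a = a' then 1 else 0)" using orth[OF G', of r a' a] r a by auto
  finally show "(\<Sum>s<d r. q r $$ (a, s) * q r $$ (a', s)) = (if a = a' then 1 else 0)" .
 qed
 have "G' = qm q * G"
 proof (rule gmat_eqI[OF Gc(2)])
  show "qm q * G : carrier_mat nn m" using Gc by simp
  fix r j a b assume r: "(r, j, a) : rset" and b: "b < m"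
  show "G' $$ (ridx (r, j, a), b) = (qm q * G) $$ (ridx (r, j, a), b)"
  unfolding qm_mult_entry[OF Gc(1) r b] using key[of r j a b] r b by simp
 qed
 then show ?thesis using q by blast
qed

lemma Hausdorff_KX: "Hausdorff_space (top_of KX)"
 unfolding KX_def
proof (rule Hausdorff_quotient_space[OF sheaf_GX, where G = "{invariant r j b c | r j b c. 1 <= r & r <= p & j < r & b < m & c < m}"])
 fix g assume "g : {invariant r j b c | r j b c. 1 <= r & r <= p & j < r & b < m & c < m}"
 then obtain r j b c where g: "g = invariant r j b c" "1 <= r" "r <= p" "j < r" "b < m" "c < m" by blast
 show "g : smooth_funs GX (pts GX)"
  unfolding g(1) invariant_def
  by (intro smooth_sum[OF sheaf_GX] smooth_mult[OF sheaf_GX] smooth_GX_entry openin_topspace) (use g in auto)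
next
 fix x y g assume xy: "x : pts GX" "y : pts GX" "Kcls x = Kcls y"
  and "g : {invariant r j b c | r j b c. 1 <= r & r <= p & j < r & b < m & c < m}"
 then obtain r j b c where g: "g = invariant r j b c" "1 <= r" "r <= p" "j < r" "b < m" "c < m" by blast
 obtain q where "qfam q" "y = qm q * x" using xy K_class_GOX_eq[of x y] by auto
 then show "g x = g y" using invariant_qm[of q x r j b c] g xy GO_carrier by simp
next
 fix x y assume xy: "x : pts GX" "y : pts GX"
  and e: "!!g. g : {invariant r j b c | r j b c. 1 <= r & r <= p & j < r & b < m & c < m} ==> g x = g y"
 have "\<exists>q. qfam q & y = qm q * x"
  by (rule invariant_separates) (use xy in simp, use xy in simp, rule e, blast)
 then show "Kcls x = Kcls y" using K_class_GOX_eq[of x y] xy by simp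
qed

section \<open>Normalization over a chart of the flag manifold\<close>

lemma top_agrees_sect:
 assumes O0: "O0 : orth_mats m" and Om: "Om : orth_mats m" and ag: "agrees Om G"
 shows "sect O0 (top G) = sect O0 Om" "sdom O0 (top G) \<longleftrightarrow> sdom O0 Om"
proof -
 have e: "top G $$ (i, j) = Om $$ (i, j)" if "i < m" "j < m" "0 < lab i" for i j
  using ag lab_pos[OF that(1)] that by (simp add: agrees_def)
 note c = orth_matsD(1)[OF O0] orth_matsD(1)[OF Om]
 show "sect O0 (top G) = sect O0 Om" "sdom O0 (top G) \<longleftrightarrow> sdom O0 Om"
  using sect_cong[OF top_carrier c(2,1) e] by blast+
qed

text \<open>The fiber coordinate: move G to the frame prescribed by the section over its flag, then
  read off the coefficients.\<close>

definition cmap :: "real mat => real mat => nat => real mat" where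
 "cmap O0 G = Cof (sect O0 (top G)) (norm_form (sect O0 (top G)) G)"

context
 fixes O0 :: "real mat"
 assumes O0: "O0 : orth_mats m"
begin

lemma sect_facts:
 assumes G: "G : GOX" and dm: "sdom O0 (top G)"
 obtains q where "qfam q" "norm_form (sect O0 (top G)) G = qm q * G" "agrees (sect O0 (top G)) (qm q * G)"
  "sect O0 (top G) : orth_mats m" "qm q * G : GOX" "bproj (Kcls G) = left_orbit stab (sect O0 (top G))"
proof -
 obtain Om where Om: "Om : orth_mats m" "agrees Om G" by (rule agrees_exists[OF G])
 note t = top_agrees_sect[OF O0 Om]
 have d': "sdom O0 Om" using dm t by simp
 obtain h where h: "h : stab" "sect O0 Om = h * Om" by (rule sect_in_orbit[OF O0 Om(1) d'])
 have s: "sect O0 (top G) = h * Om" using t h by simp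
 obtain q where q: "qfam q" "norm_form (sect O0 (top G)) G = qm q * G" "agrees (sect O0 (top G)) (qm q * G)"
  using norm_form[OF G Om h(1) s] by blast
 show thesis
 proof (rule that[OF q])
  show "sect O0 (top G) : orth_mats m" by (rule sect_orth[OF O0 dm])
  show "qm q * G : GOX" by (rule qm_GOX[OF q(1) G])
  show "bproj (Kcls G) = left_orbit stab (sect O0 (top G))"
  unfolding s stab_orbit_mult[OF Om(1) h(1)] by (rule pi_eq[OF G Om])
 qed
qed

lemma pi_in_chart_dom:
 assumes G: "G : GOX" shows "bproj (Kcls G) : chart_dom O0 \<longleftrightarrow> sdom O0 (top G)"
proof -
 obtain Om where Om: "Om : orth_mats m" "agrees Om G" by (rule agrees_exists[OF G])
 show ?thesis unfolding pi_eq[OF G Om] in_chart_dom[OF O0 Om(1)] top_agrees_sect(2)[OF O0 Om] ..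
qed

text \<open>Two representatives of a class have the same flag, hence the same section value. Their
  normalizations lie in one orbit and share the frame, so freeness makes them equal.\<close>

lemma cmap_class:
 assumes G: "G : GOX" and G': "G' : GOX" and dm: "sdom O0 (top G)" and eq: "Kcls G = Kcls G'"
 shows "sect O0 (top G) = sect O0 (top G')" "cmap O0 G = cmap O0 G'"
proof -
 obtain Om where Om: "Om : orth_mats m" "agrees Om G" by (rule agrees_exists[OF G])
 obtain Om' where Om': "Om' : orth_mats m" "agrees Om' G'" by (rule agrees_exists[OF G'])
 have "left_orbit stab Om = left_orbit stab Om'" using pi_eq[OF G Om] pi_eq[OF G' Om'] eq by simp
 then obtain h where h: "h : stab" "Om' = h * Om" using stab_orbit_eq[OF Om(1) Om'(1)] by blast
 have dO: "sdom O0 Om" using dm top_agrees_sect[OF O0 Om] by simp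
 show s: "sect O0 (top G) = sect O0 (top G')"
  unfolding top_agrees_sect[OF O0 Om] top_agrees_sect[OF O0 Om'] h(2) by (rule sect_stab(2)[OF O0 Om(1) h(1) dO, symmetric])
 have dm': "sdom O0 (top G')" using dm pi_in_chart_dom[OF G] pi_in_chart_dom[OF G'] eq by simp
 obtain q where q: "qfam q" "norm_form (sect O0 (top G)) G = qm q * G" "agrees (sect O0 (top G)) (qm q * G)"
  "sect O0 (top G) : orth_mats m" "qm q * G : GOX" by (rule sect_facts[OF G dm])
 obtain q' where q': "qfam q'" "norm_form (sect O0 (top G')) G' = qm q' * G'" "agrees (sect O0 (top G')) (qm q' * G')"
  "qm q' * G' : GOX" by (rule sect_facts[OF G' dm'])
 have Gc: "G : carrier_mat nn m" "G' : carrier_mat nn m" using GO_carrier G G' by auto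
 have "Kcls (qm q * G) = Kcls (qm q' * G')"
  using K_class_qm[OF Gc(1) q(1)] K_class_qm[OF Gc(2) q'(1)] eq by simp
 then obtain u where u: "qfam u" "qm q' * G' = qm u * (qm q * G)" using K_class_GOX_eq[OF q(5) q'(4)] by blast
 have "qm u * (qm q * G) = qm q * G"
  by (rule agrees_unique[OF q(4,3) _ u(1)]) (use q'(3) u s Gc in simp_all)
 then have "norm_form (sect O0 (top G)) G = norm_form (sect O0 (top G')) G'" using u q(2) q'(2) by simp
 then show "cmap O0 G = cmap O0 G'" unfolding cmap_def using s by simp
qed

text \<open>A normal form whose frame already is a section value is not moved by normalization, so
  its coordinates are the coefficients it was built from. This is one half of the trivialization
  being bijective.\<close>

lemma Gof_section:
 assumes s: "s : orth_mats m" "sdom O0 s" "sect O0 s = s" and C: "C : VC"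
 shows "sdom O0 (top (Gof s C))" "sect O0 (top (Gof s C)) = s" "cmap O0 (Gof s C) = C"
proof -
 note t = top_agrees_sect[OF O0 s(1) Gof_agrees[of s C]]
 show dm: "sdom O0 (top (Gof s C))" and e: "sect O0 (top (Gof s C)) = s" using t s by simp_all
 have G: "Gof s C : GOX" by (rule Gof_GO[OF s(1)])
 obtain q where q: "qfam q" "norm_form (sect O0 (top (Gof s C))) (Gof s C) = qm q * Gof s C"
  "agrees (sect O0 (top (Gof s C))) (qm q * Gof s C)" by (rule sect_facts[OF G dm])
 have "qm q * Gof s C = Gof s C" by (rule agrees_unique[OF s(1) Gof_agrees _ q(1)]) (use q(3) e in simp_all)
 then have "norm_form s (Gof s C) = Gof s C" using q(2) e by simp
 then show "cmap O0 (Gof s C) = C" unfolding cmap_def e using Cof_Gof[OF s(1) C] by simp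
qed

lemma openin_sdom: "openin (top_of GX) {G : GOX. sdom O0 (top G)}"
 using smooth_funs_sdom[OF sheaf_GX smooth_mat_top[OF openin_topspace] O0] by simp

lemma preimage_chart: "{G : pts GX. Kcls G : {y : pts KX. bproj y : chart_dom O0}} = {G : GOX. sdom O0 (top G)}"
 using pi_in_chart_dom by auto

lemma openin_bundle_chart: "openin (top_of KX) {y : pts KX. bproj y : chart_dom O0}"
 using openin_sdom preimage_chart unfolding KX_def topology_quotient_space by (auto simp: KX_def)

lemma smooth_mat_sect_top: "smooth_mat GX {G : GOX. sdom O0 (top G)} m m (%G. sect O0 (top G))"
 by (rule smooth_sect[OF sheaf_GX openin_sdom smooth_mat_top[OF openin_sdom] O0]) simp

lemma smooth_mat_norm_form:
 "smooth_mat GX {G : GOX. sdom O0 (top G)} nn m (%G. norm_form (sect O0 (top G)) G)"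
proof -
 let ?W = "{G : GOX. sdom O0 (top G)}"
 note W = openin_sdom
 let ?e = "%G r a c. \<Sum>b<m. sect O0 (top G) $$ (ooff r + a, b) * G $$ (ridx (r, 0, c), b)"
 have e: "(%G. ?e G r a c) : smooth_funs GX ?W" if "1 <= r" "r <= p" "a < d r" "c < d r" for r a c
  by (intro smooth_sum[OF sheaf_GX W] smooth_mult[OF sheaf_GX W] smooth_GX_entry[OF W] smooth_mat_entry[OF smooth_mat_sect_top])
  (use that ooff_le[of r] in auto)
 have "smooth_mat GX ?W nn nn (%G. qm (%r. Matrix.mat (d r) (d r) (%(a, c). ?e G r a c)))"
 proof (rule smooth_matI)
  fix i j assume i: "i < nn" and j: "j < nn"
  obtain r l a where ra: "(r, l, a) : rset" "i = ridx (r, l, a)" by (rule ridx_cases[OF i])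
  obtain r' l' a' where ra': "(r', l', a') : rset" "j = ridx (r', l', a')" by (rule ridx_cases[OF j])
  show "(%G. qm (%r. Matrix.mat (d r) (d r) (%(a, c). ?e G r a c)) $$ (i, j)) : smooth_funs GX ?W"
  unfolding ra(2) ra'(2) qm_entry[OF ra(1) ra'(1)]
  using e[of r a a'] smooth_const[OF sheaf_GX W, of 0] ra(1) ra'(1) by (cases "r = r' & l = l'") auto
 qed simp
 then show ?thesis
  unfolding norm_form_def by (rule smooth_mat_mult[OF sheaf_GX W _ smooth_mat_GX[OF W]])
qed

lemma smooth_map_cmap: "smooth_map (open_subspace GX {G : GOX. sdom O0 (top G)}) VX (cmap O0)"
 unfolding VX_def model_fiber_space_def
proof (rule smooth_map_into_coordinate[OF smooth_sheaf_open_subspace[OF sheaf_GX openin_sdom]])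
 show "cmap O0 x : carrier (model_fiber_module p d)" for x using Cof_VC[unfolded VC_def] by (simp add: cmap_def)
 fix u :: "(nat => real mat) => real" assume "u : {%C. C r $$ (a, b) | r a b. r : {1..p} & a < d r & b < fiber_width d r}"
 then obtain r a e where u: "u = (%C. C r $$ (a, e))" "r : {1..p}" "a < d r" "e < fiber_width d r" by blast
 obtain l t where l: "1 <= l" "l < r" "t < wid (r - l)" "e = coff r l + t" by (rule coff_cases[OF u(4)])
 let ?W = "{G : GOX. sdom O0 (top G)}"
 note W = openin_sdom
 have "ridx (r, l, a) < nn" by (rule ridx_range(3)) (use u l in simp)
 moreover have "wid (r - l) <= m" using u(2) by (intro wid_le) auto
 then have "m - wid (r - l) + t < m" using l(3) by linarith
 ultimately have "(%G. \<Sum>b<m. norm_form (sect O0 (top G)) G $$ (ridx (r, l, a), b) * sect O0 (top G) $$ (m - wid (r - l) + t, b)) : smooth_funs GX ?W"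
  by (intro smooth_sum[OF sheaf_GX W] smooth_mult[OF sheaf_GX W] smooth_mat_entry[OF smooth_mat_norm_form] smooth_mat_entry[OF smooth_mat_sect_top]) auto
 moreover have "(%G. u (cmap O0 G)) = (%G. \<Sum>b<m. norm_form (sect O0 (top G)) G $$ (ridx (r, l, a), b) * sect O0 (top G) $$ (m - wid (r - l) + t, b))"
  using u l Cof_entry by (simp add: cmap_def fun_eq_iff)
 moreover have "pts (open_subspace GX ?W) = ?W" by auto
 ultimately show "(%G. u (cmap O0 G)) : smooth_funs (open_subspace GX ?W) (pts (open_subspace GX ?W))" by simp
qed

end

end

lemma linear_iso_inverse:
 fixes M :: "(real, 'a) module" and N :: "(real, 'b) module"
 assumes N: "vectorspace class_ring N" and \<rho>: "bij_betw \<rho> (carrier N) (carrier M)"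
  and add: "!!x y. x : carrier N ==> y : carrier N ==> \<rho> x \<oplus>\<^bsub>M\<^esub> \<rho> y = \<rho> (x \<oplus>\<^bsub>N\<^esub> y)"
  and smult: "!!c x. x : carrier N ==> c \<odot>\<^bsub>M\<^esub> \<rho> x = \<rho> (c \<odot>\<^bsub>N\<^esub> x)"
  and f: "!!x. x : carrier N ==> f (\<rho> x) = x"
 shows "linear_iso M N f"
proof -
 have ex: "\<exists>z\<in>carrier N. x = \<rho> z" if "x : carrier M" for x
  using bij_betw_imp_surj_on[OF \<rho>] that by blast
 have mem: "\<rho> z : carrier M" if "z : carrier N" for z using bij_betwE[OF \<rho>] that by blast
 have 1: "f x : carrier N" if "x : carrier M" for x using ex[OF that] f by auto
 have 2: "f (x \<oplus>\<^bsub>M\<^esub> y) = f x \<oplus>\<^bsub>N\<^esub> f y" if "x : carrier M" "y : carrier M" for x y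
  using ex[OF that(1)] ex[OF that(2)] add f real_vectorspaceD(1)[OF N] by auto
 have 3: "f (c \<odot>\<^bsub>M\<^esub> x) = c \<odot>\<^bsub>N\<^esub> f x" if "x : carrier M" for c x
  using ex[OF that] smult f real_vectorspaceD(7)[OF N] by auto
 have "bij_betw f (carrier M) (carrier N)"
 proof (rule bij_betw_byWitness[where f' = \<rho>])
  show "\<forall>x\<in>carrier M. \<rho> (f x) = x"
  proof
  fix x assume "x : carrier M"
  then obtain z where "z : carrier N" "x = \<rho> z" using ex by blast
  then show "\<rho> (f x) = x" using f by simp
  qed
 qed (use 1 mem f in auto)
 then show ?thesis using 1 2 3 by (auto simp: linear_iso_def LinearCombinations.module_hom_def)
qed

lemma smooth_map_const:
 assumes X: "smooth_sheaf X" and c: "c : pts Y" shows "smooth_map X Y (%x. c)"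
proof (rule smooth_mapI)
 show "continuous_map (top_of X) (top_of Y) (%x. c)" using c by simp
 show "(%x. f c) : smooth_funs X {x : pts X. c : W}" if "openin (top_of X) {x : pts X. c : W}" for W and f :: "'b => real"
  by (rule smooth_const[OF X that])
qed

lemma smooth_mat_open_subspace [simp]: "smooth_mat (open_subspace X U) W nr nc f = smooth_mat X W nr nc f"
 by (simp add: smooth_mat_def)

context blocks
begin

lemma mem_K_class: "x : Kcls G \<longleftrightarrow> (\<exists>q. qfam q & x = qm q * G)"
 by (auto simp: left_orbit_def Qset_qfam)

lemma K_class_self: "G : carrier_mat nn m ==> G : Kcls G"
 unfolding mem_K_class using qfam_one qm_one by (intro exI[of _ "%r. 1\<^sub>m (d r)"]) simp

section \<open>The linear structure of the fibers\<close>

lemma blocks_zero_entry: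
 assumes G: "G : carrier_mat nn m" and r: "1 <= r" "r <= p" "l < r"
 shows "rblk p d G r l = 0\<^sub>m (d r) m \<longleftrightarrow> (\<forall>a<d r. \<forall>b<m. G $$ (ridx (r, l, a), b) = 0)"
proof
 show "\<forall>a<d r. \<forall>b<m. G $$ (ridx (r, l, a), b) = 0" if e: "rblk p d G r l = 0\<^sub>m (d r) m"
 proof (intro allI impI)
  fix a b assume "a < d r" "b < m"
  then show "G $$ (ridx (r, l, a), b) = 0" using rblk_entry[OF G, of a r b l] e by simp
 qed
 show "rblk p d G r l = 0\<^sub>m (d r) m" if "\<forall>a<d r. \<forall>b<m. G $$ (ridx (r, l, a), b) = 0"
  using that rblk_entry[OF G] rblk_carrier[OF G, of r l] by (intro eq_matI) auto
qed

lemma VM_simps: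
 "carrier (model_fiber_module p d) = VC"
 "\<zero>\<^bsub>model_fiber_module p d\<^esub> = (\<lambda>r\<in>{1..p}. 0\<^sub>m (d r) (fiber_width d r))"
 "C \<oplus>\<^bsub>model_fiber_module p d\<^esub> D = (\<lambda>r\<in>{1..p}. C r + D r)"
 "c \<odot>\<^bsub>model_fiber_module p d\<^esub> C = (\<lambda>r\<in>{1..p}. c \<cdot>\<^sub>m C r)"
 by (simp_all add: VC_def model_fiber_module_def direct_sum_module_def module_mat_simps)

lemma model_vectorspace: "vectorspace class_ring (model_fiber_module p d)"
 unfolding model_fiber_module_def
proof (rule direct_sum_vectorspace)
 fix r
 show "vectorspace class_ring (module_mat TYPE(real) (d r) (fiber_width d r))"
  by (rule real_vectorspaceI) (auto simp: module_mat_simps add_smult_distrib_right_mat add_smult_distrib_left_mat intro!: eq_matI)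
qed

lemma VC_entry_carrier: "C : VC ==> r : {1..p} ==> C r : carrier_mat (d r) (fiber_width d r)"
 by (auto simp: VC_eq)

lemma Gof_add:
 assumes C: "C : VC" and D: "D : VC" and r: "(r, l, a) : rset" "0 < l" "b < m"
 shows "Gof s (\<lambda>r\<in>{1..p}. C r + D r) $$ (ridx (r, l, a), b) = Gof s C $$ (ridx (r, l, a), b) + Gof s D $$ (ridx (r, l, a), b)"
proof -
 have rr: "r : {1..p}" using r by auto
 note c = VC_entry_carrier[OF C rr] VC_entry_carrier[OF D rr]
 have "(C r + D r) $$ (a, coff r l + t) = C r $$ (a, coff r l + t) + D r $$ (a, coff r l + t)" if "t < wid (r - l)" for t
  using c r coff_less[of l r t] that by simp
 then show ?thesis unfolding Gof_entry[OF r] using rr by (simp add: distrib_right sum.distrib)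
qed

lemma Gof_smult:
 assumes C: "C : VC" and r: "(r, l, a) : rset" "0 < l" "b < m"
 shows "Gof s (\<lambda>r\<in>{1..p}. c \<cdot>\<^sub>m C r) $$ (ridx (r, l, a), b) = c * Gof s C $$ (ridx (r, l, a), b)"
proof -
 have rr: "r : {1..p}" using r by auto
 have "(c \<cdot>\<^sub>m C r) $$ (a, coff r l + t) = c * C r $$ (a, coff r l + t)" if "t < wid (r - l)" for t
  using VC_entry_carrier[OF C rr] r coff_less[of l r t] that by simp
 then show ?thesis unfolding Gof_entry[OF r] using rr by (simp add: sum_distrib_left mult.assoc)
qed

context
 fixes s :: "real mat"
 assumes s: "s : orth_mats m"
begin

lemma stack_add:
 assumes C: "C : VC" and D: "D : VC"
 shows "stack_blocks p m (%r j. if j = 0 then rblk p d (qm q * Gof s C) r 0 else rblk p d (qm q * Gof s C) r j + rblk p d (qm q * Gof s D) r j)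
  = qm q * Gof s (\<lambda>r\<in>{1..p}. C r + D r)" (is "stack_blocks p m ?X = ?R")
proof -
 have c: "qm q * Gof s C : carrier_mat nn m" for C by simp
 have X: "?X r j : carrier_mat (d r) m" for r j using rblk_carrier[OF c] by simp
 show ?thesis
  unfolding stack_blocks_eq[OF X]
 proof (rule gmat_eqI[OF gmat_carrier c])
  fix r j a b assume r: "(r, j, a) : rset" and b: "b < m"
  have a: "a < d r" using r by simp
  have rc: "rblk p d (qm q * Gof s C) r j : carrier_mat (d r) m" for C by (rule rblk_carrier[OF c])
  have L: "gmat (%r j a b. ?X r j $$ (a, b)) $$ (ridx (r, j, a), b) = ?X r j $$ (a, b)" by (rule gmat_entry[OF r b])
  show "gmat (%r j a b. ?X r j $$ (a, b)) $$ (ridx (r, j, a), b) = ?R $$ (ridx (r, j, a), b)"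
  proof (cases "j = 0")
  case True
  have "?X r j $$ (a, b) = (qm q * Gof s C) $$ (ridx (r, 0, a), b)" using True rblk_entry[OF c a b] by simp
  then show ?thesis
  unfolding L qm_mult_entry[OF Gof_carrier r b] using qm_mult_entry[OF Gof_carrier, of r 0 a b q s C] r b True
  by (simp add: Gof_entry0)
  next
  case False
  have "(rblk p d (qm q * Gof s C) r j + rblk p d (qm q * Gof s D) r j) $$ (a, b) = rblk p d (qm q * Gof s C) r j $$ (a, b) + rblk p d (qm q * Gof s D) r j $$ (a, b)"
  by (rule index_add_mat(1)) (use rc[of D] a b in auto)
  then have "?X r j $$ (a, b) = (qm q * Gof s C) $$ (ridx (r, j, a), b) + (qm q * Gof s D) $$ (ridx (r, j, a), b)"
  using False rblk_entry[OF c a b] by simp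
  also have "\<dots> = (\<Sum>x<d r. q r $$ (a, x) * (Gof s C $$ (ridx (r, j, x), b) + Gof s D $$ (ridx (r, j, x), b)))"
  unfolding qm_mult_entry[OF Gof_carrier r b] by (simp add: distrib_left sum.distrib)
  also have "\<dots> = ?R $$ (ridx (r, j, a), b)"
  unfolding qm_mult_entry[OF Gof_carrier r b] using r b False Gof_add[OF C D] by (intro sum.cong refl) simp
  finally show ?thesis unfolding L .
  qed
 qed
qed

lemma stack_smult:
 assumes C: "C : VC"
 shows "stack_blocks p m (%r j. if j = 0 then rblk p d (qm q * Gof s C) r 0 else c \<cdot>\<^sub>m rblk p d (qm q * Gof s C) r j)
  = qm q * Gof s (\<lambda>r\<in>{1..p}. c \<cdot>\<^sub>m C r)" (is "stack_blocks p m ?X = ?R")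
proof -
 have cc: "qm q * Gof s C : carrier_mat nn m" for C by simp
 have X: "?X r j : carrier_mat (d r) m" for r j using rblk_carrier[OF cc] by simp
 show ?thesis
  unfolding stack_blocks_eq[OF X]
 proof (rule gmat_eqI[OF gmat_carrier cc])
  fix r j a b assume r: "(r, j, a) : rset" and b: "b < m"
  have a: "a < d r" using r by simp
  have rc: "rblk p d (qm q * Gof s C) r j : carrier_mat (d r) m" for C by (rule rblk_carrier[OF cc])
  have L: "gmat (%r j a b. ?X r j $$ (a, b)) $$ (ridx (r, j, a), b) = ?X r j $$ (a, b)" by (rule gmat_entry[OF r b])
  show "gmat (%r j a b. ?X r j $$ (a, b)) $$ (ridx (r, j, a), b) = ?R $$ (ridx (r, j, a), b)"
  proof (cases "j = 0")
  case True
  have "?X r j $$ (a, b) = (qm q * Gof s C) $$ (ridx (r, 0, a), b)" using True rblk_entry[OF cc a b] by simp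
  then show ?thesis
  unfolding L qm_mult_entry[OF Gof_carrier r b] using qm_mult_entry[OF Gof_carrier, of r 0 a b q s C] r b True
  by (simp add: Gof_entry0)
  next
  case False
  have "(c \<cdot>\<^sub>m rblk p d (qm q * Gof s C) r j) $$ (a, b) = c * rblk p d (qm q * Gof s C) r j $$ (a, b)"
  by (rule index_smult_mat(1)) (use rc[of C] a b in auto)
  then have "?X r j $$ (a, b) = c * (qm q * Gof s C) $$ (ridx (r, j, a), b)"
  using False rblk_entry[OF cc a b] by simp
  also have "\<dots> = (\<Sum>x<d r. q r $$ (a, x) * (c * Gof s C $$ (ridx (r, j, x), b)))"
  unfolding qm_mult_entry[OF Gof_carrier r b] by (simp add: sum_distrib_left mult.left_commute)
  also have "\<dots> = ?R $$ (ridx (r, j, a), b)"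
  unfolding qm_mult_entry[OF Gof_carrier r b] using r b False Gof_smult[OF C] by (intro sum.cong refl) simp
  finally show ?thesis unfolding L .
  qed
 qed
qed

text \<open>Equal frames force the same group element, again by the formula of
  \<open>agrees_family\<close>. So in \<open>K_add\<close> each representative of one class is
  paired with exactly one of the other, and the sum is a single class.\<close>

lemma same_top_family:
 assumes q: "qfam q" and q': "qfam q'" and z: "zero_part p d (qm q * Gof s C) = zero_part p d (qm q' * Gof s D)"
 shows "qm q = qm q'"
proof (rule qm_cong)
 fix r assume r: "r : {1..p}"
 have c: "qm q * Gof s C : carrier_mat nn m" "qm q' * Gof s D : carrier_mat nn m" by simp_all
 have t: "top (qm q * Gof s C) = top (qm q' * Gof s D)" using z zero_part_eq_iff[OF c] by simp
 have G: "qm q * Gof s C : GOX" by (rule qm_GOX[OF q Gof_GO[OF s]])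
 obtain Om where Om: "Om : orth_mats m" "agrees Om (qm q * Gof s C)" by (rule agrees_exists[OF G])
 have Om2: "agrees Om (qm q' * Gof s D)" using Om(2) t by (simp add: agrees_def)
 have "q r $$ (a, x) = q' r $$ (a, x)" if "a < d r" "x < d r" for a x
 proof -
  have "q r $$ (a, x) = (\<Sum>b<m. Om $$ (ooff r + a, b) * Gof s C $$ (ridx (r, 0, x), b))"
  by (rule agrees_family[OF Om(1) Gof_agrees Om(2) q Gof_carrier s, symmetric]) (use r that in auto)
  also have "\<dots> = (\<Sum>b<m. Om $$ (ooff r + a, b) * Gof s D $$ (ridx (r, 0, x), b))"
  using r that by (intro sum.cong refl) (simp add: Gof_entry0)
  also have "\<dots> = q' r $$ (a, x)"
  by (rule agrees_family[OF Om(1) Gof_agrees Om2 q' Gof_carrier s]) (use r that in auto)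
  finally show ?thesis .
 qed
 then show "q r = q' r" using qfam_carrier[OF q r] qfam_carrier[OF q' r] by (intro eq_matI) auto
qed

text \<open>The matched representatives arise from one group element acting on both normal forms,
  and this action is linear in the blocks of positive shift. Addition of classes is thus addition of
  coefficients for a fixed frame.\<close>

lemma K_add_Gof:
 assumes C: "C : VC" and D: "D : VC"
 shows "K_add p m d (Kcls (Gof s C)) (Kcls (Gof s D)) = Kcls (Gof s (\<lambda>r\<in>{1..p}. C r + D r))"
proof (intro equalityI subsetI)
 fix x assume "x : K_add p m d (Kcls (Gof s C)) (Kcls (Gof s D))"
 then obtain q q' where q: "qfam q" "qfam q'" "zero_part p d (qm q * Gof s C) = zero_part p d (qm q' * Gof s D)"
  and x: "x = stack_blocks p m (%r j. if j = 0 then rblk p d (qm q * Gof s C) r 0 else rblk p d (qm q * Gof s C) r j + rblk p d (qm q' * Gof s D) r j)"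
  unfolding K_add_def mem_K_class by blast
 have e: "qm q' = qm q" using same_top_family[OF q] by simp
 have "x = qm q * Gof s (\<lambda>r\<in>{1..p}. C r + D r)" unfolding x e by (rule stack_add[OF C D])
 then show "x : Kcls (Gof s (\<lambda>r\<in>{1..p}. C r + D r))" unfolding mem_K_class using q by blast
next
 fix x assume "x : Kcls (Gof s (\<lambda>r\<in>{1..p}. C r + D r))"
 then obtain q where q: "qfam q" "x = qm q * Gof s (\<lambda>r\<in>{1..p}. C r + D r)" unfolding mem_K_class by blast
 have "zero_part p d (qm q * Gof s C) = zero_part p d (qm q * Gof s D)"
 proof -
  have cq: "qm q * Gof s C : carrier_mat nn m" "qm q * Gof s D : carrier_mat nn m" by simp_all
  have "top (qm q * Gof s C) $$ (i, b) = top (qm q * Gof s D) $$ (i, b)" if ib: "i < m" "b < m" for i b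
  proof (cases "i < ltot p d")
  case True
  from ltot_cases[OF True] obtain r a where r: "1 <= r" "r <= p" "a < d r" "i = ooff r + a" by blast
  then show ?thesis using top_qm[OF Gof_carrier r(1-3) ib(2)] ib(2) by (simp add: top_entry Gof_entry0)
  qed (use ib in \<open>simp add: top_def\<close>)
  then have "top (qm q * Gof s C) = top (qm q * Gof s D)" by (intro eq_matI) (simp_all add: top_def)
  then show ?thesis using zero_part_eq_iff[OF cq] by simp
 qed
 then show "x : K_add p m d (Kcls (Gof s C)) (Kcls (Gof s D))"
  unfolding K_add_def mem_K_class q(2) stack_add[OF C D, symmetric] using q(1) by blast
qed

lemma K_smult_Gof:
 assumes C: "C : VC"
 shows "K_smult p m d c (Kcls (Gof s C)) = Kcls (Gof s (\<lambda>r\<in>{1..p}. c \<cdot>\<^sub>m C r))"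
proof (intro equalityI subsetI)
 fix x assume "x : K_smult p m d c (Kcls (Gof s C))"
 then obtain q where q: "qfam q"
  and x: "x = stack_blocks p m (%r j. if j = 0 then rblk p d (qm q * Gof s C) r 0 else c \<cdot>\<^sub>m rblk p d (qm q * Gof s C) r j)"
  unfolding K_smult_def mem_K_class by blast
 show "x : Kcls (Gof s (\<lambda>r\<in>{1..p}. c \<cdot>\<^sub>m C r))"
  unfolding x stack_smult[OF C] mem_K_class using q by blast
next
 fix x assume "x : Kcls (Gof s (\<lambda>r\<in>{1..p}. c \<cdot>\<^sub>m C r))"
 then obtain q where q: "qfam q" "x = qm q * Gof s (\<lambda>r\<in>{1..p}. c \<cdot>\<^sub>m C r)" unfolding mem_K_class by blast
 show "x : K_smult p m d c (Kcls (Gof s C))"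
  unfolding K_smult_def mem_K_class q(2) stack_smult[OF C, symmetric] using q(1) by blast
qed

text \<open>The flag of G being that of s, the two frames differ by a block diagonal factor, and the
  corresponding group element moves G to frame s, where it is given by its coefficients.\<close>

lemma fiber_point:
 assumes G: "G : GOX" and bproj: "bproj (Kcls G) = left_orbit stab s"
 obtains q where "qfam q" "qm q * G : GOX" "Gof s (Cof s (qm q * G)) = qm q * G" "Kcls (qm q * G) = Kcls G"
proof -
 obtain Om where Om: "Om : orth_mats m" "agrees Om G" by (rule agrees_exists[OF G])
 have "left_orbit stab Om = left_orbit stab s" using pi_eq[OF G Om] bproj by simp
 then obtain h where h: "h : stab" "s = h * Om" using stab_orbit_eq[OF Om(1) s] by blast
 obtain q where q: "qfam q" "agrees s (qm q * G)" using norm_form[OF G Om h] by blast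
 have g: "qm q * G : GOX" by (rule qm_GOX[OF q(1) G])
 show thesis by (rule that[OF q(1) g Gof_Cof[OF s g q(2)] K_class_qm[OF GO_carrier[OF G] q(1)]])
qed

lemma pi_Gof: "bproj (Kcls (Gof s C)) = left_orbit stab s"
 by (rule pi_eq[OF Gof_GO[OF s] s Gof_agrees])

lemma zero_VC: "(\<lambda>r\<in>{1..p}. 0\<^sub>m (d r) (fiber_width d r)) : VC"
 by (auto simp: VC_eq)

lemma K_zero_Gof:
 "K_zero p m d bproj (left_orbit stab s) = Kcls (Gof s (\<lambda>r\<in>{1..p}. 0\<^sub>m (d r) (fiber_width d r)))"
 (is "_ = Kcls (Gof s ?Z)")
proof (intro equalityI subsetI)
 have z: "Gof s ?Z $$ (ridx (r, l, a), b) = 0" if "(r, l, a) : rset" "0 < l" "b < m" for r l a b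
  unfolding Gof_entry[OF that] using that coff_less[of l r] by (intro sum.neutral) auto
 fix x
 {
  assume "x : Kcls (Gof s ?Z)"
  then obtain q where q: "qfam q" "x = qm q * Gof s ?Z" unfolding mem_K_class by blast
  have x: "x : GOX" unfolding q(2) by (rule qm_GOX[OF q(1) Gof_GO[OF s]])
  have "bproj (Kcls x) = left_orbit stab s" unfolding q(2) K_class_qm[OF Gof_carrier q(1)] by (rule pi_Gof)
  moreover have "rblk p d x r l = 0\<^sub>m (d r) m" if r: "r : {1..p}" "0 < l" "l < r" for r l
  proof -
  have r': "1 <= r" "r <= p" using r by auto
  have "x $$ (ridx (r, l, a), b) = 0" if "a < d r" "b < m" for a b
  proof -
  have ra: "(r, l, a) : rset" using r that by simp
  show ?thesis
  unfolding q(2) qm_mult_entry[OF Gof_carrier ra that(2)] using z r r' that(2) by (intro sum.neutral) simp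
  qed
  then show ?thesis unfolding blocks_zero_entry[OF GO_carrier[OF x] r' r(3)] by blast
  qed
  ultimately show "x : K_zero p m d bproj (left_orbit stab s)" using x by (simp add: K_zero_def GOX_def)
 }
 assume "x : K_zero p m d bproj (left_orbit stab s)"
 then have x: "x : GOX" "bproj (Kcls x) = left_orbit stab s"
  and zz: "!!r l. r : {1..p} ==> 0 < l ==> l < r ==> rblk p d x r l = 0\<^sub>m (d r) m"
  by (auto simp: K_zero_def GOX_def)
 obtain q where q: "qfam q" "qm q * x : GOX" "Gof s (Cof s (qm q * x)) = qm q * x" "Kcls (qm q * x) = Kcls x"
  by (rule fiber_point[OF x])
 have xc: "x : carrier_mat nn m" using x(1) by (rule GO_carrier)
 have zx: "(qm q * x) $$ (ridx (r, l, a), b) = 0" if "(r, l, a) : rset" "0 < l" "b < m" for r l a b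
 proof -
  have "x $$ (ridx (r, l, a'), b) = 0" if "a' < d r" for a'
  using zz[of r l] blocks_zero_entry[OF xc, of r l] that \<open>(r, l, a) : rset\<close> \<open>0 < l\<close> \<open>b < m\<close> by auto
  then show ?thesis unfolding qm_mult_entry[OF xc that(1,3)] by (intro sum.neutral) auto
 qed
 have "Cof s (qm q * x) = ?Z"
 proof (rule VC_eqI[OF Cof_VC zero_VC])
  fix r l t a assume r: "1 <= l" "l < r" "r <= p" "a < d r" "t < wid (r - l)"
  then show "Cof s (qm q * x) r $$ (a, coff r l + t) = ?Z r $$ (a, coff r l + t)"
  unfolding Cof_entry[OF r] using zx[of r l a] coff_less[of l r t] by simp
 qed
 then have "Kcls (Gof s ?Z) = Kcls x" using q(3,4) by simp
 then show "x : Kcls (Gof s ?Z)" using K_class_self[OF xc] by simp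
qed

lemma fiber_bij:
 "bij_betw (%C. Kcls (Gof s C)) VC {x : pts KX. bproj x = left_orbit stab s}"
 unfolding bij_betw_def
proof (intro conjI inj_onI equalityI subsetI)
 fix C D assume C: "C : VC" and D: "D : VC" and e: "Kcls (Gof s C) = Kcls (Gof s D)"
 obtain q where q: "qfam q" "Gof s D = qm q * Gof s C"
  using K_class_GOX_eq[OF Gof_GO[OF s] Gof_GO[OF s], THEN iffD1, OF e] by (elim exE conjE)
 have "agrees s (qm q * Gof s C)" unfolding q(2)[symmetric] by (rule Gof_agrees)
 then have "qm q * Gof s C = Gof s C" by (rule agrees_unique[OF s Gof_agrees _ q(1) Gof_carrier])
 then have "Gof s C = Gof s D" unfolding q(2) by (rule sym)
 then have "Cof s (Gof s C) = Cof s (Gof s D)" by (rule arg_cong)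
 then show "C = D" unfolding Cof_Gof[OF s C] Cof_Gof[OF s D] .
next
 fix x assume "x : (%C. Kcls (Gof s C)) ` VC"
 then obtain C where x: "x = Kcls (Gof s C)" by (elim imageE)
 show "x : {x : pts KX. bproj x = left_orbit stab s}"
  unfolding x pts_KX using imageI[OF Gof_GO[OF s]] pi_Gof by (intro CollectI conjI)
next
 fix x assume "x : {x : pts KX. bproj x = left_orbit stab s}"
 then obtain G where G: "G : GOX" "x = Kcls G" "bproj (Kcls G) = left_orbit stab s" by auto
 obtain q where "Gof s (Cof s (qm q * G)) = qm q * G" "Kcls (qm q * G) = Kcls G"
  by (rule fiber_point[OF G(1,3)])
 then have "x = Kcls (Gof s (Cof s (qm q * G)))" using G by simp
 then show "x : (%C. Kcls (Gof s C)) ` VC" by (rule image_eqI[OF _ Cof_VC])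
qed

lemma fiber_module_simps:
 "carrier (fiber_module p m d bproj b) = {x : pts KX. bproj x = b}"
 "x \<oplus>\<^bsub>fiber_module p m d bproj b\<^esub> y = K_add p m d x y"
 "c \<odot>\<^bsub>fiber_module p m d bproj b\<^esub> x = K_smult p m d c x"
 "\<zero>\<^bsub>fiber_module p m d bproj b\<^esub> = K_zero p m d bproj b"
 by (simp_all add: fiber_module_def K_space_eq)

lemma fiber_vectorspace: "vectorspace class_ring (fiber_module p m d bproj (left_orbit stab s))"
 by (rule transfer_vectorspace[OF model_vectorspace, where \<rho> = "%C. Kcls (Gof s C)"])
  (simp_all only: VM_simps fiber_module_simps fiber_bij K_add_Gof K_smult_Gof K_zero_Gof)

lemma fiber_linear_iso:
 assumes "!!C. C : VC ==> f (Kcls (Gof s C)) = C"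
 shows "linear_iso (fiber_module p m d bproj (left_orbit stab s)) (model_fiber_module p d) f"
 by (rule linear_iso_inverse[OF model_vectorspace, where \<rho> = "%C. Kcls (Gof s C)"])
  (simp_all only: VM_simps fiber_module_simps fiber_bij K_add_Gof K_smult_Gof assms)

end

section \<open>Local trivializations\<close>

lemma smooth_map_into_OX:
 assumes "smooth_sheaf X" "smooth_mat X (pts X) m m f" "!!x. x : pts X ==> f x : orth_mats m"
 shows "smooth_map X OX f"
 unfolding OX_def by (rule smooth_map_into_matrices[OF assms])

lemma smooth_VX_entry:
 assumes "openin (top_of VX) W" "r : {1..p}" "a < d r" "c < fiber_width d r"
 shows "(%C. C r $$ (a, c)) : smooth_funs VX W"
 using assms unfolding VX_def model_fiber_space_def by (intro smooth_funs_coordinate) blast+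

context
 fixes O0 :: "real mat"
 assumes O0: "O0 : orth_mats m"
begin

text \<open>\<open>sect O0\<close> is constant on orbits, so it descends from orthogonal matrices to
  a smooth map on the chart domain in the flag manifold.\<close>

lemma section_map:
 obtains S where "smooth_map (open_subspace FX (chart_dom O0)) OX S"
  "!!Om. Om : orth_mats m ==> sdom O0 Om ==> S (left_orbit stab Om) = sect O0 Om"
proof -
 let ?W = "{x : pts OX. left_orbit stab x : chart_dom O0}"
 have W: "openin (top_of OX) ?W"
  using openin_chart_dom[OF O0] unfolding FX_def topology_quotient_space by blast
 have We: "x : orth_mats m & sdom O0 x" if "x : ?W" for x using that in_chart_dom[OF O0, of x] by simp
 have sh: "smooth_sheaf (open_subspace OX ?W)" by (rule smooth_sheaf_open_subspace[OF sheaf_OX W])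
 have pt: "pts (open_subspace OX ?W) = ?W" by auto
 have sm: "smooth_map (open_subspace OX ?W) OX (sect O0)"
 proof (rule smooth_map_into_OX[OF sh], unfold pt smooth_mat_open_subspace)
  show "smooth_mat OX ?W m m (sect O0)"
  by (rule smooth_sect[OF sheaf_OX W smooth_mat_OX[OF W] O0]) (rule We[THEN conjunct2])
  show "sect O0 x : orth_mats m" if "x : ?W" for x
  by (rule sect_orth[OF O0 We[OF that, THEN conjunct2]])
 qed
 have inv: "sect O0 x = sect O0 y" if "x : pts OX" "y : pts OX" "left_orbit stab x : chart_dom O0" "left_orbit stab x = left_orbit stab y" for x y
 proof -
  have xy: "x : orth_mats m" "y : orth_mats m" using that by auto
  have dm: "sdom O0 x" by (rule in_chart_dom[OF O0 xy(1), THEN iffD1, OF that(3)])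
  from stab_orbit_eq[OF xy, THEN iffD1, OF that(4)] obtain h where h: "h : stab" "y = h * x" by (elim bexE)
  show ?thesis unfolding h(2) by (rule sect_stab(2)[OF O0 xy(1) h(1) dm, symmetric])
 qed
 have U: "openin (top_of (quotient_space OX (left_orbit stab))) (chart_dom O0)"
  using openin_chart_dom[OF O0] by (simp only: FX_def)
 obtain S where S: "smooth_map (open_subspace (quotient_space OX (left_orbit stab)) (chart_dom O0)) OX S"
  "!!x. x : pts OX ==> left_orbit stab x : chart_dom O0 ==> S (left_orbit stab x) = sect O0 x"
  by (rule smooth_map_descend[OF sheaf_OX U sm]) (erule (3) inv, rule that)
 show thesis
 proof (rule that)
  show "smooth_map (open_subspace FX (chart_dom O0)) OX S" using S(1) by (simp only: FX_def)
  show "S (left_orbit stab Om) = sect O0 Om" if "Om : orth_mats m" "sdom O0 Om" for Om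
  using S(2)[of Om] in_chart_dom[OF O0 that(1)] that by simp
 qed
qed

lemma smooth_map_pi_local: "smooth_map (open_subspace KX {y : pts KX. bproj y : chart_dom O0}) FX bproj"
proof -
 let ?W = "{G : GOX. sdom O0 (top G)}"
 note W = openin_sdom[OF O0]
 have sh: "smooth_sheaf (open_subspace GX ?W)" by (rule smooth_sheaf_open_subspace[OF sheaf_GX W])
 have pt: "pts (open_subspace GX ?W) = ?W" by auto
 have "smooth_map (open_subspace GX ?W) OX (%G. sect O0 (top G))"
  unfolding OX_def by (rule smooth_map_into_matrices[OF sh])
  (use pt smooth_mat_sect_top[OF O0] sect_orth[OF O0] in auto)
 then have "smooth_map (open_subspace GX ?W) FX (%G. left_orbit stab (sect O0 (top G)))"
  unfolding FX_def by (rule smooth_map_comp[OF _ smooth_map_quotient_projection])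
 then have "smooth_map (open_subspace GX ?W) FX (%G. bproj (Kcls G))"
 proof (rule smooth_map_cong[OF sh])
  fix G assume "G : pts (open_subspace GX ?W)"
  then have G: "G : GOX" "sdom O0 (top G)" by auto
  show "left_orbit stab (sect O0 (top G)) = bproj (Kcls G)" by (rule sect_facts[OF O0 G]) simp
 qed
 then show ?thesis
  using smooth_map_from_quotient[OF sheaf_GX, of "Kcls" "{y : pts KX. bproj y : chart_dom O0}" FX bproj]
  preimage_chart[OF O0] openin_bundle_chart[OF O0] by (simp only: KX_def[symmetric])
qed

text \<open>The map is the projection paired with the coefficients \<open>cmap\<close>, both
  descended from normal forms. Its inverse sends (f, C) to the class of the normal form with frame S
  f and coefficients C, where S is the smooth section on the base; \<open>Gof_Cof\<close> and
  \<open>Gof_section\<close> give the two compositions.\<close>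

lemma trivialization:
 obtains \<Phi> where "local_trivialization KX FX bproj VX (chart_dom O0) \<Phi>"
  "!!G. G : GOX ==> sdom O0 (top G) ==> snd (\<Phi> (Kcls G)) = cmap O0 G"
proof -
 let ?U = "{y : pts KX. bproj y : chart_dom O0}" and ?P = "product_space (open_subspace FX (chart_dom O0)) VX"
 note U = openin_bundle_chart[OF O0]
 have pre: "{G : pts GX. Kcls G : ?U} = {G : GOX. sdom O0 (top G)}" by (rule preimage_chart[OF O0])
 have shU: "smooth_sheaf (open_subspace KX ?U)" by (rule smooth_sheaf_open_subspace[OF sheaf_KX U])
 have shF: "smooth_sheaf (open_subspace FX (chart_dom O0))" by (rule smooth_sheaf_open_subspace[OF sheaf_FX openin_chart_dom[OF O0]])
 have shP: "smooth_sheaf ?P" by (rule smooth_sheaf_product[OF shF sheaf_VX])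
 have U': "openin (top_of (quotient_space GX (Kcls))) ?U" using U by (simp only: KX_def)
 have c': "smooth_map (open_subspace GX {G : pts GX. Kcls G : ?U}) VX (cmap O0)"
  unfolding pre by (rule smooth_map_cmap[OF O0])
 have inv: "cmap O0 G = cmap O0 G'" if "G : pts GX" "G' : pts GX" "Kcls G : ?U" "Kcls G = Kcls G'" for G G'
  using cmap_class(2)[OF O0, of G G'] that pi_in_chart_dom[OF O0, of G] by simp
 obtain \<gamma> where g: "smooth_map (open_subspace (quotient_space GX (Kcls)) ?U) VX \<gamma>"
  "!!G. G : pts GX ==> Kcls G : ?U ==> \<gamma> (Kcls G) = cmap O0 G"
  by (rule smooth_map_descend[OF sheaf_GX U' c']) (erule (3) inv, rule that)
 have g1: "smooth_map (open_subspace KX ?U) VX \<gamma>" using g(1) by (simp only: KX_def)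
 have g2: "\<gamma> (Kcls G) = cmap O0 G" if "G : GOX" "sdom O0 (top G)" for G
  using g(2)[of G] that pi_in_chart_dom[OF O0 that(1)] by simp
 obtain S where S: "smooth_map (open_subspace FX (chart_dom O0)) OX S"
  "!!Om. Om : orth_mats m ==> sdom O0 Om ==> S (left_orbit stab Om) = sect O0 Om" by (rule section_map) (rule that)
 define \<Phi> where "\<Phi> y = (bproj y, \<gamma> y)" for y
 define \<Psi> where "\<Psi> z = Kcls (Gof (S (fst z)) (snd z))" for z
 have fdom: "\<exists>Om. Om : orth_mats m & sdom O0 Om & f = left_orbit stab Om & S f = sect O0 Om" if "f : chart_dom O0" for f
  using that S(2) by (auto simp: chart_dom_def)
 have ptP: "pts ?P = chart_dom O0 \<times> VC" using openin_subset[OF openin_chart_dom[OF O0]] by auto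
 have Ssec: "S f : orth_mats m & sdom O0 (S f) & sect O0 (S f) = S f & left_orbit stab (S f) = f" if f: "f : chart_dom O0" for f
 proof -
  obtain Om where Om: "Om : orth_mats m" "sdom O0 Om" "f = left_orbit stab Om" "S f = sect O0 Om" using fdom[OF f] by blast
  obtain h where h: "h : stab" "sect O0 Om = h * Om" by (rule sect_in_orbit[OF O0 Om(1,2)])
  show ?thesis unfolding Om(4) using sect_idem[OF O0 Om(2)] sect_orth[OF O0 Om(2)] stab_orbit_mult[OF Om(1) h(1)] h(2) Om(3) by simp
 qed
 have \<Phi>s: "smooth_map (open_subspace KX ?U) ?P \<Phi>"
 proof (rule smooth_map_into_product[OF shU shF sheaf_VX])
  show "smooth_map (open_subspace KX ?U) (open_subspace FX (chart_dom O0)) (%x. fst (\<Phi> x))"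
  unfolding \<Phi>_def fst_conv by (rule smooth_map_into_open[OF smooth_map_pi_local _ openin_chart_dom[OF O0]]) simp
  show "smooth_map (open_subspace KX ?U) VX (%x. snd (\<Phi> x))" unfolding \<Phi>_def snd_conv by (rule g1)
 qed
 have Gs: "smooth_map ?P GX (%z. Gof (S (fst z)) (snd z))"
  unfolding GX_def
 proof (rule smooth_map_into_matrices[OF shP])
  have Sm: "(%z. S (fst z) $$ (i, b)) : smooth_funs ?P (pts ?P)" if "i < m" "b < m" for i b
  by (rule smooth_map_pullback_pts[OF smooth_map_comp[OF smooth_map_fst[OF shF sheaf_VX] S(1)]])
  (rule smooth_mat_entry[OF smooth_mat_OX[OF openin_topspace] that])
  have Cm: "(%z. snd z r $$ (a, c)) : smooth_funs ?P (pts ?P)" if "r : {1..p}" "a < d r" "c < fiber_width d r" for r a c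
  by (rule smooth_map_pullback_pts[OF smooth_map_snd[OF shF sheaf_VX]]) (rule smooth_VX_entry[OF openin_topspace that])
  show "smooth_mat ?P (pts ?P) nn m (%z. Gof (S (fst z)) (snd z))"
  proof (rule smooth_matI)
  fix i b assume i: "i < nn" and b: "b < m"
  obtain r l a where ra: "(r, l, a) : rset" "i = ridx (r, l, a)" by (rule ridx_cases[OF i])
  show "(%z. Gof (S (fst z)) (snd z) $$ (i, b)) : smooth_funs ?P (pts ?P)"
  proof (cases "l = 0")
  case True
  then show ?thesis using ra b Gof_entry0[of r a b] ooff_le[of r] Sm[of "ooff r + a" b] by simp
  next
  case False
  have w: "wid (r - l) <= m" using ra by (intro wid_le) auto
  have "(%z. \<Sum>t<wid (r - l). snd z r $$ (a, coff r l + t) * S (fst z) $$ (m - wid (r - l) + t, b)) : smooth_funs ?P (pts ?P)"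
  by (intro smooth_sum[OF shP openin_topspace] smooth_mult[OF shP openin_topspace] Sm Cm)
  (use ra b False w coff_less[of l r] in auto)
  then show ?thesis using Gof_entry[OF ra(1) _ b] False by (simp add: ra(2))
  qed
  qed simp
  show "Gof (S (fst x)) (snd x) : GOX" if "x : pts ?P" for x
  using that Ssec[of "fst x"] Gof_GO unfolding ptP by auto
 qed
 have \<Psi>s: "smooth_map ?P (open_subspace KX ?U) \<Psi>"
 proof (rule smooth_map_into_open[OF _ _ U])
  show "smooth_map ?P KX \<Psi>" unfolding \<Psi>_def KX_def by (rule smooth_map_comp[OF Gs smooth_map_quotient_projection])
  show "\<Psi> x : ?U" if "x : pts ?P" for x
  using that Ssec[of "fst x"] Gof_GO[of "S (fst x)" "snd x"] pi_Gof[of "S (fst x)" "snd x"] unfolding ptP \<Psi>_def by auto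
 qed
 have "diffeomorphism (open_subspace KX ?U) ?P \<Phi>"
 proof (rule diffeomorphismI[OF \<Phi>s \<Psi>s])
  fix y assume "y : pts (open_subspace KX ?U)"
  then obtain G where G: "G : GOX" "y = Kcls G" "bproj y : chart_dom O0" by auto
  then have dm: "sdom O0 (top G)" using pi_in_chart_dom[OF O0 G(1)] by simp
  obtain q where q: "qfam q" "norm_form (sect O0 (top G)) G = qm q * G" "agrees (sect O0 (top G)) (qm q * G)"
  "sect O0 (top G) : orth_mats m" "qm q * G : GOX" "bproj (Kcls G) = left_orbit stab (sect O0 (top G))"
  by (rule sect_facts[OF O0 G(1) dm])
  let ?s = "sect O0 (top G)"
  have si: "sdom O0 ?s" "sect O0 ?s = ?s" using sect_idem[OF O0 dm] by auto
  have "S (bproj y) = ?s" unfolding G(2) q(6) using S(2)[OF q(4) si(1)] si(2) by simp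
  moreover have "\<gamma> y = Cof ?s (qm q * G)" using g2[OF G(1) dm] G(2) q(2) by (simp add: cmap_def)
  ultimately have "\<Psi> (\<Phi> y) = Kcls (qm q * G)" using Gof_Cof[OF q(4,5,3)] by (simp add: \<Psi>_def \<Phi>_def)
  then show "\<Psi> (\<Phi> y) = y" using K_class_qm[OF GO_carrier[OF G(1)] q(1)] G(2) by simp
 next
  fix z assume "z : pts ?P"
  then have z: "fst z : chart_dom O0" "snd z : VC" unfolding ptP by auto
  let ?s = "S (fst z)"
  have s: "?s : orth_mats m" "sdom O0 ?s" "sect O0 ?s = ?s" "left_orbit stab ?s = fst z" using Ssec[OF z(1)] by auto
  have "bproj (\<Psi> z) = fst z" using pi_Gof[OF s(1)] s(4) by (simp add: \<Psi>_def)
  moreover have "\<gamma> (\<Psi> z) = snd z"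
  using g2[OF Gof_GO[OF s(1)], of "snd z"] Gof_section[OF O0 s(1-3) z(2)] by (simp add: \<Psi>_def)
  ultimately show "\<Phi> (\<Psi> z) = z" by (simp add: \<Phi>_def)
 qed
 then have "local_trivialization KX FX bproj VX (chart_dom O0) \<Phi>"
  using openin_chart_dom[OF O0] by (auto simp: local_trivialization_def \<Phi>_def)
 moreover have "snd (\<Phi> (Kcls G)) = cmap O0 G" if "G : GOX" "sdom O0 (top G)" for G
  using g2[OF that] by (simp add: \<Phi>_def)
 ultimately show thesis by (rule that)
qed

end


section \<open>The bundle as a manifold\<close>

definition fdim :: nat where "fdim = (\<Sum>r=1..p. d r * fiber_width d r)"

definition vset :: "(nat \<times> nat \<times> nat) set" where
 "vset = (SIGMA r:{1..p}. {..<d r} \<times> {..<fiber_width d r})"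

lemma card_vset: "card vset = fdim" "finite vset"
 by (simp_all add: vset_def fdim_def)

lemma VX_chart: "\<exists>\<phi>. diffeomorphism VX (Rn_space fdim) \<phi>"
proof -
 obtain e where e: "bij_betw e {0..<fdim} vset" using ex_bij_betw_nat_finite[OF card_vset(2)] card_vset(1) by auto
 define e' where "e' = inv_into {0..<fdim} e"
 have ee: "e' (e i) = i" "e i : vset" if "i < fdim" for i
  using that e bij_betw_inv_into_left[OF e, of i] bij_betwE[OF e] by (auto simp: e'_def)
 have ee': "e (e' x) = x" "e' x < fdim" if "x : vset" for x
  using that bij_betw_inv_into_right[OF e, of x] bij_betwE[OF bij_betw_inv_into[OF e]] by (auto simp: e'_def)
 define \<phi> where "\<phi> C i = (if i < fdim then case e i of (r, a, c) => C r $$ (a, c) else (0::real))" for C :: "nat => real mat" and i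
 define \<psi> where "\<psi> x = (\<lambda>r\<in>{1..p}. Matrix.mat (d r) (fiber_width d r) (%(a, c). x (e' (r, a, c)) :: real))" for x
 have "diffeomorphism VX (Rn_space fdim) \<phi>"
 proof (rule diffeomorphismI)
  show "smooth_map VX (Rn_space fdim) \<phi>"
  proof (rule smooth_map_into_Rn[OF sheaf_VX])
  fix i assume i: "i < fdim"
  obtain r a c where rac: "e i = (r, a, c)" by (cases "e i")
  then have "r : {1..p}" "a < d r" "c < fiber_width d r" using ee(2)[OF i] by (auto simp: vset_def)
  then show "(%x. \<phi> x i) : smooth_funs VX (pts VX)"
  using smooth_VX_entry[OF openin_topspace] i rac by (simp add: \<phi>_def)
  qed (simp add: \<phi>_def)
  show "smooth_map (Rn_space fdim) VX \<psi>"
  unfolding VX_def model_fiber_space_def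
  proof (rule smooth_map_into_coordinate[OF smooth_sheaf_Rn])
  show "\<psi> x : carrier (model_fiber_module p d)" for x
  unfolding VC_def[symmetric] VC_eq by (auto simp: \<psi>_def)
  fix u :: "(nat => real mat) => real" assume "u : {%C. C r $$ (a, b) | r a b. r : {1..p} & a < d r & b < fiber_width d r}"
  then obtain r a c where u: "u = (%C. C r $$ (a, c))" "r : {1..p}" "a < d r" "c < fiber_width d r" by blast
  then show "(%x. u (\<psi> x)) : smooth_funs (Rn_space fdim) (pts (Rn_space fdim))"
  using smooth_funs_Rn_coord_pts by (simp add: \<psi>_def)
  qed
  show "\<psi> (\<phi> C) = C" if "C : pts VX" for C
  proof -
  have C: "C : VC" using that by simp
  have P: "\<psi> (\<phi> C) : VC" by (auto simp: VC_eq \<psi>_def)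
  show ?thesis
  proof (rule VC_eqI[OF P C])
  fix r l t a assume r: "1 <= l" "l < r" "r <= p" "a < d r" "t < wid (r - l)"
  have v: "(r, a, coff r l + t) : vset" using r coff_less[of l r t] by (simp add: vset_def)
  show "\<psi> (\<phi> C) r $$ (a, coff r l + t) = C r $$ (a, coff r l + t)"
  using r coff_less[of l r t] ee'[OF v] by (simp add: \<psi>_def \<phi>_def)
  qed
  qed
  show "\<phi> (\<psi> x) = x" if "x : pts (Rn_space fdim)" for x
  proof
  fix i
  show "\<phi> (\<psi> x) i = x i"
  proof (cases "i < fdim")
  case True
  obtain r a c where rac: "e i = (r, a, c)" by (cases "e i")
  then show ?thesis using ee[OF True] True by (auto simp: \<phi>_def \<psi>_def vset_def)
  next
  case False
  then show ?thesis using that by (simp add: \<phi>_def topspace_Euclidean_space)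
  qed
  qed
 qed
 then show ?thesis by blast
qed

lemma smooth_manifold_VX: "smooth_manifold fdim VX"
proof (rule smooth_manifoldI[OF sheaf_VX])
 show "Hausdorff_space (top_of VX)"
 proof (rule Hausdorff_space_separating_funs)
  fix C D assume "C : topspace (top_of VX)" "D : topspace (top_of VX)" and ne: "C ~= D"
  then have CD: "C : VC" "D : VC" by auto
  obtain r l t a where r: "1 <= l" "l < r" "r <= p" "a < d r" "t < wid (r - l)" "C r $$ (a, coff r l + t) ~= D r $$ (a, coff r l + t)"
  proof (rule ccontr)
  assume n: "\<not> thesis"
  have "C = D"
  proof (rule VC_eqI[OF CD], rule ccontr)
  fix r l t a assume "1 <= l" "l < r" "r <= p" "a < d r" "t < wid (r - l)" "C r $$ (a, coff r l + t) ~= D r $$ (a, coff r l + t)"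
  then have thesis by (rule that)
  then show False using n by contradiction
  qed
  then show False using ne by contradiction
  qed
  have "(%C. C r $$ (a, coff r l + t)) : smooth_funs VX (topspace (top_of VX))"
  by (rule smooth_VX_entry[OF openin_topspace]) (use r coff_less[of l r t] in auto)
  from smooth_funs_continuous[OF sheaf_VX this openin_topspace]
  have "continuous_map (top_of VX) euclideanreal (%C. C r $$ (a, coff r l + t))"
  unfolding subtopology_topspace .
  then show "\<exists>f. continuous_map (top_of VX) euclideanreal f & f C ~= f D" using r(6) by blast
 qed
 have "{%C. C r $$ (a, b) | r a b. r : {1..p} & a < d r & b < fiber_width d r} \<subseteq> (%(r, a, b) C. C r $$ (a, b) :: real) ` vset"
 proof
  fix u :: "(nat => real mat) => real" assume "u : {%C. C r $$ (a, b) | r a b. r : {1..p} & a < d r & b < fiber_width d r}"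
  then obtain r a c where u: "u = (%C. C r $$ (a, c))" "r : {1..p}" "a < d r" "c < fiber_width d r" by blast
  show "u : (%(r, a, b) C. C r $$ (a, b) :: real) ` vset"
  by (rule image_eqI[of _ _ "(r, a, c)"]) (use u in \<open>simp_all add: vset_def\<close>)
 qed
 then have "finite {%C. C r $$ (a, b) :: real | r a b. r : {1..p} & a < d r & b < fiber_width d r}"
  by (rule finite_subset) (rule finite_imageI[OF card_vset(2)])
 then show "second_countable (top_of VX)"
  unfolding VX_def model_fiber_space_def by (rule second_countable_coordinate_space)
 obtain \<phi> where \<phi>: "diffeomorphism VX (Rn_space fdim) \<phi>" using VX_chart by blast
 have e: "open_subspace VX (pts VX) = VX" unfolding open_subspace_def subtopology_topspace by simp
 show "\<exists>U \<phi>. openin (top_of VX) U & x : U & diffeomorphism (open_subspace VX U) (Rn_space fdim) \<phi>" if "x : pts VX" for x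
  by (rule exI[of _ "pts VX"], rule exI[of _ \<phi>], intro conjI openin_topspace that) (simp only: e \<phi>)
qed

lemma pi_surj: "bproj ` pts KX = pts FX"
proof (intro equalityI subsetI)
 fix b assume "b : bproj ` pts KX"
 then obtain G where G: "G : GOX" "b = bproj (Kcls G)" by auto
 obtain Om where Om: "Om : orth_mats m" "agrees Om G" by (rule agrees_exists[OF G(1)])
 show "b : pts FX" unfolding G(2) pi_eq[OF G(1) Om] pts_FX by (rule imageI[OF Om(1)])
next
 fix b assume "b : pts FX"
 then obtain s where s: "s : orth_mats m" "b = left_orbit stab s" by auto
 \<comment> \<open>Any coefficients will do: the flag of \<open>Gof s C\<close> is that of s for
   every C.\<close>
 have "b = bproj (Kcls (Gof s undefined))" using pi_Gof[OF s(1)] s(2) by simp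
 then show "b : bproj ` pts KX" unfolding pts_KX by (rule image_eqI) (rule imageI[OF Gof_GO[OF s(1)]])
qed

lemma base_point:
 assumes "b : pts FX" obtains O0 where "O0 : orth_mats m" "b = left_orbit stab O0" "b : chart_dom O0"
proof -
 obtain O0 where O0: "O0 : orth_mats m" "b = left_orbit stab O0" using assms by auto
 show thesis by (rule that[OF O0]) (use in_chart_dom[OF O0(1) O0(1)] sdom_self[OF O0(1)] O0(2) in simp)
qed

lemma smooth_map_pi: "smooth_map KX FX bproj"
proof (rule smooth_map_local[OF sheaf_KX])
 fix y assume y: "y : pts KX"
 then have "bproj y : pts FX" using pi_surj by blast
 then obtain O0 where O0: "O0 : orth_mats m" "bproj y : chart_dom O0" by (rule base_point) (rule that)
 show "\<exists>U. openin (top_of KX) U & y : U & smooth_map (open_subspace KX U) FX bproj"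
  using openin_bundle_chart[OF O0(1)] smooth_map_pi_local[OF O0(1)] O0(2) y
  by (intro exI[of _ "{y : pts KX. bproj y : chart_dom O0}"]) simp
qed

text \<open>A trivialization followed by a chart of the flag manifold and linear coordinates on the
  model fiber is a chart, so the dimensions add.\<close>

lemma smooth_manifold_KX: "smooth_manifold (card upper_pairs + fdim) KX"
proof (rule smooth_manifoldI[OF sheaf_KX Hausdorff_KX second_countable_KX])
 fix y assume y: "y : pts KX"
 then have "bproj y : pts FX" using pi_surj by blast
 then obtain O0 where O0: "O0 : orth_mats m" "bproj y : chart_dom O0" by (rule base_point) (rule that)
 obtain \<Phi> where \<Phi>: "local_trivialization KX FX bproj VX (chart_dom O0) \<Phi>" by (rule trivialization[OF O0(1)])
 have shF: "smooth_sheaf (open_subspace FX (chart_dom O0))" by (rule smooth_sheaf_open_subspace[OF sheaf_FX openin_chart_dom[OF O0(1)]])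
 obtain \<phi> where \<phi>: "diffeomorphism (open_subspace FX (chart_dom O0)) (Rn_space (card upper_pairs)) \<phi>" using flag_chart[OF O0(1)] by blast
 obtain \<psi> where \<psi>: "diffeomorphism VX (Rn_space fdim) \<psi>" using VX_chart by blast
 have 1: "diffeomorphism (open_subspace KX {y : pts KX. bproj y : chart_dom O0}) (product_space (open_subspace FX (chart_dom O0)) VX) \<Phi>"
  using \<Phi> by (simp add: local_trivialization_def)
 note d = diffeomorphism_comp[OF diffeomorphism_comp[OF 1 diffeomorphism_product[OF shF smooth_sheaf_Rn sheaf_VX smooth_sheaf_Rn \<phi> \<psi>]] diffeomorphism_Rn_product]
 show "\<exists>U \<phi>. openin (top_of KX) U & y : U & diffeomorphism (open_subspace KX U) (Rn_space (card upper_pairs + fdim)) \<phi>"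
  by (rule exI[of _ "{y : pts KX. bproj y : chart_dom O0}"], rule exI, intro conjI, rule openin_bundle_chart[OF O0(1)], use y O0(2) in simp, rule d)
qed

lemma fiber_bundle: "smooth_fiber_bundle KX FX bproj VX"
 unfolding smooth_fiber_bundle_def
proof (intro conjI ballI)
 fix b assume "b : pts FX"
 then obtain O0 where O0: "O0 : orth_mats m" "b : chart_dom O0" by (rule base_point) (rule that)
 obtain \<Phi> where "local_trivialization KX FX bproj VX (chart_dom O0) \<Phi>" by (rule trivialization[OF O0(1)])
 then show "\<exists>U \<Phi>. b : U & local_trivialization KX FX bproj VX U \<Phi>"
  by (intro exI[of _ "chart_dom O0"] exI[of _ \<Phi>] conjI O0(2))
qed (rule exI, rule smooth_manifold_KX, rule exI, rule smooth_manifold_FX, rule exI, rule smooth_manifold_VX, rule smooth_map_pi, rule pi_surj)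

lemma fiber_is_vectorspace:
 assumes "b : pts FX"
 shows "vectorspace class_ring (fiber_module p m d bproj b)" "\<exists>\<phi>. linear_iso (fiber_module p m d bproj b) (model_fiber_module p d) \<phi>"
proof -
 obtain s where s: "s : orth_mats m" "b = left_orbit stab s" using assms by auto
 show "vectorspace class_ring (fiber_module p m d bproj b)" unfolding s(2) by (rule fiber_vectorspace[OF s(1)])
 have inj: "inj_on (%C. Kcls (Gof s C)) VC" using fiber_bij[OF s(1)] by (rule bij_betw_imp_inj_on)
 have "linear_iso (fiber_module p m d bproj b) (model_fiber_module p d) (inv_into VC (%C. Kcls (Gof s C)))"
  unfolding s(2) by (rule fiber_linear_iso[OF s(1)]) (rule inv_into_f_f[OF inj])
 then show "\<exists>\<phi>. linear_iso (fiber_module p m d bproj b) (model_fiber_module p d) \<phi>" by blast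
qed

text \<open>Over a flag f in the chart domain, the second component of the trivialization inverts
  the map from C to the class of \<open>Gof s C\<close>, where s is the section value at f. That map
  carries the operations of the model to those of the fiber, so the trivialization is linear on each
  fiber.\<close>

lemma vector_bundle: "smooth_vector_bundle KX FX bproj (fiber_module p m d bproj) VX (model_fiber_module p d)"
 unfolding smooth_vector_bundle_def
proof (intro conjI ballI)
 show "smooth_fiber_bundle KX FX bproj VX" by (rule fiber_bundle)
 show "vectorspace class_ring (model_fiber_module p d)" by (rule model_vectorspace)
 show "carrier (model_fiber_module p d) = pts VX" by (simp add: VM_simps)
 fix b assume b: "b : pts FX"
 show "vectorspace class_ring (fiber_module p m d bproj b)" by (rule fiber_is_vectorspace[OF b])
 show "carrier (fiber_module p m d bproj b) = {x : pts KX. bproj x = b}" by (rule fiber_module_simps(1)[OF orth_mats_one])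
 obtain O0 where O0: "O0 : orth_mats m" "b : chart_dom O0" using b by (rule base_point) (rule that)
 obtain \<Phi> where \<Phi>: "local_trivialization KX FX bproj VX (chart_dom O0) \<Phi>"
  "!!G. G : GOX ==> sdom O0 (top G) ==> snd (\<Phi> (Kcls G)) = cmap O0 G" by (rule trivialization[OF O0(1)]) (rule that)
 have "linear_iso (fiber_module p m d bproj b') (model_fiber_module p d) (snd \<circ> \<Phi>)" if b': "b' : chart_dom O0" for b'
 proof -
  obtain Om where Om: "Om : orth_mats m" "sdom O0 Om" "b' = left_orbit stab Om" using b' by (auto simp: chart_dom_def)
  obtain h where h: "h : stab" "sect O0 Om = h * Om" by (rule sect_in_orbit[OF O0(1) Om(1,2)])
  let ?s = "sect O0 Om"
  have s: "?s : orth_mats m" by (rule sect_orth[OF O0(1) Om(2)])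
  have b's: "b' = left_orbit stab ?s" using stab_orbit_mult[OF Om(1) h(1)] h(2) Om(3) by simp
  note si = sect_idem[OF O0(1) Om(2)]
  show ?thesis
  unfolding b's
  proof (rule fiber_linear_iso[OF s])
  fix C assume C: "C : VC"
  note g = Gof_section[OF O0(1) s si C]
  show "(snd \<circ> \<Phi>) (Kcls (Gof ?s C)) = C" using \<Phi>(2)[OF Gof_GO[OF s] g(1)] g(3) by simp
  qed
 qed
 then show "\<exists>U \<Phi>. b : U & local_trivialization KX FX bproj VX U \<Phi> & (\<forall>b'\<in>U. linear_iso (fiber_module p m d bproj b') (model_fiber_module p d) (snd \<circ> \<Phi>))"
  by (intro exI[of _ "chart_dom O0"] exI[of _ \<Phi>] conjI O0(2) \<Phi>(1) ballI)
qed

text \<open>With width 0 the model fiber is one point, so the projection is bijective. Its inverse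
  is smooth because locally it is the inverse trivialization applied to (f, C0).\<close>

lemma trivial_fiber_diffeomorphism:
 assumes z: "!!r. r : {1..p} ==> fiber_width d r = 0"
 shows "diffeomorphism KX FX bproj"
proof -
 define C0 where "C0 = (\<lambda>r\<in>{1..p}. 0\<^sub>m (d r) (fiber_width d r) :: real mat)"
 have C0: "C0 : VC" unfolding C0_def by (rule zero_VC[OF orth_mats_one])
 have VC1: "C = C0" if "C : VC" for C
 proof (rule VC_eqI[OF that C0])
  fix r l t a assume "1 <= l" "l < r" "r <= p" "t < wid (r - l)"
  then show "C r $$ (a, coff r l + t) = C0 r $$ (a, coff r l + t)" using coff_less[of l r t] z[of r] by simp
 qed
 \<comment> \<open>A globally chosen inverse. Injectivity of the projection identifies it with each
   local smooth inverse.\<close>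
 define \<sigma> where "\<sigma> b = (SOME y. y : pts KX & bproj y = b)" for b
 have inj: "y = y'" if "y : pts KX" "y' : pts KX" "bproj y = bproj y'" for y y'
 proof -
  have "bproj y : pts FX" unfolding pi_surj[symmetric] by (rule imageI) (rule that)
  then obtain s where s: "s : orth_mats m" "bproj y = left_orbit stab s" unfolding pts_FX by (elim imageE)
  have "y : (%C. Kcls (Gof s C)) ` VC" "y' : (%C. Kcls (Gof s C)) ` VC"
  unfolding bij_betw_imp_surj_on[OF fiber_bij[OF s(1)]]
  by (intro CollectI conjI that(1,2) s(2) trans[OF that(3)[symmetric] s(2)])+
  then obtain C C' where C: "C : VC" "y = Kcls (Gof s C)" "C' : VC" "y' = Kcls (Gof s C')" by (elim imageE)
  show ?thesis unfolding C(2,4) VC1[OF C(1)] VC1[OF C(3)] ..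
 qed
 have \<sigma>: "\<sigma> b : pts KX" "bproj (\<sigma> b) = b" if "b : pts FX" for b
 proof -
  have "b : bproj ` pts KX" unfolding pi_surj by (rule that)
  then have "\<exists>y. y : pts KX & bproj y = b" by (elim imageE) (rule exI, rule conjI, assumption, rule sym)
  then have "\<sigma> b : pts KX & bproj (\<sigma> b) = b" unfolding \<sigma>_def by (rule someI_ex)
  then show "\<sigma> b : pts KX" "bproj (\<sigma> b) = b" by auto
 qed
 have "smooth_map FX KX \<sigma>"
 proof (rule smooth_map_local[OF sheaf_FX])
  fix b assume "b : pts FX"
  then obtain O0 where O0: "O0 : orth_mats m" "b : chart_dom O0" by (rule base_point) (rule that)
  obtain \<Phi> where \<Phi>: "local_trivialization KX FX bproj VX (chart_dom O0) \<Phi>" by (rule trivialization[OF O0(1)])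
  let ?U = "{y : pts KX. bproj y : chart_dom O0}"
  have o: "openin (top_of FX) (chart_dom O0)" by (rule openin_chart_dom[OF O0(1)])
  have shF: "smooth_sheaf (open_subspace FX (chart_dom O0))" by (rule smooth_sheaf_open_subspace[OF sheaf_FX o])
  have dif: "diffeomorphism (open_subspace KX ?U) (product_space (open_subspace FX (chart_dom O0)) VX) \<Phi>"
  and fst: "!!x. x : pts KX ==> bproj x : chart_dom O0 ==> fst (\<Phi> x) = bproj x"
  using \<Phi> by (auto simp: local_trivialization_def)
  obtain \<psi> where \<psi>: "smooth_map (product_space (open_subspace FX (chart_dom O0)) VX) (open_subspace KX ?U) \<psi>"
  "!!z. z : pts (product_space (open_subspace FX (chart_dom O0)) VX) ==> \<Phi> (\<psi> z) = z"
  by (rule diffeomorphismE[OF dif]) (rule that)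
  have in_prod: "smooth_map (open_subspace FX (chart_dom O0)) (product_space (open_subspace FX (chart_dom O0)) VX) (%b. (b, C0))"
  by (rule smooth_map_into_product[OF shF shF sheaf_VX]) (simp_all add: smooth_map_ident smooth_map_const[OF shF] C0)
  have "smooth_map (open_subspace FX (chart_dom O0)) KX (%b. \<psi> (b, C0))"
  by (rule smooth_map_comp[OF smooth_map_comp[OF in_prod \<psi>(1)] smooth_map_open_inclusion[OF sheaf_KX openin_bundle_chart[OF O0(1)]]])
  then have "smooth_map (open_subspace FX (chart_dom O0)) KX \<sigma>"
  proof (rule smooth_map_cong[OF shF])
  fix f assume f0: "f : pts (open_subspace FX (chart_dom O0))"
  then have f: "f : pts FX" "f : chart_dom O0" by auto
  have z: "(f, C0) : pts (product_space (open_subspace FX (chart_dom O0)) VX)" using f0 C0 by simp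
  have "\<psi> (f, C0) : pts KX \<inter> ?U"
  using smooth_map_pts[OF \<psi>(1) z] unfolding top_of_open_subspace topspace_subtopology .
  then have y: "\<psi> (f, C0) : pts KX" "bproj (\<psi> (f, C0)) : chart_dom O0" by blast+
  have "bproj (\<psi> (f, C0)) = f" using fst[OF y] \<psi>(2)[OF z] by simp
  then show "\<psi> (f, C0) = \<sigma> f" using inj[OF y(1) \<sigma>(1)[OF f(1)]] \<sigma>(2)[OF f(1)] by simp
  qed
  then show "\<exists>U. openin (top_of FX) U & b : U & smooth_map (open_subspace FX U) KX \<sigma>" using o O0(2) by blast
 qed
 then show ?thesis
 proof (rule diffeomorphismI[OF smooth_map_pi])
  show "\<sigma> (bproj y) = y" if "y : pts KX" for y
  proof -
  have "bproj y : pts FX" unfolding pi_surj[symmetric] by (rule imageI) (rule that)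
  then have b: "bproj y : pts FX" .
  show ?thesis by (rule inj[OF \<sigma>(1)[OF b] that \<sigma>(2)[OF b]])
  qed
  show "bproj (\<sigma> b) = b" if "b : pts FX" for b by (rule \<sigma>(2)[OF that])
 qed
qed

section \<open>Dimensions\<close>

text \<open>For a row with label r the admissible columns are those with smaller label, that is the
  last \<open>wid r\<close> columns; there are d r such rows, and label 0 contributes
  nothing.\<close>

lemma card_upper_pairs: "card upper_pairs = (\<Sum>i=1..p. \<Sum>j<i. d i * d j)"
proof -
 have e: "{y. y < m & lab y < n} = {m - wid n..<m}" if "n <= p" for n
 proof (cases "n = 0")
  case False
  then show ?thesis using lab_less_iff[of _ n] that by auto
 qed (auto simp: wid_def)
 have "upper_pairs = (SIGMA x:{..<m}. {y. y < m & lab y < lab x})" by (auto simp: upper_pairs_def)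
 then have "card upper_pairs = (\<Sum>x<m. card {y. y < m & lab y < lab x})" by simp
 also have "\<dots> = (\<Sum>x<m. wid (lab x))"
  using e lab_decode(1) wid_le by (intro sum.cong refl) (simp add: le_SucI)
 also have "\<dots> = (\<Sum>r\<le>p. \<Sum>a<d r. wid (lab (ooff r + a)))" by (rule sum_over_blocks)
 also have "\<dots> = (\<Sum>r\<le>p. d r * wid r)" using lab_ooff by (intro sum.cong refl) simp
 also have "\<dots> = (\<Sum>r=1..p. d r * wid r)"
  by (rule sum.mono_neutral_right) (auto simp: wid_def)
 finally show ?thesis by (simp add: wid_def sum_distrib_left)
qed

lemma fdim_eq: "fdim = (\<Sum>r=1..p. d r * (\<Sum>l=1..r - 1. \<Sum>j=0..r - l - 1. d j))"
 by (simp add: fdim_def fiber_width_def)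

text \<open>The widths in the fiber over row label r are wid 1, ..., wid (r - 1), and the flag
  contributes wid r. So the dimension is the sum over r of d r (wid 1 + ... + wid r). With wid i = m
  - D i, D i being the sum of the d j for j >= i, exchanging the summations turns the subtracted
  part into the sum of the squares of the D i.\<close>

lemma dimension_formula:
 "int (card upper_pairs + fdim) = int m * (\<Sum>j=1..p. int j * int (d j)) - (\<Sum>i=1..p. (\<Sum>j=i..p. int (d j))\<^sup>2)"
proof -
 define D where "D i = (\<Sum>j=i..p. int (d j))" for i
 have w: "int (wid i) = int m - D i" if "i <= p" for i
  using sum_split_wid[of i] that by (simp add: D_def flip: of_nat_sum)
 have fw: "wid r + fiber_width d r = (\<Sum>i=1..r. wid i)" if "1 <= r" for r
 proof -
  have "fiber_width d r = (\<Sum>i=1..<r. wid i)"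
  unfolding fiber_width_eq by (subst (2) sum.atLeastLessThan_rev) simp
  moreover have "{1..r} = insert r {1..<r}" using that by auto
  ultimately show ?thesis by simp
 qed
 have "card upper_pairs + fdim = (\<Sum>r=1..p. d r * (\<Sum>i=1..r. wid i))"
  unfolding card_upper_pairs fdim_def sum.distrib[symmetric]
  using fw by (intro sum.cong refl) (simp add: wid_def sum_distrib_left[symmetric] distrib_left[symmetric])
 then have "int (card upper_pairs + fdim) = (\<Sum>r=1..p. int (d r) * (\<Sum>i=1..r. int m - D i))"
  using w by (simp add: sum_distrib_left)
 also have "\<dots> = (\<Sum>r=1..p. int m * (int r * int (d r)) - (\<Sum>i=1..r. int (d r) * D i))"
  by (intro sum.cong refl) (simp add: sum_subtractf algebra_simps sum_distrib_left)
 also have "\<dots> = int m * (\<Sum>j=1..p. int j * int (d j)) - (\<Sum>r=1..p. \<Sum>i=1..r. int (d r) * D i)"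
  by (simp add: sum_subtractf sum_distrib_left)
 also have "(\<Sum>r=1..p. \<Sum>i=1..r. int (d r) * D i) = (\<Sum>r=1..p. \<Sum>i\<in>{i : {1..p}. i <= r}. int (d r) * D i)"
  by (intro sum.cong refl) auto
 also have "\<dots> = (\<Sum>i=1..p. \<Sum>r\<in>{r : {1..p}. i <= r}. int (d r) * D i)"
  by (rule sum.swap_restrict) auto
 also have "\<dots> = (\<Sum>i=1..p. (D i)\<^sup>2)"
 proof (intro sum.cong refl)
  fix i assume "i : {1..p}"
  then have "{r : {1..p}. i <= r} = {i..p}" by auto
  then show "(\<Sum>r\<in>{r : {1..p}. i <= r}. int (d r) * D i) = (D i)\<^sup>2"
  by (simp add: D_def power2_eq_square sum_distrib_right)
 qed
 finally show ?thesis by (simp add: D_def)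
qed

text \<open>Every label j in the width satisfies j <= r - l - 1 <= p - 2. Label 0 is empty when
  \<open>ltot p d = m\<close>; the labels from 1 to p - 2 need the second condition. Without it the
  fiber can be nonzero: for p = 3 and d 0 = 0 with d 1 and d 3 positive, the width at r = 3 is d
  1.\<close>

lemma fiber_width_zero:
 assumes c: "p = 1 \<or> (ltot p d = m & (\<forall>j. 1 <= j & j + 2 <= p --> d j = 0))" and r: "r : {1..p}"
 shows "fiber_width d r = 0"
 unfolding fiber_width_def
proof (intro sum.neutral ballI)
 fix l j assume l: "l : {1..r - 1}" and j: "j : {0..r - l - 1}"
 then have "j + 2 <= p" "p ~= 1" using r by auto
 then show "d j = 0" using c d0 by (cases "j = 0") auto
qed

section \<open>The acting group\<close>

lemma Qspace_sheaf: "smooth_sheaf (Qspace p d)" "pts (Qspace p d) = Qset p d"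
 by (simp_all add: Qspace_def smooth_sheaf_coordinate_space)

lemma orth_product_sheaf: "smooth_sheaf (orth_product_space g n)" "pts (orth_product_space g n) = (\<Pi>\<^sub>E i\<in>{1..g}. orth_mats (n i))"
 by (simp_all add: orth_product_space_def smooth_sheaf_coordinate_space)

text \<open>Reads the diagonal block with shift 0 for each nonempty label, numbered increasingly
  from 1; the inverse repeats the blocks through \<open>ofseq\<close> and \<open>qm\<close>. Both
  directions only select or copy entries, so they are smooth.\<close>

definition qfac :: "real mat => nat => real mat" where
 "qfac Q = (\<lambda>i\<in>{1..g_num p d}. sqblk p d Q (rl ! (i - 1)) 0 (rl ! (i - 1)) 0)"

lemma rl_nth:
 assumes "i : {1..g_num p d}" shows "rl ! (i - 1) : {1..p}" "l_seq p d i = d (rl ! (i - 1))"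
proof -
 have "i - 1 < length rl" using assms rl_facts(3) by auto
 then have "rl ! (i - 1) : set rl" by (rule nth_mem)
 then show "rl ! (i - 1) : {1..p}" using rl_facts(2) by auto
 show "l_seq p d i = d (rl ! (i - 1))" by (simp add: l_seq_def rl_def)
qed

lemma qfac_qm:
 assumes q: "qfam q" shows "qfac (qm q) = (\<lambda>i\<in>{1..g_num p d}. q (rl ! (i - 1)))"
 unfolding qfac_def
proof (rule restrict_ext)
 fix i assume i: "i : {1..g_num p d}"
 note r = rl_nth(1)[OF i]
 have "0 < rl ! (i - 1)" using r by simp
 then show "sqblk p d (qm q) (rl ! (i - 1)) 0 (rl ! (i - 1)) 0 = q (rl ! (i - 1))"
  using sqblk_qm[of "rl ! (i - 1)" "rl ! (i - 1)" 0 0 q] r qfam_carrier[OF q r] by simp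
qed

lemma ofseq_qfam: "h : (\<Pi>\<^sub>E i\<in>{1..g_num p d}. orth_mats (l_seq p d i)) ==> qfam (ofseq h)"
 unfolding qfam_def using ofseq_orth by (auto simp: PiE_iff)

lemma qfac_ofseq:
 assumes h: "h : (\<Pi>\<^sub>E i\<in>{1..g_num p d}. orth_mats (l_seq p d i))"
 shows "qfac (qm (ofseq h)) = h"
 unfolding qfac_qm[OF ofseq_qfam[OF h]]
proof
 fix i
 show "(\<lambda>i\<in>{1..g_num p d}. ofseq h (rl ! (i - 1))) i = h i"
 proof (cases "i : {1..g_num p d}")
  case True
  then have "i - 1 < length rl" using rl_facts(3) by auto
  then show ?thesis using ofseq_nth[of "i - 1" h] True by simp
 qed (use h in \<open>auto simp: PiE_iff extensional_def\<close>)
qed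

lemma ofseq_qfac:
 assumes q: "qfam q" shows "qm (ofseq (qfac (qm q))) = qm q"
proof (rule qm_cong)
 fix r assume r: "r : {1..p}"
 show "ofseq (qfac (qm q)) r = q r"
 proof (cases "0 < d r")
  case True
  then have "r : set rl" using rl_facts(2) r by simp
  then obtain k where k: "k < length rl" "r = rl ! k" by (auto simp: in_set_conv_nth)
  show ?thesis unfolding k(2) ofseq_nth[OF k(1)] qfac_qm[OF q] using k(1) rl_facts(3) by simp
 next
  case False
  then have "r \<notin> set rl" using rl_facts(2) by simp
  moreover have "q r : carrier_mat 0 0" using qfam_carrier[OF q r] False by simp
  ultimately show ?thesis by (auto simp: ofseq_def intro!: eq_matI)
 qed
qed

lemma qfac_mem: "qfam q ==> qfac (qm q) : (\<Pi>\<^sub>E i\<in>{1..g_num p d}. orth_mats (l_seq p d i))"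
 unfolding qfac_qm using rl_nth qfam_orth by (auto simp: PiE_iff)

lemma qfac_iso: "qfac : iso (Qgroup p d) (product_group {1..g_num p d} (%i. orth_group (l_seq p d i)))"
proof (rule isoI)
 show "qfac : hom (Qgroup p d) (product_group {1..g_num p d} (%i. orth_group (l_seq p d i)))"
 proof (rule homI)
  fix x y assume "x : carrier (Qgroup p d)" "y : carrier (Qgroup p d)"
  then obtain q q' where q: "qfam q" "x = qm q" and q': "qfam q'" "y = qm q'" by (auto simp: Qgroup_def Qset_qfam)
  have qq: "qfam (%r. q r * q' r)" using q q' orth_mats_mult by (simp add: qfam_def)
  have xy: "x * y = qm (%r. q r * q' r)" unfolding q q' by (rule qm_mult) (use qfam_carrier q q' in auto)
  show "qfac x : carrier (product_group {1..g_num p d} (%i. orth_group (l_seq p d i)))"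
  using qfac_mem[OF q(1)] q(2) by (simp add: orth_group_def)
  show "qfac (x \<otimes>\<^bsub>Qgroup p d\<^esub> y) = qfac x \<otimes>\<^bsub>product_group {1..g_num p d} (%i. orth_group (l_seq p d i))\<^esub> qfac y"
  using xy qfac_qm[OF qq] qfac_qm[OF q(1)] qfac_qm[OF q'(1)] q(2) q'(2)
  by (auto simp: Qgroup_def orth_group_def fun_eq_iff)
 qed
 show "bij_betw qfac (carrier (Qgroup p d)) (carrier (product_group {1..g_num p d} (%i. orth_group (l_seq p d i))))"
 proof (rule bij_betw_byWitness[where f' = "%h. qm (ofseq h)"])
  show "\<forall>Q\<in>carrier (Qgroup p d). qm (ofseq (qfac Q)) = Q"
  using ofseq_qfac by (auto simp: Qgroup_def Qset_qfam)
  show "\<forall>h\<in>carrier (product_group {1..g_num p d} (%i. orth_group (l_seq p d i))). qfac (qm (ofseq h)) = h"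
  using qfac_ofseq by (simp add: orth_group_def)
  show "qfac ` carrier (Qgroup p d) \<subseteq> carrier (product_group {1..g_num p d} (%i. orth_group (l_seq p d i)))"
  using qfac_mem by (auto simp: Qgroup_def Qset_qfam orth_group_def)
  show "(%h. qm (ofseq h)) ` carrier (product_group {1..g_num p d} (%i. orth_group (l_seq p d i))) \<subseteq> carrier (Qgroup p d)"
  using ofseq_qfam by (auto simp: Qgroup_def Qset_qfam orth_group_def)
 qed
qed

lemma Qspace_entry:
 assumes "i < nn" "j < nn" shows "(%Q. Q $$ (i, j)) : smooth_funs (Qspace p d) (Qset p d)"
proof -
 have sub: "Qset p d \<subseteq> carrier_mat nn nn" by (auto simp: Qset_qfam)
 have Q: "Qspace p d = coordinate_space (Qset p d) (mat_entries nn nn)" by (simp add: Qspace_def nn_def)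
 have o: "openin (top_of (coordinate_space (Qset p d) (mat_entries nn nn))) (Qset p d)"
  using openin_topspace[of "top_of (coordinate_space (Qset p d) (mat_entries nn nn))"] by simp
 show ?thesis unfolding Q by (rule smooth_mat_entry[OF smooth_mat_coordinate[OF o sub] assms])
qed

lemma smooth_map_qfac: "smooth_map (Qspace p d) (orth_product_space (g_num p d) (l_seq p d)) qfac"
 unfolding orth_product_space_def
proof (rule smooth_map_into_coordinate[OF Qspace_sheaf(1)], unfold Qspace_sheaf(2))
 show "qfac Q : (\<Pi>\<^sub>E i\<in>{1..g_num p d}. orth_mats (l_seq p d i))" if "Q : Qset p d" for Q
  using that qfac_mem by (auto simp: Qset_qfam)
 fix u :: "(nat => real mat) => real" assume "u : {%h. h i $$ (a, b) | i a b. i : {1..g_num p d} & a < l_seq p d i & b < l_seq p d i}"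
 then obtain i a b where u: "u = (%h. h i $$ (a, b))" "i : {1..g_num p d}" "a < l_seq p d i" "b < l_seq p d i" by blast
 define r where "r = rl ! (i - 1)"
 have r: "r : {1..p}" "a < d r" "b < d r" using rl_nth[OF u(2)] u(3,4) by (simp_all add: r_def)
 have "ridx (r, 0, a) < nn" "ridx (r, 0, b) < nn" by (rule ridx_range(3), use r in simp)+
 then have "(%Q. Q $$ (ridx (r, 0, a), ridx (r, 0, b))) : smooth_funs (Qspace p d) (Qset p d)" by (rule Qspace_entry)
 moreover have "u (qfac Q) = Q $$ (ridx (r, 0, a), ridx (r, 0, b))" for Q
  using u(1,2) sqblk_entry[OF r(2,3), of Q 0 0] by (simp add: qfac_def r_def)
 ultimately show "(%Q. u (qfac Q)) : smooth_funs (Qspace p d) (Qset p d)" by simp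
qed

lemma ofseq_entry_smooth:
 assumes r: "r : {1..p}" "a < d r" "a' < d r"
 shows "(%h. ofseq h r $$ (a, a')) : smooth_funs (orth_product_space (g_num p d) (l_seq p d)) (pts (orth_product_space (g_num p d) (l_seq p d)))"
proof -
 have "r : set rl" using r rl_facts(2) by auto
 then obtain k where k: "k < length rl" "rl ! k = r" unfolding in_set_conv_nth by (elim exE conjE)
 have ki: "Suc k : {1..g_num p d}" using k rl_facts(3) by simp
 have l: "l_seq p d (Suc k) = d r" using rl_nth(2)[OF ki] k(2) by simp
 have e: "(%h. ofseq h r $$ (a, a')) = (%h. h (Suc k) $$ (a, a'))"
  unfolding k(2)[symmetric] ofseq_nth[OF k(1)] by (rule refl)
 show ?thesis
  unfolding e orth_product_space_def
  by (rule smooth_funs_coordinate[OF _ openin_topspace], rule CollectI,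
  rule exI[of _ "Suc k"], rule exI[of _ a], rule exI[of _ a'], intro conjI refl) (use ki l r in simp_all)
qed

lemma smooth_map_ofseq: "smooth_map (orth_product_space (g_num p d) (l_seq p d)) (Qspace p d) (%h. qm (ofseq h))"
proof -
 define X where "X = orth_product_space (g_num p d) (l_seq p d)"
 have sh: "smooth_sheaf X" unfolding X_def by (rule orth_product_sheaf)
 have "smooth_map X (coordinate_space (Qset p d) (mat_entries nn nn)) (%h. qm (ofseq h))"
 proof (rule smooth_map_into_matrices[OF sh])
  show "qm (ofseq h) : Qset p d" if "h : pts X" for h
  unfolding Qset_qfam
  by (intro CollectI exI[of _ "ofseq h"] conjI refl ofseq_qfam) (use that in \<open>simp only: X_def orth_product_sheaf(2)\<close>)
  show "smooth_mat X (pts X) nn nn (%h. qm (ofseq h))"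
  proof (rule smooth_matI)
  fix i j assume i: "i < nn" and j: "j < nn"
  obtain r l a where ra: "(r, l, a) : rset" "i = ridx (r, l, a)" by (rule ridx_cases[OF i])
  obtain r' l' a' where ra': "(r', l', a') : rset" "j = ridx (r', l', a')" by (rule ridx_cases[OF j])
  have e: "(%h. qm (ofseq h) $$ (i, j)) = (%h. if r = r' & l = l' then ofseq h r $$ (a, a') else 0)"
  unfolding ra(2) ra'(2) qm_entry[OF ra(1) ra'(1)] by (rule refl)
  show "(%h. qm (ofseq h) $$ (i, j)) : smooth_funs X (pts X)"
  proof (cases "r = r' & l = l'")
  case True
  have "a' < d r" using ra'(1) True by simp
  then show ?thesis
  unfolding e if_P[OF True] unfolding X_def using ra(1) by (intro ofseq_entry_smooth) simp_all
  next
  case False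
  show ?thesis unfolding e if_not_P[OF False] by (rule smooth_const[OF sh openin_topspace])
  qed
  qed simp
 qed
 then show ?thesis unfolding Qspace_def nn_def X_def .
qed

lemma qfac_diffeomorphism: "diffeomorphism (Qspace p d) (orth_product_space (g_num p d) (l_seq p d)) qfac"
proof (rule diffeomorphismI[OF smooth_map_qfac smooth_map_ofseq])
 show "qm (ofseq (qfac Q)) = Q" if Q: "Q : pts (Qspace p d)" for Q
 proof -
  obtain q where q: "qfam q" "Q = qm q" using Q unfolding Qspace_sheaf Qset_qfam by (elim CollectE exE conjE)
  show ?thesis unfolding q(2) by (rule ofseq_qfac[OF q(1)])
 qed
 show "qfac (qm (ofseq h)) = h" if "h : pts (orth_product_space (g_num p d) (l_seq p d))" for h
  using that unfolding orth_product_sheaf(2) by (rule qfac_ofseq)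
qed


section \<open>The class of a representation\<close>

lemma perp_block:
 assumes h: "h : carrier_mat (m - ltot p d) (m - ltot p d)"
 shows "diag_block_mat [1\<^sub>m (ltot p d), h] : carrier_mat m m"
  and "i < m ==> j < m ==> diag_block_mat [1\<^sub>m (ltot p d), h] $$ (i, j) =
  (if i < ltot p d \<or> j < ltot p d then (if i = j then 1 else 0) else (h :: real mat) $$ (i - ltot p d, j - ltot p d))"
proof -
 let ?l = "ltot p d"
 have hd: "dim_row h = m - ?l" "dim_col h = m - ?l" using h by auto
 show "diag_block_mat [1\<^sub>m ?l, h] : carrier_mat m m"
  using hd ltot_le by (intro carrier_matI) (simp_all add: diag_block_mat_dims del: diag_block_mat.simps)
 assume ij: "i < m" "j < m"
 show "diag_block_mat [1\<^sub>m ?l, h] $$ (i, j) = (if i < ?l \<or> j < ?l then (if i = j then 1 else 0) else h $$ (i - ?l, j - ?l))"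
 proof (cases "i < ?l")
  case True
  then show ?thesis using diag_block_mat_row[of "[]" "1\<^sub>m ?l" "[h]" i j] hd ij ltot_le by auto
 next
  case False
  then show ?thesis using diag_block_mat_row[of "[1\<^sub>m ?l]" h "[]" "i - ?l" j] hd ij ltot_le by auto
 qed
qed

lemma sum_tail:
 assumes z: "!!s. s < ltot p d ==> f s = (0 :: real)"
 shows "(\<Sum>s<m. f s) = (\<Sum>s<m - ltot p d. f (ltot p d + s))"
proof -
 have "(\<Sum>s<m. f s) = (\<Sum>s\<in>{ltot p d..<m}. f s)"
  by (rule sum.mono_neutral_right) (use z in auto)
 also have "\<dots> = (\<Sum>s<m - ltot p d. f (ltot p d + s))"
  using sum.shift_bounds_nat_ivl[of f 0 "ltot p d" "m - ltot p d"] ltot_le by (simp add: lessThan_atLeast0 add.commute)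
 finally show ?thesis .
qed

lemma perp_groupD:
 assumes "g : perp_group p m d"
 shows "g : orth_mats m" and "i < m ==> j < m ==> i < ltot p d \<or> j < ltot p d ==> g $$ (i, j) = (if i = j then 1 else 0)"
proof -
 let ?l = "ltot p d"
 obtain h where h: "h : orth_mats (m - ?l)" "g = diag_block_mat [1\<^sub>m ?l, h]" using assms by (auto simp: perp_group_def)
 note D = perp_block[OF orth_matsD(1)[OF h(1)], folded h(2)]
 show "i < m ==> j < m ==> i < ?l \<or> j < ?l ==> g $$ (i, j) = (if i = j then 1 else 0)" using D(2) by simp
 show "g : orth_mats m"
 proof (rule orth_mats_eqI[OF D(1)])
  fix a a' assume a: "a < m" "a' < m"
  consider "a < ?l" | "a' < ?l" | "?l <= a" "?l <= a'" by linarith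
  then show "(\<Sum>s<m. g $$ (a, s) * g $$ (a', s)) = (if a = a' then 1 else 0)"
  proof cases
  case 1
  then have "(\<Sum>s<m. g $$ (a, s) * g $$ (a', s)) = (\<Sum>s<m. if s = a then g $$ (a', s) else 0)"
  using D(2) a by (intro sum.cong refl) auto
  also have "\<dots> = g $$ (a', a)" using a by simp
  finally show ?thesis using D(2)[of a' a] a 1 by auto
  next
  case 2
  then have "(\<Sum>s<m. g $$ (a, s) * g $$ (a', s)) = (\<Sum>s<m. if s = a' then g $$ (a, s) else 0)"
  using D(2) a by (intro sum.cong refl) auto
  also have "\<dots> = g $$ (a, a')" using a by simp
  finally show ?thesis using D(2)[of a a'] a 2 by auto
  next
  case 3
  have "(\<Sum>s<m. g $$ (a, s) * g $$ (a', s)) = (\<Sum>s<m - ?l. g $$ (a, ?l + s) * g $$ (a', ?l + s))"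
  by (rule sum_tail) (use D(2) a 3 ltot_le in auto)
  also have "\<dots> = (\<Sum>s<m - ?l. h $$ (a - ?l, s) * h $$ (a' - ?l, s))"
  using D(2) a 3 by (intro sum.cong refl) simp
  finally show ?thesis using orth_mats_rows[OF h(1), of "a - ?l" "a' - ?l"] 3 a by auto
  qed
 qed
qed

lemma perp_groupI:
 assumes g: "g : orth_mats m" and gd: "!!i j. i < m ==> j < m ==> i < ltot p d \<or> j < ltot p d ==> g $$ (i, j) = (if i = j then 1 else 0)"
 shows "g : perp_group p m d"
proof -
 let ?l = "ltot p d"
 have gc: "g : carrier_mat m m" using g by (rule orth_matsD)
 define h where "h = Matrix.mat (m - ?l) (m - ?l) (%(i, j). g $$ (?l + i, ?l + j))"
 have hc: "h : carrier_mat (m - ?l) (m - ?l)" by (simp add: h_def)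
 note D = perp_block[OF hc]
 have "g = diag_block_mat [1\<^sub>m ?l, h]"
 proof (rule eq_matI)
  fix i j assume "i < dim_row (diag_block_mat [1\<^sub>m ?l, h])" "j < dim_col (diag_block_mat [1\<^sub>m ?l, h])"
  then have ij: "i < m" "j < m" using D(1) by auto
  show "g $$ (i, j) = diag_block_mat [1\<^sub>m ?l, h] $$ (i, j)" unfolding D(2)[OF ij] using gd[OF ij] ij by (auto simp: h_def)
 qed (use D(1) gc in auto)
 moreover have "h : orth_mats (m - ?l)"
 proof (rule orth_mats_eqI[OF hc])
  fix a a' assume a: "a < m - ?l" "a' < m - ?l"
  have "(\<Sum>s<m. g $$ (?l + a, s) * g $$ (?l + a', s)) = (\<Sum>s<m - ?l. g $$ (?l + a, ?l + s) * g $$ (?l + a', ?l + s))"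
  by (rule sum_tail) (use gd a ltot_le in auto)
  also have "\<dots> = (\<Sum>s<m - ?l. h $$ (a, s) * h $$ (a', s))" using a by (intro sum.cong refl) (simp add: h_def)
  finally show "(\<Sum>s<m - ?l. h $$ (a, s) * h $$ (a', s)) = (if a = a' then 1 else 0)"
  using orth_mats_rows[OF g, of "?l + a" "?l + a'"] a by auto
 qed
 ultimately show ?thesis unfolding perp_group_def by blast
qed

text \<open>An orthogonal matrix that is the identity in its first rows and columns is an orthogonal
  matrix on the rest; in this form products and transposes are easy to control.\<close>

lemma perp_group_eq:
 "perp_group p m d = {g : orth_mats m. \<forall>i<m. \<forall>j<m. i < ltot p d \<or> j < ltot p d --> g $$ (i, j) = (if i = j then 1 else 0)}"
proof (intro equalityI subsetI CollectI conjI allI impI)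
 fix g assume g: "g : perp_group p m d"
 show "g : orth_mats m" by (rule perp_groupD(1)[OF g])
 show "g $$ (i, j) = (if i = j then 1 else 0)" if "i < m" "j < m" "i < ltot p d \<or> j < ltot p d" for i j
  by (rule perp_groupD(2)[OF g that])
next
 fix g assume "g : {g : orth_mats m. \<forall>i<m. \<forall>j<m. i < ltot p d \<or> j < ltot p d --> g $$ (i, j) = (if i = j then 1 else 0)}"
 then show "g : perp_group p m d" by (intro perp_groupI) auto
qed

text \<open>Both matrices share the rows prescribed by G, so Om' times the transpose of Om has unit
  vectors in the corresponding rows and columns and belongs to the group of the last rows.\<close>

lemma stiefel_class_unique:
 assumes Om: "Om : orth_mats m" "agrees Om G" and Om': "Om' : orth_mats m" "agrees Om' G"
 shows "stiefel_class p m d Om = stiefel_class p m d Om'"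
proof -
 let ?H = "perp_group p m d" and ?l = "ltot p d"
 have c: "Om : carrier_mat m m" "Om' : carrier_mat m m" using Om Om' orth_matsD by auto
 have one: "1\<^sub>m m : ?H" using orth_mats_one by (simp add: perp_group_eq)
 have sub: "?H \<subseteq> carrier_mat m m" using orth_matsD(1) by (auto simp: perp_group_eq)
 have mult: "g * h : ?H" if g: "g : ?H" and h: "h : ?H" for g h
 proof -
  have gc: "g : carrier_mat m m" "h : carrier_mat m m" using g h sub by auto
  have "(g * h) $$ (i, j) = (if i = j then 1 else 0)" if ij: "i < m" "j < m" "i < ?l \<or> j < ?l" for i j
  proof (cases "i < ?l")
  case True
  have "(g * h) $$ (i, j) = (\<Sum>s<m. if s = i then h $$ (s, j) else 0)"
  unfolding mult_entry[OF gc ij(1,2)] using g True ij by (intro sum.cong refl) (auto simp: perp_group_eq)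
  then show ?thesis using h ij True by (simp add: perp_group_eq)
  next
  case False
  then have "(g * h) $$ (i, j) = (\<Sum>s<m. if s = j then g $$ (i, s) else 0)"
  unfolding mult_entry[OF gc ij(1,2)] using h ij by (intro sum.cong refl) (auto simp: perp_group_eq)
  then show ?thesis using g ij False by (simp add: perp_group_eq)
  qed
  then show ?thesis using g h orth_mats_mult[of g m h] by (simp add: perp_group_eq)
 qed
 have inv: "tr_mat h : ?H & tr_mat h * h = 1\<^sub>m m" if h: "h : ?H" for h
 proof -
  have ho: "h : orth_mats m" using h by (simp add: perp_group_eq)
  have "tr_mat h $$ (i, j) = h $$ (j, i)" if "i < m" "j < m" for i j using orth_matsD(1)[OF ho] that by auto
  then show ?thesis using h orth_mats_transpose[OF ho] orth_mats_transpose_mult[OF ho] by (auto simp: perp_group_eq)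
 qed
 let ?g = "Om' * tr_mat Om"
 have "?g : ?H"
  unfolding perp_group_eq
 proof (intro CollectI conjI allI impI)
  show "?g : orth_mats m" by (intro orth_mats_mult orth_mats_transpose Om Om')
  fix i j assume ij: "i < m" "j < m" "i < ?l \<or> j < ?l"
  have e: "Om $$ (i, b) = Om' $$ (i, b)" if "i < ?l" "b < m" for i b using Om(2) Om'(2) that by (simp add: agrees_def)
  have "?g $$ (i, j) = (\<Sum>b<m. Om' $$ (i, b) * Om $$ (j, b))" by (rule mult_transpose_entry[OF c(2,1) ij(1,2)])
  \<comment> \<open>One of the two indices belongs to the shared rows; its row may be rewritten as a
    row of the other matrix, after which both rows come from one orthogonal matrix.\<close>
  also have "\<dots> = (if i = j then 1 else 0)"
  proof (cases "i < ?l")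
  case True
  then show ?thesis using e[of i] orth_mats_rows[OF Om(1) ij(1,2)] by simp
  next
  case False
  then show ?thesis using e[of j] orth_mats_rows[OF Om'(1) ij(1,2)] ij by simp
  qed
  finally show "?g $$ (i, j) = (if i = j then 1 else 0)" .
 qed
 moreover have "Om' = ?g * Om"
 proof -
  have "?g * Om = Om' * (tr_mat Om * Om)" by (rule assoc_mult_mat) (use c in auto)
  then show ?thesis using orth_mats_transpose_mult[OF Om(1)] c by simp
 qed
 ultimately show ?thesis using left_orbit_eq_iff[OF one mult inv sub c] by blast
qed

end

section \<open>The generalized Rayleigh quotient\<close>

text \<open>Gram-Schmidt for the form B, whose triangular factor R has positive diagonal. R is kept
  explicit because its squared determinant later cancels in the Rayleigh quotient.\<close>

lemma orthonormalize_rows: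
 assumes B: "pos_def_mat N B" and Y: "Y : carrier_mat n N"
  and indep: "!!c. (!!j. j < N ==> (\<Sum>i<n. c i * Y $$ (i, j)) = 0) ==> (!!i. i < n ==> c i = 0)"
 obtains R where "R : carrier_mat n n" "mdet R ~= 0" "(R * Y) * B * tr_mat (R * Y) = 1\<^sub>m n"
proof -
 have Bc: "B : carrier_mat N N" and Bt: "tr_mat B = B" using B by (auto simp: pos_def_mat_def)
 define b where "b s t = B $$ (s, t)" for s t
 define y where "y i j = Y $$ (i, j)" for i j
 have sym: "b s t = b t s" if "s < N" "t < N" for s t
 proof -
  have "B $$ (s, t) = tr_mat B $$ (s, t)" by (simp only: Bt)
  then show ?thesis using that Bc by (simp add: b_def)
 qed
 have pos: "bil N b x x > 0" if j: "j < N" "x j ~= 0" for x j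
 proof -
  define v where "v = Matrix.vec N x"
  have vi: "vec_index v j = x j" if "j < N" for j using that by (simp add: v_def)
  have "v ~= 0\<^sub>v N"
  proof
  assume "v = 0\<^sub>v N"
  then show False using vi[OF j(1)] j by simp
  qed
  then have "scalar_prod v (B *\<^sub>v v) > 0" using B by (simp add: pos_def_mat_def v_def)
  also have "scalar_prod v (B *\<^sub>v v) = (\<Sum>s<N. x s * (\<Sum>t<N. b s t * x t))"
  using Bc unfolding scalar_prod_def by (auto simp: v_def scalar_prod_def b_def lessThan_atLeast0 intro!: sum.cong)
  also have "\<dots> = bil N b x x" by (simp add: bil_def sum_distrib_left mult.assoc)
  finally show ?thesis .
 qed
 have ind: "c i = 0" if "!!j. j < N ==> (\<Sum>i<n. c i * y i j) = 0" "i < n" for c i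
  using indep[of c i] that by (simp add: y_def)
 obtain R where R: "R : carrier_mat n n" "!!i l. i < l ==> l < n ==> R $$ (i, l) = 0" "!!i. i < n ==> R $$ (i, i) > 0"
  "!!i j. i < n ==> gs N b y i j = (\<Sum>l<n. R $$ (i, l) * y l j)"
  by (rule gs_triangular[where m = N and b = b and n = n and Y = y])
  (rule sym, assumption, assumption, rule pos, assumption, assumption, rule ind, assumption, assumption, rule that)
 have det: "mdet R ~= 0"
  by (rule det_lower_triangular_nonzero[OF R(1,2)]) (use R(3) in force)+
 have RY: "R * Y : carrier_mat n N" using R(1) Y by (rule mult_carrier_mat)
 have e: "(R * Y) $$ (i, j) = gs N b y i j" if "i < n" "j < N" for i j
  unfolding mult_entry[OF R(1) Y that] R(4)[OF that(1)] by (simp add: y_def)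
 have "((R * Y) * B * tr_mat (R * Y)) $$ (i, k) = (if i = k then 1 else 0)" if ik: "i < n" "k < n" for i k
 proof -
  have "((R * Y) * B * tr_mat (R * Y)) $$ (i, k) = (\<Sum>t<N. ((R * Y) * B) $$ (i, t) * (R * Y) $$ (k, t))"
  by (rule mult_transpose_entry[OF mult_carrier_mat[OF RY Bc] RY ik])
  also have "\<dots> = (\<Sum>t<N. (\<Sum>s<N. gs N b y i s * b s t) * gs N b y k t)"
  using e ik mult_entry[OF RY Bc ik(1)] by (intro sum.cong refl) (simp add: b_def)
  also have "\<dots> = bil N b (gs N b y i) (gs N b y k)"
  unfolding bil_def sum_distrib_right by (rule sum.swap)
  also have "\<dots> = (if i = k then 1 else 0)"
  by (rule gs_orthonormal[where m = N and b = b and n = n and Y = y, OF _ _ _ ik])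
  (rule sym, assumption, assumption, rule pos, assumption, assumption, rule ind, assumption, assumption)
  finally show ?thesis .
 qed
 then have "(R * Y) * B * tr_mat (R * Y) = 1\<^sub>m n"
  using RY by (intro eq_matI) auto
 with R(1) det show thesis by (rule that)
qed

text \<open>Leibniz formula: n! terms, each a product of n entries.\<close>

lemma abs_det_le:
 fixes M :: "real mat"
 assumes M: "M : carrier_mat n n" and b: "!!i j. i < n ==> j < n ==> \<bar>M $$ (i, j)\<bar> <= K"
 shows "\<bar>mdet M\<bar> <= fact n * K ^ n"
proof -
 have fin: "finite {q. q permutes {0..<n}}" by (rule finite_permutations) simp
 have "\<bar>mdet M\<bar> <= (\<Sum>q\<in>{q. q permutes {0..<n}}. \<bar>signof q * (\<Prod>i=0..<n. M $$ (i, q i))\<bar>)"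
  unfolding det_def'[OF M] by (rule sum_abs)
 also have "\<dots> <= (\<Sum>q\<in>{q. q permutes {0..<n}}. K ^ n)"
 proof (rule sum_mono)
  fix q assume "q : {q. q permutes {0..<n}}"
  then have q: "q i < n" if "i < n" for i using permutes_in_image[of q "{0..<n}" i] that by simp
  have "\<bar>signof q * (\<Prod>i=0..<n. M $$ (i, q i))\<bar> = (\<Prod>i=0..<n. \<bar>M $$ (i, q i)\<bar>)"
  by (simp add: abs_mult abs_prod sign_def)
  also have "\<dots> <= (\<Prod>i=0..<n. K)" by (rule prod_mono) (use b q in auto)
  finally show "\<bar>signof q * (\<Prod>i=0..<n. M $$ (i, q i))\<bar> <= K ^ n" by simp
 qed
 also have "\<dots> = fact n * K ^ n" using card_permutations[of "{0..<n}" n] by simp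
 finally show ?thesis .
qed

lemma det_congruence:
 fixes X :: "real mat"
 assumes R: "R : carrier_mat n n" and X: "X : carrier_mat n N" and A: "A : carrier_mat N N"
 shows "mdet ((R * X) * A * tr_mat (R * X)) = (mdet R)\<^sup>2 * mdet (X * A * tr_mat X)"
proof -
 have M: "X * A * tr_mat X : carrier_mat n n" using X A by auto
 have "(R * X) * A * tr_mat (R * X) = R * (X * A * tr_mat X) * tr_mat R"
 proof -
  have "(R * X) * A * tr_mat (R * X) = (R * (X * A)) * (tr_mat X * tr_mat R)"
  unfolding transpose_mult[OF R X] assoc_mult_mat[OF R X A] ..
  also have "\<dots> = R * ((X * A) * (tr_mat X * tr_mat R))"
  by (rule assoc_mult_mat[of _ n n _ N _ n]) (use R X A in auto)
  also have "(X * A) * (tr_mat X * tr_mat R) = X * A * tr_mat X * tr_mat R"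
  by (rule assoc_mult_mat[of _ n N _ n _ n, symmetric]) (use R X A in auto)
  also have "R * (X * A * tr_mat X * tr_mat R) = R * (X * A * tr_mat X) * tr_mat R"
  by (rule assoc_mult_mat[of _ n n _ n _ n, symmetric]) (use R M in auto)
  finally show ?thesis .
 qed
 moreover have "mdet (R * (X * A * tr_mat X) * tr_mat R) = mdet R * mdet (X * A * tr_mat X) * mdet (tr_mat R)"
  using det_mult[of "R * (X * A * tr_mat X)" n "tr_mat R"] det_mult[OF R M] R M by simp
 ultimately show ?thesis by (simp add: det_transpose[OF R] power2_eq_square)
qed

text \<open>A basis change \<open>S\<close> orthonormal for \<open>B\<close> turns the \<open>B\<close>-orthonormal rows of \<open>U\<close> into rows \<open>W\<close>
 that are orthonormal for the standard form, with entries in \<open>[-1, 1]\<close>.\<close>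

lemma orthonormal_rows_bound:
 assumes B: "pos_def_mat N B" and A: "A : carrier_mat N N"
 obtains K where "!!n U i k. U : carrier_mat n N ==> U * B * tr_mat U = 1\<^sub>m n ==> i < n ==> k < n ==>
  \<bar>(U * A * tr_mat U) $$ (i, k)\<bar> <= K"
proof -
 have Bc: "B : carrier_mat N N" using B by (simp add: pos_def_mat_def)
 have ind: "c i = 0" if z: "!!j. j < N ==> (\<Sum>i<N. c i * (1\<^sub>m N :: real mat) $$ (i, j)) = 0" and i: "i < N" for c i
 proof -
  have "(\<Sum>l<N. c l * (1\<^sub>m N :: real mat) $$ (l, i)) = (\<Sum>l<N. if l = i then c l else 0)"
  using i by (intro sum.cong refl) auto
  then show ?thesis using z[OF i] i by simp
 qed
 \<comment> \<open>Orthonormalizing the unit vectors for B produces a basis change with S B S' =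
   1.\<close>
 obtain S0 where S0: "S0 : carrier_mat N N" "(S0 * 1\<^sub>m N) * B * tr_mat (S0 * 1\<^sub>m N) = 1\<^sub>m N"
  by (rule orthonormalize_rows[OF B one_carrier_mat]) (rule ind, assumption, assumption, rule that)
 define S where "S = S0"
 have S: "S : carrier_mat N N" "S * B * tr_mat S = 1\<^sub>m N" using S0 by (simp_all add: S_def)
 \<comment> \<open>The inverse of S, read off from S B S' = 1.\<close>
 define T where "T = B * tr_mat S"
 have T: "T : carrier_mat N N" unfolding T_def using S(1) Bc by auto
 have ST: "S * T = 1\<^sub>m N" unfolding T_def using S(2) assoc_mult_mat[OF S(1) Bc, of "tr_mat S" N] S(1) by simp
 have TS: "T * S = 1\<^sub>m N" by (rule mat_mult_left_right_inverse[OF S(1) T ST])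
 define A' where "A' = S * A * tr_mat S"
 have A': "A' : carrier_mat N N" unfolding A'_def using S(1) A by auto
 show thesis
 proof (rule that)
  fix n U i k assume U: "U : carrier_mat n N" and UB: "U * B * tr_mat U = 1\<^sub>m n" and ik: "i < n" "k < n"
  define W where "W = U * T"
  have W: "W : carrier_mat n N" unfolding W_def by (rule mult_carrier_mat[OF U T])
  have US: "U = W * S" unfolding W_def assoc_mult_mat[OF U T S(1)] TS using U by simp
  have cong: "U * X * tr_mat U = W * (S * X * tr_mat S) * tr_mat W" if X: "X : carrier_mat N N" for X
  proof -
  have "U * X * tr_mat U = (W * (S * X)) * (tr_mat S * tr_mat W)"
  unfolding US transpose_mult[OF W S(1)] assoc_mult_mat[OF W S(1) X] ..
  also have "\<dots> = W * ((S * X) * (tr_mat S * tr_mat W))"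
  by (rule assoc_mult_mat[of _ n N _ N _ n]) (use W S(1) X in auto)
  also have "(S * X) * (tr_mat S * tr_mat W) = S * X * tr_mat S * tr_mat W"
  by (rule assoc_mult_mat[of _ N N _ N _ n, symmetric]) (use W S(1) X in auto)
  also have "W * (S * X * tr_mat S * tr_mat W) = W * (S * X * tr_mat S) * tr_mat W"
  by (rule assoc_mult_mat[of _ n N _ N _ n, symmetric]) (use W S(1) X in auto)
  finally show ?thesis .
  qed
  have WW: "W * tr_mat W = 1\<^sub>m n" using cong[OF Bc] UB W unfolding S(2) by simp
  have Wb: "\<bar>W $$ (i, s)\<bar> <= 1" if "i < n" "s < N" for i s
  proof -
  have "(W $$ (i, s))\<^sup>2 <= (\<Sum>s<N. (W $$ (i, s))\<^sup>2)"
  by (rule member_le_sum[of s "{..<N}" "%s. (W $$ (i, s))\<^sup>2"]) (use that in auto)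
  also have "\<dots> = (W * tr_mat W) $$ (i, i)"
  unfolding mult_transpose_entry[OF W W that(1) that(1)] by (simp add: power2_eq_square)
  also have "\<dots> = 1" using WW that by simp
  finally show ?thesis by (simp add: abs_square_le_1)
  qed
  have "(U * A * tr_mat U) $$ (i, k) = (\<Sum>t<N. (\<Sum>s<N. W $$ (i, s) * A' $$ (s, t)) * W $$ (k, t))"
  unfolding cong[OF A] A'_def[symmetric] mult_transpose_entry[OF mult_carrier_mat[OF W A'] W ik]
  using mult_entry[OF W A' ik(1)] by simp
  also have "\<bar>\<dots>\<bar> <= (\<Sum>t<N. \<bar>(\<Sum>s<N. W $$ (i, s) * A' $$ (s, t)) * W $$ (k, t)\<bar>)" by (rule sum_abs)
  also have "\<dots> <= (\<Sum>t<N. \<Sum>s<N. \<bar>A' $$ (s, t)\<bar>)"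
  proof (rule sum_mono)
  fix t assume "t : {..<N}"
  then have t: "t < N" by simp
  have "\<bar>(\<Sum>s<N. W $$ (i, s) * A' $$ (s, t)) * W $$ (k, t)\<bar> <= \<bar>\<Sum>s<N. W $$ (i, s) * A' $$ (s, t)\<bar> * 1"
  unfolding abs_mult by (rule mult_left_mono[OF Wb[OF ik(2) t]]) simp
  also have "\<dots> <= (\<Sum>s<N. \<bar>W $$ (i, s) * A' $$ (s, t)\<bar>)" using sum_abs by simp
  also have "\<dots> <= (\<Sum>s<N. \<bar>A' $$ (s, t)\<bar>)"
  using Wb[OF ik(1)] by (intro sum_mono) (simp add: abs_mult mult_left_le_one_le)
  finally show "\<bar>(\<Sum>s<N. W $$ (i, s) * A' $$ (s, t)) * W $$ (k, t)\<bar> <= (\<Sum>s<N. \<bar>A' $$ (s, t)\<bar>)" .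
  qed
  finally show "\<bar>(U * A * tr_mat U) $$ (i, k)\<bar> <= (\<Sum>t<N. \<Sum>s<N. \<bar>A' $$ (s, t)\<bar>)" .
 qed
qed

context blocks
begin

section \<open>The matrix kappa(G) and its determinants\<close>

lemma hstack_entry:
 assumes f: "!!i. i : {1..p} ==> f i : carrier_mat n m"
 shows "hstack n (map f (rev [1..<Suc p])) : carrier_mat n (p * m)"
  and "i : {1..p} ==> a < n ==> b < m ==> hstack n (map f (rev [1..<Suc p])) $$ (a, (p - i) * m + b) = f i $$ (a, b)"
proof -
 let ?T = "%i. tr_mat (f i)"
 have V: "hstack n (map f (rev [1..<Suc p])) = tr_mat (vstack n (map ?T (rev [1..<Suc p])))"
  by (simp add: hstack_def comp_def)
 have dc: "dim_col A = n" if "A : set (map ?T (rev [1..<Suc p]))" for A using that f by force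
 have len: "sum_list (map dim_row (map ?T (rev [Suc i..<Suc p]))) = (p - i) * m" for i
 proof -
  have "dim_col (f x) = m" if "x : set (rev [Suc i..<Suc p])" for x
  proof -
  have "x : {1..p}" using that by auto
  then show ?thesis using f by blast
  qed
  then have "map dim_row (map ?T (rev [Suc i..<Suc p])) = map (%i. m) (rev [Suc i..<Suc p])"
  unfolding map_map by (intro map_cong refl) simp
  then show ?thesis by (simp only: map_replicate_const length_rev length_upt sum_list_replicate) simp
 qed
 have "vstack n (map ?T (rev [1..<Suc p])) : carrier_mat (p * m) n"
  using len[of 0] by (intro carrier_matI vstack_dims(2) dc) (simp_all only: vstack_dims(1), simp_all)
 then show "hstack n (map f (rev [1..<Suc p])) : carrier_mat n (p * m)" unfolding V by simp
 assume i: "i : {1..p}" and a: "a < n" and b: "b < m"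
 have s: "map ?T (rev [1..<Suc p]) = map ?T (rev [Suc i..<Suc p]) @ ?T i # map ?T (rev [1..<i])"
  using rev_upt_split[of 1 i "Suc p"] i by simp
 have "vstack n (map ?T (rev [1..<Suc p])) $$ (sum_list (map dim_row (map ?T (rev [Suc i..<Suc p]))) + b, a) = ?T i $$ (b, a)"
  unfolding s by (rule vstack_entry) (use dc[unfolded s] in blast, use f[OF i] a b in auto)
 then have e: "vstack n (map ?T (rev [1..<Suc p])) $$ ((p - i) * m + b, a) = f i $$ (a, b)"
  unfolding len using f[OF i] a b by simp
 have "(p - i) * m + b < p * m"
 proof -
  have "(p - i) * m + b < Suc (p - i) * m" using b by simp
  also have "\<dots> <= p * m" by (rule mult_le_mono1) (use i in auto)
  finally show ?thesis .
 qed
 then show "hstack n (map f (rev [1..<Suc p])) $$ (a, (p - i) * m + b) = f i $$ (a, b)"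
  unfolding V using e a \<open>vstack n (map ?T (rev [1..<Suc p])) : carrier_mat (p * m) n\<close> by simp
qed

text \<open>The row blocks of kappa(G) ascend in l while those of G descend in j, so block (r, l)
  occupies the rows of shift j = r - 1 - l. Then r - l = j + 1, and the rows of kappa(G) can be
  addressed by \<open>ridx\<close> as well. Column block i starts at (p - i) m since i
  descends.\<close>

lemma kappa_entry:
 assumes G: "G : carrier_mat nn m"
 shows "kappa p m d G : carrier_mat nn (p * m)"
  and "(r, j, a) : rset ==> i : {1..p} ==> b < m ==>
  kappa p m d G $$ (ridx (r, j, a), (p - i) * m + b) = (if i <= Suc j then G $$ (ridx (r, Suc j - i, a), b) else 0)"
proof -
 define f where "f r l i = (if i <= r - l then rblk p d G r (r - l - i) else 0\<^sub>m (d r) m)" for r l i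
 define X where "X r j = hstack (d r) (map (f r (r - 1 - j)) (rev [1..<Suc p]))" for r j
 have fc: "f r l i : carrier_mat (d r) m" for r l i using rblk_carrier[OF G] by (simp add: f_def)
 have rv: "map (g :: nat => real mat) [0..<r] = map (%j. g (r - 1 - j)) (rev [0..<r])" for g r
  by (rule nth_equalityI) (simp_all add: rev_nth)
 have k: "kappa p m d G = vstack (p * m) (concat (map (%r. map (%j. X r j) (rev [0..<r])) (rev [1..<Suc p])))"
  unfolding kappa_def X_def f_def rv ..
 have Xc: "X r j : carrier_mat (d r) (p * m)" for r j unfolding X_def by (rule hstack_entry(1)) (rule fc)
 show "kappa p m d G : carrier_mat nn (p * m)" unfolding k by (rule vstack_blocks(1)) (rule Xc)
 assume r: "(r, j, a) : rset" and i: "i : {1..p}" and b: "b < m"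
 have c: "(p - i) * m + b < p * m"
 proof -
  have "(p - i) * m + b < Suc (p - i) * m" using b by simp
  also have "\<dots> <= p * m" by (rule mult_le_mono1) (use i in auto)
  finally show ?thesis .
 qed
 have "kappa p m d G $$ (ridx (r, j, a), (p - i) * m + b) = X r j $$ (a, (p - i) * m + b)"
  unfolding k by (rule vstack_blocks(2)[OF Xc r c])
 also have "\<dots> = f r (r - 1 - j) i $$ (a, b)" unfolding X_def by (rule hstack_entry(2)[OF fc i _ b]) (use r in simp)
 also have "\<dots> = (if i <= Suc j then G $$ (ridx (r, Suc j - i, a), b) else 0)"
 proof -
  have "r - (r - 1 - j) = Suc j" using r by auto
  then show ?thesis using rblk_entry[OF G _ b, of a r] r b by (simp add: f_def)
 qed
 finally show "kappa p m d G $$ (ridx (r, j, a), (p - i) * m + b) = (if i <= Suc j then G $$ (ridx (r, Suc j - i, a), b) else 0)" .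
qed

lemma column_cases:
 assumes "c < p * m" obtains i b where "i : {1..p}" "b < m" "c = (p - i) * m + b"
proof -
 have m: "0 < m" using assms by (cases m) auto
 have q: "c div m < p" using assms by (simp add: less_mult_imp_div_less)
 show thesis
  by (rule that[of "p - c div m" "c mod m"]) (use q m in auto)
qed

text \<open>In the row of shift j all entries come from blocks of G with the same r, and the group
  acts on these by one matrix \<open>q r\<close>; so the action on G is the action on
  kappa(G).\<close>

lemma kappa_qm:
 assumes q: "qfam q" and G: "G : carrier_mat nn m"
 shows "kappa p m d (qm q * G) = qm q * kappa p m d G"
proof (rule eq_matI)
 have G': "qm q * G : carrier_mat nn m" using G by simp
 note c = kappa_entry(1)[OF G'] kappa_entry(1)[OF G]
 have Rc: "qm q * kappa p m d G : carrier_mat nn (p * m)" by (rule mult_carrier_mat[OF qm_carrier c(2)])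
 show "dim_row (kappa p m d (qm q * G)) = dim_row (qm q * kappa p m d G)" "dim_col (kappa p m d (qm q * G)) = dim_col (qm q * kappa p m d G)"
  unfolding carrier_matD[OF c(1)] carrier_matD[OF Rc] by (rule refl)+
 fix x y assume "x < dim_row (qm q * kappa p m d G)" "y < dim_col (qm q * kappa p m d G)"
 then have x: "x < nn" and y: "y < p * m" unfolding carrier_matD[OF Rc] by blast+
 obtain r j a where r: "(r, j, a) : rset" "x = ridx (r, j, a)" by (rule ridx_cases[OF x])
 obtain i b where i: "i : {1..p}" "b < m" "y = (p - i) * m + b" by (rule column_cases[OF y])
 have "(qm q * kappa p m d G) $$ (x, y) = (\<Sum>a'<d r. q r $$ (a, a') * kappa p m d G $$ (ridx (r, j, a'), y))"
  unfolding r(2) by (rule qm_mult_entry[OF c(2) r(1) y])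
 also have "\<dots> = (\<Sum>a'<d r. q r $$ (a, a') * (if i <= Suc j then G $$ (ridx (r, Suc j - i, a'), b) else 0))"
  unfolding i(3) using kappa_entry(2)[OF G _ i(1,2), of r j] r(1) by (intro sum.cong refl) simp
 also have "\<dots> = kappa p m d (qm q * G) $$ (x, y)"
  unfolding r(2) i(3) kappa_entry(2)[OF G' r(1) i(1,2)]
  using qm_mult_entry[OF G, of r "Suc j - i" a b q] r(1) i by (auto intro!: sum.neutral)
 finally show "kappa p m d (qm q * G) $$ (x, y) = (qm q * kappa p m d G) $$ (x, y)" by simp
qed

lemma det_qm:
 assumes q: "qfam q" shows "(mdet (qm q))\<^sup>2 = 1"
proof -
 have "qm (%r. tr_mat (q r)) = tr_mat (qm q)"
 proof (rule nmat_eqI)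
  fix x y assume xy: "x : rset" "y : rset"
  obtain r j a where x: "x = (r, j, a)" by (cases x)
  obtain r' j' a' where y: "y = (r', j', a')" by (cases y)
  have "tr_mat (qm q) $$ (ridx x, ridx y) = qm q $$ (ridx y, ridx x)"
  using ridx_range(3)[OF xy(1)[unfolded x]] ridx_range(3)[OF xy(2)[unfolded y]] carrier_matD[OF qm_carrier[of q]]
  unfolding x y by (intro index_transpose_mat(1)) (simp_all only:)
  then show "qm (%r. tr_mat (q r)) $$ (ridx x, ridx y) = tr_mat (qm q) $$ (ridx x, ridx y)"
  using xy qfam_carrier[OF q, of r] unfolding x y by (auto simp: qm_entry)
 qed simp_all
 then have "tr_mat (qm q) * qm q = 1\<^sub>m nn" using qfam_inverse(2)[OF q] by simp
 then have "mdet (tr_mat (qm q) * qm q) = 1" by simp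
 then show ?thesis
  using det_mult[of "tr_mat (qm q)" nn "qm q"] det_transpose[OF qm_carrier, of q] by (simp add: power2_eq_square)
qed

lemma rayleigh_form_qm:
 assumes q: "qfam q" and G: "G : carrier_mat nn m" and A: "A : carrier_mat (m * p) (m * p)"
 shows "rayleigh_form p m d A (qm q * G) = rayleigh_form p m d A G"
 unfolding rayleigh_form_def kappa_qm[OF q G]
 using det_congruence[OF qm_carrier kappa_entry(1)[OF G], of A q] A det_qm[OF q] by (simp add: mult.commute)

text \<open>In the columns of the block \<open>i = j + 1\<close> the rows \<open>(r, j', a)\<close> of \<open>\<kappa>(G)\<close> vanish for \<open>j' < j\<close>, and those
  with \<open>j' = j\<close> are the orthonormal rows of the blocks \<open>G\<^bsub>r,0\<^esub>\<close>.\<close>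

lemma kappa_rows_independent:
 assumes G: "G : GOX" and z: "!!c. c < p * m ==> (\<Sum>i<nn. w i * kappa p m d G $$ (i, c)) = 0"
  and r: "(r, j, a) : rset"
 shows "w (ridx (r, j, a)) = 0"
 using r
\<comment> \<open>The induction descends from the largest shift, so coefficients of rows with larger
  shift are already 0. In the column block j + 1 only the rows of shift j are left.\<close>
proof (induction "p - j" arbitrary: r j a rule: less_induct)
 case less
 have Gc: "G : carrier_mat nn m" using G by (rule GO_carrier)
 have jp: "Suc j : {1..p}" using less.prems by auto
 have IH: "w (ridx (r', j', a')) = 0" if "(r', j', a') : rset" "j < j'" for r' j' a'
  by (rule less.hyps[OF _ that(1)]) (use that less.prems in auto)
 have i0: "ooff r + a < ltot p d" using less.prems ooff_ltot[of r a] by simp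
 have sum0: "(\<Sum>x\<in>rset. w (ridx x) * (if fst (snd x) = j then G $$ (ridx (fst x, 0, snd (snd x)), b) else 0)) = 0" if b: "b < m" for b
 proof -
  have c: "(p - Suc j) * m + b < p * m"
  proof -
  have "(p - Suc j) * m + b < Suc (p - Suc j) * m" using b by simp
  also have "\<dots> <= p * m" by (rule mult_le_mono1) (use jp in auto)
  finally show ?thesis .
  qed
  have "0 = (\<Sum>x\<in>rset. w (ridx x) * kappa p m d G $$ (ridx x, (p - Suc j) * m + b))"
  using z[OF c] unfolding sum_rows by simp
  also have "\<dots> = (\<Sum>x\<in>rset. w (ridx x) * (if fst (snd x) = j then G $$ (ridx (fst x, 0, snd (snd x)), b) else 0))"
  proof (rule sum.cong[OF refl])
  fix x assume x: "x : rset"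
  obtain r' j' a' where xe: "x = (r', j', a')" by (cases x)
  show "w (ridx x) * kappa p m d G $$ (ridx x, (p - Suc j) * m + b) = w (ridx x) * (if fst (snd x) = j then G $$ (ridx (fst x, 0, snd (snd x)), b) else 0)"
  using kappa_entry(2)[OF Gc x[unfolded xe] jp b] IH[OF x[unfolded xe]] by (cases j' j rule: linorder_cases) (simp_all add: xe)
  qed
  finally show ?thesis by simp
 qed
 \<comment> \<open>Taking the inner product with one row of the orthonormal frame isolates the
   coefficient of that row.\<close>
 have "0 = (\<Sum>b<m. (\<Sum>x\<in>rset. w (ridx x) * (if fst (snd x) = j then G $$ (ridx (fst x, 0, snd (snd x)), b) else 0)) * top G $$ (ooff r + a, b))"
  using sum0 by simp
 also have "\<dots> = (\<Sum>x\<in>rset. \<Sum>b<m. w (ridx x) * (if fst (snd x) = j then G $$ (ridx (fst x, 0, snd (snd x)), b) else 0) * top G $$ (ooff r + a, b))"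
  unfolding sum_distrib_right by (rule sum.swap)
 also have "\<dots> = (\<Sum>x\<in>rset. if x = (r, j, a) then w (ridx x) else 0)"
 proof (rule sum.cong[OF refl])
  fix x assume x: "x : rset"
  obtain r' j' a' where xe: "x = (r', j', a')" by (cases x)
  have r': "1 <= r'" "r' <= p" "a' < d r'" using x xe by auto
  show "(\<Sum>b<m. w (ridx x) * (if fst (snd x) = j then G $$ (ridx (fst x, 0, snd (snd x)), b) else 0) * top G $$ (ooff r + a, b)) = (if x = (r, j, a) then w (ridx x) else 0)"
  proof (cases "j' = j")
  case True
  have "(\<Sum>b<m. top G $$ (ooff r' + a', b) * top G $$ (ooff r + a, b)) = (if ooff r' + a' = ooff r + a then 1 else 0)"
  by (rule G[unfolded GO_iff, THEN conjunct2, THEN conjunct1, rule_format, OF ooff_ltot[OF r'] i0])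
  moreover have "(\<Sum>b<m. w (ridx x) * (if fst (snd x) = j then G $$ (ridx (fst x, 0, snd (snd x)), b) else 0) * top G $$ (ooff r + a, b))
  = w (ridx x) * (\<Sum>b<m. top G $$ (ooff r' + a', b) * top G $$ (ooff r + a, b))"
  unfolding sum_distrib_left using True r' by (intro sum.cong refl) (simp add: xe top_entry mult.assoc)
  ultimately show ?thesis using ooff_eq_iff[of r' r a' a] r' less.prems True by (simp add: xe)
  qed (simp add: xe)
 qed
 also have "\<dots> = w (ridx (r, j, a))" using less.prems finite_rset by simp
 finally show ?case by simp
qed

lemma smooth_rayleigh_form:
 assumes A: "A : carrier_mat (m * p) (m * p)"
 shows "rayleigh_form p m d A : smooth_funs GX (pts GX)"
proof -
 note o = openin_topspace[of "top_of GX"]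
 have A': "A : carrier_mat (p * m) (p * m)" using A by (simp add: mult.commute)
 have k: "smooth_mat GX (pts GX) nn (p * m) (kappa p m d)"
 proof (rule smooth_matI)
  show "kappa p m d G : carrier_mat nn (p * m)" if "G : pts GX" for G using kappa_entry(1) GO_carrier that by simp
  fix x y assume x: "x < nn" and y: "y < p * m"
  obtain r j a where r: "(r, j, a) : rset" "x = ridx (r, j, a)" by (rule ridx_cases[OF x])
  obtain i b where i: "i : {1..p}" "b < m" "y = (p - i) * m + b" by (rule column_cases[OF y])
  have "(%G. if i <= Suc j then G $$ (ridx (r, Suc j - i, a), b) else 0) : smooth_funs GX (pts GX)"
  using smooth_GX_entry[OF o, of "(r, Suc j - i, a)" b] smooth_const[OF sheaf_GX o, of 0] r(1) i by (cases "i <= Suc j") auto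
  then show "(%G. kappa p m d G $$ (x, y)) : smooth_funs GX (pts GX)"
  proof (rule smooth_funs_cong[OF sheaf_GX _ o])
  fix G assume "G : pts GX"
  then have G: "G : carrier_mat nn m" using GO_carrier by simp
  show "(if i <= Suc j then G $$ (ridx (r, Suc j - i, a), b) else 0) = kappa p m d G $$ (x, y)"
  unfolding r(2) i(3) kappa_entry(2)[OF G r(1) i(1,2)] ..
  qed
 qed
 show ?thesis
  unfolding rayleigh_form_def[abs_def]
  by (rule smooth_det[OF sheaf_GX o], rule smooth_mat_mult[OF sheaf_GX o], rule smooth_mat_mult[OF sheaf_GX o k],
  rule smooth_mat_const[OF sheaf_GX o A'], rule smooth_mat_transpose[OF sheaf_GX o k])
qed

text \<open>Replacing kappa(G) by U = R kappa(G) multiplies numerator and denominator by the same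
  squared determinant. As the denominator becomes 1, it was nonzero; the numerator is a determinant
  of size n_min whose entries are bounded by a K that depends on A and B only.\<close>

lemma rayleigh_bounded:
 assumes A: "A : carrier_mat (m * p) (m * p)" and B: "pos_def_mat (m * p) B"
 shows "!!G. G : GOX ==> rayleigh_form p m d B G ~= 0"
  and "\<exists>c. \<forall>G\<in>GOX. \<bar>rayleigh p m d A B G\<bar> <= c"
proof -
 have A': "A : carrier_mat (p * m) (p * m)" using A by (simp add: mult.commute)
 have B': "pos_def_mat (p * m) B" using B by (simp add: mult.commute)
 have Bc: "B : carrier_mat (p * m) (p * m)" using B' by (simp add: pos_def_mat_def)
 obtain K where K: "!!n U i k. U : carrier_mat n (p * m) ==> U * B * tr_mat U = 1\<^sub>m n ==> i < n ==> k < n ==>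
  \<bar>(U * A * tr_mat U) $$ (i, k)\<bar> <= K" by (rule orthonormal_rows_bound[OF B' A']) (rule that)
 have main: "rayleigh_form p m d B G ~= 0 & \<bar>rayleigh p m d A B G\<bar> <= fact nn * K ^ nn" if G: "G : GOX" for G
 proof -
  have Gc: "G : carrier_mat nn m" using G by (rule GO_carrier)
  note k = kappa_entry(1)[OF Gc]
  have ind: "w i = 0" if z: "!!c. c < p * m ==> (\<Sum>i<nn. w i * kappa p m d G $$ (i, c)) = 0" and i: "i < nn" for w i
  proof -
  obtain r j a where r: "(r, j, a) : rset" "i = ridx (r, j, a)" by (rule ridx_cases[OF i])
  show ?thesis unfolding r(2) by (rule kappa_rows_independent[OF G z r(1)])
  qed
  obtain R where R: "R : carrier_mat nn nn" "mdet R ~= 0"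
  "(R * kappa p m d G) * B * tr_mat (R * kappa p m d G) = 1\<^sub>m nn"
  by (rule orthonormalize_rows[OF B' k]) (rule ind, assumption, assumption, rule that)
  let ?U = "R * kappa p m d G"
  have U: "?U : carrier_mat nn (p * m)" by (rule mult_carrier_mat[OF R(1) k])
  have b: "(mdet R)\<^sup>2 * rayleigh_form p m d B G = 1"
  using det_congruence[OF R(1) k Bc] unfolding R(3) by (simp add: rayleigh_form_def)
  then have nz: "rayleigh_form p m d B G ~= 0" by auto
  have a: "mdet (?U * A * tr_mat ?U) = (mdet R)\<^sup>2 * rayleigh_form p m d A G"
  using det_congruence[OF R(1) k A'] by (simp add: rayleigh_form_def)
  have "rayleigh p m d A B G = ((mdet R)\<^sup>2 * rayleigh_form p m d A G) / ((mdet R)\<^sup>2 * rayleigh_form p m d B G)"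
  using R(2) by (simp add: rayleigh_def)
  also have "\<dots> = mdet (?U * A * tr_mat ?U)" unfolding b a by simp
  finally have e: "rayleigh p m d A B G = mdet (?U * A * tr_mat ?U)" .
  have "\<bar>mdet (?U * A * tr_mat ?U)\<bar> <= fact nn * K ^ nn"
  by (rule abs_det_le) (use U A' in simp, rule K[OF U R(3)])
  then show ?thesis using nz e by simp
 qed
 show "!!G. G : GOX ==> rayleigh_form p m d B G ~= 0" using main by blast
 show "\<exists>c. \<forall>G\<in>GOX. \<bar>rayleigh p m d A B G\<bar> <= c" using main by blast
qed

text \<open>The acting matrices have determinant 1 or -1, so both determinants, and with them the
  quotient, are invariant; smoothness and the bound then pass to the quotient space.\<close>

lemma rayleigh_descends:
 assumes A: "A : carrier_mat (m * p) (m * p)" and B: "pos_def_mat (m * p) B"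
 shows "\<exists>R. (\<forall>G\<in>GOX. R (Kcls G) = rayleigh p m d A B G) & R : smooth_funs KX (pts KX) & bounded (R ` pts KX)"
proof -
 have Bc: "B : carrier_mat (m * p) (m * p)" using B by (simp add: pos_def_mat_def)
 have sm: "rayleigh p m d A B : smooth_funs GX (pts GX)"
  unfolding rayleigh_def[abs_def]
  by (rule smooth_divide[OF sheaf_GX openin_topspace smooth_rayleigh_form[OF A] smooth_rayleigh_form[OF Bc]])
  (use rayleigh_bounded(1)[OF A B] in simp)
 have inv: "rayleigh p m d A B G = rayleigh p m d A B G'" if "G : pts GX" "G' : pts GX" "Kcls G = Kcls G'" for G G'
 proof -
  have G: "G : GOX" "G' : GOX" using that by auto
  from K_class_GOX_eq[OF G, THEN iffD1, OF that(3)] obtain q where q: "qfam q" "G' = qm q * G" by (elim exE conjE)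
  show ?thesis unfolding q(2) rayleigh_def rayleigh_form_qm[OF q(1) GO_carrier[OF G(1)] A] rayleigh_form_qm[OF q(1) GO_carrier[OF G(1)] Bc] ..
 qed
 obtain R where R0: "R : smooth_funs (quotient_space GX (Kcls)) (pts (quotient_space GX (Kcls)))"
  and R2: "!!G. G : pts GX ==> R (Kcls G) = rayleigh p m d A B G"
  by (rule smooth_funs_descend[OF sheaf_GX sm]) (erule (2) inv, rule that)
 have R: "R : smooth_funs KX (pts KX)" "!!G. G : pts GX ==> R (Kcls G) = rayleigh p m d A B G"
  using R0 R2 by (simp_all only: KX_def)
 obtain c where c: "\<forall>G\<in>GOX. \<bar>rayleigh p m d A B G\<bar> <= c" using rayleigh_bounded(2)[OF A B] by blast
 have "bounded (R ` pts KX)"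
 proof (rule boundedI)
  fix x assume "x : R ` pts KX"
  then obtain G where "G : GOX" "x = R (Kcls G)" by auto
  then show "norm x <= c" using R(2) c by simp
 qed
 then show ?thesis using R by (intro exI[of _ R]) simp
qed

end

theorem theorem2:
  fixes k m p :: nat and d :: "nat \<Rightarrow> nat"
  assumes "k \<ge> 1" and "m \<ge> 1" and "p \<ge> 1"
    and "d p > 0"
    and "ltot p d \<le> min k m"
    and "d 0 = m - ltot p d"
  shows
    \<comment> \<open>(1)\<close>
    "(\<exists>\<phi>. \<phi> \<in> iso (Qgroup p d) (product_group {1..g_num p d} (\<lambda>i. orth_group (l_seq p d i))) \<and>
          diffeomorphism (Qspace p d) (orth_product_space (g_num p d) (l_seq p d)) \<phi>)
     \<and>
     \<comment> \<open>(2)\<close>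
     (\<forall>G\<in>GO p m d. \<exists>C Om. represents p m d C Om G)
     \<and>
     (\<forall>G\<in>GO p m d. \<forall>C Om C\<^sub>1 Om\<^sub>1. represents p m d C Om G \<and> represents p m d C\<^sub>1 Om\<^sub>1 G \<longrightarrow>
        stiefel_class p m d Om = stiefel_class p m d Om\<^sub>1)
     \<and>
     \<comment> \<open>(3)\<close>
     (\<exists>\<pi>. (\<forall>G\<in>GO p m d. \<forall>C Om. represents p m d C Om G \<longrightarrow>
              \<pi> (K_class p d G) = flag_class p m d Om) \<and>
           smooth_fiber_bundle (K_space p m d) (flag_manifold p m d) \<pi> (model_fiber_space p d) \<and>
           (\<forall>b\<in>pts (flag_manifold p m d).
              vectorspace class_ring (fiber_module p m d \<pi> b) \<and>
              (\<exists>\<phi>. linear_iso (fiber_module p m d \<pi> b) (model_fiber_module p d) \<phi>)) \<and>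
           smooth_vector_bundle (K_space p m d) (flag_manifold p m d) \<pi> (fiber_module p m d \<pi>)
             (model_fiber_space p d) (model_fiber_module p d) \<and>
           (p = 1 \<or> (ltot p d = m \<and> (\<forall>j. 1 \<le> j \<and> j + 2 \<le> p \<longrightarrow> d j = 0)) \<longrightarrow>
              diffeomorphism (K_space p m d) (flag_manifold p m d) \<pi>))
     \<and>
     \<comment> \<open>(4)\<close>
     (\<exists>n. smooth_manifold n (K_space p m d) \<and>
          int n = int m * (\<Sum>j=1..p. int j * int (d j)) - (\<Sum>i=1..p. (\<Sum>j=i..p. int (d j))\<^sup>2))
     \<and>
     \<comment> \<open>(5)\<close>
     smooth_manifold
       ((\<Sum>i=1..p. \<Sum>j<i. d i * d j) +
        (\<Sum>r=1..p. d r * (\<Sum>l=1..r - 1. \<Sum>j=0..r - l - 1. d j)))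
       (K_space p m d)
     \<and>
     \<comment> \<open>(6)\<close>
     (\<forall>A B. A \<in> carrier_mat (m * p) (m * p) \<and> transpose_mat A = A \<and> pos_def_mat (m * p) B \<longrightarrow>
        (\<forall>G\<in>GO p m d. rayleigh_form p m d B G \<noteq> 0) \<and>
        (\<exists>R. (\<forall>G\<in>GO p m d. R (K_class p d G) = rayleigh p m d A B G) \<and>
             R \<in> smooth_funs (K_space p m d) (pts (K_space p m d)) \<and>
             bounded (R ` pts (K_space p m d))))"
proof -
  interpret blocks p m d using assms by unfold_locales auto
  have eqs: "GO p m d = GOX" "K_space p m d = KX" "flag_manifold p m d = FX" "model_fiber_space p d = VX"
    by (simp_all add: GOX_def K_space_eq flag_manifold_eq VX_def)
  show ?thesis
    unfolding eqs flag_group_eq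
  proof (intro conjI)
    show "\<exists>\<phi>. \<phi> \<in> iso (Qgroup p d) (product_group {1..g_num p d} (\<lambda>i. orth_group (l_seq p d i))) \<and>
        diffeomorphism (Qspace p d) (orth_product_space (g_num p d) (l_seq p d)) \<phi>"
      by (intro exI[of _ qfac] conjI qfac_iso qfac_diffeomorphism)
    show "\<forall>G\<in>GOX. \<exists>C Om. represents p m d C Om G"
      by (intro ballI represents_exists)
    show "\<forall>G\<in>GOX. \<forall>C Om C\<^sub>1 Om\<^sub>1. represents p m d C Om G \<and> represents p m d C\<^sub>1 Om\<^sub>1 G \<longrightarrow>
        stiefel_class p m d Om = stiefel_class p m d Om\<^sub>1"
    proof (intro ballI allI impI, elim conjE)
      fix G C Om C1 Om1 assume G: "G \<in> GOX" and r: "represents p m d C Om G" "represents p m d C1 Om1 G"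
      show "stiefel_class p m d Om = stiefel_class p m d Om1"
        by (rule stiefel_class_unique[OF represents_agrees[OF r(1) GO_carrier[OF G]] represents_agrees[OF r(2) GO_carrier[OF G]]])
    qed
    show "\<exists>\<pi>. (\<forall>G\<in>GOX. \<forall>C Om. represents p m d C Om G \<longrightarrow> \<pi> (K_class p d G) = left_orbit stab Om) \<and>
        smooth_fiber_bundle KX FX \<pi> VX \<and>
        (\<forall>b\<in>pts FX. vectorspace class_ring (fiber_module p m d \<pi> b) \<and>
           (\<exists>\<phi>. linear_iso (fiber_module p m d \<pi> b) (model_fiber_module p d) \<phi>)) \<and>
        smooth_vector_bundle KX FX \<pi> (fiber_module p m d \<pi>) VX (model_fiber_module p d) \<and>
        (p = 1 \<or> (ltot p d = m \<and> (\<forall>j. 1 \<le> j \<and> j + 2 \<le> p \<longrightarrow> d j = 0)) \<longrightarrow> diffeomorphism KX FX \<pi>)"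
    proof (intro exI[of _ bproj] conjI ballI allI impI)
      fix G C Om assume G: "G \<in> GOX" and r: "represents p m d C Om G"
      show "bproj (K_class p d G) = left_orbit stab Om"
        by (rule pi_eq[OF G represents_agrees[OF r GO_carrier[OF G]]])
    next
      assume c: "p = 1 \<or> (ltot p d = m \<and> (\<forall>j. 1 \<le> j \<and> j + 2 \<le> p \<longrightarrow> d j = 0))"
      show "diffeomorphism KX FX bproj"
        by (rule trivial_fiber_diffeomorphism) (rule fiber_width_zero[OF c])
    qed (rule fiber_bundle fiber_is_vectorspace vector_bundle | assumption)+
    show "\<exists>n. smooth_manifold n KX \<and>
        int n = int m * (\<Sum>j=1..p. int j * int (d j)) - (\<Sum>i=1..p. (\<Sum>j=i..p. int (d j))\<^sup>2)"
      by (intro exI[of _ "card upper_pairs + fdim"] conjI smooth_manifold_KX dimension_formula)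
    show "smooth_manifold ((\<Sum>i=1..p. \<Sum>j<i. d i * d j) + (\<Sum>r=1..p. d r * (\<Sum>l=1..r - 1. \<Sum>j=0..r - l - 1. d j))) KX"
      using smooth_manifold_KX unfolding card_upper_pairs fdim_eq .
    show "\<forall>A B. A \<in> carrier_mat (m * p) (m * p) \<and> transpose_mat A = A \<and> pos_def_mat (m * p) B \<longrightarrow>
        (\<forall>G\<in>GOX. rayleigh_form p m d B G \<noteq> 0) \<and>
        (\<exists>R. (\<forall>G\<in>GOX. R (K_class p d G) = rayleigh p m d A B G) \<and>
             R \<in> smooth_funs KX (pts KX) \<and> bounded (R ` pts KX))"
    proof (intro allI impI, elim conjE)
      fix A B :: "real mat" assume AB: "A \<in> carrier_mat (m * p) (m * p)" "pos_def_mat (m * p) B"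
      show "(\<forall>G\<in>GOX. rayleigh_form p m d B G \<noteq> 0) \<and>
        (\<exists>R. (\<forall>G\<in>GOX. R (K_class p d G) = rayleigh p m d A B G) \<and> R \<in> smooth_funs KX (pts KX) \<and> bounded (R ` pts KX))"
        by (intro conjI ballI rayleigh_bounded(1)[OF AB] rayleigh_descends[OF AB])
    qed
  qed
qed

end
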